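(* Let $\mathcal{C}$ be a finite tensor category over $k$ with modular object $\alpha$, and let $\Lambda: \mathbf{1} \to \mathsf{Z}(\alpha)$ be a non-zero categorical left integral or a non-zero categorical right integral of $\mathcal{C}$. Then $$\varepsilon_{\alpha} \circ \Lambda \neq 0 \iff \mathcal{C} \text{ is semisimple}.$$
   Context: Setting. $k$ is an algebraically closed field of arbitrary characteristic. A finite abelian category over $k$ is a $k$-linear category equivalent to the category of finite-dimensional left modules over a finite-dimensional $k$-algebra. A finite tensor category over $k$ is a rigid monoidal category $\mathcal{C}$ (taken to be strict, with unit object $\mathbf{1}$) that is a finite abelian category over $k$, whose tensor product is $k$-linear in each variable, and whose unit object is simple. The left dual of $X$ is $(X^*, \mathrm{ev}_X: X^* \otimes X \to \mathbf{1}, \mathrm{coev}_X: \mathbf{1} \to X \otimes X^* )$. Central Hopf comonad. For $V \in \mathcal{C}$ the end $\mathsf{Z}(V) = \int_{X \in \mathcal{C}} X \otimes V \otimes X^*$ exists; let $\pi_{V;X}: \mathsf{Z}(V) \to X \otimes V \otimes X^*$ be its universal dinatural transformation, natural in $V$. Put $\varepsilon_V := \pi_{V;\mathbf{1}}: \mathsf{Z}(V) \to V$ and let $\mathsf{m}_{V,W}: \mathsf{Z}(V) \otimes \mathsf{Z}(W) \to \mathsf{Z}(V \otimes W)$ be determined by $\pi_{V \otimes W;X} \circ \mathsf{m}_{V,W} = (\mathrm{id}_X \otimes \mathrm{id}_V \otimes \mathrm{ev}_X \otimes \mathrm{id}_W \otimes \mathrm{id}_{X^*}) \circ (\pi_{V;X}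 \otimes \pi_{W;X})$ for all $V,W,X \in \mathcal{C}$. Modular object. Let $\mathsf{R}: \mathcal{C} \to \mathcal{Z}(\mathcal{C})$ be a right adjoint of the forgetful functor $\mathsf{U}$ from the Drinfeld center $\mathcal{Z}(\mathcal{C})$ to $\mathcal{C}$ (one has $\mathsf{Z} = \mathsf{U}\mathsf{R}$). The modular object $\alpha$ of $\mathcal{C}$ is the unique (up to isomorphism) simple object of $\mathcal{C}$ with $\mathrm{Hom}_{\mathcal{Z}(\mathcal{C})}(\mathsf{R}(\alpha), \mathbf{1}) \neq 0$; it is invertible. Integrals. A categorical left integral is a morphism $\Lambda: \mathbf{1} \to \mathsf{Z}(\alpha)$ in $\mathcal{C}$ with $\mathsf{m}_{\mathbf{1},\alpha} \circ (\mathrm{id}_{\mathsf{Z}(\mathbf{1})} \otimes \Lambda) = \varepsilon_{\mathbf{1}} \otimes \Lambda$. A categorical right integral is a morphism $\Lambda: \mathbf{1} \to \mathsf{Z}(\alpha)$ with $\mathsf{m}_{\alpha,\mathbf{1}} \circ (\Lambda \otimes \mathrm{id}_{\mathsf{Z}(\mathbf{1})}) = \Lambda \otimes \varepsilon_{\mathbf{1}}$. *)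

theory Defs
  imports
    "HOL-Library.FuncSet"
    "HOL-Computational_Algebra.Polynomial"
    "Jordan_Normal_Form.Matrix"
begin

no_notation mult (infixl "\<otimes>\<index>" 70)
no_notation one ("\<one>\<index>")

section \<open>Categories, functors and adjunctions\<close>

text \<open>
  A category is given by a carrier set of objects and a carrier set of arrows, each arrow having one
  source and one target; \<open>g \<cdot> f\<close> is composition in the usual order and is only meaningful if
  the target of \<open>f\<close> is the source of \<open>g\<close>.
\<close>

record ('o, 'm) category =
  Obj :: "'o set"
  Arr :: "'m set"
  Src :: "'m \<Rightarrow> 'o"
  Tgt :: "'m \<Rightarrow> 'o"
  Idn :: "'o \<Rightarrow> 'm" ("idn\<index>")
  Comp :: "'m \<Rightarrow> 'm \<Rightarrow> 'm" (infixl "\<cdot>\<index>" 65)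

definition Hom :: "('o, 'm, 'z) category_scheme \<Rightarrow> 'o \<Rightarrow> 'o \<Rightarrow> 'm set" where
  "Hom C X Y = {f \<in> Arr C. Src C f = X \<and> Tgt C f = Y}"

locale category =
  fixes C :: "('o, 'm, 'z) category_scheme" (structure)
  assumes Src_in: "f \<in> Arr C \<Longrightarrow> Src C f \<in> Obj C"
    and Tgt_in: "f \<in> Arr C \<Longrightarrow> Tgt C f \<in> Obj C"
    and id_Hom: "X \<in> Obj C \<Longrightarrow> idn X \<in> Hom C X X"
    and comp_Hom: "f \<in> Hom C X Y \<Longrightarrow> g \<in> Hom C Y W \<Longrightarrow> g \<cdot> f \<in> Hom C X W"
    and comp_id: "f \<in> Hom C X Y \<Longrightarrow> f \<cdot> idn X = f"
    and id_comp: "f \<in> Hom C X Y \<Longrightarrow> idn Y \<cdot> f = f"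
    and comp_assoc: "f \<in> Hom C X Y \<Longrightarrow> g \<in> Hom C Y W \<Longrightarrow> h \<in> Hom C W W' \<Longrightarrow>
      h \<cdot> (g \<cdot> f) = (h \<cdot> g) \<cdot> f"

context
  fixes C :: "('o, 'm, 'z) category_scheme" (structure)
begin

definition iso_arr :: "'m \<Rightarrow> bool" where
  "iso_arr f \<longleftrightarrow> f \<in> Arr C \<and>
     (\<exists>g \<in> Hom C (Tgt C f) (Src C f). g \<cdot> f = idn (Src C f) \<and> f \<cdot> g = idn (Tgt C f))"

definition mono_arr :: "'m \<Rightarrow> bool" where
  "mono_arr f \<longleftrightarrow> f \<in> Arr C \<and>
     (\<forall>W \<in> Obj C. \<forall>g \<in> Hom C W (Src C f). \<forall>h \<in> Hom C W (Src C f). f \<cdot> g = f \<cdot> h \<longrightarrow> g = h)"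

end

record ('o, 'm, 'p, 'n) cat_functor =
  FObj :: "'o \<Rightarrow> 'p"
  FArr :: "'m \<Rightarrow> 'n"

definition is_functor :: "('o, 'm, 'z) category_scheme \<Rightarrow> ('p, 'n, 'y) category_scheme \<Rightarrow>
    ('o, 'm, 'p, 'n) cat_functor \<Rightarrow> bool" where
  "is_functor C D F \<longleftrightarrow>
     (\<forall>X \<in> Obj C. FObj F X \<in> Obj D) \<and>
     (\<forall>X \<in> Obj C. \<forall>Y \<in> Obj C. \<forall>f \<in> Hom C X Y. FArr F f \<in> Hom D (FObj F X) (FObj F Y)) \<and>
     (\<forall>X \<in> Obj C. FArr F (idn\<^bsub>C\<^esub> X) = idn\<^bsub>D\<^esub> (FObj F X)) \<and>
     (\<forall>X \<in> Obj C. \<forall>Y \<in> Obj C. \<forall>W \<in> Obj C. \<forall>f \<in> Hom C X Y. \<forall>g \<in> Hom C Y W.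
        FArr F (g \<cdot>\<^bsub>C\<^esub> f) = FArr F g \<cdot>\<^bsub>D\<^esub> FArr F f)"

definition id_functor :: "('o, 'm, 'o, 'm) cat_functor" where
  "id_functor = \<lparr>FObj = (\<lambda>X. X), FArr = (\<lambda>f. f)\<rparr>"

definition comp_functor :: "('p, 'n, 'q, 'l) cat_functor \<Rightarrow> ('o, 'm, 'p, 'n) cat_functor \<Rightarrow>
    ('o, 'm, 'q, 'l) cat_functor" where
  "comp_functor G F = \<lparr>FObj = (\<lambda>X. FObj G (FObj F X)), FArr = (\<lambda>f. FArr G (FArr F f))\<rparr>"

definition nat_isomorphic :: "('o, 'm, 'z) category_scheme \<Rightarrow> ('p, 'n, 'y) category_scheme \<Rightarrow>
    ('o, 'm, 'p, 'n) cat_functor \<Rightarrow> ('o, 'm, 'p, 'n) cat_functor \<Rightarrow> bool" where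
  "nat_isomorphic C D F G \<longleftrightarrow> (\<exists>\<eta>.
     (\<forall>X \<in> Obj C. \<eta> X \<in> Hom D (FObj F X) (FObj G X) \<and> iso_arr D (\<eta> X)) \<and>
     (\<forall>X \<in> Obj C. \<forall>Y \<in> Obj C. \<forall>f \<in> Hom C X Y.
        FArr G f \<cdot>\<^bsub>D\<^esub> \<eta> X = \<eta> Y \<cdot>\<^bsub>D\<^esub> FArr F f))"

definition right_adjoint :: "('o, 'm, 'z) category_scheme \<Rightarrow> ('p, 'n, 'y) category_scheme \<Rightarrow>
    ('o, 'm, 'p, 'n) cat_functor \<Rightarrow> ('p, 'n, 'o, 'm) cat_functor \<Rightarrow> bool" where
  "right_adjoint C D F G \<longleftrightarrow> is_functor C D F \<and> is_functor D C G \<and> (\<exists>\<phi>.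
     (\<forall>X \<in> Obj C. \<forall>V \<in> Obj D. bij_betw (\<phi> X V) (Hom D (FObj F X) V) (Hom C X (FObj G V))) \<and>
     (\<forall>X \<in> Obj C. \<forall>X' \<in> Obj C. \<forall>V \<in> Obj D. \<forall>V' \<in> Obj D.
        \<forall>h \<in> Hom C X' X. \<forall>g \<in> Hom D V V'. \<forall>f \<in> Hom D (FObj F X) V.
          \<phi> X' V' (g \<cdot>\<^bsub>D\<^esub> f \<cdot>\<^bsub>D\<^esub> FArr F h) = FArr G g \<cdot>\<^bsub>C\<^esub> \<phi> X V f \<cdot>\<^bsub>C\<^esub> h))"


section \<open>Linear categories\<close>

record ('o, 'm, 'k) linear_category = "('o, 'm) category" +
  Plus :: "'m \<Rightarrow> 'm \<Rightarrow> 'm" (infixl "\<oplus>\<^sub>a\<index>" 60)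
  Zero :: "'o \<Rightarrow> 'o \<Rightarrow> 'm"
  Scale :: "'k \<Rightarrow> 'm \<Rightarrow> 'm" (infixr "\<star>\<index>" 75)

locale linear_category = category C
  for C :: "('o, 'm, 'k :: field, 'z) linear_category_scheme" (structure) +
  assumes plus_Hom: "f \<in> Hom C X Y \<Longrightarrow> g \<in> Hom C X Y \<Longrightarrow> f \<oplus>\<^sub>a g \<in> Hom C X Y"
    and zero_Hom: "X \<in> Obj C \<Longrightarrow> Y \<in> Obj C \<Longrightarrow> Zero C X Y \<in> Hom C X Y"
    and scale_Hom: "f \<in> Hom C X Y \<Longrightarrow> c \<star> f \<in> Hom C X Y"
    and plus_assoc: "f \<in> Hom C X Y \<Longrightarrow> g \<in> Hom C X Y \<Longrightarrow> h \<in> Hom C X Y \<Longrightarrow>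
      (f \<oplus>\<^sub>a g) \<oplus>\<^sub>a h = f \<oplus>\<^sub>a (g \<oplus>\<^sub>a h)"
    and plus_comm: "f \<in> Hom C X Y \<Longrightarrow> g \<in> Hom C X Y \<Longrightarrow> f \<oplus>\<^sub>a g = g \<oplus>\<^sub>a f"
    and zero_plus: "f \<in> Hom C X Y \<Longrightarrow> Zero C X Y \<oplus>\<^sub>a f = f"
    and ex_minus: "f \<in> Hom C X Y \<Longrightarrow> \<exists>g \<in> Hom C X Y. f \<oplus>\<^sub>a g = Zero C X Y"
    and scale_plus: "f \<in> Hom C X Y \<Longrightarrow> g \<in> Hom C X Y \<Longrightarrow> c \<star> (f \<oplus>\<^sub>a g) = c \<star> f \<oplus>\<^sub>a c \<star> g"
    and plus_scale: "f \<in> Hom C X Y \<Longrightarrow> (c + d) \<star> f = c \<star> f \<oplus>\<^sub>a d \<star> f"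
    and scale_scale: "f \<in> Hom C X Y \<Longrightarrow> c \<star> d \<star> f = (c * d) \<star> f"
    and one_scale: "f \<in> Hom C X Y \<Longrightarrow> 1 \<star> f = f"
    and comp_plus: "f \<in> Hom C X Y \<Longrightarrow> f' \<in> Hom C X Y \<Longrightarrow> g \<in> Hom C Y W \<Longrightarrow>
      g \<cdot> (f \<oplus>\<^sub>a f') = (g \<cdot> f) \<oplus>\<^sub>a (g \<cdot> f')"
    and plus_comp: "f \<in> Hom C X Y \<Longrightarrow> g \<in> Hom C Y W \<Longrightarrow> g' \<in> Hom C Y W \<Longrightarrow>
      (g \<oplus>\<^sub>a g') \<cdot> f = (g \<cdot> f) \<oplus>\<^sub>a (g' \<cdot> f)"
    and comp_scale: "f \<in> Hom C X Y \<Longrightarrow> g \<in> Hom C Y W \<Longrightarrow> g \<cdot> (c \<star> f) = c \<star> (g \<cdot> f)"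
    and scale_comp: "f \<in> Hom C X Y \<Longrightarrow> g \<in> Hom C Y W \<Longrightarrow> (c \<star> g) \<cdot> f = c \<star> (g \<cdot> f)"

definition linear_functor :: "('o, 'm, 'k, 'z) linear_category_scheme \<Rightarrow>
    ('p, 'n, 'k, 'y) linear_category_scheme \<Rightarrow> ('o, 'm, 'p, 'n) cat_functor \<Rightarrow> bool" where
  "linear_functor C D F \<longleftrightarrow> is_functor C D F \<and>
     (\<forall>X \<in> Obj C. \<forall>Y \<in> Obj C. \<forall>f \<in> Hom C X Y. \<forall>g \<in> Hom C X Y.
        FArr F (f \<oplus>\<^sub>a\<^bsub>C\<^esub> g) = FArr F f \<oplus>\<^sub>a\<^bsub>D\<^esub> FArr F g) \<and>
     (\<forall>X \<in> Obj C. \<forall>Y \<in> Obj C. \<forall>f \<in> Hom C X Y. \<forall>c. FArr F (c \<star>\<^bsub>C\<^esub> f) = c \<star>\<^bsub>D\<^esub> FArr F f)"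

definition linear_equivalent :: "('o, 'm, 'k, 'z) linear_category_scheme \<Rightarrow>
    ('p, 'n, 'k, 'y) linear_category_scheme \<Rightarrow> bool" where
  "linear_equivalent C D \<longleftrightarrow> (\<exists>F G. linear_functor C D F \<and> linear_functor D C G \<and>
     nat_isomorphic C C (comp_functor G F) id_functor \<and>
     nat_isomorphic D D (comp_functor F G) id_functor)"

context
  fixes C :: "('o, 'm, 'k, 'z) linear_category_scheme" (structure)
begin

definition zero_object :: "'o \<Rightarrow> bool" where
  "zero_object X \<longleftrightarrow> X \<in> Obj C \<and> idn X = Zero C X X"

definition simple_object :: "'o \<Rightarrow> bool" where
  "simple_object X \<longleftrightarrow> X \<in> Obj C \<and> \<not> zero_object X \<and>
     (\<forall>f \<in> Arr C. Tgt C f = X \<and> mono_arr C f \<longrightarrow> zero_object (Src C f) \<or> iso_arr C f)"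

text \<open>\<open>X\<close> is the direct sum of the family \<open>S 0, \<dots>, S (n - 1)\<close>; for \<open>n = 0\<close> it is a zero object.\<close>

definition direct_sum :: "nat \<Rightarrow> (nat \<Rightarrow> 'o) \<Rightarrow> 'o \<Rightarrow> bool" where
  "direct_sum n S X \<longleftrightarrow> (\<exists>i p.
     (\<forall>a < n. i a \<in> Hom C (S a) X \<and> p a \<in> Hom C X (S a)) \<and>
     (\<forall>a < n. \<forall>b < n. p a \<cdot> i b = (if a = b then idn (S a) else Zero C (S b) (S a))) \<and>
     foldr (\<lambda>a s. (i a \<cdot> p a) \<oplus>\<^sub>a s) [0..<n] (Zero C X X) = idn X)"

definition semisimple :: bool where
  "semisimple \<longleftrightarrow> (\<forall>X \<in> Obj C. \<exists>n S. (\<forall>a < n. simple_object (S a)) \<and> direct_sum n S X)"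

end


section \<open>Finite abelian categories\<close>

text \<open>
  Up to isomorphism, a finite-dimensional algebra has underlying vector space \<open>k\<^sup>d\<close>, and a
  finite-dimensional left module over it has underlying vector space \<open>k\<^sup>n\<close>, with \<open>a\<close> acting
  through an \<open>n \<times> n\<close> matrix. As finite abelian categories are only defined up to equivalence,
  it suffices to consider these. Functions are made extensional, so that a module is determined
  by the action of the elements of the algebra.
\<close>

record 'k fd_algebra =
  adim :: nat
  amult :: "'k vec \<Rightarrow> 'k vec \<Rightarrow> 'k vec"
  aone :: "'k vec"

abbreviation acarrier :: "'k fd_algebra \<Rightarrow> 'k vec set" where
  "acarrier A \<equiv> carrier_vec (adim A)"

definition is_fd_algebra :: "'k :: field fd_algebra \<Rightarrow> bool" where
  "is_fd_algebra A \<longleftrightarrow>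
     aone A \<in> acarrier A \<and>
     (\<forall>a \<in> acarrier A. \<forall>b \<in> acarrier A. amult A a b \<in> acarrier A) \<and>
     (\<forall>a \<in> acarrier A. amult A (aone A) a = a \<and> amult A a (aone A) = a) \<and>
     (\<forall>a \<in> acarrier A. \<forall>b \<in> acarrier A. \<forall>c \<in> acarrier A.
        amult A (amult A a b) c = amult A a (amult A b c) \<and>
        amult A (a + b) c = amult A a c + amult A b c \<and>
        amult A a (b + c) = amult A a b + amult A a c) \<and>
     (\<forall>a \<in> acarrier A. \<forall>b \<in> acarrier A. \<forall>t.
        amult A (t \<cdot>\<^sub>v a) b = t \<cdot>\<^sub>v amult A a b \<and> amult A a (t \<cdot>\<^sub>v b) = t \<cdot>\<^sub>v amult A a b)"

type_synonym 'k fd_module = "nat \<times> ('k vec \<Rightarrow> 'k mat)"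

definition fd_modules :: "'k :: field fd_algebra \<Rightarrow> 'k fd_module set" where
  "fd_modules A = {(n, \<rho>). \<rho> \<in> acarrier A \<rightarrow>\<^sub>E carrier_mat n n \<and>
     \<rho> (aone A) = 1\<^sub>m n \<and>
     (\<forall>a \<in> acarrier A. \<forall>b \<in> acarrier A. \<rho> (amult A a b) = \<rho> a * \<rho> b \<and> \<rho> (a + b) = \<rho> a + \<rho> b) \<and>
     (\<forall>a \<in> acarrier A. \<forall>t. \<rho> (t \<cdot>\<^sub>v a) = t \<cdot>\<^sub>m \<rho> a)}"

text \<open>An arrow is a module homomorphism together with its source and target.\<close>

definition module_category :: "'k :: field fd_algebra \<Rightarrow>
    ('k fd_module, 'k fd_module \<times> 'k mat \<times> 'k fd_module, 'k) linear_category" where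
  "module_category A = \<lparr>
     Obj = fd_modules A,
     Arr = {(M, T, N). M \<in> fd_modules A \<and> N \<in> fd_modules A \<and> T \<in> carrier_mat (fst N) (fst M) \<and>
       (\<forall>a \<in> acarrier A. T * snd M a = snd N a * T)},
     Src = (\<lambda>(M, T, N). M),
     Tgt = (\<lambda>(M, T, N). N),
     Idn = (\<lambda>M. (M, 1\<^sub>m (fst M), M)),
     Comp = (\<lambda>(M', T', N') (M, T, N). (M, T' * T, N')),
     Plus = (\<lambda>(M, T, N) (M', T', N'). (M, T + T', N)),
     Zero = (\<lambda>M N. (M, 0\<^sub>m (fst N) (fst M), N)),
     Scale = (\<lambda>c (M, T, N). (M, c \<cdot>\<^sub>m T, N))\<rparr>"

definition finite_abelian :: "('o, 'm, 'k :: field, 'z) linear_category_scheme \<Rightarrow> bool" where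
  "finite_abelian C \<longleftrightarrow> linear_category C \<and>
     (\<exists>A. is_fd_algebra A \<and> linear_equivalent C (module_category A))"


section \<open>Finite tensor categories\<close>

record ('o, 'm, 'k) tensor_category = "('o, 'm, 'k) linear_category" +
  TObj :: "'o \<Rightarrow> 'o \<Rightarrow> 'o" (infixl "\<boxtimes>\<index>" 70)
  TArr :: "'m \<Rightarrow> 'm \<Rightarrow> 'm" (infixl "\<otimes>\<index>" 70)
  UnitObj :: "'o" ("\<one>\<index>")

locale strict_monoidal_category = category C
  for C :: "('o, 'm, 'k, 'z) tensor_category_scheme" (structure) +
  assumes unit_Obj: "\<one> \<in> Obj C"
    and tensor_Obj: "X \<in> Obj C \<Longrightarrow> Y \<in> Obj C \<Longrightarrow> X \<boxtimes> Y \<in> Obj C"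
    and tensor_Hom: "f \<in> Hom C X Y \<Longrightarrow> g \<in> Hom C X' Y' \<Longrightarrow> f \<otimes> g \<in> Hom C (X \<boxtimes> X') (Y \<boxtimes> Y')"
    and tensor_id: "X \<in> Obj C \<Longrightarrow> Y \<in> Obj C \<Longrightarrow> idn X \<otimes> idn Y = idn (X \<boxtimes> Y)"
    and tensor_comp: "f \<in> Hom C X Y \<Longrightarrow> g \<in> Hom C Y W \<Longrightarrow> f' \<in> Hom C X' Y' \<Longrightarrow> g' \<in> Hom C Y' W' \<Longrightarrow>
      (g \<cdot> f) \<otimes> (g' \<cdot> f') = (g \<otimes> g') \<cdot> (f \<otimes> f')"
    and assoc_Obj: "X \<in> Obj C \<Longrightarrow> Y \<in> Obj C \<Longrightarrow> W \<in> Obj C \<Longrightarrow> (X \<boxtimes> Y) \<boxtimes> W = X \<boxtimes> (Y \<boxtimes> W)"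
    and assoc_Arr: "f \<in> Arr C \<Longrightarrow> g \<in> Arr C \<Longrightarrow> h \<in> Arr C \<Longrightarrow> (f \<otimes> g) \<otimes> h = f \<otimes> (g \<otimes> h)"
    and unit_Obj_left: "X \<in> Obj C \<Longrightarrow> \<one> \<boxtimes> X = X"
    and unit_Obj_right: "X \<in> Obj C \<Longrightarrow> X \<boxtimes> \<one> = X"
    and unit_Arr_left: "f \<in> Arr C \<Longrightarrow> idn \<one> \<otimes> f = f"
    and unit_Arr_right: "f \<in> Arr C \<Longrightarrow> f \<otimes> idn \<one> = f"

definition is_left_dual :: "('o, 'm, 'k, 'z) tensor_category_scheme \<Rightarrow> 'o \<Rightarrow> 'o \<Rightarrow> 'm \<Rightarrow> 'm \<Rightarrow> bool" where
  "is_left_dual C X Y e c \<longleftrightarrow> Y \<in> Obj C \<and>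
     e \<in> Hom C (Y \<boxtimes>\<^bsub>C\<^esub> X) \<one>\<^bsub>C\<^esub> \<and> c \<in> Hom C \<one>\<^bsub>C\<^esub> (X \<boxtimes>\<^bsub>C\<^esub> Y) \<and>
     (idn\<^bsub>C\<^esub> X \<otimes>\<^bsub>C\<^esub> e) \<cdot>\<^bsub>C\<^esub> (c \<otimes>\<^bsub>C\<^esub> idn\<^bsub>C\<^esub> X) = idn\<^bsub>C\<^esub> X \<and>
     (e \<otimes>\<^bsub>C\<^esub> idn\<^bsub>C\<^esub> Y) \<cdot>\<^bsub>C\<^esub> (idn\<^bsub>C\<^esub> Y \<otimes>\<^bsub>C\<^esub> c) = idn\<^bsub>C\<^esub> Y"

text \<open>In \<open>right_rigid\<close> the object \<open>Y\<close> is a right dual of \<open>X\<close>, i.e. \<open>X\<close> is a left dual of \<open>Y\<close>.\<close>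

locale finite_tensor_category =
  linear_category C + strict_monoidal_category C
  for C :: "('o, 'm, 'k :: alg_closed_field, 'z) tensor_category_scheme" (structure) +
  assumes finite_abelian: "finite_abelian C"
    and tensor_plus_left: "f \<in> Hom C X Y \<Longrightarrow> f' \<in> Hom C X Y \<Longrightarrow> g \<in> Hom C X' Y' \<Longrightarrow>
      (f \<oplus>\<^sub>a f') \<otimes> g = (f \<otimes> g) \<oplus>\<^sub>a (f' \<otimes> g)"
    and tensor_plus_right: "f \<in> Hom C X Y \<Longrightarrow> g \<in> Hom C X' Y' \<Longrightarrow> g' \<in> Hom C X' Y' \<Longrightarrow>
      f \<otimes> (g \<oplus>\<^sub>a g') = (f \<otimes> g) \<oplus>\<^sub>a (f \<otimes> g')"
    and tensor_scale_left: "f \<in> Arr C \<Longrightarrow> g \<in> Arr C \<Longrightarrow> (c \<star> f) \<otimes> g = c \<star> (f \<otimes> g)"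
    and tensor_scale_right: "f \<in> Arr C \<Longrightarrow> g \<in> Arr C \<Longrightarrow> f \<otimes> (c \<star> g) = c \<star> (f \<otimes> g)"
    and left_rigid: "X \<in> Obj C \<Longrightarrow> \<exists>Y e c. is_left_dual C X Y e c"
    and right_rigid: "X \<in> Obj C \<Longrightarrow> \<exists>Y e c. Y \<in> Obj C \<and> is_left_dual C Y X e c"
    and simple_unit: "simple_object C \<one>"


section \<open>The Drinfeld center and the modular object\<close>

context
  fixes C :: "('o, 'm, 'k, 'z) tensor_category_scheme" (structure)
begin

definition half_braiding :: "'o \<Rightarrow> ('o \<Rightarrow> 'm) \<Rightarrow> bool" where
  "half_braiding V \<sigma> \<longleftrightarrow> \<sigma> \<in> extensional (Obj C) \<and>
     (\<forall>X \<in> Obj C. \<sigma> X \<in> Hom C (V \<boxtimes> X) (X \<boxtimes> V) \<and> iso_arr C (\<sigma> X)) \<and>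
     (\<forall>X \<in> Obj C. \<forall>Y \<in> Obj C. \<forall>f \<in> Hom C X Y. (f \<otimes> idn V) \<cdot> \<sigma> X = \<sigma> Y \<cdot> (idn V \<otimes> f)) \<and>
     (\<forall>X \<in> Obj C. \<forall>Y \<in> Obj C. \<sigma> (X \<boxtimes> Y) = (idn X \<otimes> \<sigma> Y) \<cdot> (\<sigma> X \<otimes> idn Y))"

definition center_objects :: "('o \<times> ('o \<Rightarrow> 'm)) set" where
  "center_objects = {(V, \<sigma>). V \<in> Obj C \<and> half_braiding V \<sigma>}"

definition drinfeld_center ::
    "('o \<times> ('o \<Rightarrow> 'm), ('o \<times> ('o \<Rightarrow> 'm)) \<times> 'm \<times> ('o \<times> ('o \<Rightarrow> 'm)), 'k) linear_category" where
  "drinfeld_center = \<lparr>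
     Obj = center_objects,
     Arr = {(A, f, B). A \<in> center_objects \<and> B \<in> center_objects \<and> f \<in> Hom C (fst A) (fst B) \<and>
       (\<forall>X \<in> Obj C. (idn X \<otimes> f) \<cdot> snd A X = snd B X \<cdot> (f \<otimes> idn X))},
     Src = (\<lambda>(A, f, B). A),
     Tgt = (\<lambda>(A, f, B). B),
     Idn = (\<lambda>A. (A, idn (fst A), A)),
     Comp = (\<lambda>(A', f', B') (A, f, B). (A, f' \<cdot> f, B')),
     Plus = (\<lambda>(A, f, B) (A', f', B'). (A, f \<oplus>\<^sub>a f', B)),
     Zero = (\<lambda>A B. (A, Zero C (fst A) (fst B), B)),
     Scale = (\<lambda>c (A, f, B). (A, c \<star> f, B))\<rparr>"

definition center_unit :: "'o \<times> ('o \<Rightarrow> 'm)" where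
  "center_unit = (\<one>, \<lambda>X \<in> Obj C. idn X)"

definition forgetful_functor ::
    "('o \<times> ('o \<Rightarrow> 'm), ('o \<times> ('o \<Rightarrow> 'm)) \<times> 'm \<times> ('o \<times> ('o \<Rightarrow> 'm)), 'o, 'm) cat_functor" where
  "forgetful_functor = \<lparr>FObj = fst, FArr = (\<lambda>(A, f, B). f)\<rparr>"

definition modular_object ::
    "('o, 'm, 'o \<times> ('o \<Rightarrow> 'm), ('o \<times> ('o \<Rightarrow> 'm)) \<times> 'm \<times> ('o \<times> ('o \<Rightarrow> 'm))) cat_functor \<Rightarrow>
      'o \<Rightarrow> bool" where
  "modular_object R \<alpha> \<longleftrightarrow> simple_object C \<alpha> \<and>
     (\<exists>f \<in> Hom drinfeld_center (FObj R \<alpha>) center_unit.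
        f \<noteq> Zero drinfeld_center (FObj R \<alpha>) center_unit)"

end


section \<open>The central Hopf comonad and categorical integrals\<close>

record ('o, 'm) left_duality =
  DObj :: "'o \<Rightarrow> 'o"
  Ev :: "'o \<Rightarrow> 'm"
  Coev :: "'o \<Rightarrow> 'm"

context
  fixes C :: "('o, 'm, 'k, 'z) tensor_category_scheme" (structure)
    and D :: "('o, 'm) left_duality"
begin

definition is_left_duality :: bool where
  "is_left_duality \<longleftrightarrow> (\<forall>X \<in> Obj C. is_left_dual C X (DObj D X) (Ev D X) (Coev D X))"

text \<open>The dual \<open>f\<^sup>* : Y\<^sup>* \<rightarrow> X\<^sup>*\<close> of \<open>f : X \<rightarrow> Y\<close>.\<close>

definition dual_arr :: "'m \<Rightarrow> 'm" where
  "dual_arr f = (let X = Src C f; Y = Tgt C f in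
     (Ev D Y \<otimes> idn (DObj D X)) \<cdot> (idn (DObj D Y) \<otimes> f \<otimes> idn (DObj D X)) \<cdot> (idn (DObj D Y) \<otimes> Coev D X))"

definition dinatural :: "'o \<Rightarrow> 'o \<Rightarrow> ('o \<Rightarrow> 'm) \<Rightarrow> bool" where
  "dinatural V E p \<longleftrightarrow> E \<in> Obj C \<and>
     (\<forall>X \<in> Obj C. p X \<in> Hom C E (X \<boxtimes> V \<boxtimes> DObj D X)) \<and>
     (\<forall>X \<in> Obj C. \<forall>Y \<in> Obj C. \<forall>f \<in> Hom C X Y.
        (f \<otimes> idn V \<otimes> idn (DObj D X)) \<cdot> p X = (idn Y \<otimes> idn V \<otimes> dual_arr f) \<cdot> p Y)"

definition is_end :: "'o \<Rightarrow> 'o \<Rightarrow> ('o \<Rightarrow> 'm) \<Rightarrow> bool" where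
  "is_end V E p \<longleftrightarrow> dinatural V E p \<and>
     (\<forall>E' p'. dinatural V E' p' \<longrightarrow> (\<exists>!u. u \<in> Hom C E' E \<and> (\<forall>X \<in> Obj C. p X \<cdot> u = p' X)))"

text \<open>
  A choice of the ends \<open>Z V\<close> with their universal dinatural transformations \<open>\<pi> V\<close>. The action of
  \<open>Z\<close> on arrows is the unique one for which \<open>\<pi>\<close> is natural in \<open>V\<close>.
\<close>

definition central_comonad :: "('o \<Rightarrow> 'o) \<Rightarrow> ('o \<Rightarrow> 'o \<Rightarrow> 'm) \<Rightarrow> bool" where
  "central_comonad Z \<pi> \<longleftrightarrow> (\<forall>V \<in> Obj C. is_end V (Z V) (\<pi> V))"

text \<open>
  The usual formula \<open>\<epsilon>\<^sub>V = \<pi> V \<one>\<close> identifies \<open>\<one>\<^sup>*\<close> with \<open>\<one>\<close>. Since \<open>D\<close> is an arbitrary choice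
  of left duals, the identification is the isomorphism \<open>Ev D \<one> : \<one>\<^sup>* \<rightarrow> \<one>\<close>.
\<close>

definition counit_Z :: "('o \<Rightarrow> 'o \<Rightarrow> 'm) \<Rightarrow> 'o \<Rightarrow> 'm" where
  "counit_Z \<pi> V = (idn V \<otimes> Ev D \<one>) \<cdot> \<pi> V \<one>"

definition mult_Z :: "('o \<Rightarrow> 'o) \<Rightarrow> ('o \<Rightarrow> 'o \<Rightarrow> 'm) \<Rightarrow> 'o \<Rightarrow> 'o \<Rightarrow> 'm" where
  "mult_Z Z \<pi> V W = (THE u. u \<in> Hom C (Z V \<boxtimes> Z W) (Z (V \<boxtimes> W)) \<and>
     (\<forall>X \<in> Obj C. \<pi> (V \<boxtimes> W) X \<cdot> u =
        (idn X \<otimes> idn V \<otimes> Ev D X \<otimes> idn W \<otimes> idn (DObj D X)) \<cdot> (\<pi> V X \<otimes> \<pi> W X)))"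

definition left_integral :: "('o \<Rightarrow> 'o) \<Rightarrow> ('o \<Rightarrow> 'o \<Rightarrow> 'm) \<Rightarrow> 'o \<Rightarrow> 'm \<Rightarrow> bool" where
  "left_integral Z \<pi> \<alpha> \<Lambda> \<longleftrightarrow> \<Lambda> \<in> Hom C \<one> (Z \<alpha>) \<and>
     mult_Z Z \<pi> \<one> \<alpha> \<cdot> (idn (Z \<one>) \<otimes> \<Lambda>) = counit_Z \<pi> \<one> \<otimes> \<Lambda>"

definition right_integral :: "('o \<Rightarrow> 'o) \<Rightarrow> ('o \<Rightarrow> 'o \<Rightarrow> 'm) \<Rightarrow> 'o \<Rightarrow> 'm \<Rightarrow> bool" where
  "right_integral Z \<pi> \<alpha> \<Lambda> \<longleftrightarrow> \<Lambda> \<in> Hom C \<one> (Z \<alpha>) \<and>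
     mult_Z Z \<pi> \<alpha> \<one> \<cdot> (\<Lambda> \<otimes> idn (Z \<one>)) = \<Lambda> \<otimes> counit_Z \<pi> \<one>"

end

end

theory Submission
  imports Defs "Jordan_Normal_Form.Char_Poly"
begin

text \<open>
  By duality and the universal property of \<open>Z \<alpha>\<close>, a morphism \<open>\<Lambda> : \<one> \<rightarrow> Z \<alpha>\<close> amounts to a natural
  transformation \<open>l X : X \<rightarrow> X \<boxtimes> \<alpha>\<close> with \<open>l \<one> = counit \<cdot> \<Lambda>\<close>. It is an integral iff every natural family
  \<open>t X : W \<boxtimes> X \<rightarrow> X\<close> becomes trivial on one side of \<open>l\<close>, that is, acts there through \<open>t \<one> : W \<rightarrow> \<one>\<close>.

  If \<open>C\<close> is semisimple, let \<open>p\<close> be the natural endomorphism of the identity functor that projects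
  away from the isotypic component of \<open>\<one>\<close>. Since \<open>p \<one> = 0\<close>, the integral property gives \<open>l X \<cdot> p X = 0\<close>,
  so \<open>l\<close> lives on copies of \<open>\<one>\<close>, and \<open>l \<one> = 0\<close> would force \<open>l = 0\<close>.

  Conversely, let \<open>l \<one> \<noteq> 0\<close>. Then \<open>\<alpha>\<close> is isomorphic to \<open>\<one>\<close> and \<open>l\<close> becomes a natural endomorphism of
  the identity functor. Let \<open>G\<close> and \<open>I\<close> be the projective generator and the injective cogenerator
  coming from the regular module. The canonical elements of \<open>Hom G X \<otimes> Hom X I\<close> define a natural
  family \<open>G \<boxtimes> I\<^sup>* \<boxtimes> X \<rightarrow> X\<close>, and its triviality makes \<open>\<one>\<close> a direct summand of \<open>G\<close>. So \<open>\<one>\<close> is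
  projective, and by rigidity every object is projective.
\<close>

text \<open>The matrices that present \<open>C\<close> know nothing of its tensor product, so
  vectors cannot be tensored with vectors. The way out is to turn elements of \<open>X\<close> into
  arrows \<open>G \<rightarrow> X\<close> and linear functionals on \<open>X\<close> into arrows
  \<open>X \<rightarrow> I\<close>, which can be tensored like all arrows; the dual of
  \<open>I\<close> moves the target of a functional to the unit object. The price is that linear
  independence has to be recovered inside the category. This takes two things: tensoring preserves
  epimorphisms, by rigidity, and the algebra acts on the unit object by operators of rank one, by
  algebraic closedness of the field. Independence is what converts triviality into a splitting: an
  endomorphism of \<open>G\<close> that is killed by all arrows
  \<open>G \<rightarrow> \<one>\<close> is also killed by \<open>l G\<close>. After correction by a
  rank one endomorphism, \<open>l G\<close> therefore factors through an arrow
  \<open>G \<rightarrow> \<one>\<close>, and \<open>l \<one> = id\<close> makes the other factor a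
  section of that arrow. The parameter \<open>W\<close> of the natural families is taken to be
  \<open>G \<boxtimes> I\<^sup>*\<close> here; the other implication tests only with
  \<open>W = \<one>\<close>.\<close>

no_notation mult (infixl "\<otimes>\<index>" 70)
no_notation one ("\<one>\<index>")

section \<open>Matrices over a field\<close>

text \<open>Induction on the columns of \<open>T\<close>, with one-sided inverses of
  \<open>K\<close> and \<open>L\<close> carried along. A new column in the span of \<open>K\<close>
  only extends \<open>L\<close>; otherwise the column itself is adjoined to \<open>K\<close>. With
  index functions in place of matrices, adding a row or a column is a case distinction.\<close>

lemma rank_factorization_fun:
  fixes T :: "nat \<Rightarrow> nat \<Rightarrow> 'a :: field"
  shows "\<exists>(r::nat) K K' L L'. (\<forall>i<n. \<forall>j<m. T i j = (\<Sum>k<r. K i k * L k j)) \<and>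
    (\<forall>a<r. \<forall>b<r. (\<Sum>i<n. K' a i * K i b) = (if a = b then 1 else 0)) \<and>
    (\<forall>a<r. \<forall>b<r. (\<Sum>j<m. L a j * L' j b) = (if a = b then 1 else 0))"
proof (induction m)
  case 0
  show ?case by (rule exI[of _ 0]) auto
next
  case (Suc m)
  then obtain r :: nat and K K' L L' where IH:
    "\<forall>i<n. \<forall>j<m. T i j = (\<Sum>k<r. K i k * L k j)"
    "\<forall>a<r. \<forall>b<r. (\<Sum>i<n. K' a i * K i b) = (if a = b then 1 else 0)"
    "\<forall>a<r. \<forall>b<r. (\<Sum>j<m. L a j * L' j b) = (if a = b then 1 else 0)"
    by (elim exE conjE) (rule that)
  note T = IH(1)[rule_format] and K = IH(2)[rule_format] and L = IH(3)[rule_format]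
  \<comment> \<open>If column \<open>m\<close> lies in the span of \<open>K\<close>, its coordinates
    must be these, because \<open>K'\<close> is a left inverse of \<open>K\<close>. Comparing the
    column with this candidate decides membership in the span.\<close>
  define d where "d = (\<lambda>k. \<Sum>i<n. K' k i * T i m)"
  have d: "(\<Sum>i<n. K' k i * T i m) = d k" for k by (simp add: d_def)
  show ?case
  proof (cases "\<forall>i<n. T i m = (\<Sum>k<r. K i k * d k)")
    case True
    show ?thesis
    proof (rule exI[of _ r], rule exI[of _ K], rule exI[of _ K'],
        rule exI[of _ "\<lambda>k j. if j < m then L k j else d k"],
        rule exI[of _ "\<lambda>j k. if j < m then L' j k else 0"], intro conjI allI impI)
      fix i j assume ij: "i < n" "j < Suc m"
      show "T i j = (\<Sum>k<r. K i k * (if j < m then L k j else d k))"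
      proof (cases "j < m")
        case False
        then have "j = m" using ij by simp
        then show ?thesis using True ij by simp
      qed (simp add: T ij)
    next
      fix a b assume ab: "a < r" "b < r"
      show "(\<Sum>i<n. K' a i * K i b) = (if a = b then 1 else 0)" using K ab .
      show "(\<Sum>j<Suc m. (if j < m then L a j else d a) * (if j < m then L' j b else 0)) = (if a = b then 1 else 0)"
        using L[OF ab] by simp
    qed
  next
    case False
    then obtain p where p: "p < n" "T p m \<noteq> (\<Sum>k<r. K p k * d k)" by auto
    \<comment> \<open>Row \<open>p\<close> witnesses that the residual of column \<open>m\<close>
      under \<open>1 - K K'\<close> is nonzero, and \<open>c\<close> is the entry of the residual
      there. The functional \<open>\<phi>\<close> takes the \<open>p\<close>-th entry of the
      residual of a vector and divides by \<open>c\<close>, so it vanishes on the columns of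
      \<open>K\<close> and is 1 on the new column.\<close>
    define c where "c = T p m - (\<Sum>k<r. K p k * d k)"
    have c: "c \<noteq> 0" using p by (simp add: c_def)
    define \<phi> where "\<phi> = (\<lambda>j. ((if j = p then 1 else 0) - (\<Sum>k<r. K p k * K' k j)) / c)"
    have sum_\<phi>: "(\<Sum>i<n. \<phi> i * x i) = (x p - (\<Sum>k<r. K p k * (\<Sum>i<n. K' k i * x i))) / c"
      for x :: "nat \<Rightarrow> 'a"
    proof -
      have "(\<Sum>i<n. \<phi> i * x i) = (\<Sum>i<n. ((if i = p then x i else 0) - (\<Sum>k<r. K p k * (K' k i * x i))) / c)"
        by (intro sum.cong)
          (auto simp: \<phi>_def divide_simps c left_diff_distrib sum_distrib_right mult.assoc)
      also have "\<dots> = ((\<Sum>i<n. if i = p then x i else 0) - (\<Sum>i<n. \<Sum>k<r. K p k * (K' k i * x i))) / c"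
        by (simp add: sum_divide_distrib[symmetric] sum_subtractf)
      also have "(\<Sum>i<n. \<Sum>k<r. K p k * (K' k i * x i)) = (\<Sum>k<r. \<Sum>i<n. K p k * (K' k i * x i))"
        by (rule sum.swap)
      finally show ?thesis using p(1) by (simp add: sum_distrib_left)
    qed
    have \<phi>K: "(\<Sum>i<n. \<phi> i * K i b) = 0" if "b < r" for b
    proof -
      have "(\<Sum>k<r. K p k * (\<Sum>i<n. K' k i * K i b)) = (\<Sum>k<r. if k = b then K p k else 0)"
        by (intro sum.cong) (auto simp: K that)
      then show ?thesis using that by (simp add: sum_\<phi>)
    qed
    have \<phi>T: "(\<Sum>i<n. \<phi> i * T i m) = 1"
      using c by (simp add: sum_\<phi> d c_def[symmetric])
    show ?thesis
    \<comment> \<open>The old rows of \<open>K'\<close> are corrected by multiples of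
      \<open>\<phi>\<close> so that they vanish on the new column; the new row is
      \<open>\<phi>\<close> itself.\<close>
    proof (rule exI[of _ "Suc r"], rule exI[of _ "\<lambda>i k. if k < r then K i k else T i m"],
        rule exI[of _ "\<lambda>k i. if k < r then K' k i - d k * \<phi> i else \<phi> i"],
        rule exI[of _ "\<lambda>k j. if k < r then if j < m then L k j else 0 else if j < m then 0 else 1"],
        rule exI[of _ "\<lambda>j k. if k < r then if j < m then L' j k else 0 else if j < m then 0 else 1"],
        intro conjI allI impI)
      fix a b assume ab: "a < Suc r" "b < Suc r"
      have *: "(\<Sum>i<n. (K' a i - d a * \<phi> i) * x i) = (\<Sum>i<n. K' a i * x i) - d a * (\<Sum>i<n. \<phi> i * x i)"
        for x by (simp add: left_diff_distrib sum_subtractf sum_distrib_left mult.assoc)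
      show "(\<Sum>i<n. (if a < r then K' a i - d a * \<phi> i else \<phi> i) * (if b < r then K i b else T i m))
          = (if a = b then 1 else 0)"
        using ab by (cases "a < r"; cases "b < r") (simp_all add: * K \<phi>K \<phi>T d less_Suc_eq)
      show "(\<Sum>j<Suc m. (if a < r then if j < m then L a j else 0 else if j < m then 0 else 1) *
          (if b < r then if j < m then L' j b else 0 else if j < m then 0 else 1)) = (if a = b then 1 else 0)"
        using ab L by (cases "a < r"; cases "b < r") (simp_all add: less_Suc_eq)
    next
      fix i j assume ij: "i < n" "j < Suc m"
      show "T i j = (\<Sum>k<Suc r. (if k < r then K i k else T i m) *
          (if k < r then if j < m then L k j else 0 else if j < m then 0 else 1))"
      proof (cases "j < m")
        case True
        then show ?thesis using T[OF ij(1) True] by simp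
      next
        case False
        then have "j = m" using ij by simp
        then show ?thesis by simp
      qed
    qed
  qed
qed

lemma rank_factorization:
  fixes T :: "'a :: field mat"
  assumes "T \<in> carrier_mat n m"
  obtains r K K' L L' where "K \<in> carrier_mat n r" "K' \<in> carrier_mat r n" "L \<in> carrier_mat r m"
    "L' \<in> carrier_mat m r" "K' * K = 1\<^sub>m r" "L * L' = 1\<^sub>m r" "T = K * L"
proof -
  obtain r :: nat and K K' L L' where *: "\<forall>i<n. \<forall>j<m. T $$ (i, j) = (\<Sum>k<r. K i k * L k j)"
    "\<forall>a<r. \<forall>b<r. (\<Sum>i<n. K' a i * K i b) = (if a = b then 1 else 0)"
    "\<forall>a<r. \<forall>b<r. (\<Sum>j<m. L a j * L' j b) = (if a = b then 1 else 0)"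
    using rank_factorization_fun[of n m "\<lambda>i j. T $$ (i, j)"] by (elim exE conjE) (rule that)
  show ?thesis
  proof
    show "mat r n (\<lambda>(a, b). K' a b) * mat n r (\<lambda>(a, b). K a b) = 1\<^sub>m r"
      by (rule eq_matI) (use * in \<open>auto simp: scalar_prod_def lessThan_atLeast0[symmetric]\<close>)
    show "mat r m (\<lambda>(a, b). L a b) * mat m r (\<lambda>(a, b). L' a b) = 1\<^sub>m r"
      by (rule eq_matI) (use * in \<open>auto simp: scalar_prod_def lessThan_atLeast0[symmetric]\<close>)
    show "T = mat n r (\<lambda>(a, b). K a b) * mat r m (\<lambda>(a, b). L a b)"
      by (rule eq_matI) (use * assms in \<open>auto simp: scalar_prod_def lessThan_atLeast0[symmetric]\<close>)
  qed auto
qed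

text \<open>If \<open>n < r\<close>, padding with zeros makes both factors square without changing
  the product, so they are two-sided inverses. But row \<open>n\<close> of the padded
  \<open>B\<close> is zero, hence so is the \<open>(n, n)\<close> entry of the product in the other
  order.\<close>

lemma right_inverse_dim:
  fixes A :: "'a :: field mat"
  assumes A: "A \<in> carrier_mat r n" and B: "B \<in> carrier_mat n r" and AB: "A * B = 1\<^sub>m r"
  shows "r \<le> n"
proof (rule ccontr)
  assume "\<not> r \<le> n"
  then have r: "n < r" by simp
  define A' where "A' = mat r r (\<lambda>(i, j). if j < n then A $$ (i, j) else 0)"
  define B' where "B' = mat r r (\<lambda>(i, j). if i < n then B $$ (i, j) else 0)"
  have c: "A' \<in> carrier_mat r r" "B' \<in> carrier_mat r r" by (auto simp: A'_def B'_def)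
  have "A' * B' = A * B"
  proof (rule eq_matI)
    fix i j assume ij: "i < dim_row (A * B)" "j < dim_col (A * B)"
    have "(\<Sum>k<r. A' $$ (i, k) * B' $$ (k, j)) = (\<Sum>k<n. A $$ (i, k) * B $$ (k, j))"
      by (rule sum.mono_neutral_cong_right) (use r ij A B in \<open>auto simp: A'_def B'_def\<close>)
    then show "(A' * B') $$ (i, j) = (A * B) $$ (i, j)"
      using ij A B by (simp add: scalar_prod_def lessThan_atLeast0[symmetric] A'_def B'_def)
  qed (use A B in \<open>auto simp: A'_def B'_def\<close>)
  then have "B' * A' = 1\<^sub>m r" using mat_mult_left_right_inverse[OF c] AB by simp
  then have "(B' * A') $$ (n, n) = 1" using r by simp
  then show False using r by (simp add: scalar_prod_def A'_def B'_def)
qed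

lemma mat_assoc:
  fixes A :: "'a :: semiring_0 mat"
  assumes "dim_col A = dim_row B" "dim_col B = dim_row C"
  shows "A * B * C = A * (B * C)"
  by (rule assoc_mult_mat[of A "dim_row A" "dim_row B" B "dim_row C" C "dim_col C"])
    (use assms in \<open>auto intro!: carrier_matI\<close>)

text \<open>Products are normalised by nesting to the right, which hides the factor
  \<open>A * B\<close>. In this form an equation for \<open>A * B\<close> still rewrites inside such
  a product.\<close>

lemma mat_assoc_subst:
  fixes A :: "'a :: semiring_0 mat"
  assumes "A * B = M" "dim_col A = dim_row B" "dim_col B = dim_row C"
  shows "A * (B * C) = M * C"
  using mat_assoc[OF assms(2,3)] assms(1) by simp

lemma mat_vec_assoc:
  fixes A :: "'a :: semiring_0 mat"
  assumes "dim_col A = dim_row B" "dim_col B = dim_vec v"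
  shows "(A * B) *\<^sub>v v = A *\<^sub>v (B *\<^sub>v v)"
  by (rule assoc_mult_mat_vec[of A "dim_row A" "dim_row B" B "dim_vec v" v])
    (use assms in \<open>auto intro!: carrier_matI carrier_vecI\<close>)

lemma vec_eq_iff_minus_zero:
  fixes v :: "'a :: ab_group_add vec"
  assumes "v \<in> carrier_vec n" "w \<in> carrier_vec n" "v - w = 0\<^sub>v n"
  shows "v = w"
proof (rule eq_vecI)
  fix i assume i: "i < dim_vec w"
  have "(v - w) $ i = 0" unfolding assms(3) using assms(2) i by simp
  moreover have "(v - w) $ i = v $ i - w $ i" using i by simp
  ultimately show "v $ i = w $ i" by simp
qed (use assms in auto)

lemma mult_mat_unit_vec:
  fixes A :: "'a :: comm_ring_1 mat"
  assumes "A \<in> carrier_mat n m" "i < m"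
  shows "A *\<^sub>v unit_vec m i = col A i"
  using assms by (intro eq_vecI) auto

lemma mat_minus_zero: "M \<in> carrier_mat n m \<Longrightarrow> M - 0\<^sub>m n m = (M :: 'a :: group_add mat)"
  by (intro eq_matI) auto

lemma zero_mat_mult_vec: "v \<in> carrier_vec m \<Longrightarrow> 0\<^sub>m n m *\<^sub>v (v :: 'a :: semiring_0 vec) = 0\<^sub>v n"
  by (intro eq_vecI) (auto simp: scalar_prod_def)

lemma mat_mult_zero_vec: "A \<in> carrier_mat n m \<Longrightarrow> A *\<^sub>v 0\<^sub>v m = (0\<^sub>v n :: 'a :: semiring_0 vec)"
  by (intro eq_vecI) auto

lemma nonzero_vec_index:
  assumes "v \<in> carrier_vec n" "v \<noteq> 0\<^sub>v n"
  shows "\<exists>i<n. v $ i \<noteq> 0"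
proof (rule ccontr)
  assume "\<not> ?thesis"
  then have "v = 0\<^sub>v n" using assms(1) by (intro eq_vecI) auto
  then show False using assms(2) by simp
qed

lemma mat_eq_by_vec:
  fixes A B :: "'a :: comm_ring_1 mat"
  assumes "A \<in> carrier_mat n m" "B \<in> carrier_mat n m" "\<And>v. v \<in> carrier_vec m \<Longrightarrow> A *\<^sub>v v = B *\<^sub>v v"
  shows "A = B"
proof (rule mat_col_eqI)
  fix i assume i: "i < dim_col B"
  then have "A *\<^sub>v unit_vec m i = B *\<^sub>v unit_vec m i" by (intro assms(3)) auto
  then show "col A i = col B i" using assms(1,2) i
    by (simp add: mult_mat_unit_vec)
qed (use assms in auto)

lemma linear_map_matrix:
  fixes f :: "'a :: field vec \<Rightarrow> 'a vec"
  assumes f: "\<And>v. v \<in> carrier_vec n \<Longrightarrow> f v \<in> carrier_vec m"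
    and add: "\<And>v w. v \<in> carrier_vec n \<Longrightarrow> w \<in> carrier_vec n \<Longrightarrow> f (v + w) = f v + f w"
    and smult: "\<And>c v. v \<in> carrier_vec n \<Longrightarrow> f (c \<cdot>\<^sub>v v) = c \<cdot>\<^sub>v f v"
  obtains M where "M \<in> carrier_mat m n" "\<And>v. v \<in> carrier_vec n \<Longrightarrow> f v = M *\<^sub>v v"
proof
  define M where "M = mat m n (\<lambda>(i, j). f (unit_vec n j) $ i)"
  show M: "M \<in> carrier_mat m n" by (simp add: M_def)
  fix v :: "'a vec" assume v: "v \<in> carrier_vec n"
  \<comment> \<open>\<open>w k\<close> keeps the first \<open>k\<close> coordinates of
    \<open>v\<close>. Induction on \<open>k\<close> replaces the expansion of \<open>v\<close> as a
    sum of vectors.\<close>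
  define w where "w = (\<lambda>k. vec n (\<lambda>i. if i < k then v $ i else 0))"
  have w: "w k \<in> carrier_vec n" for k by (simp add: w_def)
  have "f (w k) = M *\<^sub>v w k" if "k \<le> n" for k using that
  proof (induction k)
    case 0
    have "w 0 = 0 \<cdot>\<^sub>v w 0" by (auto simp: w_def)
    then have "f (w 0) = 0 \<cdot>\<^sub>v f (w 0)" using smult[OF w, of 0 0] by metis
    also have "\<dots> = 0\<^sub>v m" using f[OF w, of 0] by auto
    finally show ?case using M by (auto simp: w_def scalar_prod_def)
  next
    case (Suc k)
    have e: "unit_vec n k \<in> carrier_vec n" by simp
    have "w (Suc k) = w k + v $ k \<cdot>\<^sub>v unit_vec n k"
      using Suc.prems by (intro eq_vecI) (auto simp: w_def less_Suc_eq)
    moreover have "f (unit_vec n k) = M *\<^sub>v unit_vec n k"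
      using Suc.prems f[OF e] by (intro eq_vecI) (auto simp: M_def)
    ultimately show ?case
      using Suc w[of k] e by (simp add: add smult mult_add_distrib_mat_vec[OF M] mult_mat_vec[OF M])
  qed
  moreover have "w n = v" using v by (auto simp: w_def)
  ultimately show "f v = M *\<^sub>v v" by (metis le_refl)
qed

text \<open>For a full rank factorization \<open>K = A * L\<close>, the vector
  \<open>L' L x - x\<close> lies in the kernel of \<open>K\<close> because
  \<open>L * L' = 1\<close>. Injectivity thus makes \<open>L'\<close> a two-sided inverse of
  \<open>L\<close>, and \<open>L' * A'\<close> is a left inverse of \<open>K\<close>.\<close>

lemma injective_left_inverse:
  fixes K :: "'a :: field mat"
  assumes K: "K \<in> carrier_mat n m"
    and inj: "\<And>x. x \<in> carrier_vec m \<Longrightarrow> K *\<^sub>v x = 0\<^sub>v n \<Longrightarrow> x = 0\<^sub>v m"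
  obtains K' where "K' \<in> carrier_mat m n" "K' * K = 1\<^sub>m m"
proof -
  obtain r A A' L L' where f: "A \<in> carrier_mat n r" "A' \<in> carrier_mat r n" "L \<in> carrier_mat r m"
    "L' \<in> carrier_mat m r" "A' * A = 1\<^sub>m r" "L * L' = 1\<^sub>m r" "K = A * L"
    using rank_factorization[OF K] by metis
  have "L' * L = 1\<^sub>m m"
  proof (rule mat_eq_by_vec[of _ m m])
    fix x :: "'a vec" assume x: "x \<in> carrier_vec m"
    have Lx: "L' *\<^sub>v (L *\<^sub>v x) \<in> carrier_vec m" using f x by simp
    have "K *\<^sub>v (L' *\<^sub>v (L *\<^sub>v x)) = (A * (L * L') * L) *\<^sub>v x"
      using f(1-4) x unfolding f(7) by (simp add: mat_assoc mat_vec_assoc)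
    also have "\<dots> = K *\<^sub>v x" using f by simp
    finally have "K *\<^sub>v (L' *\<^sub>v (L *\<^sub>v x) - x) = 0\<^sub>v n"
      using f x Lx K by (simp add: mult_minus_distrib_mat_vec)
    then have "L' *\<^sub>v (L *\<^sub>v x) - x = 0\<^sub>v m" using x Lx by (intro inj) auto
    then have "L' *\<^sub>v (L *\<^sub>v x) = x" using vec_eq_iff_minus_zero Lx x by blast
    then show "(L' * L) *\<^sub>v x = 1\<^sub>m m *\<^sub>v x" using f(3,4) x by simp
  qed (use f(3,4) in simp_all)
  moreover have "L' * A' * K = L' * (A' * A * L)"
    unfolding f(7) using f(1-4) by (simp add: mat_assoc)
  ultimately have "(L' * A') * K = 1\<^sub>m m" using f(3,5) by simp
  then show ?thesis using f(2,4) by (intro that[of "L' * A'"]) simp_all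
qed

lemma surjective_right_inverse:
  fixes L :: "'a :: comm_ring_1 mat"
  assumes L: "L \<in> carrier_mat r m"
    and surj: "\<And>y. y \<in> carrier_vec r \<Longrightarrow> \<exists>x \<in> carrier_vec m. L *\<^sub>v x = y"
  obtains L' where "L' \<in> carrier_mat m r" "L * L' = 1\<^sub>m r"
proof -
  have "\<exists>x \<in> carrier_vec m. L *\<^sub>v x = unit_vec r i" for i by (rule surj) simp
  then obtain x where x: "\<And>i. x i \<in> carrier_vec m" "\<And>i. L *\<^sub>v x i = unit_vec r i" by metis
  define L' where "L' = mat m r (\<lambda>(i, j). x j $ i)"
  have L': "L' \<in> carrier_mat m r" by (simp add: L'_def)
  have "L * L' = 1\<^sub>m r"
  proof (rule mat_col_eqI)
    fix j assume j: "j < dim_col (1\<^sub>m r :: 'a mat)"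
    have "col L' j = x j" using j x(1)[of j] by (auto simp: L'_def)
    then have "col (L * L') j = L *\<^sub>v x j" using j by (subst col_mult2[OF L L']) simp_all
    then show "col (L * L') j = col (1\<^sub>m r) j" using j x(2) by simp
  qed (use L L' in simp_all)
  then show ?thesis by (rule that[OF L'])
qed

lemma alg_closed_eigenvector:
  fixes B :: "'a :: alg_closed_field mat"
  assumes B: "B \<in> carrier_mat r r" and r: "0 < r"
  shows "\<exists>\<mu> v. v \<in> carrier_vec r \<and> v \<noteq> 0\<^sub>v r \<and> B *\<^sub>v v = \<mu> \<cdot>\<^sub>v v"
proof -
  have "degree (char_poly B) = r" using degree_monic_char_poly[OF B] by simp
  then obtain \<mu> where "poly (char_poly B) \<mu> = 0"
    using alg_closed_imp_poly_has_root[of "char_poly B"] r by blast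
  then have "eigenvalue B \<mu>" 
    using eigenvalue_root_char_poly[OF B, of \<mu>] by blast
  then have "\<exists>v. eigenvector B v \<mu>" 
    unfolding eigenvalue_def 
    .
  then obtain v where v: "eigenvector B v \<mu>" 
    by blast
  have "dim_row B = r"
    using B
    by simp
  then have "v \<in> carrier_vec r \<and> v \<noteq> 0\<^sub>v r \<and> B *\<^sub>v v = \<mu> \<cdot>\<^sub>v v" 
    using v 
    unfolding eigenvector_def 
    by simp
  then show ?thesis
    by blast
qed

text \<open>A weak form of Burnside's theorem on irreducible matrix algebras, by the usual argument: a
  nonzero member \<open>T\<close> of least rank satisfies \<open>T M T \<in> k T\<close> for all members \<open>M\<close>, so it has rank one.\<close>

lemma irreducible_rank_one:
  fixes \<A> :: "'a :: alg_closed_field mat set"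
  assumes carrier: "\<A> \<subseteq> carrier_mat n n"
    and mult: "\<And>M N. M \<in> \<A> \<Longrightarrow> N \<in> \<A> \<Longrightarrow> M * N \<in> \<A>"
    and add: "\<And>M N. M \<in> \<A> \<Longrightarrow> N \<in> \<A> \<Longrightarrow> M + N \<in> \<A>"
    and smult: "\<And>c M. M \<in> \<A> \<Longrightarrow> c \<cdot>\<^sub>m M \<in> \<A>"
    and irr: "\<And>x y. x \<in> carrier_vec n \<Longrightarrow> x \<noteq> 0\<^sub>v n \<Longrightarrow> y \<in> carrier_vec n \<Longrightarrow> \<exists>M \<in> \<A>. M *\<^sub>v x = y"
    and x: "x \<in> carrier_vec n" "x \<noteq> 0\<^sub>v n" and s: "s \<in> carrier_vec n"
  obtains M \<sigma> where "M \<in> \<A>" "\<sigma> \<in> carrier_vec n" "\<sigma> \<bullet> x = 1"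
    "\<And>y. y \<in> carrier_vec n \<Longrightarrow> M *\<^sub>v y = (\<sigma> \<bullet> y) \<cdot>\<^sub>v s"
proof -
  \<comment> \<open>A nonzero member factors through a space of dimension \<open>r\<close>. The
    least such \<open>r\<close> serves as least rank, and the factorization is exactly what the
    argument works with.\<close>
  define P where "P = (\<lambda>r. \<exists>T \<in> \<A>. T \<noteq> 0\<^sub>m n n \<and> (\<exists>K \<in> carrier_mat n r. \<exists>L \<in> carrier_mat r n. T = K * L))"
  have "P n"
  proof -
    obtain T where T: "T \<in> \<A>" "T *\<^sub>v x = x" using irr x by blast
    then have "T \<noteq> 0\<^sub>m n n" using x zero_mat_mult_vec[OF x(1)] by auto
    moreover have Tn: "T \<in> carrier_mat n n" using T carrier by blast
    moreover have "T = T * 1\<^sub>m n" using right_mult_one_mat[OF Tn] by simp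
    ultimately show ?thesis unfolding P_def
      using T(1) by (intro bexI[of _ T] conjI bexI[of _ "1\<^sub>m n"]) simp_all
  qed
  define r where "r = (LEAST r. P r)"
  have "P r" unfolding r_def by (rule LeastI) fact
  have least: "r \<le> q" if "P q" for q unfolding r_def using that by (rule Least_le)
  obtain T K L where T: "T \<in> \<A>" "T \<noteq> 0\<^sub>m n n" and K: "K \<in> carrier_mat n r" and L: "L \<in> carrier_mat r n"
    and TKL: "T = K * L" using \<open>P r\<close> unfolding P_def by blast
  have Tc: "T \<in> carrier_mat n n" using T carrier by auto
  have r0: "0 < r"
  proof (rule ccontr)
    assume "\<not> 0 < r"
    then have "T = 0\<^sub>m n n" using K L TKL by (intro eq_matI) (auto simp: scalar_prod_def)
    then show False using T by simp
  qed
  have TMT: "\<exists>\<mu>. T * M * T = \<mu> \<cdot>\<^sub>m T" if M: "M \<in> \<A>" for M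
  proof -
    have Mc: "M \<in> carrier_mat n n" using M carrier by auto
    \<comment> \<open>\<open>B\<close> is the compression of \<open>M\<close> to the space through
      which \<open>T\<close> factors, so that \<open>T M T = K B L\<close>. An eigenvalue
      \<open>\<mu>\<close> of \<open>B\<close> makes \<open>S = B - \<mu>\<close> singular.\<close>
    define B where "B = L * M * K"
    have B: "B \<in> carrier_mat r r" using K L Mc by (simp add: B_def)
    obtain \<mu> v where v: "v \<in> carrier_vec r" "v \<noteq> 0\<^sub>v r" "B *\<^sub>v v = \<mu> \<cdot>\<^sub>v v"
      using alg_closed_eigenvector[OF B r0] by blast
    define S where "S = B + (- \<mu>) \<cdot>\<^sub>m 1\<^sub>m r"
    have S: "S \<in> carrier_mat r r" using B by (simp add: S_def)
    have Sv: "S *\<^sub>v v = 0\<^sub>v r"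
    proof -
      have "S *\<^sub>v v = B *\<^sub>v v + ((- \<mu>) \<cdot>\<^sub>m 1\<^sub>m r) *\<^sub>v v"
        unfolding S_def using B v by (intro add_mult_distrib_mat_vec) auto
      also have "((- \<mu>) \<cdot>\<^sub>m 1\<^sub>m r) *\<^sub>v v = (- \<mu>) \<cdot>\<^sub>v v" using v by auto
      finally show ?thesis using v by auto
    qed
    obtain q K1 K1' L1 L1' where f: "K1 \<in> carrier_mat r q" "K1' \<in> carrier_mat q r" "L1 \<in> carrier_mat q r"
      "L1' \<in> carrier_mat r q" "K1' * K1 = 1\<^sub>m q" "L1 * L1' = 1\<^sub>m q" "S = K1 * L1"
      by (rule rank_factorization[OF S])
    have "q \<le> r" using right_inverse_dim[OF f(3,4,6)] .
    \<comment> \<open>If \<open>S\<close> had full rank, both of its factors would be invertible and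
      the eigenvector \<open>v\<close> in its kernel would be zero.\<close>
    moreover have "q \<noteq> r"
    proof
      assume qr: "q = r"
      then have L1: "L1' * L1 = 1\<^sub>m r" using mat_mult_left_right_inverse f(3,4,6) by metis
      have "v = L1' *\<^sub>v ((K1' * K1) *\<^sub>v (L1 *\<^sub>v v))"
        using L1 f(1-6) v(1) by (simp add: mat_vec_assoc[symmetric])
      also have "(K1' * K1) *\<^sub>v (L1 *\<^sub>v v) = K1' *\<^sub>v (S *\<^sub>v v)"
        unfolding f(7) using f(1-3) v(1) by (simp add: mat_vec_assoc)
      also have "L1' *\<^sub>v \<dots> = 0\<^sub>v r" using Sv f(2,4) by (simp add: mat_mult_zero_vec)
      finally have "v = 0\<^sub>v r" .
      then show False using v by simp
    qed
    ultimately have qr: "q < r" by simp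
    \<comment> \<open>\<open>T M T - \<mu> T = K S L\<close> belongs to the algebra and factors
      through dimension \<open>q < r\<close>, so minimality of \<open>r\<close> forces it to be
      zero.\<close>
    define T' where "T' = T * M * T + (- \<mu>) \<cdot>\<^sub>m T"
    have T': "T' \<in> \<A>" using T M by (simp add: T'_def mult add smult)
    have "T' = K * S * L"
    proof -
      have "K * S = K * B + K * ((- \<mu>) \<cdot>\<^sub>m 1\<^sub>m r)"
        unfolding S_def by (rule mult_add_distrib_mat[OF K B]) simp
      then have "K * S * L = K * B * L + K * ((- \<mu>) \<cdot>\<^sub>m 1\<^sub>m r) * L"
        using add_mult_distrib_mat[OF mult_carrier_mat[OF K B] mult_carrier_mat[OF K smult_carrier_mat[OF one_carrier_mat]] L]
        by simp
      also have "K * B * L = T * M * T"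
        unfolding B_def TKL using K L Mc by (simp add: mat_assoc)
      also have "K * ((- \<mu>) \<cdot>\<^sub>m 1\<^sub>m r) * L = (- \<mu>) \<cdot>\<^sub>m T"
        unfolding TKL using mult_smult_distrib[OF K one_carrier_mat] mult_smult_assoc_mat[OF K L] K by simp
      finally show ?thesis by (simp add: T'_def)
    qed
    then have fac: "T' = (K * K1) * (L1 * L)" unfolding f(7)
      using K L f(1,3) by (simp add: mat_assoc)
    have "T' = 0\<^sub>m n n"
    proof (rule ccontr)
      assume "T' \<noteq> 0\<^sub>m n n"
      then have "P q" unfolding P_def
        using T' fac mult_carrier_mat[OF K f(1)] mult_carrier_mat[OF f(3) L] by blast
      then show False using least qr by fastforce
    qed
    then have "T * M * T = \<mu> \<cdot>\<^sub>m T"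
    proof (intro eq_matI)
      fix i j assume ij: "i < dim_row (\<mu> \<cdot>\<^sub>m T)" "j < dim_col (\<mu> \<cdot>\<^sub>m T)"
      have "T' $$ (i, j) = 0" using \<open>T' = 0\<^sub>m n n\<close> ij Tc by auto
      then show "(T * M * T) $$ (i, j) = (\<mu> \<cdot>\<^sub>m T) $$ (i, j)" using ij Tc Mc
        by (simp add: T'_def del: index_mult_mat(1))
    qed (use Tc Mc in auto)
    then show ?thesis by blast
  qed
  obtain z where z: "z \<in> carrier_vec n" "T *\<^sub>v z \<noteq> 0\<^sub>v n"
    using mat_eq_by_vec[OF Tc zero_carrier_mat] T(2) by (auto simp: zero_mat_mult_vec)
  define w where "w = T *\<^sub>v z"
  have w: "w \<in> carrier_vec n" "w \<noteq> 0\<^sub>v n" using z Tc by (auto simp: w_def)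
  then obtain i where i: "i < n" "w $ i \<noteq> 0" using nonzero_vec_index by auto
  \<comment> \<open>\<open>T y\<close> will turn out to be a multiple of \<open>w\<close>; since
    \<open>w $ i\<close> is nonzero, the multiple can be read off from coordinate
    \<open>i\<close>.\<close>
  define \<tau> where "\<tau> = (1 / w $ i) \<cdot>\<^sub>v row T i"
  have \<tau>: "\<tau> \<in> carrier_vec n" using Tc i by (simp add: \<tau>_def)
  have \<tau>y: "\<tau> \<bullet> y = (T *\<^sub>v y) $ i / w $ i" if "y \<in> carrier_vec n" for y
    using that Tc i by (simp add: \<tau>_def)
  have Ty: "T *\<^sub>v y = (\<tau> \<bullet> y) \<cdot>\<^sub>v w" if y: "y \<in> carrier_vec n" for y
  proof -
    \<comment> \<open>Irreducibility writes \<open>y\<close> as \<open>M w\<close> with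
      \<open>w = T z\<close>, so \<open>T y = T M T z\<close> is a multiple of
      \<open>T z = w\<close>. Hence \<open>T\<close> has rank one.\<close>
    obtain M where M: "M \<in> \<A>" "M *\<^sub>v w = y" using irr w y by blast
    have Mc: "M \<in> carrier_mat n n" using M carrier by auto
    obtain \<mu> where \<mu>: "T * M * T = \<mu> \<cdot>\<^sub>m T" using TMT M by blast
    have "T *\<^sub>v y = (T * M * T) *\<^sub>v z"
      unfolding M(2)[symmetric] w_def using Tc Mc z by (simp add: mat_vec_assoc mat_assoc)
    also have "\<dots> = \<mu> \<cdot>\<^sub>v w" unfolding \<mu> w_def using Tc z by auto
    finally have "T *\<^sub>v y = \<mu> \<cdot>\<^sub>v w" .
    moreover from this have "\<tau> \<bullet> y = \<mu>" using \<tau>y[OF y] i w by simp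
    ultimately show ?thesis by simp
  qed
  have \<tau>z: "\<tau> \<bullet> z = 1" using \<tau>y z i by (simp add: w_def[symmetric])
  \<comment> \<open>Irreducibility also moves the rank one operator into place: \<open>B\<close>
    carries \<open>x\<close> to \<open>z\<close>, where the functional is 1, and \<open>A\<close>
    carries the image line to the line of \<open>s\<close>.\<close>
  obtain A B where AB: "A \<in> \<A>" "A *\<^sub>v w = s" "B \<in> \<A>" "B *\<^sub>v x = z" using irr[OF w s] irr[OF x z(1)] by auto
  have ABc: "A \<in> carrier_mat n n" "B \<in> carrier_mat n n" using AB carrier by auto
  define \<sigma> where "\<sigma> = B\<^sup>T *\<^sub>v \<tau>"
  have \<sigma>: "\<sigma> \<bullet> y = \<tau> \<bullet> (B *\<^sub>v y)" if "y \<in> carrier_vec n" for y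
    using ABc \<tau> that by (simp add: \<sigma>_def transpose_vec_mult_scalar)
  show ?thesis
  proof
    show "A * T * B \<in> \<A>" using AB T mult by blast
    show "\<sigma> \<in> carrier_vec n" using ABc \<tau> by (simp add: \<sigma>_def)
    show "\<sigma> \<bullet> x = 1" using \<sigma> x AB \<tau>z by simp
    fix y :: "'a vec" assume y: "y \<in> carrier_vec n"
    have "(A * T * B) *\<^sub>v y = A *\<^sub>v (T *\<^sub>v (B *\<^sub>v y))"
      using ABc Tc y by (simp add: mat_vec_assoc mat_assoc)
    also have "T *\<^sub>v (B *\<^sub>v y) = (\<sigma> \<bullet> y) \<cdot>\<^sub>v w" using Ty[of "B *\<^sub>v y"] \<sigma> ABc y by simp
    also have "A *\<^sub>v \<dots> = (\<sigma> \<bullet> y) \<cdot>\<^sub>v s" using ABc w AB(2) by (simp add: mult_mat_vec)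
    finally show "(A * T * B) *\<^sub>v y = (\<sigma> \<bullet> y) \<cdot>\<^sub>v s" .
  qed
qed

section \<open>Presenting a finite abelian category by matrices\<close>

context category
begin

lemma Hom_Obj: "f \<in> Hom C X Y \<Longrightarrow> X \<in> Obj C" "f \<in> Hom C X Y \<Longrightarrow> Y \<in> Obj C"
  using Src_in Tgt_in unfolding Hom_def by auto

lemma Hom_Arr: "f \<in> Hom C X Y \<Longrightarrow> f \<in> Arr C"
  unfolding Hom_def by auto

lemma Hom_Src_Tgt: "f \<in> Hom C X Y \<Longrightarrow> Src C f = X" "f \<in> Hom C X Y \<Longrightarrow> Tgt C f = Y"
  unfolding Hom_def by auto

lemma iso_arrI:
  assumes "f \<in> Hom C X Y" "g \<in> Hom C Y X" "g \<cdot> f = idn X" "f \<cdot> g = idn Y"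
  shows "iso_arr C f"
  using assms unfolding iso_arr_def Hom_def by auto

lemma iso_arrE:
  assumes "iso_arr C f" "f \<in> Hom C X Y"
  obtains g where "g \<in> Hom C Y X" "g \<cdot> f = idn X" "f \<cdot> g = idn Y"
  using assms unfolding iso_arr_def by (auto simp: Hom_Src_Tgt)

lemma iso_arr_cancel_left:
  assumes "iso_arr C e" and e: "e \<in> Hom C Y W" and f: "f \<in> Hom C X Y" and g: "g \<in> Hom C X Y"
    and eq: "e \<cdot> f = e \<cdot> g"
  shows "f = g"
proof -
  obtain d where d: "d \<in> Hom C W Y" "d \<cdot> e = idn Y" using iso_arrE[OF assms(1,2)] by blast
  have "f = d \<cdot> (e \<cdot> f)" using comp_assoc[OF f e d(1)] d(2) id_comp[OF f] by simp
  also have "\<dots> = g" unfolding eq using comp_assoc[OF g e d(1)] d(2) id_comp[OF g] by simp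
  finally show ?thesis .
qed

lemma iso_arr_cancel_right:
  assumes "iso_arr C e" and e: "e \<in> Hom C X Y" and f: "f \<in> Hom C Y W" and g: "g \<in> Hom C Y W"
    and eq: "f \<cdot> e = g \<cdot> e"
  shows "f = g"
proof -
  obtain d where d: "d \<in> Hom C Y X" "e \<cdot> d = idn Y" using iso_arrE[OF assms(1,2)] by blast
  have "f = f \<cdot> e \<cdot> d" using comp_assoc[OF d(1) e f] d(2) comp_id[OF f] by simp
  also have "\<dots> = g" unfolding eq using comp_assoc[OF d(1) e g] d(2) comp_id[OF g] by simp
  finally show ?thesis .
qed

end

lemma nat_isomorphic_id:
  assumes "nat_isomorphic C C (comp_functor G F) id_functor"
  shows "\<exists>\<eta>. (\<forall>X \<in> Obj C. \<eta> X \<in> Hom C (FObj G (FObj F X)) X \<and> iso_arr C (\<eta> X)) \<and>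
    (\<forall>X \<in> Obj C. \<forall>Y \<in> Obj C. \<forall>f \<in> Hom C X Y. f \<cdot>\<^bsub>C\<^esub> \<eta> X = \<eta> Y \<cdot>\<^bsub>C\<^esub> FArr G (FArr F f))"
  using assms unfolding nat_isomorphic_def comp_functor_def id_functor_def cat_functor.simps .

lemma equivalence_faithful:
  assumes C: "category C" and GF: "nat_isomorphic C C (comp_functor G F) id_functor"
    and f: "f \<in> Hom C X Y" and g: "g \<in> Hom C X Y" and eq: "FArr F f = FArr F g"
  shows "f = g"
proof -
  interpret category C by fact
  obtain \<eta> where \<eta>: "\<forall>X \<in> Obj C. \<eta> X \<in> Hom C (FObj G (FObj F X)) X \<and> iso_arr C (\<eta> X)"
    "\<forall>X \<in> Obj C. \<forall>Y \<in> Obj C. \<forall>f \<in> Hom C X Y. f \<cdot>\<^bsub>C\<^esub> \<eta> X = \<eta> Y \<cdot>\<^bsub>C\<^esub> FArr G (FArr F f)"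
    using nat_isomorphic_id[OF GF] by (elim exE conjE) (rule that)
  have XY: "X \<in> Obj C" "Y \<in> Obj C" using f Hom_Obj by auto
  have "f \<cdot>\<^bsub>C\<^esub> \<eta> X = g \<cdot>\<^bsub>C\<^esub> \<eta> X" using \<eta>(2) XY f g eq by simp
  moreover have "\<eta> X \<in> Hom C (FObj G (FObj F X)) X" "iso_arr C (\<eta> X)" using \<eta>(1) XY by simp_all
  ultimately show ?thesis using iso_arr_cancel_right f g by blast
qed

text \<open>The preimage of \<open>h\<close> is \<open>G h\<close> conjugated by the natural
  isomorphism between \<open>G F\<close> and the identity. This gives \<open>G (F f) = G h\<close>,
  and \<open>G\<close> is faithful by \<open>equivalence_faithful\<close> with the two functors
  exchanged.\<close>

lemma equivalence_full:
  assumes C: "category C" and D: "category D" and F: "is_functor C D F" and G: "is_functor D C G"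
    and GF: "nat_isomorphic C C (comp_functor G F) id_functor"
    and FG: "nat_isomorphic D D (comp_functor F G) id_functor"
    and X: "X \<in> Obj C" and Y: "Y \<in> Obj C" and h: "h \<in> Hom D (FObj F X) (FObj F Y)"
  obtains f where "f \<in> Hom C X Y" "FArr F f = h"
proof -
  interpret category C by fact
  obtain \<eta> where \<eta>: "\<forall>X \<in> Obj C. \<eta> X \<in> Hom C (FObj G (FObj F X)) X \<and> iso_arr C (\<eta> X)"
    "\<forall>X \<in> Obj C. \<forall>Y \<in> Obj C. \<forall>f \<in> Hom C X Y. f \<cdot>\<^bsub>C\<^esub> \<eta> X = \<eta> Y \<cdot>\<^bsub>C\<^esub> FArr G (FArr F f)"
    using nat_isomorphic_id[OF GF] by (elim exE conjE) (rule that)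
  have e: "\<eta> X \<in> Hom C (FObj G (FObj F X)) X" "\<eta> Y \<in> Hom C (FObj G (FObj F Y)) Y"
    "iso_arr C (\<eta> X)" "iso_arr C (\<eta> Y)" using \<eta>(1) X Y by simp_all
  have FXY: "FObj F X \<in> Obj D" "FObj F Y \<in> Obj D" using F X Y unfolding is_functor_def by auto
  have Gh: "FArr G h \<in> Hom C (FObj G (FObj F X)) (FObj G (FObj F Y))"
    using G FXY h unfolding is_functor_def by blast
  obtain e' where e': "e' \<in> Hom C X (FObj G (FObj F X))" "e' \<cdot>\<^bsub>C\<^esub> \<eta> X = idn\<^bsub>C\<^esub> (FObj G (FObj F X))"
    using iso_arrE[OF e(3,1)] by blast
  define f where "f = \<eta> Y \<cdot>\<^bsub>C\<^esub> FArr G h \<cdot>\<^bsub>C\<^esub> e'"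
  have f: "f \<in> Hom C X Y" unfolding f_def by (rule comp_Hom[OF e'(1) comp_Hom[OF Gh e(2)]])
  have Ff: "FArr F f \<in> Hom D (FObj F X) (FObj F Y)" using F X Y f unfolding is_functor_def by blast
  then have GFf: "FArr G (FArr F f) \<in> Hom C (FObj G (FObj F X)) (FObj G (FObj F Y))"
    using G FXY unfolding is_functor_def by blast
  have "\<eta> Y \<cdot>\<^bsub>C\<^esub> FArr G (FArr F f) = f \<cdot>\<^bsub>C\<^esub> \<eta> X" using \<eta>(2) X Y f by simp
  also have "\<dots> = \<eta> Y \<cdot>\<^bsub>C\<^esub> FArr G h \<cdot>\<^bsub>C\<^esub> (e' \<cdot>\<^bsub>C\<^esub> \<eta> X)"
    unfolding f_def by (rule comp_assoc[symmetric, OF e(1) e'(1) comp_Hom[OF Gh e(2)]])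
  also have "\<dots> = \<eta> Y \<cdot>\<^bsub>C\<^esub> FArr G h" unfolding e'(2) by (rule comp_id[OF comp_Hom[OF Gh e(2)]])
  finally have "FArr G (FArr F f) = FArr G h" using iso_arr_cancel_left[OF e(4,2) GFf Gh] by simp
  then have "FArr F f = h" using equivalence_faithful[OF D FG Ff h] by simp
  then show ?thesis using f that by blast
qed

lemma fd_modules_carrier: "(n, \<rho>) \<in> fd_modules A \<Longrightarrow> a \<in> acarrier A \<Longrightarrow> \<rho> a \<in> carrier_mat n n"
  unfolding fd_modules_def by auto

lemma module_category_Hom:
  "((M, T, N) \<in> Hom (module_category A) M' N') \<longleftrightarrow> M = M' \<and> N = N' \<and> M \<in> fd_modules A \<and> N \<in> fd_modules A \<and>
    T \<in> carrier_mat (fst N) (fst M) \<and> (\<forall>a \<in> acarrier A. T * snd M a = snd N a * T)"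
  unfolding module_category_def Hom_def by auto

lemma category_module_category:
  fixes A :: "'k :: field fd_algebra"
  shows "category (module_category A)" (is "category ?M")
proof
  fix f assume "f \<in> Arr ?M"
  then show "Src ?M f \<in> Obj ?M" "Tgt ?M f \<in> Obj ?M" by (auto simp: module_category_def)
next
  fix X assume "X \<in> Obj ?M"
  moreover obtain n \<rho> where "X = (n, \<rho>)" by fastforce
  ultimately have "(X, 1\<^sub>m (fst X), X) \<in> Hom ?M X X" unfolding module_category_Hom
    by (auto simp: module_category_def dest: fd_modules_carrier)
  then show "idn\<^bsub>?M\<^esub> X \<in> Hom ?M X X" by (simp add: module_category_def)
next
  fix f X Y g W assume f: "f \<in> Hom ?M X Y" and g: "g \<in> Hom ?M Y W"
  obtain S where f': "f = (X, S, Y)" using f by (cases f) (simp add: module_category_Hom)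
  obtain T where g': "g = (Y, T, W)" using g by (cases g) (simp add: module_category_Hom)
  obtain n \<rho> n' \<rho>' n'' \<rho>'' where XYW: "X = (n, \<rho>)" "Y = (n', \<rho>')" "W = (n'', \<rho>'')"
    by (meson surj_pair)
  note * = XYW f' g'
  have c: "S \<in> carrier_mat n' n" "T \<in> carrier_mat n'' n'" "X \<in> fd_modules A" "Y \<in> fd_modules A" "W \<in> fd_modules A"
    "\<And>a. a \<in> acarrier A \<Longrightarrow> S * \<rho> a = \<rho>' a * S" "\<And>a. a \<in> acarrier A \<Longrightarrow> T * \<rho>' a = \<rho>'' a * T"
    using f g unfolding f' g' by (simp_all add: module_category_Hom XYW)
  have "(T * S) * \<rho> a = \<rho>'' a * (T * S)" if a: "a \<in> acarrier A" for a
  proof -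
    have r: "\<rho> a \<in> carrier_mat n n" "\<rho>' a \<in> carrier_mat n' n'" "\<rho>'' a \<in> carrier_mat n'' n''"
      using c(3-5) a * fd_modules_carrier by auto
    show ?thesis using c(1,2) r by (simp add: mat_assoc c(6)[OF a] mat_assoc_subst[OF c(7)[OF a]])
  qed
  then have "(X, T * S, W) \<in> Hom ?M X W" unfolding module_category_Hom using c XYW by simp
  then show "g \<cdot>\<^bsub>?M\<^esub> f \<in> Hom ?M X W" unfolding f' g' by (simp add: module_category_def)
next
  fix f X Y assume f: "f \<in> Hom ?M X Y"
  then obtain S where "f = (X, S, Y)" "S \<in> carrier_mat (fst Y) (fst X)"
    by (cases f) (auto simp: module_category_Hom)
  then show "f \<cdot>\<^bsub>?M\<^esub> idn\<^bsub>?M\<^esub> X = f" "idn\<^bsub>?M\<^esub> Y \<cdot>\<^bsub>?M\<^esub> f = f"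
    by (auto simp: module_category_def)
next
  fix f X Y g W h V assume f: "f \<in> Hom ?M X Y" and g: "g \<in> Hom ?M Y W" and h: "h \<in> Hom ?M W V"
  obtain S where f': "f = (X, S, Y)" using f by (cases f) (simp add: module_category_Hom)
  obtain T where g': "g = (Y, T, W)" using g by (cases g) (simp add: module_category_Hom)
  obtain R where h': "h = (W, R, V)" using h by (cases h) (simp add: module_category_Hom)
  have "S \<in> carrier_mat (fst Y) (fst X)" "T \<in> carrier_mat (fst W) (fst Y)" "R \<in> carrier_mat (fst V) (fst W)"
    using f g h unfolding f' g' h' by (simp_all add: module_category_Hom)
  then show "h \<cdot>\<^bsub>?M\<^esub> (g \<cdot>\<^bsub>?M\<^esub> f) = h \<cdot>\<^bsub>?M\<^esub> g \<cdot>\<^bsub>?M\<^esub> f"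
    unfolding f' g' h' by (simp add: module_category_def mat_assoc)
qed

text \<open>A finite abelian category, presented by the matrices \<open>U f\<close> that an equivalence with a module
  category assigns to its arrows.\<close>

locale matrix_category = linear_category C
  for C :: "('o, 'm, 'k :: field, 'z) linear_category_scheme" (structure) +
  fixes A :: "'k fd_algebra" and dim :: "'o \<Rightarrow> nat" and act :: "'o \<Rightarrow> 'k vec \<Rightarrow> 'k mat" and U :: "'m \<Rightarrow> 'k mat"
  assumes algebra: "is_fd_algebra A"
    and act_module: "X \<in> Obj C \<Longrightarrow> (dim X, act X) \<in> fd_modules A"
    and U_carrier: "f \<in> Hom C X Y \<Longrightarrow> U f \<in> carrier_mat (dim Y) (dim X)"
    and U_act: "f \<in> Hom C X Y \<Longrightarrow> a \<in> acarrier A \<Longrightarrow> U f * act X a = act Y a * U f"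
    and U_id: "X \<in> Obj C \<Longrightarrow> U (idn X) = 1\<^sub>m (dim X)"
    and U_comp: "f \<in> Hom C X Y \<Longrightarrow> g \<in> Hom C Y W \<Longrightarrow> U (g \<cdot> f) = U g * U f"
    and U_plus: "f \<in> Hom C X Y \<Longrightarrow> g \<in> Hom C X Y \<Longrightarrow> U (f \<oplus>\<^sub>a g) = U f + U g"
    and U_scale: "f \<in> Hom C X Y \<Longrightarrow> U (c \<star> f) = c \<cdot>\<^sub>m U f"
    and U_faithful: "f \<in> Hom C X Y \<Longrightarrow> g \<in> Hom C X Y \<Longrightarrow> U f = U g \<Longrightarrow> f = g"
    and U_full: "X \<in> Obj C \<Longrightarrow> Y \<in> Obj C \<Longrightarrow> T \<in> carrier_mat (dim Y) (dim X) \<Longrightarrow>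
      (\<And>a. a \<in> acarrier A \<Longrightarrow> T * act X a = act Y a * T) \<Longrightarrow> \<exists>f \<in> Hom C X Y. U f = T"
    and U_surj: "(n, \<rho>) \<in> fd_modules A \<Longrightarrow> \<exists>X \<in> Obj C. \<exists>P \<in> carrier_mat n (dim X). \<exists>Q \<in> carrier_mat (dim X) n.
      P * Q = 1\<^sub>m n \<and> Q * P = 1\<^sub>m (dim X) \<and> (\<forall>a \<in> acarrier A. P * act X a = \<rho> a * P)"

lemma finite_abelian_matrix_category:
  fixes C :: "('o, 'm, 'k :: field, 'z) linear_category_scheme"
  assumes "finite_abelian C"
  obtains A dim act U where "matrix_category C A dim act U"
proof -
  interpret linear_category C using assms unfolding finite_abelian_def by simp
  obtain A F G where A: "is_fd_algebra A" and F: "linear_functor C (module_category A) F"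
    and G: "linear_functor (module_category A) C G"
    and GF: "nat_isomorphic C C (comp_functor G F) id_functor"
    and FG: "nat_isomorphic (module_category A) (module_category A) (comp_functor F G) id_functor"
    using assms unfolding finite_abelian_def linear_equivalent_def by auto
  let ?M = "module_category A"
  define dim where "dim X = fst (FObj F X)" for X
  define act where "act X = snd (FObj F X)" for X
  define U where "U f = fst (snd (FArr F f))" for f
  have FX: "FObj F X = (dim X, act X)" for X by (simp add: dim_def act_def)
  have Ffun: "is_functor C ?M F" and Gfun: "is_functor ?M C G" using F G unfolding linear_functor_def by auto
  have obj: "(dim X, act X) \<in> fd_modules A" if "X \<in> Obj C" for X
    using Ffun that unfolding is_functor_def FX by (auto simp: module_category_def)
  have arr: "FArr F f \<in> Hom ?M (FObj F X) (FObj F Y)" if "f \<in> Hom C X Y" for f X Y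
    using Ffun that Hom_Obj[OF that] unfolding is_functor_def by auto
  have arrU: "FArr F f = (FObj F X, U f, FObj F Y)" if "f \<in> Hom C X Y" for f X Y
    using arr[OF that] unfolding U_def by (cases "FArr F f") (auto simp: module_category_Hom)
  have "matrix_category C A dim act U"
  proof
    fix f X Y assume f: "f \<in> Hom C X Y"
    show "U f \<in> carrier_mat (dim Y) (dim X)"
      using arr[OF f] unfolding arrU[OF f] FX by (auto simp: module_category_Hom)
    show "U f * act X a = act Y a * U f" if "a \<in> acarrier A" for a
      using arr[OF f] that unfolding arrU[OF f] FX by (auto simp: module_category_Hom)
    show "U (c \<star>\<^bsub>C\<^esub> f) = c \<cdot>\<^sub>m U f" for c
      using F Hom_Obj[OF f] f arrU[OF f] arrU[OF scale_Hom[OF f, of c]]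
      unfolding linear_functor_def by (auto simp: module_category_def)
    fix g assume g: "g \<in> Hom C X Y"
    have "FArr F (f \<oplus>\<^sub>a\<^bsub>C\<^esub> g) = FArr F f \<oplus>\<^sub>a\<^bsub>?M\<^esub> FArr F g"
      using F Hom_Obj[OF f] f g unfolding linear_functor_def by blast
    then show "U (f \<oplus>\<^sub>a\<^bsub>C\<^esub> g) = U f + U g"
      using arrU[OF f] arrU[OF g] arrU[OF plus_Hom[OF f g]] by (auto simp: module_category_def)
    assume "U f = U g"
    then have "FArr F f = FArr F g" using arrU f g by metis
    then show "f = g" using equivalence_faithful[OF _ GF f g] category_axioms by blast
  next
    fix f X Y g W assume f: "f \<in> Hom C X Y" and g: "g \<in> Hom C Y W"
    have "FArr F (g \<cdot>\<^bsub>C\<^esub> f) = FArr F g \<cdot>\<^bsub>?M\<^esub> FArr F f"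
      using Ffun Hom_Obj[OF f] Hom_Obj[OF g] f g unfolding is_functor_def by blast
    then show "U (g \<cdot>\<^bsub>C\<^esub> f) = U g * U f"
      using arrU[OF f] arrU[OF g] arrU[OF comp_Hom[OF f g]] by (auto simp: module_category_def)
  next
    fix X assume X: "X \<in> Obj C"
    show "U (idn\<^bsub>C\<^esub> X) = 1\<^sub>m (dim X)"
      using Ffun X arrU[OF id_Hom[OF X]] unfolding is_functor_def by (auto simp: module_category_def FX)
    fix Y T assume Y: "Y \<in> Obj C" and T: "T \<in> carrier_mat (dim Y) (dim X)"
      "\<And>a. a \<in> acarrier A \<Longrightarrow> T * act X a = act Y a * T"
    have h: "(FObj F X, T, FObj F Y) \<in> Hom ?M (FObj F X) (FObj F Y)"
      using obj X Y T by (auto simp: module_category_Hom FX)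
    obtain f where "f \<in> Hom C X Y" "FArr F f = (FObj F X, T, FObj F Y)"
      using equivalence_full[OF category_axioms category_module_category Ffun Gfun GF FG X Y h] by metis
    then have "U f = T" by (simp add: U_def)
    then show "\<exists>f \<in> Hom C X Y. U f = T" using \<open>f \<in> Hom C X Y\<close> by (rule bexI)
  next
    fix n \<rho> assume m: "(n, \<rho>) \<in> fd_modules A"
    then have mO: "(n, \<rho>) \<in> Obj ?M" by (simp add: module_category_def)
    \<comment> \<open>The module is realised by its image under the inverse equivalence;
      \<open>P\<close> and \<open>Q\<close> are the matrices of the natural isomorphism at
      \<open>(n, \<rho>)\<close> and of its inverse.\<close>
    define X where "X = FObj G (n, \<rho>)"
    have X: "X \<in> Obj C" using Gfun mO unfolding is_functor_def X_def by blast
    obtain \<theta> where \<theta>: "\<theta> \<in> Hom ?M (FObj F X) (n, \<rho>)" "iso_arr ?M \<theta>"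
      using nat_isomorphic_id[OF FG] mO unfolding X_def by blast
    obtain \<theta>' where \<theta>': "\<theta>' \<in> Hom ?M (n, \<rho>) (FObj F X)" "\<theta>' \<cdot>\<^bsub>?M\<^esub> \<theta> = idn\<^bsub>?M\<^esub> (FObj F X)"
      "\<theta> \<cdot>\<^bsub>?M\<^esub> \<theta>' = idn\<^bsub>?M\<^esub> (n, \<rho>)"
      using category.iso_arrE[OF category_module_category \<theta>(2,1)] by blast
    obtain P where P: "\<theta> = (FObj F X, P, (n, \<rho>))" using \<theta>(1) by (cases \<theta>) (simp add: module_category_Hom)
    obtain Q where Q: "\<theta>' = ((n, \<rho>), Q, FObj F X)" using \<theta>'(1) by (cases \<theta>') (simp add: module_category_Hom)
    have "P \<in> carrier_mat n (dim X)" "\<forall>a \<in> acarrier A. P * act X a = \<rho> a * P"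
      using \<theta>(1) unfolding P FX by (simp_all add: module_category_Hom)
    moreover have "Q \<in> carrier_mat (dim X) n" using \<theta>'(1) unfolding Q FX by (simp add: module_category_Hom)
    moreover have "Q * P = 1\<^sub>m (dim X)" "P * Q = 1\<^sub>m n"
      using \<theta>'(2,3) unfolding P Q FX by (simp_all add: module_category_def)
    ultimately show "\<exists>X \<in> Obj C. \<exists>P \<in> carrier_mat n (dim X). \<exists>Q \<in> carrier_mat (dim X) n.
      P * Q = 1\<^sub>m n \<and> Q * P = 1\<^sub>m (dim X) \<and> (\<forall>a \<in> acarrier A. P * act X a = \<rho> a * P)"
      using X by (intro bexI[of _ X] bexI[of _ P] bexI[of _ Q] conjI) simp_all
  qed (simp_all add: A obj)
  then show ?thesis by (rule that)
qed

context linear_category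
begin

lemma plus_cancel:
  assumes f: "f \<in> Hom C X Y" and g: "g \<in> Hom C X Y" and fg: "f \<oplus>\<^sub>a g = g"
  shows "f = Zero C X Y"
proof -
  obtain h where h: "h \<in> Hom C X Y" "g \<oplus>\<^sub>a h = Zero C X Y" using ex_minus g by blast
  have "f = Zero C X Y \<oplus>\<^sub>a f" using zero_plus f by simp
  also have "\<dots> = f \<oplus>\<^sub>a (g \<oplus>\<^sub>a h)"
    using h(2) plus_comm[OF zero_Hom[OF Hom_Obj[OF f]] f] by simp
  also have "\<dots> = g \<oplus>\<^sub>a h" using plus_assoc[OF f g h(1)] fg by simp
  finally show ?thesis using h by simp
qed

lemma comp_zero:
  assumes g: "g \<in> Hom C Y W" and X: "X \<in> Obj C"
  shows "g \<cdot> Zero C X Y = Zero C X W"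
proof -
  note z = zero_Hom[OF X Hom_Obj(1)[OF g]]
  have "g \<cdot> Zero C X Y \<oplus>\<^sub>a g \<cdot> Zero C X Y = g \<cdot> Zero C X Y"
    unfolding comp_plus[OF z z g, symmetric] zero_plus[OF z] ..
  then show ?thesis by (rule plus_cancel[OF comp_Hom[OF z g] comp_Hom[OF z g]])
qed

lemma zero_comp:
  assumes f: "f \<in> Hom C X Y" and W: "W \<in> Obj C"
  shows "Zero C Y W \<cdot> f = Zero C X W"
proof -
  note z = zero_Hom[OF Hom_Obj(2)[OF f] W]
  have "Zero C Y W \<cdot> f \<oplus>\<^sub>a Zero C Y W \<cdot> f = Zero C Y W \<cdot> f"
    unfolding plus_comp[OF f z z, symmetric] zero_plus[OF z] ..
  then show ?thesis by (rule plus_cancel[OF comp_Hom[OF f z] comp_Hom[OF f z]])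
qed

end

lemma fd_moduleD:
  assumes "(n, \<rho>) \<in> fd_modules A"
  shows "a \<in> acarrier A \<Longrightarrow> \<rho> a \<in> carrier_mat n n" "\<rho> (aone A) = 1\<^sub>m n"
    "a \<in> acarrier A \<Longrightarrow> b \<in> acarrier A \<Longrightarrow> \<rho> (amult A a b) = \<rho> a * \<rho> b"
    "a \<in> acarrier A \<Longrightarrow> b \<in> acarrier A \<Longrightarrow> \<rho> (a + b) = \<rho> a + \<rho> b"
    "a \<in> acarrier A \<Longrightarrow> \<rho> (t \<cdot>\<^sub>v a) = t \<cdot>\<^sub>m \<rho> a"
  using assms unfolding fd_modules_def by auto

lemma fd_algebraD:
  assumes "is_fd_algebra A"
  shows "aone A \<in> acarrier A" "a \<in> acarrier A \<Longrightarrow> b \<in> acarrier A \<Longrightarrow> amult A a b \<in> acarrier A"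
    "a \<in> acarrier A \<Longrightarrow> amult A (aone A) a = a" "a \<in> acarrier A \<Longrightarrow> amult A a (aone A) = a"
    "a \<in> acarrier A \<Longrightarrow> b \<in> acarrier A \<Longrightarrow> c \<in> acarrier A \<Longrightarrow> amult A (amult A a b) c = amult A a (amult A b c)"
    "a \<in> acarrier A \<Longrightarrow> b \<in> acarrier A \<Longrightarrow> c \<in> acarrier A \<Longrightarrow> amult A (a + b) c = amult A a c + amult A b c"
    "a \<in> acarrier A \<Longrightarrow> b \<in> acarrier A \<Longrightarrow> c \<in> acarrier A \<Longrightarrow> amult A a (b + c) = amult A a b + amult A a c"
    "a \<in> acarrier A \<Longrightarrow> b \<in> acarrier A \<Longrightarrow> amult A (t \<cdot>\<^sub>v a) b = t \<cdot>\<^sub>v amult A a b"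
    "a \<in> acarrier A \<Longrightarrow> b \<in> acarrier A \<Longrightarrow> amult A a (t \<cdot>\<^sub>v b) = t \<cdot>\<^sub>v amult A a b"
  using assms unfolding is_fd_algebra_def by auto

lemma fd_moduleI:
  assumes A: "is_fd_algebra A"
    and "\<And>a. a \<in> acarrier A \<Longrightarrow> \<rho> a \<in> carrier_mat n n" "\<rho> (aone A) = 1\<^sub>m n"
    "\<And>a b. a \<in> acarrier A \<Longrightarrow> b \<in> acarrier A \<Longrightarrow> \<rho> (amult A a b) = \<rho> a * \<rho> b"
    "\<And>a b. a \<in> acarrier A \<Longrightarrow> b \<in> acarrier A \<Longrightarrow> \<rho> (a + b) = \<rho> a + \<rho> b"
    "\<And>a t. a \<in> acarrier A \<Longrightarrow> \<rho> (t \<cdot>\<^sub>v a) = t \<cdot>\<^sub>m \<rho> a"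
  shows "(n, restrict \<rho> (acarrier A)) \<in> fd_modules A"
  unfolding fd_modules_def using assms(2-) fd_algebraD(1,2)[OF A] by (simp add: restrict_PiE_iff)

lemma mat_eq_iff_minus_zero:
  fixes M :: "'a :: ab_group_add mat"
  assumes "M \<in> carrier_mat n m" "N \<in> carrier_mat n m" "M - N = 0\<^sub>m n m"
  shows "M = N"
proof (rule eq_matI)
  fix i j assume i: "i < dim_row N" "j < dim_col N"
  have "(M - N) $$ (i, j) = 0" unfolding assms(3) using assms(2) i by simp
  moreover have "(M - N) $$ (i, j) = M $$ (i, j) - N $$ (i, j)" using i by simp
  ultimately show "M $$ (i, j) = N $$ (i, j)" by simp
qed (use assms in auto)

lemma left_inverse_cancel:
  fixes K :: "'k :: field mat"
  assumes "K' \<in> carrier_mat r n" "K \<in> carrier_mat n r" "K' * K = 1\<^sub>m r"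
    and "dim_row S = r" "dim_row T = r" "K * S = K * T"
  shows "S = T"
proof -
  have "M = K' * (K * M)" if "dim_row M = r" for M
    using mat_assoc_subst[OF assms(3), of M] left_mult_one_mat'[of M r] that assms(1,2) by simp
  from this[OF assms(4)] this[OF assms(5)] show ?thesis unfolding assms(6) by (rule trans[OF _ sym])
qed

lemma right_inverse_cancel:
  fixes L :: "'k :: field mat"
  assumes "L' \<in> carrier_mat n r" "L \<in> carrier_mat r n" "L * L' = 1\<^sub>m r"
    and "dim_col S = r" "dim_col T = r" "S * L = T * L"
  shows "S = T"
proof -
  have "M = M * L * L'" if "dim_col M = r" for M
    using mat_assoc[of M L L'] right_mult_one_mat'[of M r] that assms(1-3) by simp
  from this[OF assms(4)] this[OF assms(5)] show ?thesis unfolding assms(6) by (rule trans[OF _ sym])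
qed

text \<open>The columns of \<open>K\<close> span a stable subspace and \<open>\<rho>'\<close> is the
  action in these coordinates. As \<open>K\<close> can be cancelled on the left, each module axiom
  for \<open>\<rho>'\<close> is checked after multiplication by \<open>K\<close>, where it is the
  axiom for \<open>\<rho>\<close>.\<close>

lemma fd_submodule:
  fixes K :: "'k :: field mat"
  assumes A: "is_fd_algebra A" and M: "(n, \<rho>) \<in> fd_modules A"
    and K: "K' \<in> carrier_mat r n" "K \<in> carrier_mat n r" "K' * K = 1\<^sub>m r"
    and \<rho>': "\<And>a. a \<in> acarrier A \<Longrightarrow> \<rho>' a \<in> carrier_mat r r" "\<And>a. a \<in> acarrier A \<Longrightarrow> K * \<rho>' a = \<rho> a * K"
  shows "(r, restrict \<rho>' (acarrier A)) \<in> fd_modules A"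
proof (rule fd_moduleI[OF A \<rho>'(1)])
  note c = left_inverse_cancel[OF K] and m = fd_moduleD[OF M] and a = fd_algebraD[OF A]
  show "\<rho>' (aone A) = 1\<^sub>m r"
    using \<rho>'(1)[OF a(1)] \<rho>'(2)[OF a(1)] m(2) K(2) by - (rule c, simp_all)
  fix x assume x: "x \<in> acarrier A"
  note x' = \<rho>'(1)[OF x] \<rho>'(2)[OF x] m(1)[OF x]
  show "\<rho>' (t \<cdot>\<^sub>v x) = t \<cdot>\<^sub>m \<rho>' x" for t
  proof -
    have tx: "t \<cdot>\<^sub>v x \<in> acarrier A" using x by simp
    have "K * \<rho>' (t \<cdot>\<^sub>v x) = K * (t \<cdot>\<^sub>m \<rho>' x)"
      unfolding \<rho>'(2)[OF tx] m(5)[OF x] mult_smult_assoc_mat[OF x'(3) K(2)] mult_smult_distrib[OF K(2) x'(1)] x'(2) ..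
    then show ?thesis using \<rho>'(1)[OF tx] x'(1) by - (rule c, simp_all)
  qed
  fix y assume y: "y \<in> acarrier A"
  note y' = \<rho>'(1)[OF y] \<rho>'(2)[OF y] m(1)[OF y]
  show "\<rho>' (x + y) = \<rho>' x + \<rho>' y"
  proof -
    have xy: "x + y \<in> acarrier A" using x y by simp
    have "K * \<rho>' (x + y) = K * (\<rho>' x + \<rho>' y)"
      unfolding \<rho>'(2)[OF xy] m(4)[OF x y] add_mult_distrib_mat[OF x'(3) y'(3) K(2)]
        mult_add_distrib_mat[OF K(2) x'(1) y'(1)] x'(2) y'(2) ..
    then show ?thesis using \<rho>'(1)[OF xy] x'(1) y'(1) by - (rule c, simp_all)
  qed
  have "K * \<rho>' (amult A x y) = K * (\<rho>' x * \<rho>' y)"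
    using \<rho>'(1)[OF x] \<rho>'(1)[OF y] m(1)[OF x] m(1)[OF y] K(1,2)
    by (simp add: \<rho>'(2)[OF a(2)[OF x y]] \<rho>'(2)[OF y] m(3)[OF x y] mat_assoc mat_assoc_subst[OF \<rho>'(2)[OF x]])
  then show "\<rho>' (amult A x y) = \<rho>' x * \<rho>' y"
    using \<rho>'(1)[OF x] \<rho>'(1)[OF a(2)[OF x y]] by - (rule c, simp_all)
qed

lemma fd_quotient_module:
  fixes L :: "'k :: field mat"
  assumes A: "is_fd_algebra A" and M: "(n, \<rho>) \<in> fd_modules A"
    and L: "L' \<in> carrier_mat n r" "L \<in> carrier_mat r n" "L * L' = 1\<^sub>m r"
    and \<rho>': "\<And>a. a \<in> acarrier A \<Longrightarrow> \<rho>' a \<in> carrier_mat r r" "\<And>a. a \<in> acarrier A \<Longrightarrow> \<rho>' a * L = L * \<rho> a"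
  shows "(r, restrict \<rho>' (acarrier A)) \<in> fd_modules A"
proof (rule fd_moduleI[OF A \<rho>'(1)])
  note c = right_inverse_cancel[OF L] and m = fd_moduleD[OF M] and a = fd_algebraD[OF A]
  show "\<rho>' (aone A) = 1\<^sub>m r"
    using \<rho>'(1)[OF a(1)] \<rho>'(2)[OF a(1)] m(2) L(2) by - (rule c, simp_all)
  fix x assume x: "x \<in> acarrier A"
  note x' = \<rho>'(1)[OF x] \<rho>'(2)[OF x] m(1)[OF x]
  show "\<rho>' (t \<cdot>\<^sub>v x) = t \<cdot>\<^sub>m \<rho>' x" for t
  proof -
    have tx: "t \<cdot>\<^sub>v x \<in> acarrier A" using x by simp
    have "\<rho>' (t \<cdot>\<^sub>v x) * L = (t \<cdot>\<^sub>m \<rho>' x) * L"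
      unfolding \<rho>'(2)[OF tx] m(5)[OF x] mult_smult_assoc_mat[OF x'(1) L(2)] mult_smult_distrib[OF L(2) x'(3)] x'(2) ..
    then show ?thesis using \<rho>'(1)[OF tx] x'(1) by - (rule c, simp_all)
  qed
  fix y assume y: "y \<in> acarrier A"
  note y' = \<rho>'(1)[OF y] \<rho>'(2)[OF y] m(1)[OF y]
  show "\<rho>' (x + y) = \<rho>' x + \<rho>' y"
  proof -
    have xy: "x + y \<in> acarrier A" using x y by simp
    have "\<rho>' (x + y) * L = (\<rho>' x + \<rho>' y) * L"
      unfolding \<rho>'(2)[OF xy] m(4)[OF x y] add_mult_distrib_mat[OF x'(1) y'(1) L(2)]
        mult_add_distrib_mat[OF L(2) x'(3) y'(3)] x'(2) y'(2) ..
    then show ?thesis using \<rho>'(1)[OF xy] x'(1) y'(1) by - (rule c, simp_all)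
  qed
  have "\<rho>' (amult A x y) * L = \<rho>' x * \<rho>' y * L"
    using \<rho>'(1)[OF x] \<rho>'(1)[OF y] m(1)[OF x] m(1)[OF y] L(1,2)
    by (simp add: \<rho>'(2)[OF a(2)[OF x y]] \<rho>'(2)[OF y] m(3)[OF x y] mat_assoc mat_assoc_subst[OF \<rho>'(2)[OF x]])
  then show "\<rho>' (amult A x y) = \<rho>' x * \<rho>' y"
    using \<rho>'(1)[OF y] \<rho>'(1)[OF a(2)[OF x y]] by - (rule c, simp_all)
qed

section \<open>Injective and surjective arrows, images and cokernels\<close>

context matrix_category
begin

lemmas alg = fd_algebraD[OF algebra]
lemmas act = fd_moduleD[OF act_module]

lemma U_zero: "X \<in> Obj C \<Longrightarrow> Y \<in> Obj C \<Longrightarrow> U (Zero C X Y) = 0\<^sub>m (dim Y) (dim X)"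
proof -
  assume X: "X \<in> Obj C" and Y: "Y \<in> Obj C"
  note z = zero_Hom[OF X Y]
  have c: "U (Zero C X Y) \<in> carrier_mat (dim Y) (dim X)" using U_carrier[OF z] .
  have e: "U (Zero C X Y) + U (Zero C X Y) = U (Zero C X Y)" using U_plus[OF z z] zero_plus[OF z] by simp
  have "U (Zero C X Y) $$ (i, j) = 0" if ij: "i < dim Y" "j < dim X" for i j
  proof -
    have "(U (Zero C X Y) + U (Zero C X Y)) $$ (i, j) = U (Zero C X Y) $$ (i, j) + 0" unfolding e by simp
    then show ?thesis using c ij by (simp del: add_0_right) 
  qed
  then show ?thesis using c by (intro eq_matI) auto
qed

text \<open>Injectivity is phrased on vectors so that linear algebra applies directly. That it
  coincides with being a monomorphism depends on the generator \<open>G\<close> and is shown in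
  \<open>inj_arr_mono\<close> and \<open>mono_arr_inj\<close>.\<close>

definition inj_arr :: "'m \<Rightarrow> bool" where
  "inj_arr f \<longleftrightarrow> (\<forall>x \<in> carrier_vec (dim (Src C f)). U f *\<^sub>v x = 0\<^sub>v (dim (Tgt C f)) \<longrightarrow> x = 0\<^sub>v (dim (Src C f)))"

definition surj_arr :: "'m \<Rightarrow> bool" where
  "surj_arr f \<longleftrightarrow> (\<forall>y \<in> carrier_vec (dim (Tgt C f)). \<exists>x \<in> carrier_vec (dim (Src C f)). U f *\<^sub>v x = y)"

lemma inj_arr_left_inverse:
  assumes "f \<in> Hom C X Y" "inj_arr f"
  obtains K where "K \<in> carrier_mat (dim X) (dim Y)" "K * U f = 1\<^sub>m (dim X)"
  using assms injective_left_inverse[OF U_carrier[OF assms(1)]]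
  unfolding inj_arr_def Hom_Src_Tgt[OF assms(1)] by metis

lemma left_inverse_inj_arr:
  assumes f: "f \<in> Hom C X Y" and K: "K \<in> carrier_mat (dim X) (dim Y)" "K * U f = 1\<^sub>m (dim X)"
  shows "inj_arr f"
  unfolding inj_arr_def Hom_Src_Tgt[OF f]
proof (intro ballI impI)
  fix x assume x: "x \<in> carrier_vec (dim X)" "U f *\<^sub>v x = 0\<^sub>v (dim Y)"
  have "x = (K * U f) *\<^sub>v x" using K x by simp
  also have "\<dots> = K *\<^sub>v (U f *\<^sub>v x)" using K(1) x U_carrier[OF f] by (simp add: mat_vec_assoc)
  finally show "x = 0\<^sub>v (dim X)" unfolding x(2) mat_mult_zero_vec[OF K(1)] .
qed

lemma surj_arr_right_inverse:
  assumes "f \<in> Hom C X Y" "surj_arr f"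
  obtains L where "L \<in> carrier_mat (dim X) (dim Y)" "U f * L = 1\<^sub>m (dim Y)"
  using assms surjective_right_inverse[OF U_carrier[OF assms(1)]]
  unfolding surj_arr_def Hom_Src_Tgt[OF assms(1)] by metis

lemma right_inverse_surj_arr:
  assumes f: "f \<in> Hom C X Y" and K: "K \<in> carrier_mat (dim X) (dim Y)" "U f * K = 1\<^sub>m (dim Y)"
  shows "surj_arr f"
  unfolding surj_arr_def Hom_Src_Tgt[OF f]
proof (intro ballI)
  fix y :: "'k vec" assume y: "y \<in> carrier_vec (dim Y)"
  have "U f *\<^sub>v (K *\<^sub>v y) = (U f * K) *\<^sub>v y" using K(1) y U_carrier[OF f] by (simp add: mat_vec_assoc)
  then show "\<exists>x \<in> carrier_vec (dim X). U f *\<^sub>v x = y" using K y by (intro bexI[of _ "K *\<^sub>v y"]) auto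
qed

lemma inj_arr_cancel:
  assumes "e \<in> Hom C Y W" "inj_arr e" "f \<in> Hom C X Y" "g \<in> Hom C X Y" "e \<cdot> f = e \<cdot> g"
  shows "f = g"
proof -
  obtain K where K: "K \<in> carrier_mat (dim Y) (dim W)" "K * U e = 1\<^sub>m (dim Y)"
    using inj_arr_left_inverse assms by metis
  have "U e * U f = U e * U g"
    using U_comp[OF assms(3,1)] U_comp[OF assms(4,1)] assms(5) by simp
  then have "U f = U g"
    using U_carrier[OF assms(3)] U_carrier[OF assms(4)]
    by - (rule left_inverse_cancel[OF K(1) U_carrier[OF assms(1)] K(2)], simp_all)
  then show ?thesis by (rule U_faithful[OF assms(3,4)])
qed

lemma surj_arr_cancel:
  assumes "e \<in> Hom C X Y" "surj_arr e" "f \<in> Hom C Y W" "g \<in> Hom C Y W" "f \<cdot> e = g \<cdot> e"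
  shows "f = g"
proof -
  obtain K where K: "K \<in> carrier_mat (dim X) (dim Y)" "U e * K = 1\<^sub>m (dim Y)"
    using surj_arr_right_inverse assms by metis
  have "U f * U e = U g * U e"
    using U_comp[OF assms(1,3)] U_comp[OF assms(1,4)] assms(5) by simp
  then have "U f = U g"
    using U_carrier[OF assms(3)] U_carrier[OF assms(4)]
    by - (rule right_inverse_cancel[OF K(1) U_carrier[OF assms(1)] K(2)], simp_all)
  then show ?thesis by (rule U_faithful[OF assms(3,4)])
qed

text \<open>A left and a right inverse of \<open>U f\<close> coincide, and the inverse of an
  intertwining matrix is again intertwining, so fullness turns it into an arrow.\<close>

lemma bij_arr_iso:
  assumes f: "f \<in> Hom C X Y" and "inj_arr f" "surj_arr f"
  shows "iso_arr C f"
proof -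
  obtain K where K: "K \<in> carrier_mat (dim X) (dim Y)" "K * U f = 1\<^sub>m (dim X)"
    using inj_arr_left_inverse assms by metis
  obtain L where L: "L \<in> carrier_mat (dim X) (dim Y)" "U f * L = 1\<^sub>m (dim Y)"
    using surj_arr_right_inverse assms by metis
  note Uf = U_carrier[OF f]
  have XY: "X \<in> Obj C" "Y \<in> Obj C" using f Hom_Obj by auto
  have "K * (U f * L) = L" using K(1) L(1) Uf by (simp add: mat_assoc_subst[OF K(2)])
  then have KL: "K = L" using K L by simp
  have "K * act Y a = act X a * K" if a: "a \<in> acarrier A" for a
  proof (rule right_inverse_cancel[OF K(1) Uf])
    show "U f * K = 1\<^sub>m (dim Y)" using L KL by simp
    have c: "act X a \<in> carrier_mat (dim X) (dim X)" "act Y a \<in> carrier_mat (dim Y) (dim Y)"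
      using act(1) XY a by auto
    then show "K * act Y a * U f = act X a * K * U f"
      using K(1) Uf by (simp add: mat_assoc U_act[OF f a, symmetric] mat_assoc_subst[OF K(2)] K(2))
    show "dim_col (K * act Y a) = dim Y" "dim_col (act X a * K) = dim Y" using c K(1) by simp_all
  qed
  then obtain g where g: "g \<in> Hom C Y X" "U g = K" using U_full[of Y X K] XY K by auto
  show ?thesis
  proof (rule iso_arrI[OF f g(1)])
    show "g \<cdot> f = idn X" using f g XY K by (intro U_faithful[of _ X X] comp_Hom id_Hom) (auto simp: U_comp U_id)
    show "f \<cdot> g = idn Y" using f g XY L KL by (intro U_faithful[of _ Y Y] comp_Hom id_Hom) (auto simp: U_comp U_id)
  qed
qed

lemma inj_arr_dim:
  assumes "f \<in> Hom C X Y" "inj_arr f"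
  shows "dim X \<le> dim Y"
  using inj_arr_left_inverse[OF assms] right_inverse_dim U_carrier[OF assms(1)] by metis

lemma inj_arr_iso:
  assumes f: "f \<in> Hom C X Y" "inj_arr f" and d: "dim Y \<le> dim X"
  shows "iso_arr C f"
proof -
  have eq: "dim X = dim Y" using inj_arr_dim[OF f] d by simp
  obtain K where K: "K \<in> carrier_mat (dim X) (dim Y)" "K * U f = 1\<^sub>m (dim X)"
    using inj_arr_left_inverse f by metis
  then have "U f * K = 1\<^sub>m (dim Y)" using mat_mult_left_right_inverse[of K "dim X" "U f"] U_carrier[OF f(1)] eq by simp
  then show ?thesis using bij_arr_iso f right_inverse_surj_arr K by blast
qed

lemma subobject:
  assumes X: "X \<in> Obj C" and K: "K' \<in> carrier_mat r (dim X)" "K \<in> carrier_mat (dim X) r" "K' * K = 1\<^sub>m r"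
    and \<rho>: "\<And>a. a \<in> acarrier A \<Longrightarrow> \<rho> a \<in> carrier_mat r r" "\<And>a. a \<in> acarrier A \<Longrightarrow> K * \<rho> a = act X a * K"
  obtains Y m P Q where "m \<in> Hom C Y X" "inj_arr m" "P \<in> carrier_mat r (dim Y)" "Q \<in> carrier_mat (dim Y) r"
    "P * Q = 1\<^sub>m r" "U m = K * P"
proof -
  obtain Y P Q where Y: "Y \<in> Obj C" and P: "P \<in> carrier_mat r (dim Y)" and Q: "Q \<in> carrier_mat (dim Y) r"
    and PQ: "P * Q = 1\<^sub>m r" "Q * P = 1\<^sub>m (dim Y)"
    and Pa: "\<And>a. a \<in> acarrier A \<Longrightarrow> P * act Y a = \<rho> a * P"
    using U_surj[OF fd_submodule[OF algebra act_module[OF X] K \<rho>]] by auto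
  have "K * P * act Y a = act X a * (K * P)" if a: "a \<in> acarrier A" for a
    using K(1,2) P \<rho>(1)[OF a] act(1)[OF X a] act(1)[OF Y a]
    by (simp add: mat_assoc Pa[OF a] mat_assoc_subst[OF \<rho>(2)[OF a]])
  then obtain m where m: "m \<in> Hom C Y X" "U m = K * P" using U_full[OF Y X, of "K * P"] K P by auto
  have "Q * K' * U m = 1\<^sub>m (dim Y)"
    unfolding m using K(1,2) P Q by (simp add: mat_assoc mat_assoc_subst[OF K(3)] PQ)
  then have "inj_arr m" using K(1) Q by (intro left_inverse_inj_arr[OF m(1), of "Q * K'"]) simp_all
  then show ?thesis by (rule that[OF m(1) _ P Q PQ(1) m(2)])
qed

text \<open>A full rank factorization \<open>U f = K * L\<close> presents the image of
  \<open>f\<close> as the column space of \<open>K\<close>. Only the action on this space has to be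
  supplied; \<open>L\<close> is then equivariant because it becomes so after the injective
  \<open>m\<close>.\<close>

lemma image_factorization:
  assumes f: "f \<in> Hom C X Y"
  obtains J e m where "e \<in> Hom C X J" "m \<in> Hom C J Y" "f = m \<cdot> e" "surj_arr e" "inj_arr m"
proof -
  have XY: "X \<in> Obj C" "Y \<in> Obj C" using f Hom_Obj by auto
  obtain r K K' L L' where K: "K \<in> carrier_mat (dim Y) r" "K' \<in> carrier_mat r (dim Y)" "K' * K = 1\<^sub>m r"
    and L: "L \<in> carrier_mat r (dim X)" "L' \<in> carrier_mat (dim X) r" "L * L' = 1\<^sub>m r" and KL: "U f = K * L"
    by (rule rank_factorization[OF U_carrier[OF f]])
  \<comment> \<open>The action induced on the image: lift coordinates to \<open>X\<close> with
    \<open>L'\<close>, act there, and return with \<open>L\<close>. By equivariance of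
    \<open>f\<close> the choice of lift does not matter.\<close>
  define \<rho> where "\<rho> a = L * act X a * L'" for a
  have \<rho>: "\<rho> a \<in> carrier_mat r r" if "a \<in> acarrier A" for a unfolding \<rho>_def using L(1,2) act(1)[OF XY(1) that] by simp
  have K\<rho>: "K * \<rho> a = act Y a * K" if a: "a \<in> acarrier A" for a
  proof -
    have e: "K * (L * act X a) = act Y a * (K * L)"
      using U_act[OF f a] K(1) L(1) act(1)[OF XY(1) a] unfolding KL by (simp add: mat_assoc)
    show ?thesis unfolding \<rho>_def
      using K(1) L(1,2) act(1)[OF XY(1) a] act(1)[OF XY(2) a] mat_assoc_subst[OF e, of L'] L(3)
      by (simp add: mat_assoc)
  qed
  obtain J m P Q where m: "m \<in> Hom C J Y" "inj_arr m" and P: "P \<in> carrier_mat r (dim J)"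
    and Q: "Q \<in> carrier_mat (dim J) r" and PQ: "P * Q = 1\<^sub>m r" and Um: "U m = K * P"
    by (rule subobject[OF XY(2) K(2,1,3) \<rho> K\<rho>])
  have J: "J \<in> Obj C" using m Hom_Obj by auto
  have UmQL: "U m * (Q * L) = U f" unfolding Um KL
    using K(1) L(1) P Q by (simp add: mat_assoc mat_assoc_subst[OF PQ])
  obtain M where M: "M \<in> carrier_mat (dim J) (dim Y)" "M * U m = 1\<^sub>m (dim J)"
    using inj_arr_left_inverse m by metis
  have "Q * L * act X a = act J a * (Q * L)" if a: "a \<in> acarrier A" for a
  proof (rule left_inverse_cancel[OF M(1) U_carrier[OF m(1)] M(2)])
    note c = L(1) Q U_carrier[OF m(1)] act(1)[OF XY(1) a] act(1)[OF XY(2) a] act(1)[OF J a]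
    have "U m * (Q * L * act X a) = U f * act X a"
      unfolding UmQL[symmetric] using c by (simp add: mat_assoc)
    also have "\<dots> = act Y a * (U m * (Q * L))" unfolding UmQL using U_act[OF f a] .
    also have "\<dots> = U m * (act J a * (Q * L))"
      using c by (simp add: mat_assoc mat_assoc_subst[OF U_act[OF m(1) a]])
    finally show "U m * (Q * L * act X a) = U m * (act J a * (Q * L))" .
    show "dim_row (Q * L * act X a) = dim J" "dim_row (act J a * (Q * L)) = dim J" using c by simp_all
  qed
  then obtain e where e: "e \<in> Hom C X J" "U e = Q * L" using U_full[of X J "Q * L"] XY J Q L by auto
  have "f = m \<cdot> e" using U_faithful[OF f comp_Hom[OF e(1) m(1)]] U_comp[OF e(1) m(1)] e UmQL by simp
  moreover have "surj_arr e"
  proof (rule right_inverse_surj_arr[OF e(1)])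
    show "L' * P \<in> carrier_mat (dim X) (dim J)" using L P by simp
    have sq: "r = dim J"
    proof (rule antisym)
      show "r \<le> dim J" using right_inverse_dim[OF P Q PQ] .
      have "M * K * P = M * U m" unfolding Um using M(1) K(1) P by (simp add: mat_assoc)
      then show "dim J \<le> r" using right_inverse_dim[of "M * K" "dim J" r P] M K P by simp
    qed
    then have QP: "Q * P = 1\<^sub>m (dim J)" using mat_mult_left_right_inverse[of P r Q] P Q PQ by simp
    show "U e * (L' * P) = 1\<^sub>m (dim J)"
      unfolding e using L(1,2) P Q by (simp add: mat_assoc mat_assoc_subst[OF L(3)] QP)
  qed
  ultimately show ?thesis by (rule that[OF e(1) m(1) _ _ m(2)])
qed

text \<open>A left inverse \<open>K'\<close> of \<open>U m\<close> is only linear, not equivariant,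
  yet \<open>E = 1 - U m K'\<close> is an idempotent whose kernel is the image of \<open>m\<close>.
  A factorization \<open>E = S * L\<close> makes \<open>L\<close> the quotient map and
  \<open>S\<close> a linear section of it. The last clause says that \<open>m\<close> is a kernel of
  \<open>q\<close>; uniqueness of the factor is not stated, since \<open>m\<close> can be
  cancelled.\<close>

lemma cokernel:
  assumes m: "m \<in> Hom C Y X" "inj_arr m"
  obtains Q q where "q \<in> Hom C X Q" "surj_arr q" "q \<cdot> m = Zero C Y Q"
    "\<And>W f. f \<in> Hom C W X \<Longrightarrow> q \<cdot> f = Zero C W Q \<Longrightarrow> \<exists>r \<in> Hom C W Y. f = m \<cdot> r"
proof -
  have YX: "Y \<in> Obj C" "X \<in> Obj C" using m Hom_Obj by auto
  let ?n = "dim X"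
  obtain K' where K': "K' \<in> carrier_mat (dim Y) ?n" "K' * U m = 1\<^sub>m (dim Y)"
    using inj_arr_left_inverse m by metis
  note K = U_carrier[OF m(1)]
  have KK: "U m * K' \<in> carrier_mat ?n ?n" using K K' by simp
  define E where "E = 1\<^sub>m ?n - U m * K'"
  have E: "E \<in> carrier_mat ?n ?n" unfolding E_def by (rule minus_carrier_mat[OF KK])
  have EM: "E * M = M - U m * (K' * M)" if "M \<in> carrier_mat ?n j" for M j
    unfolding E_def using that K K'(1) by (simp add: minus_mult_distrib_mat[OF one_carrier_mat KK] mat_assoc)
  have EK: "E * U m = 0\<^sub>m ?n (dim Y)" using EM[OF K] K K' by simp
  obtain r S S' L L' where S: "S \<in> carrier_mat ?n r" "S' \<in> carrier_mat r ?n" "S' * S = 1\<^sub>m r"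
    and L: "L \<in> carrier_mat r ?n" "L' \<in> carrier_mat ?n r" "L * L' = 1\<^sub>m r" and SL: "E = S * L"
    by (rule rank_factorization[OF E])
  have LK: "L * U m = 0\<^sub>m r (dim Y)"
  proof (rule left_inverse_cancel[OF S(2,1,3)])
    show "S * (L * U m) = S * 0\<^sub>m r (dim Y)"
      using S(1) L(1) K EK unfolding SL by (simp add: mat_assoc)
  qed (use L(1) in simp_all)
  have "K' * E = K' * 1\<^sub>m ?n - K' * (U m * K')" unfolding E_def
    using K K'(1) by (intro mult_minus_distrib_mat) auto
  also have "K' * (U m * K') = K'" using K K'(1) by (simp add: mat_assoc_subst[OF K'(2)])
  finally have "K' * E = 0\<^sub>m (dim Y) ?n" using K'(1) by simp
  \<comment> \<open>Idempotence of \<open>E = S L\<close> becomes \<open>L S = 1\<close> after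
    cancelling \<open>S\<close> on the left and \<open>L\<close> on the right.\<close>
  then have "E * E = E" using EM[OF E] K mat_minus_zero[OF E] by simp
  then have SLSL: "S * (L * (S * L)) = S * L" unfolding SL using S(1) L(1) by (simp add: mat_assoc)
  have LSL: "L * (S * L) = L"
    by (rule left_inverse_cancel[OF S(2,1,3) _ _ SLSL]) (use S(1) L(1) in simp_all)
  have LS: "L * S = 1\<^sub>m r"
    by (rule right_inverse_cancel[OF L(2,1,3)]) (use S(1) L(1) LSL in \<open>simp_all add: mat_assoc\<close>)
  \<comment> \<open>The action on the quotient: lift with \<open>S\<close>, act, project with
    \<open>L\<close>. It is well defined because \<open>L\<close> kills the stable image of
    \<open>m\<close>.\<close>
  define \<rho> where "\<rho> a = L * act X a * S" for a
  have \<rho>: "\<rho> a \<in> carrier_mat r r" if "a \<in> acarrier A" for a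
    unfolding \<rho>_def using S(1) L(1) act(1)[OF YX(2) that] by simp
  have \<rho>L: "\<rho> a * L = L * act X a" if a: "a \<in> acarrier A" for a
  proof -
    note c = S(1) L(1) K K'(1) act(1)[OF YX(2) a] act(1)[OF YX(1) a]
    have La: "L * act X a \<in> carrier_mat r ?n" using c by simp
    have "L * act X a * (U m * K') = L * (U m * (act Y a * K'))"
      using c by (simp add: mat_assoc mat_assoc_subst[OF U_act[OF m(1) a]])
    also have "\<dots> = 0\<^sub>m r ?n" using c by (simp add: mat_assoc_subst[OF LK])
    finally have z: "L * act X a * (U m * K') = 0\<^sub>m r ?n" .
    have "\<rho> a * L = (L * act X a) * E" unfolding \<rho>_def SL using c by (simp add: mat_assoc)
    also have "\<dots> = (L * act X a) * 1\<^sub>m ?n - (L * act X a) * (U m * K')"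
      unfolding E_def by (rule mult_minus_distrib_mat[OF La one_carrier_mat KK])
    finally show ?thesis unfolding z using right_mult_one_mat[OF La] mat_minus_zero[OF La] by simp
  qed
  obtain Q P P' where Q: "Q \<in> Obj C" and P: "P \<in> carrier_mat r (dim Q)" and P': "P' \<in> carrier_mat (dim Q) r"
    and PP: "P * P' = 1\<^sub>m r" "P' * P = 1\<^sub>m (dim Q)"
    and Pa: "\<And>a. a \<in> acarrier A \<Longrightarrow> P * act Q a = \<rho> a * P"
    using U_surj[OF fd_quotient_module[OF algebra act_module[OF YX(2)] L(2,1,3) \<rho> \<rho>L]] by auto
  have "P' * L * act X a = act Q a * (P' * L)" if a: "a \<in> acarrier A" for a
  proof (rule left_inverse_cancel[OF P' P PP(2)])
    note c = P P' L(1) act(1)[OF YX(2) a] act(1)[OF Q a] \<rho>[OF a]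
    have "P * (P' * L * act X a) = \<rho> a * L" using c
      by (simp add: mat_assoc mat_assoc_subst[OF PP(1)] \<rho>L[OF a])
    also have "\<dots> = P * (act Q a * (P' * L))"
      using c by (simp add: mat_assoc mat_assoc_subst[OF Pa[OF a]] mat_assoc_subst[OF PP(1)])
    finally show "P * (P' * L * act X a) = P * (act Q a * (P' * L))" .
    show "dim_row (P' * L * act X a) = dim Q" "dim_row (act Q a * (P' * L)) = dim Q" using c by simp_all
  qed
  then obtain q where q: "q \<in> Hom C X Q" "U q = P' * L"
    using U_full[OF YX(2) Q, of "P' * L"] P' L by auto
  show ?thesis
  proof (rule that[OF q(1)])
    show "surj_arr q"
    proof (rule right_inverse_surj_arr[OF q(1)])
      show "S * P \<in> carrier_mat ?n (dim Q)" using S P by simp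
      show "U q * (S * P) = 1\<^sub>m (dim Q)" unfolding q
        using S(1) L(1) P P' by (simp add: mat_assoc mat_assoc_subst[OF LS] PP)
    qed
    have "U q * U m = 0\<^sub>m (dim Q) (dim Y)" unfolding q using P' L(1) K by (simp add: mat_assoc LK)
    then show "q \<cdot> m = Zero C Y Q" using U_comp[OF m(1) q(1)] YX Q
      by (intro U_faithful[OF comp_Hom[OF m(1) q(1)] zero_Hom]) (simp_all add: U_zero)
  next
    fix W f assume f: "f \<in> Hom C W X" and qf: "q \<cdot> f = Zero C W Q"
    have W: "W \<in> Obj C" using f Hom_Obj by auto
    note Uf = U_carrier[OF f]
    have LUf: "L * U f = 0\<^sub>m r (dim W)"
    proof (rule left_inverse_cancel[OF P P' PP(1)])
      have "P' * (L * U f) = U (q \<cdot> f)" unfolding U_comp[OF f q(1)] q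
        using P' L(1) Uf by (simp add: mat_assoc)
      then show "P' * (L * U f) = P' * 0\<^sub>m r (dim W)" using qf W Q P' by (simp add: U_zero)
    qed (use L(1) in simp_all)
    \<comment> \<open>Columns of \<open>U f\<close> lie in the kernel of \<open>E\<close>, on which
      \<open>U m K'\<close> is the identity; so \<open>K' U f\<close> is the required factor. It is
      equivariant because it is so after the injective \<open>m\<close>.\<close>
    have "E * U f = 0\<^sub>m ?n (dim W)" unfolding SL using S(1) L(1) Uf by (simp add: mat_assoc LUf)
    then have *: "U f - U m * (K' * U f) = 0\<^sub>m ?n (dim W)" using EM[OF Uf] by simp
    have UmK: "U m * (K' * U f) = U f"
      by (rule mat_eq_iff_minus_zero[symmetric, OF Uf _ *]) (use K K'(1) Uf in simp)
    have "K' * U f * act W a = act Y a * (K' * U f)" if a: "a \<in> acarrier A" for a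
    proof (rule left_inverse_cancel[OF K'(1) K K'(2)])
      note c = K K'(1) Uf act(1)[OF W a] act(1)[OF YX(1) a] act(1)[OF YX(2) a]
      have "U m * (K' * U f * act W a) = U m * (K' * U f) * act W a" using c by (simp add: mat_assoc)
      also have "\<dots> = act X a * (U m * (K' * U f))" unfolding UmK using U_act[OF f a] .
      also have "\<dots> = U m * (act Y a * (K' * U f))"
        using c by (simp add: mat_assoc mat_assoc_subst[OF U_act[OF m(1) a]])
      finally show "U m * (K' * U f * act W a) = U m * (act Y a * (K' * U f))" .
      show "dim_row (K' * U f * act W a) = dim Y" "dim_row (act Y a * (K' * U f)) = dim Y" using c by simp_all
    qed
    then obtain t where t: "t \<in> Hom C W Y" "U t = K' * U f"
      using U_full[OF W YX(1), of "K' * U f"] K' Uf by auto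
    then have "f = m \<cdot> t" using U_faithful[OF f comp_Hom[OF t(1) m(1)]] U_comp[OF t(1) m(1)] UmK by simp
    then show "\<exists>t \<in> Hom C W Y. f = m \<cdot> t" using t(1) by (rule bexI)
  qed
qed

text \<open>With a linear section \<open>P\<close> of \<open>U q\<close>, the candidate is
  \<open>U f P\<close>. The difference between \<open>x\<close> and \<open>P (U q x)\<close> lies in
  the kernel of \<open>q\<close>, so \<open>f\<close> does not see it; equivariance follows by
  cancelling \<open>q\<close> on the right.\<close>

lemma surj_arr_factor:
  assumes q: "q \<in> Hom C X Y" "surj_arr q" and f: "f \<in> Hom C X W"
    and ker: "\<And>x. x \<in> carrier_vec (dim X) \<Longrightarrow> U q *\<^sub>v x = 0\<^sub>v (dim Y) \<Longrightarrow> U f *\<^sub>v x = 0\<^sub>v (dim W)"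
  obtains r where "r \<in> Hom C Y W" "r \<cdot> q = f"
proof -
  have XYW: "X \<in> Obj C" "Y \<in> Obj C" "W \<in> Obj C" using q f Hom_Obj by auto
  note Uq = U_carrier[OF q(1)] and Uf = U_carrier[OF f]
  obtain P where P: "P \<in> carrier_mat (dim X) (dim Y)" "U q * P = 1\<^sub>m (dim Y)"
    using surj_arr_right_inverse q by metis
  have RU: "U f * P * U q = U f"
  proof (rule mat_eq_by_vec)
    fix x :: "'k vec" assume x: "x \<in> carrier_vec (dim X)"
    define y where "y = P *\<^sub>v (U q *\<^sub>v x)"
    have y: "y \<in> carrier_vec (dim X)" using P Uq x by (simp add: y_def)
    have "U q *\<^sub>v y = (U q * P) *\<^sub>v (U q *\<^sub>v x)" unfolding y_def using P(1) Uq x by (simp add: mat_vec_assoc)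
    then have "U q *\<^sub>v (x - y) = 0\<^sub>v (dim Y)" using P Uq x y by (simp add: mult_minus_distrib_mat_vec)
    then have "U f *\<^sub>v x - U f *\<^sub>v y = 0\<^sub>v (dim W)"
      using ker[of "x - y"] Uf x y by (simp add: mult_minus_distrib_mat_vec)
    then have "U f *\<^sub>v x = U f *\<^sub>v y" using Uf x y by - (rule vec_eq_iff_minus_zero[of _ "dim W"], simp_all)
    then show "(U f * P * U q) *\<^sub>v x = U f *\<^sub>v x"
      unfolding y_def using P(1) Uq Uf x by (simp add: mat_vec_assoc mat_assoc)
  qed (use P(1) Uq Uf in auto)
  have "U f * P * act Y a = act W a * (U f * P)" if a: "a \<in> acarrier A" for a
  proof (rule right_inverse_cancel[OF P(1) Uq P(2)])
    note c = P(1) Uq Uf act(1)[OF XYW(1) a] act(1)[OF XYW(2) a] act(1)[OF XYW(3) a]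
    have RU': "U f * (P * U q) = U f" using RU c by (simp add: mat_assoc)
    have "U f * P * act Y a * U q = U f * (P * U q) * act X a"
      using c by (simp add: mat_assoc U_act[OF q(1) a])
    also have "\<dots> = act W a * (U f * (P * U q))" unfolding RU' using U_act[OF f a] .
    also have "\<dots> = act W a * (U f * P) * U q" using c by (simp add: mat_assoc)
    finally show "U f * P * act Y a * U q = act W a * (U f * P) * U q" .
    show "dim_col (U f * P * act Y a) = dim Y" "dim_col (act W a * (U f * P)) = dim Y" using c by simp_all
  qed
  then obtain r where r: "r \<in> Hom C Y W" "U r = U f * P" using U_full[OF XYW(2,3), of "U f * P"] P Uf by auto
  then have "r \<cdot> q = f" using U_faithful[OF comp_Hom[OF q(1) r(1)] f] U_comp[OF q(1) r(1)] RU by simp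
  then show ?thesis by (rule that[OF r(1)])
qed

end

section \<open>A projective generator and an injective cogenerator\<close>

lemma linear_map_matrix_ex:
  fixes f :: "'a :: field vec \<Rightarrow> 'a vec"
  assumes "\<And>v. v \<in> carrier_vec n \<Longrightarrow> f v \<in> carrier_vec m"
    and "\<And>v w. v \<in> carrier_vec n \<Longrightarrow> w \<in> carrier_vec n \<Longrightarrow> f (v + w) = f v + f w"
    and "\<And>c v. v \<in> carrier_vec n \<Longrightarrow> f (c \<cdot>\<^sub>v v) = c \<cdot>\<^sub>v f v"
  shows "\<exists>M \<in> carrier_mat m n. \<forall>v \<in> carrier_vec n. M *\<^sub>v v = f v"
proof -
  obtain M where M: "M \<in> carrier_mat m n" "\<And>v. v \<in> carrier_vec n \<Longrightarrow> f v = M *\<^sub>v v"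
    by (rule linear_map_matrix[of n f m, OF assms]) auto
  show ?thesis by (rule bexI[OF _ M(1)]) (simp add: M(2))
qed

lemma smult_mat_mult_vec:
  fixes M :: "'a :: comm_ring_1 mat"
  assumes "M \<in> carrier_mat n m" "v \<in> carrier_vec m"
  shows "(t \<cdot>\<^sub>m M) *\<^sub>v v = t \<cdot>\<^sub>v (M *\<^sub>v v)"
  using assms by (intro eq_vecI) auto

context matrix_category
begin

lemma left_multiplication:
  "\<exists>L. \<forall>a \<in> acarrier A. L a \<in> carrier_mat (adim A) (adim A) \<and> (\<forall>b \<in> acarrier A. L a *\<^sub>v b = amult A a b)"
proof (rule bchoice, rule ballI)
  fix a assume a: "a \<in> acarrier A"
  have "\<exists>M \<in> carrier_mat (adim A) (adim A). \<forall>b \<in> acarrier A. M *\<^sub>v b = amult A a b"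
    by (rule linear_map_matrix_ex) (use a alg in simp_all)
  then show "\<exists>M. M \<in> carrier_mat (adim A) (adim A) \<and> (\<forall>b \<in> acarrier A. M *\<^sub>v b = amult A a b)" by blast
qed

lemma right_multiplication:
  "\<exists>R. \<forall>a \<in> acarrier A. R a \<in> carrier_mat (adim A) (adim A) \<and> (\<forall>b \<in> acarrier A. R a *\<^sub>v b = amult A b a)"
proof (rule bchoice, rule ballI)
  fix a assume a: "a \<in> acarrier A"
  have "\<exists>M \<in> carrier_mat (adim A) (adim A). \<forall>b \<in> acarrier A. M *\<^sub>v b = amult A b a"
    by (rule linear_map_matrix_ex) (use a alg in simp_all)
  then show "\<exists>M. M \<in> carrier_mat (adim A) (adim A) \<and> (\<forall>b \<in> acarrier A. M *\<^sub>v b = amult A b a)" by blast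
qed

text \<open>The object \<open>G\<close> corresponds to the regular module and \<open>\<iota>\<close> to the unit of the algebra.\<close>

lemma ex_generator:
  "\<exists>G \<iota>. G \<in> Obj C \<and> \<iota> \<in> carrier_vec (dim G) \<and>
    (\<forall>X \<in> Obj C. \<forall>x \<in> carrier_vec (dim X). \<exists>g \<in> Hom C G X. U g *\<^sub>v \<iota> = x) \<and>
    (\<forall>y \<in> carrier_vec (dim G). \<exists>a \<in> acarrier A. act G a *\<^sub>v \<iota> = y)"
proof -
  obtain L where L': "\<forall>a \<in> acarrier A. L a \<in> carrier_mat (adim A) (adim A) \<and>
    (\<forall>b \<in> acarrier A. L a *\<^sub>v b = amult A a b)"
    using left_multiplication by (rule exE)
  have L: "L a \<in> carrier_mat (adim A) (adim A)" "\<And>b. b \<in> acarrier A \<Longrightarrow> L a *\<^sub>v b = amult A a b"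
    if "a \<in> acarrier A" for a using L' that by simp_all
  have "(adim A, restrict L (acarrier A)) \<in> fd_modules A"
  proof (rule fd_moduleI[OF algebra L(1)])
    show "L (aone A) = 1\<^sub>m (adim A)"
      by (rule mat_eq_by_vec[OF L(1)[OF alg(1)] one_carrier_mat]) (simp add: L(2) alg)
    fix a assume a: "a \<in> acarrier A"
    show "L (t \<cdot>\<^sub>v a) = t \<cdot>\<^sub>m L a" for t
      by (rule mat_eq_by_vec[OF L(1)]) (use a L(1)[OF a] in \<open>simp_all add: L(2) alg smult_mat_mult_vec[OF L(1)[OF a]]\<close>)
    fix b assume b: "b \<in> acarrier A"
    show "L (a + b) = L a + L b"
      by (rule mat_eq_by_vec[OF L(1)])
        (use a b L(1)[OF a] L(1)[OF b] in \<open>simp_all add: L(2) alg add_mult_distrib_mat_vec[OF L(1)[OF a] L(1)[OF b]]\<close>)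
    show "L (amult A a b) = L a * L b"
    proof (rule mat_eq_by_vec[OF L(1)[OF alg(2)[OF a b]] mult_carrier_mat[OF L(1)[OF a] L(1)[OF b]]])
      fix v assume v: "v \<in> acarrier A"
      have "(L a * L b) *\<^sub>v v = L a *\<^sub>v (L b *\<^sub>v v)" by (rule assoc_mult_mat_vec[OF L(1)[OF a] L(1)[OF b] v])
      then show "L (amult A a b) *\<^sub>v v = (L a * L b) *\<^sub>v v"
        using a b v by (simp add: L(2) alg)
    qed
  qed
  then obtain G P Q where G: "G \<in> Obj C" and P: "P \<in> carrier_mat (adim A) (dim G)" and Q: "Q \<in> carrier_mat (dim G) (adim A)"
    and PQ: "P * Q = 1\<^sub>m (adim A)" "Q * P = 1\<^sub>m (dim G)"
    and Pa: "\<And>a. a \<in> acarrier A \<Longrightarrow> P * act G a = L a * P"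
    using U_surj by fastforce
  define \<iota> where "\<iota> = Q *\<^sub>v aone A"
  have \<iota>: "\<iota> \<in> carrier_vec (dim G)" using Q alg(1) by (simp add: \<iota>_def)
  have P\<iota>: "P *\<^sub>v \<iota> = aone A" unfolding \<iota>_def assoc_mult_mat_vec[OF P Q alg(1), symmetric] PQ using alg(1) by simp
  have "\<exists>g \<in> Hom C G X. U g *\<^sub>v \<iota> = x" if X: "X \<in> Obj C" and x: "x \<in> carrier_vec (dim X)" for X x
  proof -
    note aX = act[OF X]
    \<comment> \<open>The module map \<open>a \<mapsto> a x\<close> from the regular module to
      \<open>X\<close>, which takes the unit to \<open>x\<close>; composed with \<open>P\<close> it
      becomes an arrow out of \<open>G\<close>.\<close>
    have "\<exists>M \<in> carrier_mat (dim X) (adim A). \<forall>a \<in> acarrier A. M *\<^sub>v a = act X a *\<^sub>v x"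
    proof (rule linear_map_matrix_ex)
      fix v assume v: "v \<in> acarrier A"
      show "act X v *\<^sub>v x \<in> carrier_vec (dim X)" using aX(1)[OF v] x by simp
      show "act X (t \<cdot>\<^sub>v v) *\<^sub>v x = t \<cdot>\<^sub>v (act X v *\<^sub>v x)" for t
        unfolding aX(5)[OF v] by (rule smult_mat_mult_vec[OF aX(1)[OF v] x])
      fix w assume w: "w \<in> acarrier A"
      show "act X (v + w) *\<^sub>v x = act X v *\<^sub>v x + act X w *\<^sub>v x"
        unfolding aX(4)[OF v w] by (rule add_mult_distrib_mat_vec[OF aX(1)[OF v] aX(1)[OF w] x])
    qed
    then obtain M where M: "M \<in> carrier_mat (dim X) (adim A)" "\<And>a. a \<in> acarrier A \<Longrightarrow> M *\<^sub>v a = act X a *\<^sub>v x"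
      by blast
    have M_L: "M * L a = act X a * M" if a: "a \<in> acarrier A" for a
    proof (rule mat_eq_by_vec[OF mult_carrier_mat[OF M(1) L(1)[OF a]] mult_carrier_mat[OF aX(1)[OF a] M(1)]])
      fix b assume b: "b \<in> acarrier A"
      have "(M * L a) *\<^sub>v b = act X (amult A a b) *\<^sub>v x"
        unfolding assoc_mult_mat_vec[OF M(1) L(1)[OF a] b] L(2)[OF a b] by (rule M(2)[OF alg(2)[OF a b]])
      also have "\<dots> = act X a *\<^sub>v (act X b *\<^sub>v x)"
        unfolding aX(3)[OF a b] by (rule assoc_mult_mat_vec[OF aX(1)[OF a] aX(1)[OF b] x])
      finally show "(M * L a) *\<^sub>v b = (act X a * M) *\<^sub>v b"
        unfolding assoc_mult_mat_vec[OF aX(1)[OF a] M(1) b] M(2)[OF b] .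
    qed
    have M_P: "M * P * act G a = act X a * (M * P)" if a: "a \<in> acarrier A" for a
      using M(1) P aX(1)[OF a] act(1)[OF G a] L(1)[OF a]
      by (simp add: mat_assoc Pa[OF a] mat_assoc_subst[OF M_L[OF a]])
    obtain g where g: "g \<in> Hom C G X" "U g = M * P"
      using U_full[OF G X mult_carrier_mat[OF M(1) P] M_P] by blast
    have "U g *\<^sub>v \<iota> = x"
      unfolding g(2) assoc_mult_mat_vec[OF M(1) P \<iota>] P\<iota> M(2)[OF alg(1)] aX(2) using x by simp
    then show ?thesis using g(1) by (rule bexI)
  qed
  moreover have "\<exists>a \<in> acarrier A. act G a *\<^sub>v \<iota> = y" if y: "y \<in> carrier_vec (dim G)" for y
  proof
    \<comment> \<open>Through \<open>P\<close>, the vector \<open>y\<close> of \<open>G\<close> is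
      an element of the algebra, and an algebra element arises from the unit by its own
      action.\<close>
    show a: "P *\<^sub>v y \<in> acarrier A" using P y by simp
    let ?a = "P *\<^sub>v y"
    have "act G ?a *\<^sub>v \<iota> = (Q * P) *\<^sub>v (act G ?a *\<^sub>v \<iota>)"
      unfolding PQ using act(1)[OF G a] \<iota> by simp
    also have "\<dots> = Q *\<^sub>v ((P * act G ?a) *\<^sub>v \<iota>)"
      using Q P act(1)[OF G a] \<iota> by (simp add: mat_vec_assoc)
    also have "(P * act G ?a) *\<^sub>v \<iota> = ?a"
      unfolding Pa[OF a] assoc_mult_mat_vec[OF L(1)[OF a] P \<iota>] P\<iota> L(2)[OF a alg(1)] by (rule alg(4)[OF a])
    also have "Q *\<^sub>v ?a = y" unfolding assoc_mult_mat_vec[OF Q P y, symmetric] PQ using y by simp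
    finally show "act G ?a *\<^sub>v \<iota> = y" .
  qed
  ultimately show ?thesis using G \<iota> by blast
qed

text \<open>The object \<open>I\<close> corresponds to the linear dual of the right regular module and \<open>\<kappa>\<close> to
  evaluation at the unit of the algebra.\<close>

lemma ex_cogenerator:
  "\<exists>I \<kappa>. I \<in> Obj C \<and> \<kappa> \<in> carrier_vec (dim I) \<and>
    (\<forall>X \<in> Obj C. \<forall>x \<in> carrier_vec (dim X). \<exists>h \<in> Hom C X I. (U h)\<^sup>T *\<^sub>v \<kappa> = x) \<and>
    (\<forall>y \<in> carrier_vec (dim I). \<exists>a \<in> acarrier A. (act I a)\<^sup>T *\<^sub>v \<kappa> = y)"
proof -
  obtain R where R': "\<forall>a \<in> acarrier A. R a \<in> carrier_mat (adim A) (adim A) \<and>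
    (\<forall>b \<in> acarrier A. R a *\<^sub>v b = amult A b a)"
    using right_multiplication by (rule exE)
  have R: "R a \<in> carrier_mat (adim A) (adim A)" "\<And>b. b \<in> acarrier A \<Longrightarrow> R a *\<^sub>v b = amult A b a"
    if "a \<in> acarrier A" for a using R' that by simp_all
  have R1: "R (aone A) = 1\<^sub>m (adim A)"
    by (rule mat_eq_by_vec[OF R(1)[OF alg(1)] one_carrier_mat]) (simp add: R(2) alg)
  have Rs: "R (t \<cdot>\<^sub>v a) = t \<cdot>\<^sub>m R a" if a: "a \<in> acarrier A" for a t
    by (rule mat_eq_by_vec[OF R(1)]) (use a R(1)[OF a] in \<open>simp_all add: R(2) alg smult_mat_mult_vec[OF R(1)[OF a]]\<close>)
  have Rp: "R (a + b) = R a + R b" if a: "a \<in> acarrier A" and b: "b \<in> acarrier A" for a b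
    by (rule mat_eq_by_vec[OF R(1)])
      (use a b R(1)[OF a] R(1)[OF b] in \<open>simp_all add: R(2) alg add_mult_distrib_mat_vec[OF R(1)[OF a] R(1)[OF b]]\<close>)
  have Rm: "R (amult A a b) = R b * R a" if a: "a \<in> acarrier A" and b: "b \<in> acarrier A" for a b
  proof (rule mat_eq_by_vec[OF R(1)[OF alg(2)[OF a b]] mult_carrier_mat[OF R(1)[OF b] R(1)[OF a]]])
    fix v assume v: "v \<in> acarrier A"
    have "(R b * R a) *\<^sub>v v = R b *\<^sub>v (R a *\<^sub>v v)" by (rule assoc_mult_mat_vec[OF R(1)[OF b] R(1)[OF a] v])
    then show "R (amult A a b) *\<^sub>v v = (R b * R a) *\<^sub>v v"
      using a b v by (simp add: R(2) alg)
  qed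
  \<comment> \<open>Right multiplications reverse products and transposition reverses them once
    more, so the transposes form a left module: the dual of the right regular module.\<close>
  have "(adim A, restrict (\<lambda>a. (R a)\<^sup>T) (acarrier A)) \<in> fd_modules A"
  proof (rule fd_moduleI[OF algebra])
    fix a assume a: "a \<in> acarrier A"
    show "(R a)\<^sup>T \<in> carrier_mat (adim A) (adim A)" using R(1)[OF a] by simp
    show "(R (t \<cdot>\<^sub>v a))\<^sup>T = t \<cdot>\<^sub>m (R a)\<^sup>T" for t
      unfolding Rs[OF a] using R(1)[OF a] by (intro eq_matI) auto
    fix b assume b: "b \<in> acarrier A"
    show "(R (a + b))\<^sup>T = (R a)\<^sup>T + (R b)\<^sup>T" unfolding Rp[OF a b] by (rule transpose_add[OF R(1)[OF a] R(1)[OF b]])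
    show "(R (amult A a b))\<^sup>T = (R a)\<^sup>T * (R b)\<^sup>T" unfolding Rm[OF a b] by (rule transpose_mult[OF R(1)[OF b] R(1)[OF a]])
  qed (simp add: R1)
  then obtain I P Q where I: "I \<in> Obj C" and P: "P \<in> carrier_mat (adim A) (dim I)" and Q: "Q \<in> carrier_mat (dim I) (adim A)"
    and PQ: "P * Q = 1\<^sub>m (adim A)" "Q * P = 1\<^sub>m (dim I)"
    and Pa: "\<And>a. a \<in> acarrier A \<Longrightarrow> P * act I a = (R a)\<^sup>T * P"
    using U_surj by fastforce
  define \<kappa> where "\<kappa> = P\<^sup>T *\<^sub>v aone A"
  have PT: "P\<^sup>T \<in> carrier_mat (dim I) (adim A)" and QT: "Q\<^sup>T \<in> carrier_mat (adim A) (dim I)" using P Q by simp_all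
  have \<kappa>: "\<kappa> \<in> carrier_vec (dim I)" using PT alg(1) by (simp add: \<kappa>_def)
  have QP: "Q\<^sup>T * P\<^sup>T = 1\<^sub>m (adim A)" "P\<^sup>T * Q\<^sup>T = 1\<^sub>m (dim I)"
    using PQ transpose_mult[OF P Q] transpose_mult[OF Q P] by simp_all
  have Q\<kappa>: "Q\<^sup>T *\<^sub>v \<kappa> = aone A"
    unfolding \<kappa>_def assoc_mult_mat_vec[OF QT PT alg(1), symmetric] QP using alg(1) by simp
  have aP: "(act I a)\<^sup>T * P\<^sup>T = P\<^sup>T * R a" if a: "a \<in> acarrier A" for a
    using arg_cong[OF Pa[OF a], of transpose_mat] transpose_mult[OF P act(1)[OF I a]]
      transpose_mult[OF _ P, of "(R a)\<^sup>T" "adim A"] R(1)[OF a] by simp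
  have "\<exists>h \<in> Hom C X I. (U h)\<^sup>T *\<^sub>v \<kappa> = x" if X: "X \<in> Obj C" and x: "x \<in> carrier_vec (dim X)" for X x
  proof -
    note aX = act[OF X]
    have aT: "(act X a)\<^sup>T \<in> carrier_mat (dim X) (dim X)" if "a \<in> acarrier A" for a using aX(1)[OF that] by simp
    \<comment> \<open>A functional \<open>x\<close> on \<open>X\<close> determines the map from
      \<open>X\<close> to the dual of the algebra that sends \<open>v\<close> to
      \<open>a \<mapsto> x (a v)\<close>. The matrix \<open>M\<close> is the transpose of this
      map.\<close>
    have "\<exists>M \<in> carrier_mat (dim X) (adim A). \<forall>a \<in> acarrier A. M *\<^sub>v a = (act X a)\<^sup>T *\<^sub>v x"
    proof (rule linear_map_matrix_ex)
      fix v assume v: "v \<in> acarrier A"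
      show "(act X v)\<^sup>T *\<^sub>v x \<in> carrier_vec (dim X)" using aT[OF v] x by simp
      have "(t \<cdot>\<^sub>m act X v)\<^sup>T = t \<cdot>\<^sub>m (act X v)\<^sup>T" for t using aX(1)[OF v] by (intro eq_matI) auto
      then show "(act X (t \<cdot>\<^sub>v v))\<^sup>T *\<^sub>v x = t \<cdot>\<^sub>v ((act X v)\<^sup>T *\<^sub>v x)" for t
        unfolding aX(5)[OF v] using smult_mat_mult_vec[OF aT[OF v] x] by simp
      fix w assume w: "w \<in> acarrier A"
      show "(act X (v + w))\<^sup>T *\<^sub>v x = (act X v)\<^sup>T *\<^sub>v x + (act X w)\<^sup>T *\<^sub>v x"
        unfolding aX(4)[OF v w] transpose_add[OF aX(1)[OF v] aX(1)[OF w]]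
        by (rule add_mult_distrib_mat_vec[OF aT[OF v] aT[OF w] x])
    qed
    then obtain M where M: "M \<in> carrier_mat (dim X) (adim A)" "\<And>a. a \<in> acarrier A \<Longrightarrow> M *\<^sub>v a = (act X a)\<^sup>T *\<^sub>v x"
      by blast
    have M_R: "M * R a = (act X a)\<^sup>T * M" if a: "a \<in> acarrier A" for a
    proof (rule mat_eq_by_vec[OF mult_carrier_mat[OF M(1) R(1)[OF a]] mult_carrier_mat[OF aT[OF a] M(1)]])
      fix b assume b: "b \<in> acarrier A"
      have "(M * R a) *\<^sub>v b = (act X (amult A b a))\<^sup>T *\<^sub>v x"
        unfolding assoc_mult_mat_vec[OF M(1) R(1)[OF a] b] R(2)[OF a b] by (rule M(2)[OF alg(2)[OF b a]])
      also have "\<dots> = (act X a)\<^sup>T *\<^sub>v ((act X b)\<^sup>T *\<^sub>v x)"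
        unfolding aX(3)[OF b a] transpose_mult[OF aX(1)[OF b] aX(1)[OF a]]
        by (rule assoc_mult_mat_vec[OF aT[OF a] aT[OF b] x])
      finally show "(M * R a) *\<^sub>v b = ((act X a)\<^sup>T * M) *\<^sub>v b"
        unfolding assoc_mult_mat_vec[OF aT[OF a] M(1) b] M(2)[OF b] .
    qed
    have M_T: "M\<^sup>T \<in> carrier_mat (adim A) (dim X)" using M(1) by simp
    have M_RT: "(R a)\<^sup>T * M\<^sup>T = M\<^sup>T * act X a" if a: "a \<in> acarrier A" for a
      using arg_cong[OF M_R[OF a], of transpose_mat] transpose_mult[OF M(1) R(1)[OF a]] transpose_mult[OF aT[OF a] M(1)]
      by simp
    have aQ: "act I a * Q = Q * (R a)\<^sup>T" if a: "a \<in> acarrier A" for a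
    proof -
      note c = P Q act(1)[OF I a] R(1)[OF a]
      have "act I a * Q = Q * (P * (act I a * Q))" using c by (simp add: mat_assoc_subst[OF PQ(2)])
      also have "\<dots> = Q * (R a)\<^sup>T" using c by (simp add: mat_assoc_subst[OF Pa[OF a]] mat_assoc PQ)
      finally show ?thesis .
    qed
    have "Q * M\<^sup>T * act X a = act I a * (Q * M\<^sup>T)" if a: "a \<in> acarrier A" for a
      using Q M_T aX(1)[OF a] act(1)[OF I a] R(1)[OF a]
      by (simp add: mat_assoc M_RT[OF a, symmetric] mat_assoc_subst[OF aQ[OF a]])
    then obtain h where h: "h \<in> Hom C X I" "U h = Q * M\<^sup>T"
      using U_full[OF X I mult_carrier_mat[OF Q M_T]] by blast
    have "(U h)\<^sup>T = M * Q\<^sup>T" unfolding h(2) transpose_mult[OF Q M_T] by simp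
    then have "(U h)\<^sup>T *\<^sub>v \<kappa> = M *\<^sub>v (Q\<^sup>T *\<^sub>v \<kappa>)" using assoc_mult_mat_vec[OF M(1) QT \<kappa>] by simp
    also have "\<dots> = x" unfolding Q\<kappa> M(2)[OF alg(1)] aX(2) using x by simp
    finally show ?thesis using h(1) by (rule bexI)
  qed
  moreover have "\<exists>a \<in> acarrier A. (act I a)\<^sup>T *\<^sub>v \<kappa> = y" if y: "y \<in> carrier_vec (dim I)" for y
  proof
    show a: "Q\<^sup>T *\<^sub>v y \<in> acarrier A" using QT y by simp
    let ?a = "Q\<^sup>T *\<^sub>v y"
    have aT: "(act I ?a)\<^sup>T \<in> carrier_mat (dim I) (dim I)" using act(1)[OF I a] by simp
    have "(act I ?a)\<^sup>T *\<^sub>v \<kappa> = P\<^sup>T *\<^sub>v (R ?a *\<^sub>v aone A)"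
      unfolding \<kappa>_def assoc_mult_mat_vec[OF aT PT alg(1), symmetric] aP[OF a]
      by (rule assoc_mult_mat_vec[OF PT R(1)[OF a] alg(1)])
    also have "\<dots> = (P\<^sup>T * Q\<^sup>T) *\<^sub>v y"
      unfolding R(2)[OF a alg(1)] alg(3)[OF a] by (rule assoc_mult_mat_vec[OF PT QT y, symmetric])
    finally show "(act I ?a)\<^sup>T *\<^sub>v \<kappa> = y" unfolding QP using y by simp
  qed
  ultimately show ?thesis using I \<kappa> by blast
qed

end

section \<open>Elements of objects as arrows\<close>

text \<open>Evaluation at \<open>\<iota>\<close> identifies arrows \<open>G \<rightarrow> X\<close>
  with vectors of \<open>X\<close>: \<open>ex_el\<close> gives surjectivity and
  \<open>G_cyclic\<close> injectivity. In the same way \<open>\<kappa>\<close> identifies arrows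
  \<open>X \<rightarrow> I\<close> with linear functionals on \<open>X\<close>, written as
  vectors.\<close>

locale generated_category = matrix_category C A dim act U
  for C :: "('o, 'm, 'k :: field, 'z) linear_category_scheme" (structure) and A dim act U +
  fixes G :: 'o and \<iota> :: "'k vec" and I :: 'o and \<kappa> :: "'k vec"
  assumes G_Obj: "G \<in> Obj C" and \<iota>: "\<iota> \<in> carrier_vec (dim G)"
    and ex_el: "X \<in> Obj C \<Longrightarrow> x \<in> carrier_vec (dim X) \<Longrightarrow> \<exists>g \<in> Hom C G X. U g *\<^sub>v \<iota> = x"
    and G_cyclic: "y \<in> carrier_vec (dim G) \<Longrightarrow> \<exists>a \<in> acarrier A. act G a *\<^sub>v \<iota> = y"
    and I_Obj: "I \<in> Obj C" and \<kappa>: "\<kappa> \<in> carrier_vec (dim I)"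
    and ex_coel: "X \<in> Obj C \<Longrightarrow> x \<in> carrier_vec (dim X) \<Longrightarrow> \<exists>h \<in> Hom C X I. (U h)\<^sup>T *\<^sub>v \<kappa> = x"
    and I_cocyclic: "y \<in> carrier_vec (dim I) \<Longrightarrow> \<exists>a \<in> acarrier A. (act I a)\<^sup>T *\<^sub>v \<kappa> = y"

context generated_category
begin

lemma el_eq:
  assumes f: "f \<in> Hom C G X" and g: "g \<in> Hom C G X" and eq: "U f *\<^sub>v \<iota> = U g *\<^sub>v \<iota>"
  shows "f = g"
proof (rule U_faithful[OF f g], rule mat_eq_by_vec[OF U_carrier[OF f] U_carrier[OF g]])
  fix y :: "'k vec" assume "y \<in> carrier_vec (dim G)"
  then obtain a where a: "a \<in> acarrier A" and y: "y = act G a *\<^sub>v \<iota>" using G_cyclic by blast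
  note aG = act(1)[OF G_Obj a] and aX = act(1)[OF Hom_Obj(2)[OF f] a]
  have *: "U h *\<^sub>v y = act X a *\<^sub>v (U h *\<^sub>v \<iota>)" if h: "h \<in> Hom C G X" for h
    unfolding y assoc_mult_mat_vec[OF U_carrier[OF h] aG \<iota>, symmetric] U_act[OF h a]
    by (rule assoc_mult_mat_vec[OF aX U_carrier[OF h] \<iota>])
  show "U f *\<^sub>v y = U g *\<^sub>v y" unfolding *[OF f] *[OF g] eq ..
qed

lemma coel_eq:
  assumes f: "f \<in> Hom C X I" and g: "g \<in> Hom C X I" and eq: "(U f)\<^sup>T *\<^sub>v \<kappa> = (U g)\<^sup>T *\<^sub>v \<kappa>"
  shows "f = g"
proof -
  have c: "(U h)\<^sup>T \<in> carrier_mat (dim X) (dim I)" if "h \<in> Hom C X I" for h using U_carrier[OF that] by simp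
  have "(U f)\<^sup>T = (U g)\<^sup>T"
  proof (rule mat_eq_by_vec[OF c[OF f] c[OF g]])
    fix y :: "'k vec" assume "y \<in> carrier_vec (dim I)"
    then obtain a where a: "a \<in> acarrier A" and y: "y = (act I a)\<^sup>T *\<^sub>v \<kappa>" using I_cocyclic by blast
    note aI = act(1)[OF I_Obj a] and aX = act(1)[OF Hom_Obj(1)[OF f] a]
    have aIT: "(act I a)\<^sup>T \<in> carrier_mat (dim I) (dim I)" and aXT: "(act X a)\<^sup>T \<in> carrier_mat (dim X) (dim X)"
      using aI aX by simp_all
    have *: "(U h)\<^sup>T *\<^sub>v y = (act X a)\<^sup>T *\<^sub>v ((U h)\<^sup>T *\<^sub>v \<kappa>)" if h: "h \<in> Hom C X I" for h
      unfolding y assoc_mult_mat_vec[OF c[OF h] aIT \<kappa>, symmetric] transpose_mult[OF aI U_carrier[OF h], symmetric]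
        U_act[OF h a, symmetric] transpose_mult[OF U_carrier[OF h] aX]
      by (rule assoc_mult_mat_vec[OF aXT c[OF h] \<kappa>])
    show "(U f)\<^sup>T *\<^sub>v y = (U g)\<^sup>T *\<^sub>v y" unfolding *[OF f] *[OF g] eq ..
  qed
  then have "U f = U g" by simp
  then show ?thesis by (rule U_faithful[OF f g])
qed

text \<open>By \<open>el_eq\<close> there is only one arrow to choose, so \<open>el X\<close> is the
  inverse of evaluation at \<open>\<iota>\<close>, and it is linear and natural in
  \<open>X\<close>.\<close>

definition el :: "'o \<Rightarrow> 'k vec \<Rightarrow> 'm" where
  "el X x = (SOME g. g \<in> Hom C G X \<and> U g *\<^sub>v \<iota> = x)"

definition coel :: "'o \<Rightarrow> 'k vec \<Rightarrow> 'm" where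
  "coel X x = (SOME h. h \<in> Hom C X I \<and> (U h)\<^sup>T *\<^sub>v \<kappa> = x)"

lemma el:
  assumes "X \<in> Obj C" "x \<in> carrier_vec (dim X)"
  shows "el X x \<in> Hom C G X" "U (el X x) *\<^sub>v \<iota> = x"
proof -
  have "\<exists>g. g \<in> Hom C G X \<and> U g *\<^sub>v \<iota> = x" using ex_el[OF assms] by blast
  then have "el X x \<in> Hom C G X \<and> U (el X x) *\<^sub>v \<iota> = x" unfolding el_def by (rule someI_ex)
  then show "el X x \<in> Hom C G X" "U (el X x) *\<^sub>v \<iota> = x" by simp_all
qed

lemma coel:
  assumes "X \<in> Obj C" "x \<in> carrier_vec (dim X)"
  shows "coel X x \<in> Hom C X I" "(U (coel X x))\<^sup>T *\<^sub>v \<kappa> = x"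
proof -
  have "\<exists>h. h \<in> Hom C X I \<and> (U h)\<^sup>T *\<^sub>v \<kappa> = x" using ex_coel[OF assms] by blast
  then have "coel X x \<in> Hom C X I \<and> (U (coel X x))\<^sup>T *\<^sub>v \<kappa> = x" unfolding coel_def by (rule someI_ex)
  then show "coel X x \<in> Hom C X I" "(U (coel X x))\<^sup>T *\<^sub>v \<kappa> = x" by simp_all
qed

lemma U_vec: "f \<in> Hom C X Y \<Longrightarrow> x \<in> carrier_vec (dim X) \<Longrightarrow> U f *\<^sub>v x \<in> carrier_vec (dim Y)"
  by (rule mult_mat_vec_carrier[OF U_carrier])

lemma UT_vec: "f \<in> Hom C X Y \<Longrightarrow> x \<in> carrier_vec (dim Y) \<Longrightarrow> (U f)\<^sup>T *\<^sub>v x \<in> carrier_vec (dim X)"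
  by (rule mult_mat_vec_carrier[of _ _ "dim Y"]) (simp_all add: U_carrier)

lemma U_comp_vec:
  assumes f: "f \<in> Hom C X Y" and g: "g \<in> Hom C Y W" and x: "x \<in> carrier_vec (dim X)"
  shows "U (g \<cdot> f) *\<^sub>v x = U g *\<^sub>v (U f *\<^sub>v x)"
  unfolding U_comp[OF f g] by (rule assoc_mult_mat_vec[OF U_carrier[OF g] U_carrier[OF f] x])

lemma comp_el:
  assumes f: "f \<in> Hom C X Y" and x: "x \<in> carrier_vec (dim X)"
  shows "f \<cdot> el X x = el Y (U f *\<^sub>v x)"
proof (rule el_eq)
  note o = Hom_Obj[OF f]
  show "f \<cdot> el X x \<in> Hom C G Y" by (rule comp_Hom[OF el(1)[OF o(1) x] f])
  show "el Y (U f *\<^sub>v x) \<in> Hom C G Y" by (rule el(1)[OF o(2) U_vec[OF f x]])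
  show "U (f \<cdot> el X x) *\<^sub>v \<iota> = U (el Y (U f *\<^sub>v x)) *\<^sub>v \<iota>"
    unfolding U_comp_vec[OF el(1)[OF o(1) x] f \<iota>] el(2)[OF o(1) x] el(2)[OF o(2) U_vec[OF f x]] ..
qed

lemma el_of:
  assumes f: "f \<in> Hom C G X"
  shows "el X (U f *\<^sub>v \<iota>) = f"
  by (rule el_eq[OF el(1)[OF Hom_Obj(2)[OF f] U_vec[OF f \<iota>]] f el(2)[OF Hom_Obj(2)[OF f] U_vec[OF f \<iota>]]])

lemma coel_comp:
  assumes f: "f \<in> Hom C X Y" and x: "x \<in> carrier_vec (dim Y)"
  shows "coel Y x \<cdot> f = coel X ((U f)\<^sup>T *\<^sub>v x)"
proof (rule coel_eq)
  note o = Hom_Obj[OF f]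
  note h = coel(1)[OF o(2) x]
  have UT: "(U f)\<^sup>T \<in> carrier_mat (dim X) (dim Y)" "(U (coel Y x))\<^sup>T \<in> carrier_mat (dim Y) (dim I)"
    using U_carrier[OF f] U_carrier[OF h] by simp_all
  show "coel Y x \<cdot> f \<in> Hom C X I" by (rule comp_Hom[OF f h])
  show "coel X ((U f)\<^sup>T *\<^sub>v x) \<in> Hom C X I" by (rule coel(1)[OF o(1) UT_vec[OF f x]])
  show "(U (coel Y x \<cdot> f))\<^sup>T *\<^sub>v \<kappa> = (U (coel X ((U f)\<^sup>T *\<^sub>v x)))\<^sup>T *\<^sub>v \<kappa>"
    unfolding U_comp[OF f h] transpose_mult[OF U_carrier[OF h] U_carrier[OF f]]
      assoc_mult_mat_vec[OF UT \<kappa>] coel(2)[OF o(2) x] coel(2)[OF o(1) UT_vec[OF f x]] ..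
qed

lemma el_scale:
  assumes X: "X \<in> Obj C" and x: "x \<in> carrier_vec (dim X)"
  shows "el X (c \<cdot>\<^sub>v x) = c \<star> el X x"
proof (rule el_eq)
  have cx: "c \<cdot>\<^sub>v x \<in> carrier_vec (dim X)" using x by simp
  show "el X (c \<cdot>\<^sub>v x) \<in> Hom C G X" by (rule el(1)[OF X cx])
  show "c \<star> el X x \<in> Hom C G X" by (rule scale_Hom[OF el(1)[OF X x]])
  show "U (el X (c \<cdot>\<^sub>v x)) *\<^sub>v \<iota> = U (c \<star> el X x) *\<^sub>v \<iota>"
    unfolding el(2)[OF X cx] U_scale[OF el(1)[OF X x]] smult_mat_mult_vec[OF U_carrier[OF el(1)[OF X x]] \<iota>] el(2)[OF X x] ..
qed

lemma el_plus:
  assumes X: "X \<in> Obj C" and x: "x \<in> carrier_vec (dim X)" and y: "y \<in> carrier_vec (dim X)"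
  shows "el X (x + y) = el X x \<oplus>\<^sub>a el X y"
proof (rule el_eq)
  have xy: "x + y \<in> carrier_vec (dim X)" using x y by simp
  note ex = el(1)[OF X x] and ey = el(1)[OF X y]
  show "el X (x + y) \<in> Hom C G X" by (rule el(1)[OF X xy])
  show "el X x \<oplus>\<^sub>a el X y \<in> Hom C G X" by (rule plus_Hom[OF ex ey])
  show "U (el X (x + y)) *\<^sub>v \<iota> = U (el X x \<oplus>\<^sub>a el X y) *\<^sub>v \<iota>"
    unfolding el(2)[OF X xy] U_plus[OF ex ey] add_mult_distrib_mat_vec[OF U_carrier[OF ex] U_carrier[OF ey] \<iota>]
      el(2)[OF X x] el(2)[OF X y] ..
qed

lemma coel_scale:
  assumes X: "X \<in> Obj C" and x: "x \<in> carrier_vec (dim X)"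
  shows "coel X (c \<cdot>\<^sub>v x) = c \<star> coel X x"
proof (rule coel_eq)
  have cx: "c \<cdot>\<^sub>v x \<in> carrier_vec (dim X)" using x by simp
  note ex = coel(1)[OF X x]
  have UT: "(U (coel X x))\<^sup>T \<in> carrier_mat (dim X) (dim I)" using U_carrier[OF ex] by simp
  have e: "(c \<cdot>\<^sub>m U (coel X x))\<^sup>T = c \<cdot>\<^sub>m (U (coel X x))\<^sup>T" using U_carrier[OF ex] by (intro eq_matI) auto
  show "coel X (c \<cdot>\<^sub>v x) \<in> Hom C X I" by (rule coel(1)[OF X cx])
  show "c \<star> coel X x \<in> Hom C X I" by (rule scale_Hom[OF ex])
  show "(U (coel X (c \<cdot>\<^sub>v x)))\<^sup>T *\<^sub>v \<kappa> = (U (c \<star> coel X x))\<^sup>T *\<^sub>v \<kappa>"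
    unfolding coel(2)[OF X cx] U_scale[OF ex] e smult_mat_mult_vec[OF UT \<kappa>] coel(2)[OF X x] ..
qed

lemma coel_plus:
  assumes X: "X \<in> Obj C" and x: "x \<in> carrier_vec (dim X)" and y: "y \<in> carrier_vec (dim X)"
  shows "coel X (x + y) = coel X x \<oplus>\<^sub>a coel X y"
proof (rule coel_eq)
  have xy: "x + y \<in> carrier_vec (dim X)" using x y by simp
  note ex = coel(1)[OF X x] and ey = coel(1)[OF X y]
  have UT: "(U (coel X x))\<^sup>T \<in> carrier_mat (dim X) (dim I)" "(U (coel X y))\<^sup>T \<in> carrier_mat (dim X) (dim I)"
    using U_carrier[OF ex] U_carrier[OF ey] by simp_all
  show "coel X (x + y) \<in> Hom C X I" by (rule coel(1)[OF X xy])
  show "coel X x \<oplus>\<^sub>a coel X y \<in> Hom C X I" by (rule plus_Hom[OF ex ey])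
  show "(U (coel X (x + y)))\<^sup>T *\<^sub>v \<kappa> = (U (coel X x \<oplus>\<^sub>a coel X y))\<^sup>T *\<^sub>v \<kappa>"
    unfolding coel(2)[OF X xy] U_plus[OF ex ey] transpose_add[OF U_carrier[OF ex] U_carrier[OF ey]]
      add_mult_distrib_mat_vec[OF UT \<kappa>] coel(2)[OF X x] coel(2)[OF X y] ..
qed

lemma el_zero: "X \<in> Obj C \<Longrightarrow> el X (0\<^sub>v (dim X)) = Zero C G X"
  by (rule el_eq[OF el(1) zero_Hom]) (simp_all add: el(2) G_Obj U_zero zero_mat_mult_vec[OF \<iota>])

lemma el_nonzero:
  assumes X: "X \<in> Obj C" and x: "x \<in> carrier_vec (dim X)" "x \<noteq> 0\<^sub>v (dim X)"
  shows "el X x \<noteq> Zero C G X"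
proof
  assume "el X x = Zero C G X"
  then have "x = U (Zero C G X) *\<^sub>v \<iota>" using el(2)[OF X x(1)] by simp
  then show False using x(2) unfolding U_zero[OF G_Obj X] zero_mat_mult_vec[OF \<iota>] by simp
qed

lemma nonzero_arr_vec:
  assumes f: "f \<in> Hom C X Y" and nz: "f \<noteq> Zero C X Y"
  obtains x where "x \<in> carrier_vec (dim X)" "U f *\<^sub>v x \<noteq> 0\<^sub>v (dim Y)"
proof -
  note o = Hom_Obj[OF f]
  have "\<exists>x \<in> carrier_vec (dim X). U f *\<^sub>v x \<noteq> 0\<^sub>v (dim Y)"
  proof (rule ccontr)
    assume *: "\<not> ?thesis"
    have "U f = U (Zero C X Y)" unfolding U_zero[OF o]
      by (rule mat_eq_by_vec[OF U_carrier[OF f] zero_carrier_mat]) (use * in \<open>simp add: zero_mat_mult_vec\<close>)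
    then show False using U_faithful[OF f zero_Hom[OF o]] nz by simp
  qed
  then show ?thesis using that by blast
qed

lemma zero_object_dim:
  assumes X: "X \<in> Obj C"
  shows "zero_object C X \<longleftrightarrow> dim X = 0"
proof
  assume "zero_object C X"
  then have e: "U (idn X) = U (Zero C X X)" by (simp add: zero_object_def)
  then have e: "1\<^sub>m (dim X) = (0\<^sub>m (dim X) (dim X) :: 'k mat)" unfolding U_id[OF X] U_zero[OF X X] .
  show "dim X = 0"
  proof (rule ccontr)
    assume "dim X \<noteq> 0"
    then show False using arg_cong[OF e, of "\<lambda>M. M $$ (0, 0)"] by simp
  qed
next
  assume "dim X = 0"
  then have "U (idn X) = U (Zero C X X)" unfolding U_id[OF X] U_zero[OF X X] by (intro eq_matI) auto
  then show "zero_object C X" using U_faithful[OF id_Hom[OF X] zero_Hom[OF X X]] X by (simp add: zero_object_def)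
qed

lemma inj_arr_mono:
  assumes "f \<in> Hom C X Y" "inj_arr f"
  shows "mono_arr C f"
  unfolding mono_arr_def Hom_Src_Tgt[OF assms(1)]
  using inj_arr_cancel[OF assms] Hom_Arr[OF assms(1)] by blast

text \<open>A kernel vector \<open>x\<close> yields the arrow \<open>el X x\<close> out of
  \<open>G\<close>, which \<open>f\<close> sends to zero. A monomorphism cannot distinguish it from
  the zero arrow, so \<open>x\<close> is zero.\<close>

lemma mono_arr_inj:
  assumes f: "f \<in> Hom C X Y" and m: "mono_arr C f"
  shows "inj_arr f"
  unfolding inj_arr_def Hom_Src_Tgt[OF f]
proof (intro ballI impI)
  fix x assume x: "x \<in> carrier_vec (dim X)" and 0: "U f *\<^sub>v x = 0\<^sub>v (dim Y)"
  note o = Hom_Obj[OF f]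
  have "f \<cdot> el X x = f \<cdot> Zero C G X"
    unfolding comp_el[OF f x] 0 comp_zero[OF f G_Obj] by (rule el_zero[OF o(2)])
  then have "el X x = Zero C G X"
    using m el(1)[OF o(1) x] zero_Hom[OF G_Obj o(1)] G_Obj unfolding mono_arr_def Hom_Src_Tgt[OF f] by blast
  then show "x = 0\<^sub>v (dim X)" using el_nonzero[OF o(1) x] by blast
qed

lemma iso_arr_inj_surj:
  assumes f: "f \<in> Hom C X Y" and "iso_arr C f"
  shows "inj_arr f" "surj_arr f"
proof -
  note o = Hom_Obj[OF f]
  obtain g where g: "g \<in> Hom C Y X" "g \<cdot> f = idn X" "f \<cdot> g = idn Y" using iso_arrE[OF assms(2,1)] by blast
  show "inj_arr f"
    by (rule left_inverse_inj_arr[OF f U_carrier[OF g(1)]]) (simp add: U_comp[OF f g(1), symmetric] g(2) U_id[OF o(1)])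
  show "surj_arr f"
    by (rule right_inverse_surj_arr[OF f U_carrier[OF g(1)]]) (simp add: U_comp[OF g(1) f, symmetric] g(3) U_id[OF o(2)])
qed

lemma surj_arr_comp:
  assumes f: "f \<in> Hom C X Y" "surj_arr f" and g: "g \<in> Hom C Y W" "surj_arr g"
  shows "surj_arr (g \<cdot> f)"
  unfolding surj_arr_def Hom_Src_Tgt[OF comp_Hom[OF f(1) g(1)]]
proof
  fix w :: "'k vec" assume "w \<in> carrier_vec (dim W)"
  then obtain y where y: "y \<in> carrier_vec (dim Y)" "U g *\<^sub>v y = w"
    using g(2) unfolding surj_arr_def Hom_Src_Tgt[OF g(1)] by blast
  then obtain x where x: "x \<in> carrier_vec (dim X)" "U f *\<^sub>v x = y"
    using f(2) unfolding surj_arr_def Hom_Src_Tgt[OF f(1)] by blast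
  show "\<exists>x \<in> carrier_vec (dim X). U (g \<cdot> f) *\<^sub>v x = w"
    by (rule bexI[OF _ x(1)]) (simp add: U_comp_vec[OF f(1) g(1) x(1)] x(2) y(2))
qed

lemma simple_surj:
  assumes S: "simple_object C S" and f: "f \<in> Hom C X S" and nz: "f \<noteq> Zero C X S"
  shows "surj_arr f"
proof -
  obtain J e m where e: "e \<in> Hom C X J" and m: "m \<in> Hom C J S" and fme: "f = m \<cdot> e" and "surj_arr e" "inj_arr m"
    by (rule image_factorization[OF f])
  have mm: "mono_arr C m" by (rule inj_arr_mono[OF m \<open>inj_arr m\<close>])
  have "\<not> zero_object C J"
  proof
    assume "zero_object C J"
    then have "idn J = Zero C J J" by (simp add: zero_object_def)
    then have "e = Zero C X J" using id_comp[OF e] zero_comp[OF e Hom_Obj(1)[OF m]] by simp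
    then have "f = Zero C X S" using fme comp_zero[OF m Hom_Obj(1)[OF e]] by simp
    then show False using nz by simp
  qed
  then have "iso_arr C m"
    using S mm Hom_Arr[OF m] Hom_Src_Tgt[OF m] unfolding simple_object_def by blast
  then have "surj_arr m" by (rule iso_arr_inj_surj[OF m])
  then show ?thesis unfolding fme by (rule surj_arr_comp[OF e \<open>surj_arr e\<close> m])
qed

text \<open>If \<open>f\<close> killed a nonzero vector \<open>x\<close> of \<open>S\<close>, it
  would kill the arrow \<open>el S x\<close>. That arrow is surjective by
  \<open>simple_surj\<close>, so \<open>f\<close> would be zero. Thus no kernel object has to be
  constructed.\<close>

lemma simple_inj:
  assumes S: "simple_object C S" and f: "f \<in> Hom C S Y" and nz: "f \<noteq> Zero C S Y"
  shows "inj_arr f"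
  unfolding inj_arr_def Hom_Src_Tgt[OF f]
proof (intro ballI impI)
  fix x assume x: "x \<in> carrier_vec (dim S)" and 0: "U f *\<^sub>v x = 0\<^sub>v (dim Y)"
  note o = Hom_Obj[OF f]
  show "x = 0\<^sub>v (dim S)"
  proof (rule ccontr)
    assume "x \<noteq> 0\<^sub>v (dim S)"
    then have s: "surj_arr (el S x)" using simple_surj[OF S el(1) el_nonzero] o x by blast
    have "f \<cdot> el S x = Zero C S Y \<cdot> el S x"
      unfolding comp_el[OF f x] 0 zero_comp[OF el(1)[OF o(1) x] o(2)] by (rule el_zero[OF o(2)])
    then have "f = Zero C S Y" by (rule surj_arr_cancel[OF el(1)[OF o(1) x] s f zero_Hom[OF o]])
    then show False using nz by simp
  qed
qed

lemma simple_iso: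
  assumes "simple_object C S" "simple_object C T" and f: "f \<in> Hom C S T" "f \<noteq> Zero C S T"
  shows "iso_arr C f"
  by (rule bij_arr_iso[OF f(1) simple_inj[OF assms(1) f] simple_surj[OF assms(2) f]])

end

lemma finite_abelian_generated_category:
  fixes C :: "('o, 'm, 'k :: field, 'z) linear_category_scheme"
  assumes "finite_abelian C"
  shows "\<exists>A dim act U G \<iota> I \<kappa>. generated_category C A dim act U G \<iota> I \<kappa>"
proof -
  obtain A dim act U where M: "matrix_category C A dim act U" using finite_abelian_matrix_category[OF assms] .
  interpret matrix_category C A dim act U by fact
  obtain G \<iota> where G: "G \<in> Obj C \<and> \<iota> \<in> carrier_vec (dim G) \<and>
    (\<forall>X \<in> Obj C. \<forall>x \<in> carrier_vec (dim X). \<exists>g \<in> Hom C G X. U g *\<^sub>v \<iota> = x) \<and>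
    (\<forall>y \<in> carrier_vec (dim G). \<exists>a \<in> acarrier A. act G a *\<^sub>v \<iota> = y)"
    using ex_generator by (elim exE)
  obtain I \<kappa> where I: "I \<in> Obj C \<and> \<kappa> \<in> carrier_vec (dim I) \<and>
    (\<forall>X \<in> Obj C. \<forall>x \<in> carrier_vec (dim X). \<exists>h \<in> Hom C X I. (U h)\<^sup>T *\<^sub>v \<kappa> = x) \<and>
    (\<forall>y \<in> carrier_vec (dim I). \<exists>a \<in> acarrier A. (act I a)\<^sup>T *\<^sub>v \<kappa> = y)"
    using ex_cogenerator by (elim exE)
  have "generated_category C A dim act U G \<iota> I \<kappa>"
    by unfold_locales (use G I in simp_all)
  then show ?thesis by blast
qed

section \<open>Duals and natural actions\<close>

context strict_monoidal_category
begin

lemma tensor_split_left: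
  assumes a: "a \<in> Hom C X X'" and b: "b \<in> Hom C Y Y'"
  shows "(a \<otimes> idn Y') \<cdot> (idn X \<otimes> b) = a \<otimes> b"
  using tensor_comp[OF id_Hom[OF Hom_Obj(1)[OF a]] a b id_Hom[OF Hom_Obj(2)[OF b]]] comp_id[OF a] id_comp[OF b] by simp

lemma tensor_split_right:
  assumes a: "a \<in> Hom C X X'" and b: "b \<in> Hom C Y Y'"
  shows "(idn X' \<otimes> b) \<cdot> (a \<otimes> idn Y) = a \<otimes> b"
  using tensor_comp[OF a id_Hom[OF Hom_Obj(2)[OF a]] id_Hom[OF Hom_Obj(1)[OF b]] b] comp_id[OF b] id_comp[OF a] by simp

lemma comp_tensor_id:
  assumes f: "f \<in> Hom C X Y" and g: "g \<in> Hom C Y W" and V: "V \<in> Obj C"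
  shows "(g \<cdot> f) \<otimes> idn V = (g \<otimes> idn V) \<cdot> (f \<otimes> idn V)"
  using tensor_comp[OF f g id_Hom[OF V] id_Hom[OF V]] comp_id[OF id_Hom[OF V]] by simp

lemma id_tensor_comp:
  assumes f: "f \<in> Hom C X Y" and g: "g \<in> Hom C Y W" and V: "V \<in> Obj C"
  shows "idn V \<otimes> (g \<cdot> f) = (idn V \<otimes> g) \<cdot> (idn V \<otimes> f)"
  using tensor_comp[OF id_Hom[OF V] id_Hom[OF V] f g] comp_id[OF id_Hom[OF V]] by simp

lemma id_Arr: "X \<in> Obj C \<Longrightarrow> idn X \<in> Arr C"
  by (rule Hom_Arr[OF id_Hom])

lemma id_id_tensor:
  assumes "X \<in> Obj C" "Y \<in> Obj C" "f \<in> Arr C"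
  shows "idn X \<otimes> (idn Y \<otimes> f) = idn (X \<boxtimes> Y) \<otimes> f"
  using assoc_Arr[OF id_Arr[OF assms(1)] id_Arr[OF assms(2)] assms(3)] tensor_id[OF assms(1,2)] by simp

lemma tensor_id_id:
  assumes "X \<in> Obj C" "Y \<in> Obj C" "f \<in> Arr C"
  shows "(f \<otimes> idn X) \<otimes> idn Y = f \<otimes> idn (X \<boxtimes> Y)"
  using assoc_Arr[OF assms(3) id_Arr[OF assms(1)] id_Arr[OF assms(2)]] tensor_id[OF assms(1,2)] by simp

lemma id_tensor_Hom: "X \<in> Obj C \<Longrightarrow> f \<in> Hom C Y W \<Longrightarrow> idn X \<otimes> f \<in> Hom C (X \<boxtimes> Y) (X \<boxtimes> W)"
  by (rule tensor_Hom[OF id_Hom])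

lemma tensor_id_Hom: "X \<in> Obj C \<Longrightarrow> f \<in> Hom C Y W \<Longrightarrow> f \<otimes> idn X \<in> Hom C (Y \<boxtimes> X) (W \<boxtimes> X)"
  by (rule tensor_Hom[OF _ id_Hom])

text \<open>The adjunction between tensoring with \<open>X\<close> and with a left dual \<open>Y\<close> of \<open>X\<close> turns
  \<open>E \<rightarrow> Q \<boxtimes> Y\<close> into \<open>E \<boxtimes> X \<rightarrow> Q\<close> and back.\<close>

definition uncurry_dual :: "'m \<Rightarrow> 'o \<Rightarrow> 'o \<Rightarrow> 'm \<Rightarrow> 'm" where
  "uncurry_dual e X Q p = (idn Q \<otimes> e) \<cdot> (p \<otimes> idn X)"

definition curry_dual :: "'m \<Rightarrow> 'o \<Rightarrow> 'o \<Rightarrow> 'm \<Rightarrow> 'm" where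
  "curry_dual c Y E q = (q \<otimes> idn Y) \<cdot> (idn E \<otimes> c)"

lemma id_tensor_ev_Hom:
  assumes "Q \<in> Obj C" "e \<in> Hom C W \<one>"
  shows "idn Q \<otimes> e \<in> Hom C (Q \<boxtimes> W) Q"
  using id_tensor_Hom[OF assms] unit_Obj_right[OF assms(1)] by simp

lemma id_tensor_coev_Hom:
  assumes "Q \<in> Obj C" "c \<in> Hom C \<one> W"
  shows "idn Q \<otimes> c \<in> Hom C Q (Q \<boxtimes> W)"
  using id_tensor_Hom[OF assms] unit_Obj_right[OF assms(1)] by simp

lemma ev_tensor_id_Hom:
  assumes "Q \<in> Obj C" "e \<in> Hom C W \<one>"
  shows "e \<otimes> idn Q \<in> Hom C (W \<boxtimes> Q) Q"
  using tensor_id_Hom[OF assms] unit_Obj_left[OF assms(1)] by simp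

lemma coev_tensor_id_Hom:
  assumes "Q \<in> Obj C" "c \<in> Hom C \<one> W"
  shows "c \<otimes> idn Q \<in> Hom C Q (W \<boxtimes> Q)"
  using tensor_id_Hom[OF assms] unit_Obj_left[OF assms(1)] by simp

lemma id_ev_slide:
  assumes f: "f \<in> Hom C E Q" and e: "e \<in> Hom C W \<one>"
  shows "(idn Q \<otimes> e) \<cdot> (f \<otimes> idn W) = f \<cdot> (idn E \<otimes> e)"
  using tensor_split_right[OF f e] tensor_split_left[OF f e] unit_Arr_right[OF Hom_Arr[OF f]] by simp

lemma id_coev_slide:
  assumes f: "f \<in> Hom C E Q" and c: "c \<in> Hom C \<one> W"
  shows "(f \<otimes> idn W) \<cdot> (idn E \<otimes> c) = (idn Q \<otimes> c) \<cdot> f"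
  using tensor_split_right[OF f c] tensor_split_left[OF f c] unit_Arr_right[OF Hom_Arr[OF f]] by simp

lemma coev_id_slide:
  assumes f: "f \<in> Hom C E Q" and c: "c \<in> Hom C \<one> W"
  shows "(idn W \<otimes> f) \<cdot> (c \<otimes> idn E) = (c \<otimes> idn Q) \<cdot> f"
  using tensor_split_right[OF c f] tensor_split_left[OF c f] unit_Arr_left[OF Hom_Arr[OF f]] by simp

lemma ev_id_slide:
  assumes f: "f \<in> Hom C E Q" and e: "e \<in> Hom C W \<one>"
  shows "(e \<otimes> idn Q) \<cdot> (idn W \<otimes> f) = f \<cdot> (e \<otimes> idn E)"
  using tensor_split_right[OF e f] tensor_split_left[OF e f] unit_Arr_left[OF Hom_Arr[OF f]] by simp

context
  fixes X Y e c
  assumes X: "X \<in> Obj C" and dual: "is_left_dual C X Y e c"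
begin

lemma dual_facts:
  shows "Y \<in> Obj C" "e \<in> Hom C (Y \<boxtimes> X) \<one>" "c \<in> Hom C \<one> (X \<boxtimes> Y)"
    "(idn X \<otimes> e) \<cdot> (c \<otimes> idn X) = idn X" "(e \<otimes> idn Y) \<cdot> (idn Y \<otimes> c) = idn Y"
  using dual unfolding is_left_dual_def by simp_all

lemma uncurry_dual_Hom:
  assumes Q: "Q \<in> Obj C" and p: "p \<in> Hom C E (Q \<boxtimes> Y)"
  shows "uncurry_dual e X Q p \<in> Hom C (E \<boxtimes> X) Q"
proof -
  have "p \<otimes> idn X \<in> Hom C (E \<boxtimes> X) (Q \<boxtimes> (Y \<boxtimes> X))"
    using tensor_id_Hom[OF X p] assoc_Obj[OF Q dual_facts(1) X] by simp
  then show ?thesis unfolding uncurry_dual_def by (rule comp_Hom[OF _ id_tensor_ev_Hom[OF Q dual_facts(2)]])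
qed

lemma curry_dual_Hom:
  assumes E: "E \<in> Obj C" and q: "q \<in> Hom C (E \<boxtimes> X) Q"
  shows "curry_dual c Y E q \<in> Hom C E (Q \<boxtimes> Y)"
proof -
  have "q \<otimes> idn Y \<in> Hom C (E \<boxtimes> (X \<boxtimes> Y)) (Q \<boxtimes> Y)"
    using tensor_id_Hom[OF dual_facts(1) q] assoc_Obj[OF E X dual_facts(1)] by simp
  then show ?thesis unfolding curry_dual_def by (rule comp_Hom[OF id_tensor_coev_Hom[OF E dual_facts(3)]])
qed

text \<open>The interchange law slides \<open>q\<close> past the evaluation; what then remains on
  the tensor factor \<open>X\<close> is a zig-zag identity.\<close>

lemma uncurry_curry_dual:
  assumes E: "E \<in> Obj C" and q: "q \<in> Hom C (E \<boxtimes> X) Q"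
  shows "uncurry_dual e X Q (curry_dual c Y E q) = q"
proof -
  note Y = dual_facts(1) and e = dual_facts(2) and c = dual_facts(3)
  note Q = Hom_Obj(2)[OF q]
  have qY: "q \<otimes> idn Y \<in> Hom C (E \<boxtimes> (X \<boxtimes> Y)) (Q \<boxtimes> Y)"
    using tensor_id_Hom[OF Y q] assoc_Obj[OF E X Y] by simp
  have Ec: "idn E \<otimes> c \<in> Hom C E (E \<boxtimes> (X \<boxtimes> Y))" by (rule id_tensor_coev_Hom[OF E c])
  have cX: "c \<otimes> idn X \<in> Hom C X (X \<boxtimes> (Y \<boxtimes> X))"
    using coev_tensor_id_Hom[OF X c] assoc_Obj[OF X Y X] by simp
  have EcX: "idn E \<otimes> (c \<otimes> idn X) \<in> Hom C (E \<boxtimes> X) (E \<boxtimes> X \<boxtimes> (Y \<boxtimes> X))"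
    using id_tensor_Hom[OF E cX] assoc_Obj[OF E X tensor_Obj[OF Y X]] by simp
  have qYX: "q \<otimes> idn (Y \<boxtimes> X) \<in> Hom C (E \<boxtimes> X \<boxtimes> (Y \<boxtimes> X)) (Q \<boxtimes> (Y \<boxtimes> X))"
    by (rule tensor_id_Hom[OF tensor_Obj[OF Y X] q])
  note Qe = id_tensor_ev_Hom[OF Q e]
  have "uncurry_dual e X Q (curry_dual c Y E q)
      = (idn Q \<otimes> e) \<cdot> ((q \<otimes> idn (Y \<boxtimes> X)) \<cdot> (idn E \<otimes> (c \<otimes> idn X)))"
    unfolding uncurry_dual_def curry_dual_def comp_tensor_id[OF Ec qY X] tensor_id_id[OF Y X Hom_Arr[OF q]]
      assoc_Arr[OF id_Arr[OF E] Hom_Arr[OF c] id_Arr[OF X]] ..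
  also have "\<dots> = (idn Q \<otimes> e) \<cdot> (q \<otimes> idn (Y \<boxtimes> X)) \<cdot> (idn E \<otimes> (c \<otimes> idn X))"
    by (rule comp_assoc[OF EcX qYX Qe])
  also have "(idn Q \<otimes> e) \<cdot> (q \<otimes> idn (Y \<boxtimes> X)) = q \<cdot> (idn (E \<boxtimes> X) \<otimes> e)" by (rule id_ev_slide[OF q e])
  also have "\<dots> \<cdot> (idn E \<otimes> (c \<otimes> idn X)) = q \<cdot> ((idn (E \<boxtimes> X) \<otimes> e) \<cdot> (idn E \<otimes> (c \<otimes> idn X)))"
    by (rule comp_assoc[symmetric, OF EcX id_tensor_ev_Hom[OF tensor_Obj[OF E X] e] q])
  also have "(idn (E \<boxtimes> X) \<otimes> e) \<cdot> (idn E \<otimes> (c \<otimes> idn X)) = idn E \<otimes> idn X"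
    unfolding id_id_tensor[OF E X Hom_Arr[OF e], symmetric]
      id_tensor_comp[OF cX id_tensor_ev_Hom[OF X e] E, symmetric] dual_facts(4) ..
  finally show ?thesis unfolding tensor_id[OF E X] comp_id[OF q] .
qed

lemma curry_uncurry_dual:
  assumes Q: "Q \<in> Obj C" and p: "p \<in> Hom C E (Q \<boxtimes> Y)"
  shows "curry_dual c Y E (uncurry_dual e X Q p) = p"
proof -
  note Y = dual_facts(1) and e = dual_facts(2) and c = dual_facts(3)
  note E = Hom_Obj(1)[OF p]
  note QY = tensor_Obj[OF Q Y]
  have pX: "p \<otimes> idn X \<in> Hom C (E \<boxtimes> X) (Q \<boxtimes> (Y \<boxtimes> X))"
    using tensor_id_Hom[OF X p] assoc_Obj[OF Q Y X] by simp
  note Qe = id_tensor_ev_Hom[OF Q e]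
  have pXY: "p \<otimes> idn (X \<boxtimes> Y) \<in> Hom C (E \<boxtimes> (X \<boxtimes> Y)) (Q \<boxtimes> (Y \<boxtimes> X \<boxtimes> Y))"
    using tensor_id_Hom[OF tensor_Obj[OF X Y] p] assoc_Obj[OF Q Y tensor_Obj[OF X Y]] assoc_Obj[OF Y X Y] by simp
  have eY: "e \<otimes> idn Y \<in> Hom C (Y \<boxtimes> X \<boxtimes> Y) Y" by (rule ev_tensor_id_Hom[OF Y e])
  have Yc: "idn Y \<otimes> c \<in> Hom C Y (Y \<boxtimes> X \<boxtimes> Y)"
    using id_tensor_coev_Hom[OF Y c] assoc_Obj[OF Y X Y] by simp
  have QeY: "idn Q \<otimes> (e \<otimes> idn Y) \<in> Hom C (Q \<boxtimes> (Y \<boxtimes> X \<boxtimes> Y)) (Q \<boxtimes> Y)" by (rule id_tensor_Hom[OF Q eY])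
  have Ec: "idn E \<otimes> c \<in> Hom C E (E \<boxtimes> (X \<boxtimes> Y))" by (rule id_tensor_coev_Hom[OF E c])
  have QYc: "idn (Q \<boxtimes> Y) \<otimes> c \<in> Hom C (Q \<boxtimes> Y) (Q \<boxtimes> (Y \<boxtimes> X \<boxtimes> Y))"
    using id_tensor_coev_Hom[OF QY c] assoc_Obj[OF Q Y tensor_Obj[OF X Y]] assoc_Obj[OF Y X Y] by simp
  have "curry_dual c Y E (uncurry_dual e X Q p)
      = (idn Q \<otimes> (e \<otimes> idn Y)) \<cdot> (p \<otimes> idn (X \<boxtimes> Y)) \<cdot> (idn E \<otimes> c)"
    unfolding uncurry_dual_def curry_dual_def comp_tensor_id[OF pX Qe Y] tensor_id_id[OF X Y Hom_Arr[OF p]]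
      assoc_Arr[OF id_Arr[OF Q] Hom_Arr[OF e] id_Arr[OF Y]] ..
  also have "\<dots> = (idn Q \<otimes> (e \<otimes> idn Y)) \<cdot> ((p \<otimes> idn (X \<boxtimes> Y)) \<cdot> (idn E \<otimes> c))"
    by (rule comp_assoc[symmetric, OF Ec pXY QeY])
  also have "(p \<otimes> idn (X \<boxtimes> Y)) \<cdot> (idn E \<otimes> c) = (idn (Q \<boxtimes> Y) \<otimes> c) \<cdot> p" by (rule id_coev_slide[OF p c])
  also have "(idn Q \<otimes> (e \<otimes> idn Y)) \<cdot> ((idn (Q \<boxtimes> Y) \<otimes> c) \<cdot> p) = (idn Q \<otimes> (e \<otimes> idn Y)) \<cdot> (idn (Q \<boxtimes> Y) \<otimes> c) \<cdot> p"
    by (rule comp_assoc[OF p QYc QeY])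
  also have "(idn Q \<otimes> (e \<otimes> idn Y)) \<cdot> (idn (Q \<boxtimes> Y) \<otimes> c) = idn Q \<otimes> idn Y"
    unfolding id_id_tensor[OF Q Y Hom_Arr[OF c], symmetric] id_tensor_comp[OF Yc eY Q, symmetric] dual_facts(5) ..
  finally show ?thesis unfolding tensor_id[OF Q Y] id_comp[OF p] .
qed

lemma uncurry_dual_inj:
  assumes Q: "Q \<in> Obj C" and p: "p \<in> Hom C E (Q \<boxtimes> Y)" "p' \<in> Hom C E (Q \<boxtimes> Y)"
    and eq: "uncurry_dual e X Q p = uncurry_dual e X Q p'"
  shows "p = p'"
  using curry_uncurry_dual[OF Q p(1)] curry_uncurry_dual[OF Q p(2)] unfolding eq by (rule trans[OF sym])

lemma uncurry_dual_comp_left: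
  assumes f: "f \<in> Hom C Q Q'" and p: "p \<in> Hom C E (Q \<boxtimes> Y)"
  shows "uncurry_dual e X Q' ((f \<otimes> idn Y) \<cdot> p) = f \<cdot> uncurry_dual e X Q p"
proof -
  note Y = dual_facts(1) and e = dual_facts(2)
  note Q = Hom_Obj(1)[OF f] and Q' = Hom_Obj(2)[OF f]
  have pX: "p \<otimes> idn X \<in> Hom C (E \<boxtimes> X) (Q \<boxtimes> (Y \<boxtimes> X))"
    using tensor_id_Hom[OF X p] assoc_Obj[OF Q Y X] by simp
  have fYX: "f \<otimes> idn (Y \<boxtimes> X) \<in> Hom C (Q \<boxtimes> (Y \<boxtimes> X)) (Q' \<boxtimes> (Y \<boxtimes> X))"
    by (rule tensor_id_Hom[OF tensor_Obj[OF Y X] f])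
  have "uncurry_dual e X Q' ((f \<otimes> idn Y) \<cdot> p) = (idn Q' \<otimes> e) \<cdot> ((f \<otimes> idn (Y \<boxtimes> X)) \<cdot> (p \<otimes> idn X))"
    unfolding uncurry_dual_def comp_tensor_id[OF p tensor_id_Hom[OF Y f] X] tensor_id_id[OF Y X Hom_Arr[OF f]] ..
  also have "\<dots> = (idn Q' \<otimes> e) \<cdot> (f \<otimes> idn (Y \<boxtimes> X)) \<cdot> (p \<otimes> idn X)"
    by (rule comp_assoc[OF pX fYX id_tensor_ev_Hom[OF Q' e]])
  also have "\<dots> = f \<cdot> (idn Q \<otimes> e) \<cdot> (p \<otimes> idn X)" unfolding id_ev_slide[OF f e] ..
  also have "\<dots> = f \<cdot> uncurry_dual e X Q p" unfolding uncurry_dual_def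
    by (rule comp_assoc[symmetric, OF pX id_tensor_ev_Hom[OF Q e] f])
  finally show ?thesis .
qed

lemma uncurry_dual_comp_right:
  assumes Q: "Q \<in> Obj C" and u: "u \<in> Hom C E' E" and p: "p \<in> Hom C E (Q \<boxtimes> Y)"
  shows "uncurry_dual e X Q (p \<cdot> u) = uncurry_dual e X Q p \<cdot> (u \<otimes> idn X)"
proof -
  note Y = dual_facts(1) and e = dual_facts(2)
  have pX: "p \<otimes> idn X \<in> Hom C (E \<boxtimes> X) (Q \<boxtimes> (Y \<boxtimes> X))"
    using tensor_id_Hom[OF X p] assoc_Obj[OF Q Y X] by simp
  show ?thesis unfolding uncurry_dual_def comp_tensor_id[OF u p X]
    by (rule comp_assoc[OF tensor_id_Hom[OF X u] pX id_tensor_ev_Hom[OF Q e]])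
qed

end

text \<open>Under the adjunction, dinatural transformations \<open>E \<rightarrow> X \<boxtimes> V \<boxtimes> X\<^sup>*\<close> become natural
  transformations \<open>E \<boxtimes> X \<rightarrow> X \<boxtimes> V\<close>.\<close>

definition natural_action :: "'o \<Rightarrow> 'o \<Rightarrow> ('o \<Rightarrow> 'm) \<Rightarrow> bool" where
  "natural_action V E t \<longleftrightarrow> E \<in> Obj C \<and> (\<forall>X \<in> Obj C. t X \<in> Hom C (E \<boxtimes> X) (X \<boxtimes> V)) \<and>
    (\<forall>X \<in> Obj C. \<forall>Y \<in> Obj C. \<forall>f \<in> Hom C X Y. (f \<otimes> idn V) \<cdot> t X = t Y \<cdot> (idn E \<otimes> f))"

lemma natural_actionD:
  assumes "natural_action V E t"
  shows "E \<in> Obj C" "X \<in> Obj C \<Longrightarrow> t X \<in> Hom C (E \<boxtimes> X) (X \<boxtimes> V)"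
    "f \<in> Hom C X Y \<Longrightarrow> (f \<otimes> idn V) \<cdot> t X = t Y \<cdot> (idn E \<otimes> f)"
  using assms Hom_Obj[of f X Y] unfolding natural_action_def by blast+

lemma dinaturalD:
  assumes "dinatural C D V E p"
  shows "E \<in> Obj C" "X \<in> Obj C \<Longrightarrow> p X \<in> Hom C E (X \<boxtimes> V \<boxtimes> DObj D X)"
    "f \<in> Hom C X Y \<Longrightarrow> (f \<otimes> idn V \<otimes> idn (DObj D X)) \<cdot> p X = (idn Y \<otimes> idn V \<otimes> dual_arr C D f) \<cdot> p Y"
  using assms Hom_Obj[of f X Y] unfolding dinatural_def by blast+

lemma natural_action_comp:
  assumes V: "V \<in> Obj C" and t: "natural_action V E t" and u: "u \<in> Hom C E' E"
  shows "natural_action V E' (\<lambda>X. t X \<cdot> (u \<otimes> idn X))"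
  unfolding natural_action_def
proof (intro conjI ballI)
  show E': "E' \<in> Obj C" using u by (rule Hom_Obj)
  note E = Hom_Obj(2)[OF u]
  fix X assume X: "X \<in> Obj C"
  show tu: "t X \<cdot> (u \<otimes> idn X) \<in> Hom C (E' \<boxtimes> X) (X \<boxtimes> V)"
    by (rule comp_Hom[OF tensor_id_Hom[OF X u] natural_actionD(2)[OF t X]])
  fix Y f assume Y: "Y \<in> Obj C" and f: "f \<in> Hom C X Y"
  have "(f \<otimes> idn V) \<cdot> (t X \<cdot> (u \<otimes> idn X)) = t Y \<cdot> (idn E \<otimes> f) \<cdot> (u \<otimes> idn X)"
    unfolding comp_assoc[OF tensor_id_Hom[OF X u] natural_actionD(2)[OF t X] tensor_id_Hom[OF V f]]
      natural_actionD(3)[OF t f] ..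
  also have "\<dots> = t Y \<cdot> ((idn E \<otimes> f) \<cdot> (u \<otimes> idn X))"
    by (rule comp_assoc[symmetric, OF tensor_id_Hom[OF X u] id_tensor_Hom[OF E f] natural_actionD(2)[OF t Y]])
  also have "\<dots> = t Y \<cdot> ((u \<otimes> idn Y) \<cdot> (idn E' \<otimes> f))"
    unfolding tensor_split_left[OF u f] tensor_split_right[OF u f] ..
  also have "\<dots> = t Y \<cdot> (u \<otimes> idn Y) \<cdot> (idn E' \<otimes> f)"
    by (rule comp_assoc[OF id_tensor_Hom[OF E' f] tensor_id_Hom[OF Y u] natural_actionD(2)[OF t Y]])
  finally show "(f \<otimes> idn V) \<cdot> (t X \<cdot> (u \<otimes> idn X)) = t Y \<cdot> (u \<otimes> idn Y) \<cdot> (idn E' \<otimes> f)" .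
qed

context
  fixes D
  assumes duality: "is_left_duality C D"
begin

lemma left_dual: "X \<in> Obj C \<Longrightarrow> is_left_dual C X (DObj D X) (Ev D X) (Coev D X)"
  using duality unfolding is_left_duality_def by blast

lemma dual_obj: "X \<in> Obj C \<Longrightarrow> DObj D X \<in> Obj C"
  using dual_facts(1)[OF _ left_dual] .

lemma dual_arr_curry:
  assumes f: "f \<in> Hom C X Y"
  shows "dual_arr C D f = curry_dual (Coev D X) (DObj D X) (DObj D Y) (Ev D Y \<cdot> (idn (DObj D Y) \<otimes> f))"
proof -
  note o = Hom_Obj[OF f] and X = Hom_Obj(1)[OF f] and Y = Hom_Obj(2)[OF f]
  show ?thesis
    unfolding dual_arr_def Let_def Hom_Src_Tgt[OF f] curry_dual_def
      comp_tensor_id[OF id_tensor_Hom[OF dual_obj[OF Y] f] dual_facts(2)[OF Y left_dual[OF Y]] dual_obj[OF X]] ..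
qed

lemma dual_arr_Hom:
  assumes f: "f \<in> Hom C X Y"
  shows "dual_arr C D f \<in> Hom C (DObj D Y) (DObj D X)"
proof -
  note X = Hom_Obj(1)[OF f] and Y = Hom_Obj(2)[OF f]
  have "Ev D Y \<cdot> (idn (DObj D Y) \<otimes> f) \<in> Hom C (DObj D Y \<boxtimes> X) \<one>"
    by (rule comp_Hom[OF id_tensor_Hom[OF dual_obj[OF Y] f] dual_facts(2)[OF Y left_dual[OF Y]]])
  from curry_dual_Hom[OF X left_dual[OF X] dual_obj[OF Y] this]
  show ?thesis unfolding dual_arr_curry[OF f] unit_Obj_left[OF dual_obj[OF X]] .
qed

text \<open>The dual arrow is by definition the curried form of the right-hand side, so the equation
  is \<open>uncurry_curry_dual\<close>.\<close>

lemma ev_dual_arr: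
  assumes f: "f \<in> Hom C X Y"
  shows "Ev D X \<cdot> (dual_arr C D f \<otimes> idn X) = Ev D Y \<cdot> (idn (DObj D Y) \<otimes> f)"
proof -
  note X = Hom_Obj(1)[OF f] and Y = Hom_Obj(2)[OF f]
  have q: "Ev D Y \<cdot> (idn (DObj D Y) \<otimes> f) \<in> Hom C (DObj D Y \<boxtimes> X) \<one>"
    by (rule comp_Hom[OF id_tensor_Hom[OF dual_obj[OF Y] f] dual_facts(2)[OF Y left_dual[OF Y]]])
  have "uncurry_dual (Ev D X) X \<one> (dual_arr C D f) = Ev D Y \<cdot> (idn (DObj D Y) \<otimes> f)"
    unfolding dual_arr_curry[OF f] by (rule uncurry_curry_dual[OF X left_dual[OF X] dual_obj[OF Y] q])
  then show ?thesis
    unfolding uncurry_dual_def unit_Arr_left[OF Hom_Arr[OF dual_facts(2)[OF X left_dual[OF X]]]] .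
qed

text \<open>This is the point where dinaturality becomes naturality: by \<open>ev_dual_arr\<close>,
  a dual arrow applied to the target turns under the adjunction into \<open>f\<close> applied to the
  source.\<close>

lemma uncurry_dual_dual_arr:
  assumes Q: "Q \<in> Obj C" and f: "f \<in> Hom C X Y" and p: "p \<in> Hom C E (Q \<boxtimes> DObj D Y)"
  shows "uncurry_dual (Ev D X) X Q ((idn Q \<otimes> dual_arr C D f) \<cdot> p)
    = uncurry_dual (Ev D Y) Y Q p \<cdot> (idn E \<otimes> f)"
proof -
  note X = Hom_Obj(1)[OF f] and Y = Hom_Obj(2)[OF f] and E = Hom_Obj(1)[OF p]
  note DX = dual_obj[OF X] and DY = dual_obj[OF Y] and df = dual_arr_Hom[OF f]
  note eX = dual_facts(2)[OF X left_dual[OF X]] and eY = dual_facts(2)[OF Y left_dual[OF Y]]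
  have pX: "p \<otimes> idn X \<in> Hom C (E \<boxtimes> X) (Q \<boxtimes> (DObj D Y \<boxtimes> X))"
    using tensor_id_Hom[OF X p] assoc_Obj[OF Q DY X] by simp
  have pY: "p \<otimes> idn Y \<in> Hom C (E \<boxtimes> Y) (Q \<boxtimes> (DObj D Y \<boxtimes> Y))"
    using tensor_id_Hom[OF Y p] assoc_Obj[OF Q DY Y] by simp
  have QdX: "idn Q \<otimes> (dual_arr C D f \<otimes> idn X) \<in> Hom C (Q \<boxtimes> (DObj D Y \<boxtimes> X)) (Q \<boxtimes> (DObj D X \<boxtimes> X))"
    by (rule id_tensor_Hom[OF Q tensor_id_Hom[OF X df]])
  have Qf: "idn Q \<otimes> (idn (DObj D Y) \<otimes> f) \<in> Hom C (Q \<boxtimes> (DObj D Y \<boxtimes> X)) (Q \<boxtimes> (DObj D Y \<boxtimes> Y))"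
    by (rule id_tensor_Hom[OF Q id_tensor_Hom[OF DY f]])
  have "uncurry_dual (Ev D X) X Q ((idn Q \<otimes> dual_arr C D f) \<cdot> p)
      = (idn Q \<otimes> Ev D X) \<cdot> ((idn Q \<otimes> (dual_arr C D f \<otimes> idn X)) \<cdot> (p \<otimes> idn X))"
    unfolding uncurry_dual_def comp_tensor_id[OF p id_tensor_Hom[OF Q df] X]
      assoc_Arr[OF id_Arr[OF Q] Hom_Arr[OF df] id_Arr[OF X]] ..
  also have "\<dots> = (idn Q \<otimes> Ev D X) \<cdot> (idn Q \<otimes> (dual_arr C D f \<otimes> idn X)) \<cdot> (p \<otimes> idn X)"
    by (rule comp_assoc[OF pX QdX id_tensor_ev_Hom[OF Q eX]])
  also have "(idn Q \<otimes> Ev D X) \<cdot> (idn Q \<otimes> (dual_arr C D f \<otimes> idn X))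
      = (idn Q \<otimes> Ev D Y) \<cdot> (idn Q \<otimes> (idn (DObj D Y) \<otimes> f))"
    unfolding id_tensor_comp[OF tensor_id_Hom[OF X df] eX Q, symmetric] ev_dual_arr[OF f]
    by (rule id_tensor_comp[OF id_tensor_Hom[OF DY f] eY Q])
  also have "\<dots> \<cdot> (p \<otimes> idn X) = (idn Q \<otimes> Ev D Y) \<cdot> ((idn Q \<otimes> (idn (DObj D Y) \<otimes> f)) \<cdot> (p \<otimes> idn X))"
    by (rule comp_assoc[symmetric, OF pX Qf id_tensor_ev_Hom[OF Q eY]])
  also have "(idn Q \<otimes> (idn (DObj D Y) \<otimes> f)) \<cdot> (p \<otimes> idn X) = (p \<otimes> idn Y) \<cdot> (idn E \<otimes> f)"
    unfolding id_id_tensor[OF Q DY Hom_Arr[OF f]] tensor_split_right[OF p f] tensor_split_left[OF p f] ..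
  also have "(idn Q \<otimes> Ev D Y) \<cdot> ((p \<otimes> idn Y) \<cdot> (idn E \<otimes> f)) = uncurry_dual (Ev D Y) Y Q p \<cdot> (idn E \<otimes> f)"
    unfolding uncurry_dual_def by (rule comp_assoc[OF id_tensor_Hom[OF E f] pY id_tensor_ev_Hom[OF Q eY]])
  finally show ?thesis .
qed

lemma dinatural_uncurry:
  assumes V: "V \<in> Obj C" and p: "dinatural C D V E p"
  shows "natural_action V E (\<lambda>X. uncurry_dual (Ev D X) X (X \<boxtimes> V) (p X))"
  unfolding natural_action_def
proof (intro conjI ballI)
  show "E \<in> Obj C" by (rule dinaturalD(1)[OF p])
  have p1: "p X \<in> Hom C E (X \<boxtimes> V \<boxtimes> DObj D X)" if "X \<in> Obj C" for X by (rule dinaturalD(2)[OF p that])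
  fix X assume X: "X \<in> Obj C"
  show "uncurry_dual (Ev D X) X (X \<boxtimes> V) (p X) \<in> Hom C (E \<boxtimes> X) (X \<boxtimes> V)"
    by (rule uncurry_dual_Hom[OF X left_dual[OF X] tensor_Obj[OF X V] p1[OF X]])
  fix Y f assume Y: "Y \<in> Obj C" and f: "f \<in> Hom C X Y"
  have "(f \<otimes> idn V \<otimes> idn (DObj D X)) \<cdot> p X = (idn (Y \<boxtimes> V) \<otimes> dual_arr C D f) \<cdot> p Y"
    using dinaturalD(3)[OF p f] unfolding tensor_id[OF Y V] .
  then have "uncurry_dual (Ev D X) X (Y \<boxtimes> V) ((f \<otimes> idn V \<otimes> idn (DObj D X)) \<cdot> p X)
      = uncurry_dual (Ev D X) X (Y \<boxtimes> V) ((idn (Y \<boxtimes> V) \<otimes> dual_arr C D f) \<cdot> p Y)" by simp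
  then show "(f \<otimes> idn V) \<cdot> uncurry_dual (Ev D X) X (X \<boxtimes> V) (p X)
      = uncurry_dual (Ev D Y) Y (Y \<boxtimes> V) (p Y) \<cdot> (idn E \<otimes> f)"
    unfolding uncurry_dual_comp_left[OF X left_dual[OF X] tensor_id_Hom[OF V f] p1[OF X]]
      uncurry_dual_dual_arr[OF tensor_Obj[OF Y V] f p1[OF Y]] .
qed

text \<open>Uncurrying is injective, so dinaturality of the curried family may be checked after
  uncurrying, where it is the naturality of \<open>t\<close>.\<close>

lemma natural_action_curry:
  assumes V: "V \<in> Obj C" and t: "natural_action V E t"
  shows "dinatural C D V E (\<lambda>X. curry_dual (Coev D X) (DObj D X) E (t X))"
  unfolding dinatural_def
proof (intro conjI ballI)
  show E: "E \<in> Obj C" by (rule natural_actionD(1)[OF t])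
  have t1: "t X \<in> Hom C (E \<boxtimes> X) (X \<boxtimes> V)" if "X \<in> Obj C" for X by (rule natural_actionD(2)[OF t that])
  let ?p = "\<lambda>X. curry_dual (Coev D X) (DObj D X) E (t X)"
  have p: "?p X \<in> Hom C E (X \<boxtimes> V \<boxtimes> DObj D X)" if X: "X \<in> Obj C" for X
    by (rule curry_dual_Hom[OF X left_dual[OF X] E t1[OF X]])
  fix X assume X: "X \<in> Obj C"
  show "?p X \<in> Hom C E (X \<boxtimes> V \<boxtimes> DObj D X)" by (rule p[OF X])
  fix Y f assume Y: "Y \<in> Obj C" and f: "f \<in> Hom C X Y"
  note fV = tensor_id_Hom[OF V f]
  show "(f \<otimes> idn V \<otimes> idn (DObj D X)) \<cdot> ?p X = (idn Y \<otimes> idn V \<otimes> dual_arr C D f) \<cdot> ?p Y"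
    unfolding tensor_id[OF Y V]
  proof (rule uncurry_dual_inj[OF X left_dual[OF X] tensor_Obj[OF Y V]])
    show "(f \<otimes> idn V \<otimes> idn (DObj D X)) \<cdot> ?p X \<in> Hom C E (Y \<boxtimes> V \<boxtimes> DObj D X)"
      by (rule comp_Hom[OF p[OF X] tensor_id_Hom[OF dual_obj[OF X] fV]])
    show "(idn (Y \<boxtimes> V) \<otimes> dual_arr C D f) \<cdot> ?p Y \<in> Hom C E (Y \<boxtimes> V \<boxtimes> DObj D X)"
      by (rule comp_Hom[OF p[OF Y] id_tensor_Hom[OF tensor_Obj[OF Y V] dual_arr_Hom[OF f]]])
    have "(f \<otimes> idn V) \<cdot> t X = t Y \<cdot> (idn E \<otimes> f)" by (rule natural_actionD(3)[OF t f])
    then show "uncurry_dual (Ev D X) X (Y \<boxtimes> V) ((f \<otimes> idn V \<otimes> idn (DObj D X)) \<cdot> ?p X)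
        = uncurry_dual (Ev D X) X (Y \<boxtimes> V) ((idn (Y \<boxtimes> V) \<otimes> dual_arr C D f) \<cdot> ?p Y)"
      unfolding uncurry_dual_comp_left[OF X left_dual[OF X] fV p[OF X]]
        uncurry_dual_dual_arr[OF tensor_Obj[OF Y V] f p[OF Y]]
        uncurry_curry_dual[OF X left_dual[OF X] E t1[OF X]] uncurry_curry_dual[OF Y left_dual[OF Y] E t1[OF Y]] .
  qed
qed

end

section \<open>The central comonad and its integrals in terms of natural actions\<close>

context
  fixes D Z \<pi>
  assumes duality: "is_left_duality C D" and comonad: "central_comonad C D Z \<pi>"
begin

text \<open>The universal dinatural transformation, uncurried. In this form \<open>Z V\<close>
  represents natural actions: an arrow \<open>E \<rightarrow> Z V\<close> is the same as a natural
  family \<open>E \<boxtimes> X \<rightarrow> X \<boxtimes> V\<close>.\<close>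

definition Z_action :: "'o \<Rightarrow> 'o \<Rightarrow> 'm" where
  "Z_action V X = uncurry_dual (Ev D X) X (X \<boxtimes> V) (\<pi> V X)"

lemma Z_end:
  assumes "V \<in> Obj C"
  shows "is_end C D V (Z V) (\<pi> V)"
  using comonad assms unfolding central_comonad_def by blast

lemma Z_dinatural: "V \<in> Obj C \<Longrightarrow> dinatural C D V (Z V) (\<pi> V)"
  using Z_end unfolding is_end_def by blast

lemma Z_action_natural:
  assumes V: "V \<in> Obj C"
  shows "natural_action V (Z V) (Z_action V)"
  unfolding Z_action_def by (rule dinatural_uncurry[OF duality V Z_dinatural[OF V]])

lemmas Z_Obj = natural_actionD(1)[OF Z_action_natural]
lemmas Z_action_Hom = natural_actionD(2)[OF Z_action_natural]
lemmas \<pi>_Hom = dinaturalD(2)[OF Z_dinatural]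

lemma Z_action_comp:
  assumes V: "V \<in> Obj C" and X: "X \<in> Obj C" and u: "u \<in> Hom C E (Z V)"
  shows "uncurry_dual (Ev D X) X (X \<boxtimes> V) (\<pi> V X \<cdot> u) = Z_action V X \<cdot> (u \<otimes> idn X)"
  unfolding Z_action_def
  by (rule uncurry_dual_comp_right[OF X left_dual[OF duality X] tensor_Obj[OF X V] u \<pi>_Hom[OF V X]])

lemma Z_action_universal:
  assumes V: "V \<in> Obj C" and t: "natural_action V E t"
  shows "\<exists>u \<in> Hom C E (Z V). \<forall>X \<in> Obj C. Z_action V X \<cdot> (u \<otimes> idn X) = t X"
proof -
  let ?p = "\<lambda>X. curry_dual (Coev D X) (DObj D X) E (t X)"
  have "dinatural C D V E ?p" by (rule natural_action_curry[OF duality V t])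
  then obtain u where u: "u \<in> Hom C E (Z V)" "\<forall>X \<in> Obj C. \<pi> V X \<cdot> u = ?p X"
    using Z_end[OF V] unfolding is_end_def by blast
  have "Z_action V X \<cdot> (u \<otimes> idn X) = t X" if X: "X \<in> Obj C" for X
    unfolding Z_action_comp[OF V X u(1), symmetric] bspec[OF u(2) X]
    by (rule uncurry_curry_dual[OF X left_dual[OF duality X] natural_actionD(1)[OF t] natural_actionD(2)[OF t X]])
  then show ?thesis using u(1) by blast
qed

lemma Z_action_unique:
  assumes V: "V \<in> Obj C" and u: "u \<in> Hom C E (Z V)" and u': "u' \<in> Hom C E (Z V)"
    and eq: "\<And>X. X \<in> Obj C \<Longrightarrow> Z_action V X \<cdot> (u \<otimes> idn X) = Z_action V X \<cdot> (u' \<otimes> idn X)"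
  shows "u = u'"
proof -
  define t where "t = (\<lambda>X. Z_action V X \<cdot> (u \<otimes> idn X))"
  have t: "natural_action V E t" unfolding t_def by (rule natural_action_comp[OF V Z_action_natural[OF V] u])
  let ?p = "\<lambda>X. curry_dual (Coev D X) (DObj D X) E (t X)"
  have p: "\<pi> V X \<cdot> v = ?p X"
    if X: "X \<in> Obj C" and v: "v \<in> Hom C E (Z V)" and vt: "Z_action V X \<cdot> (v \<otimes> idn X) = t X" for X v
    using curry_uncurry_dual[OF X left_dual[OF duality X] tensor_Obj[OF X V] comp_Hom[OF v \<pi>_Hom[OF V X]]]
    unfolding Z_action_comp[OF V X v] vt by (rule sym)
  have "dinatural C D V E ?p" by (rule natural_action_curry[OF duality V t])
  then have ex1: "\<exists>!u. u \<in> Hom C E (Z V) \<and> (\<forall>X \<in> Obj C. \<pi> V X \<cdot> u = ?p X)"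
    using Z_end[OF V] unfolding is_end_def by blast
  have "\<forall>X \<in> Obj C. \<pi> V X \<cdot> u = ?p X" by (intro ballI p[OF _ u]) (simp_all add: t_def)
  moreover have "\<forall>X \<in> Obj C. \<pi> V X \<cdot> u' = ?p X" by (intro ballI p[OF _ u']) (simp_all add: t_def eq)
  ultimately show ?thesis using ex1 u u' by blast
qed

text \<open>In terms of actions the multiplication is composition: \<open>Z W\<close> acts first and
  \<open>Z V\<close> acts on the result. This composite is natural, hence induced by an arrow
  \<open>u\<close>, and \<open>u\<close> is shown to satisfy the definite description of
  \<open>mult_Z\<close>.\<close>

lemma mult_Z:
  assumes V: "V \<in> Obj C" and W: "W \<in> Obj C"
  shows "mult_Z C D Z \<pi> V W \<in> Hom C (Z V \<boxtimes> Z W) (Z (V \<boxtimes> W))"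
    "X \<in> Obj C \<Longrightarrow> Z_action (V \<boxtimes> W) X \<cdot> (mult_Z C D Z \<pi> V W \<otimes> idn X)
      = (Z_action V X \<otimes> idn W) \<cdot> (idn (Z V) \<otimes> Z_action W X)"
proof -
  define t where "t = (\<lambda>X. (Z_action V X \<otimes> idn W) \<cdot> (idn (Z V) \<otimes> Z_action W X))"
  note ZV = Z_Obj[OF V] and ZW = Z_Obj[OF W]
  note VW = tensor_Obj[OF V W] and ZZ = tensor_Obj[OF ZV ZW]
  have aV: "Z_action V X \<otimes> idn W \<in> Hom C (Z V \<boxtimes> (X \<boxtimes> W)) (X \<boxtimes> (V \<boxtimes> W))" if X: "X \<in> Obj C" for X
    using tensor_id_Hom[OF W Z_action_Hom[OF V X]] unfolding assoc_Obj[OF ZV X W] assoc_Obj[OF X V W] .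
  have aW: "idn (Z V) \<otimes> Z_action W X \<in> Hom C (Z V \<boxtimes> Z W \<boxtimes> X) (Z V \<boxtimes> (X \<boxtimes> W))" if X: "X \<in> Obj C" for X
    using id_tensor_Hom[OF ZV Z_action_Hom[OF W X]] unfolding assoc_Obj[OF ZV ZW X] .
  have tH: "t X \<in> Hom C (Z V \<boxtimes> Z W \<boxtimes> X) (X \<boxtimes> (V \<boxtimes> W))" if X: "X \<in> Obj C" for X
    unfolding t_def by (rule comp_Hom[OF aW[OF X] aV[OF X]])
  have t: "natural_action (V \<boxtimes> W) (Z V \<boxtimes> Z W) t"
    unfolding natural_action_def
  proof (intro conjI ballI ZZ tH)
    fix X Y f assume X: "X \<in> Obj C" and Y: "Y \<in> Obj C" and f: "f \<in> Hom C X Y"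
    have fVW: "f \<otimes> idn (V \<boxtimes> W) \<in> Hom C (X \<boxtimes> (V \<boxtimes> W)) (Y \<boxtimes> (V \<boxtimes> W))" by (rule tensor_id_Hom[OF VW f])
    have ZfW: "idn (Z V) \<otimes> (f \<otimes> idn W) \<in> Hom C (Z V \<boxtimes> (X \<boxtimes> W)) (Z V \<boxtimes> (Y \<boxtimes> W))"
      by (rule id_tensor_Hom[OF ZV tensor_id_Hom[OF W f]])
    have ZZf: "idn (Z V \<boxtimes> Z W) \<otimes> f \<in> Hom C (Z V \<boxtimes> Z W \<boxtimes> X) (Z V \<boxtimes> Z W \<boxtimes> Y)" by (rule id_tensor_Hom[OF ZZ f])
    have "(f \<otimes> idn (V \<boxtimes> W)) \<cdot> t X = (f \<otimes> idn (V \<boxtimes> W)) \<cdot> (Z_action V X \<otimes> idn W) \<cdot> (idn (Z V) \<otimes> Z_action W X)"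
      unfolding t_def by (rule comp_assoc[OF aW[OF X] aV[OF X] fVW])
    also have "(f \<otimes> idn (V \<boxtimes> W)) \<cdot> (Z_action V X \<otimes> idn W) = (Z_action V Y \<otimes> idn W) \<cdot> (idn (Z V) \<otimes> (f \<otimes> idn W))"
      unfolding tensor_id_id[OF V W Hom_Arr[OF f], symmetric] assoc_Arr[OF id_Arr[OF ZV] Hom_Arr[OF f] id_Arr[OF W], symmetric]
        comp_tensor_id[OF Z_action_Hom[OF V X] tensor_id_Hom[OF V f] W, symmetric]
        comp_tensor_id[OF id_tensor_Hom[OF ZV f] Z_action_Hom[OF V Y] W, symmetric]
        natural_actionD(3)[OF Z_action_natural[OF V] f] ..
    also have "\<dots> \<cdot> (idn (Z V) \<otimes> Z_action W X) = (Z_action V Y \<otimes> idn W) \<cdot> ((idn (Z V) \<otimes> (f \<otimes> idn W)) \<cdot> (idn (Z V) \<otimes> Z_action W X))"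
      by (rule comp_assoc[symmetric, OF aW[OF X] ZfW aV[OF Y]])
    also have "(idn (Z V) \<otimes> (f \<otimes> idn W)) \<cdot> (idn (Z V) \<otimes> Z_action W X) = (idn (Z V) \<otimes> Z_action W Y) \<cdot> (idn (Z V \<boxtimes> Z W) \<otimes> f)"
      unfolding id_id_tensor[OF ZV ZW Hom_Arr[OF f], symmetric]
        id_tensor_comp[OF Z_action_Hom[OF W X] tensor_id_Hom[OF W f] ZV, symmetric]
        id_tensor_comp[OF id_tensor_Hom[OF ZW f] Z_action_Hom[OF W Y] ZV, symmetric]
        natural_actionD(3)[OF Z_action_natural[OF W] f] ..
    also have "(Z_action V Y \<otimes> idn W) \<cdot> \<dots> = t Y \<cdot> (idn (Z V \<boxtimes> Z W) \<otimes> f)"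
      unfolding t_def by (rule comp_assoc[OF ZZf aW[OF Y] aV[OF Y]])
    finally show "(f \<otimes> idn (V \<boxtimes> W)) \<cdot> t X = t Y \<cdot> (idn (Z V \<boxtimes> Z W) \<otimes> f)" .
  qed
  obtain u where u: "u \<in> Hom C (Z V \<boxtimes> Z W) (Z (V \<boxtimes> W))"
    and ut: "\<And>X. X \<in> Obj C \<Longrightarrow> Z_action (V \<boxtimes> W) X \<cdot> (u \<otimes> idn X) = t X"
    using Z_action_universal[OF VW t] by blast
  let ?rhs = "\<lambda>X. (idn X \<otimes> idn V \<otimes> Ev D X \<otimes> idn W \<otimes> idn (DObj D X)) \<cdot> (\<pi> V X \<otimes> \<pi> W X)"
  \<comment> \<open>The single evaluation in the defining formula is the one that uncurries
    \<open>\<pi> V X\<close>; the remaining \<open>\<pi> W X\<close> is recovered from its action by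
    the final currying.\<close>
  have rhs: "?rhs X = curry_dual (Coev D X) (DObj D X) (Z V \<boxtimes> Z W) (t X)" if X: "X \<in> Obj C" for X
  proof -
    let ?D = "DObj D X" and ?c = "Coev D X" and ?e = "Ev D X"
    note dX = left_dual[OF duality X]
    note DX = dual_facts(1)[OF X dX] and e = dual_facts(2)[OF X dX] and c = dual_facts(3)[OF X dX]
    note XV = tensor_Obj[OF X V] and WD = tensor_Obj[OF W DX]
    have \<pi>V: "\<pi> V X \<in> Hom C (Z V) (X \<boxtimes> V \<boxtimes> ?D)" by (rule \<pi>_Hom[OF V X])
    have \<pi>W: "\<pi> W X \<in> Hom C (Z W) (X \<boxtimes> (W \<boxtimes> ?D))" using \<pi>_Hom[OF W X] unfolding assoc_Obj[OF X W DX] .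
    have aVD: "Z_action V X \<otimes> idn (W \<boxtimes> ?D) \<in> Hom C (Z V \<boxtimes> X \<boxtimes> (W \<boxtimes> ?D)) (X \<boxtimes> V \<boxtimes> (W \<boxtimes> ?D))"
      by (rule tensor_id_Hom[OF WD Z_action_Hom[OF V X]])
    have Zc: "idn (Z W) \<otimes> ?c \<in> Hom C (Z W) (Z W \<boxtimes> X \<boxtimes> ?D)"
      using id_tensor_coev_Hom[OF ZW c] unfolding assoc_Obj[OF ZW X DX, symmetric] .
    have aWD: "Z_action W X \<otimes> idn ?D \<in> Hom C (Z W \<boxtimes> X \<boxtimes> ?D) (X \<boxtimes> W \<boxtimes> ?D)"
      by (rule tensor_id_Hom[OF DX Z_action_Hom[OF W X]])
    have ZaWD: "idn (Z V) \<otimes> (Z_action W X \<otimes> idn ?D) \<in> Hom C (Z V \<boxtimes> (Z W \<boxtimes> X \<boxtimes> ?D)) (Z V \<boxtimes> X \<boxtimes> (W \<boxtimes> ?D))"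
      using id_tensor_Hom[OF ZV aWD] unfolding assoc_Obj[OF X W DX] assoc_Obj[OF ZV X WD] .
    have ZZc: "idn (Z V) \<otimes> (idn (Z W) \<otimes> ?c) \<in> Hom C (Z V \<boxtimes> Z W) (Z V \<boxtimes> (Z W \<boxtimes> X \<boxtimes> ?D))"
      by (rule id_tensor_Hom[OF ZV Zc])
    have "curry_dual ?c ?D (Z V \<boxtimes> Z W) (t X)
        = (Z_action V X \<otimes> idn (W \<boxtimes> ?D)) \<cdot> (idn (Z V) \<otimes> (Z_action W X \<otimes> idn ?D)) \<cdot> (idn (Z V) \<otimes> (idn (Z W) \<otimes> ?c))"
      unfolding curry_dual_def t_def comp_tensor_id[OF aW[OF X] aV[OF X] DX]
        tensor_id_id[OF W DX Hom_Arr[OF Z_action_Hom[OF V X]]]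
        assoc_Arr[OF id_Arr[OF ZV] Hom_Arr[OF Z_action_Hom[OF W X]] id_Arr[OF DX]]
        id_id_tensor[OF ZV ZW Hom_Arr[OF c]] ..
    also have "\<dots> = (Z_action V X \<otimes> idn (W \<boxtimes> ?D)) \<cdot> ((idn (Z V) \<otimes> (Z_action W X \<otimes> idn ?D)) \<cdot> (idn (Z V) \<otimes> (idn (Z W) \<otimes> ?c)))"
      by (rule comp_assoc[symmetric, OF ZZc ZaWD aVD])
    also have "(idn (Z V) \<otimes> (Z_action W X \<otimes> idn ?D)) \<cdot> (idn (Z V) \<otimes> (idn (Z W) \<otimes> ?c)) = idn (Z V) \<otimes> \<pi> W X"
      unfolding id_tensor_comp[OF Zc aWD ZV, symmetric]
      using curry_uncurry_dual[OF X dX tensor_Obj[OF X W] \<pi>_Hom[OF W X]]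
      unfolding curry_dual_def Z_action_def by simp
    also have "Z_action V X \<otimes> idn (W \<boxtimes> ?D)
        = (idn (X \<boxtimes> V) \<otimes> ?e \<otimes> idn (W \<boxtimes> ?D)) \<cdot> (\<pi> V X \<otimes> idn (X \<boxtimes> (W \<boxtimes> ?D)))"
    proof -
      have "\<pi> V X \<otimes> idn X \<in> Hom C (Z V \<boxtimes> X) (X \<boxtimes> V \<boxtimes> (?D \<boxtimes> X))"
        using tensor_id_Hom[OF X \<pi>V] unfolding assoc_Obj[OF XV DX X] .
      then show ?thesis
        unfolding Z_action_def uncurry_dual_def tensor_id_id[OF X WD Hom_Arr[OF \<pi>V], symmetric]
        by (rule comp_tensor_id[OF _ id_tensor_ev_Hom[OF XV e] WD])
    qed
    also have "\<dots> \<cdot> (idn (Z V) \<otimes> \<pi> W X)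
        = (idn (X \<boxtimes> V) \<otimes> ?e \<otimes> idn (W \<boxtimes> ?D)) \<cdot> ((\<pi> V X \<otimes> idn (X \<boxtimes> (W \<boxtimes> ?D))) \<cdot> (idn (Z V) \<otimes> \<pi> W X))"
    proof (rule comp_assoc[symmetric, OF id_tensor_Hom[OF ZV \<pi>W] tensor_id_Hom[OF tensor_Obj[OF X WD] \<pi>V]])
      have "X \<boxtimes> V \<boxtimes> ?D \<boxtimes> (X \<boxtimes> (W \<boxtimes> ?D)) = X \<boxtimes> V \<boxtimes> (?D \<boxtimes> X) \<boxtimes> (W \<boxtimes> ?D)"
        by (simp add: assoc_Obj X V DX W WD XV tensor_Obj)
      then show "idn (X \<boxtimes> V) \<otimes> ?e \<otimes> idn (W \<boxtimes> ?D) \<in> Hom C (X \<boxtimes> V \<boxtimes> ?D \<boxtimes> (X \<boxtimes> (W \<boxtimes> ?D))) (X \<boxtimes> V \<boxtimes> (W \<boxtimes> ?D))"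
        using tensor_id_Hom[OF WD id_tensor_ev_Hom[OF XV e]] by simp
    qed
    also have "(\<pi> V X \<otimes> idn (X \<boxtimes> (W \<boxtimes> ?D))) \<cdot> (idn (Z V) \<otimes> \<pi> W X) = \<pi> V X \<otimes> \<pi> W X"
      by (rule tensor_split_left[OF \<pi>V \<pi>W])
    also have "idn (X \<boxtimes> V) \<otimes> ?e \<otimes> idn (W \<boxtimes> ?D) = idn X \<otimes> idn V \<otimes> ?e \<otimes> idn W \<otimes> idn ?D"
      unfolding tensor_id[OF X V]
      by (rule tensor_id_id[symmetric, OF W DX Hom_Arr[OF id_tensor_ev_Hom[OF XV e]]])
    finally show ?thesis by (rule sym)
  qed
  have eq: "\<pi> (V \<boxtimes> W) X \<cdot> v = ?rhs X \<longleftrightarrow> Z_action (V \<boxtimes> W) X \<cdot> (v \<otimes> idn X) = t X"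
    if X: "X \<in> Obj C" and v: "v \<in> Hom C (Z V \<boxtimes> Z W) (Z (V \<boxtimes> W))" for X v
  proof -
    note dX = left_dual[OF duality X]
    have "Z_action (V \<boxtimes> W) X \<cdot> (v \<otimes> idn X) = uncurry_dual (Ev D X) X (X \<boxtimes> (V \<boxtimes> W)) (\<pi> (V \<boxtimes> W) X \<cdot> v)"
      by (rule Z_action_comp[OF VW X v, symmetric])
    moreover have "t X = uncurry_dual (Ev D X) X (X \<boxtimes> (V \<boxtimes> W)) (?rhs X)"
      unfolding rhs[OF X] by (rule uncurry_curry_dual[symmetric, OF X dX ZZ tH[OF X]])
    moreover have "?rhs X \<in> Hom C (Z V \<boxtimes> Z W) (X \<boxtimes> (V \<boxtimes> W) \<boxtimes> DObj D X)"
      unfolding rhs[OF X] by (rule curry_dual_Hom[OF X dX ZZ tH[OF X]])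
    ultimately show ?thesis
      using uncurry_dual_inj[OF X dX tensor_Obj[OF X VW] comp_Hom[OF v \<pi>_Hom[OF VW X]]] by auto
  qed
  have "mult_Z C D Z \<pi> V W = u"
    unfolding mult_Z_def
  proof (rule the_equality)
    show "u \<in> Hom C (Z V \<boxtimes> Z W) (Z (V \<boxtimes> W)) \<and> (\<forall>X \<in> Obj C. \<pi> (V \<boxtimes> W) X \<cdot> u = ?rhs X)"
      using u ut eq[OF _ u] by blast
    fix v assume v: "v \<in> Hom C (Z V \<boxtimes> Z W) (Z (V \<boxtimes> W)) \<and> (\<forall>X \<in> Obj C. \<pi> (V \<boxtimes> W) X \<cdot> v = ?rhs X)"
    show "v = u"
    proof (rule Z_action_unique[OF VW conjunct1[OF v] u])
      fix X assume X: "X \<in> Obj C"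
      show "Z_action (V \<boxtimes> W) X \<cdot> (v \<otimes> idn X) = Z_action (V \<boxtimes> W) X \<cdot> (u \<otimes> idn X)"
        unfolding ut[OF X] using eq[OF X conjunct1[OF v]] bspec[OF conjunct2[OF v] X] by (rule iffD1)
    qed
  qed
  then show "mult_Z C D Z \<pi> V W \<in> Hom C (Z V \<boxtimes> Z W) (Z (V \<boxtimes> W))"
    "X \<in> Obj C \<Longrightarrow> Z_action (V \<boxtimes> W) X \<cdot> (mult_Z C D Z \<pi> V W \<otimes> idn X)
      = (Z_action V X \<otimes> idn W) \<cdot> (idn (Z V) \<otimes> Z_action W X)"
    using u ut by (simp_all add: t_def)
qed

lemma counit_Z_action:
  assumes V: "V \<in> Obj C"
  shows "counit_Z C D \<pi> V = Z_action V \<one>"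
  unfolding counit_Z_def Z_action_def uncurry_dual_def unit_Obj_left[OF V]
    unit_Arr_right[OF Hom_Arr[OF \<pi>_Hom[OF V unit_Obj]]] ..

text \<open>The natural action with \<open>W = \<one>\<close> that corresponds to
  \<open>\<Lambda>\<close>, that is, the family \<open>l\<close> of the overview.\<close>

definition integral_action :: "'o \<Rightarrow> 'm \<Rightarrow> 'o \<Rightarrow> 'm" where
  "integral_action \<alpha> \<Lambda> X = Z_action \<alpha> X \<cdot> (\<Lambda> \<otimes> idn X)"

lemma integral_action_natural:
  assumes \<alpha>: "\<alpha> \<in> Obj C" and \<Lambda>: "\<Lambda> \<in> Hom C \<one> (Z \<alpha>)"
  shows "X \<in> Obj C \<Longrightarrow> integral_action \<alpha> \<Lambda> X \<in> Hom C X (X \<boxtimes> \<alpha>)"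
    "f \<in> Hom C X Y \<Longrightarrow> (f \<otimes> idn \<alpha>) \<cdot> integral_action \<alpha> \<Lambda> X = integral_action \<alpha> \<Lambda> Y \<cdot> f"
proof -
  have n: "natural_action \<alpha> \<one> (integral_action \<alpha> \<Lambda>)"
    unfolding integral_action_def by (rule natural_action_comp[OF \<alpha> Z_action_natural[OF \<alpha>] \<Lambda>])
  show "integral_action \<alpha> \<Lambda> X \<in> Hom C X (X \<boxtimes> \<alpha>)" if X: "X \<in> Obj C"
    using natural_actionD(2)[OF n X] unfolding unit_Obj_left[OF X] .
  show "(f \<otimes> idn \<alpha>) \<cdot> integral_action \<alpha> \<Lambda> X = integral_action \<alpha> \<Lambda> Y \<cdot> f" if f: "f \<in> Hom C X Y"
    using natural_actionD(3)[OF n f] unfolding unit_Arr_left[OF Hom_Arr[OF f]] .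
qed

lemma counit_integral_action:
  assumes \<alpha>: "\<alpha> \<in> Obj C" and \<Lambda>: "\<Lambda> \<in> Hom C \<one> (Z \<alpha>)"
  shows "counit_Z C D \<pi> \<alpha> \<cdot> \<Lambda> = integral_action \<alpha> \<Lambda> \<one>"
  unfolding counit_Z_action[OF \<alpha>] integral_action_def unit_Arr_right[OF Hom_Arr[OF \<Lambda>]] ..

lemma counit_Z_Hom: "V \<in> Obj C \<Longrightarrow> counit_Z C D \<pi> V \<in> Hom C (Z V) V"
  using Z_action_Hom[OF _ unit_Obj, of V] unit_Obj_right[OF Z_Obj] unit_Obj_left[of V] by (simp add: counit_Z_action)

lemma counit_Z_universal:
  assumes u: "u \<in> Hom C W (Z \<one>)" and ut: "Z_action \<one> \<one> \<cdot> (u \<otimes> idn \<one>) = s"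
  shows "counit_Z C D \<pi> \<one> \<cdot> u = s"
  using ut unfolding counit_Z_action[OF unit_Obj] unit_Arr_right[OF Hom_Arr[OF u]] .

lemma scalar_integral_action:
  assumes \<alpha>: "\<alpha> \<in> Obj C" and \<Lambda>: "\<Lambda> \<in> Hom C \<one> (Z \<alpha>)" and s: "s \<in> Hom C W \<one>" and X: "X \<in> Obj C"
  shows "Z_action \<alpha> X \<cdot> (s \<otimes> \<Lambda> \<otimes> idn X) = s \<otimes> integral_action \<alpha> \<Lambda> X"
proof -
  have \<Lambda>X: "\<Lambda> \<otimes> idn X \<in> Hom C X (Z \<alpha> \<boxtimes> X)" by (rule coev_tensor_id_Hom[OF X \<Lambda>])
  have "Z_action \<alpha> X \<cdot> (s \<otimes> (\<Lambda> \<otimes> idn X)) = (idn \<one> \<otimes> Z_action \<alpha> X) \<cdot> (s \<otimes> (\<Lambda> \<otimes> idn X))"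
    unfolding unit_Arr_left[OF Hom_Arr[OF Z_action_Hom[OF \<alpha> X]]] ..
  also have "\<dots> = (idn \<one> \<cdot> s) \<otimes> (Z_action \<alpha> X \<cdot> (\<Lambda> \<otimes> idn X))"
    by (rule tensor_comp[symmetric, OF s id_Hom[OF unit_Obj] \<Lambda>X Z_action_Hom[OF \<alpha> X]])
  finally show ?thesis
    unfolding id_comp[OF s] integral_action_def assoc_Arr[OF Hom_Arr[OF s] Hom_Arr[OF \<Lambda>] id_Arr[OF X]] .
qed

text \<open>The family \<open>t\<close> is induced by some
  \<open>u : W \<rightarrow> Z \<one>\<close>. Precomposing the integral equation with
  \<open>u\<close> gives \<open>M \<cdot> (u \<otimes> \<Lambda>) = t \<one> \<otimes>
  \<Lambda>\<close>. Let both sides act on \<open>X\<close>: by \<open>mult_Z\<close> the left side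
  is the action of \<Lambda> followed by that of \<open>u\<close>.\<close>

lemma left_integral_action:
  assumes \<alpha>: "\<alpha> \<in> Obj C" and int: "left_integral C D Z \<pi> \<alpha> \<Lambda>" and t: "natural_action \<one> W t" and X: "X \<in> Obj C"
  shows "(t X \<otimes> idn \<alpha>) \<cdot> (idn W \<otimes> integral_action \<alpha> \<Lambda> X) = t \<one> \<otimes> integral_action \<alpha> \<Lambda> X"
proof -
  define M where "M = mult_Z C D Z \<pi> \<one> \<alpha>"
  have \<Lambda>: "\<Lambda> \<in> Hom C \<one> (Z \<alpha>)" and M\<Lambda>: "M \<cdot> (idn (Z \<one>) \<otimes> \<Lambda>) = counit_Z C D \<pi> \<one> \<otimes> \<Lambda>"
    using int unfolding left_integral_def M_def by simp_all
  note one = unit_Obj and Z1 = Z_Obj[OF unit_Obj] and Z\<alpha> = Z_Obj[OF \<alpha>] and W = natural_actionD(1)[OF t]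
  have M: "M \<in> Hom C (Z \<one> \<boxtimes> Z \<alpha>) (Z \<alpha>)"
    using mult_Z(1)[OF one \<alpha>] unfolding M_def unit_Obj_left[OF \<alpha>] .
  obtain u where u: "u \<in> Hom C W (Z \<one>)" and ut: "\<And>X. X \<in> Obj C \<Longrightarrow> Z_action \<one> X \<cdot> (u \<otimes> idn X) = t X"
    using Z_action_universal[OF one t] by blast
  let ?l = "integral_action \<alpha> \<Lambda> X"
  note lX = integral_action_natural(1)[OF \<alpha> \<Lambda> X]
  note \<epsilon> = counit_Z_Hom[OF one]
  have Z\<Lambda>: "idn (Z \<one>) \<otimes> \<Lambda> \<in> Hom C (Z \<one>) (Z \<one> \<boxtimes> Z \<alpha>)" by (rule id_tensor_coev_Hom[OF Z1 \<Lambda>])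
  have u\<Lambda>: "u \<otimes> \<Lambda> \<in> Hom C W (Z \<one> \<boxtimes> Z \<alpha>)" using tensor_Hom[OF u \<Lambda>] unfolding unit_Obj_right[OF W] .
  have Z\<Lambda>u: "(idn (Z \<one>) \<otimes> \<Lambda>) \<cdot> u = u \<otimes> \<Lambda>"
    using tensor_split_right[OF u \<Lambda>] unfolding unit_Arr_right[OF Hom_Arr[OF u]] .
  have "M \<cdot> (u \<otimes> \<Lambda>) = M \<cdot> (idn (Z \<one>) \<otimes> \<Lambda>) \<cdot> u"
    unfolding Z\<Lambda>u[symmetric] by (rule comp_assoc[OF u Z\<Lambda> M])
  also have "\<dots> = (counit_Z C D \<pi> \<one> \<otimes> \<Lambda>) \<cdot> (u \<otimes> idn \<one>)" unfolding M\<Lambda> unit_Arr_right[OF Hom_Arr[OF u]] ..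
  also have "\<dots> = (counit_Z C D \<pi> \<one> \<cdot> u) \<otimes> \<Lambda>"
    unfolding tensor_comp[symmetric, OF u \<epsilon> id_Hom[OF one] \<Lambda>] comp_id[OF \<Lambda>] ..
  also have "counit_Z C D \<pi> \<one> \<cdot> u = t \<one>" by (rule counit_Z_universal[OF u ut[OF one]])
  finally have Mu: "M \<cdot> (u \<otimes> \<Lambda>) = t \<one> \<otimes> \<Lambda>" .
  have t1: "t \<one> \<in> Hom C W \<one>"
    using natural_actionD(2)[OF t one] unfolding unit_Obj_right[OF W] unit_Obj_right[OF one] .
  have \<Lambda>X: "\<Lambda> \<otimes> idn X \<in> Hom C X (Z \<alpha> \<boxtimes> X)" by (rule coev_tensor_id_Hom[OF X \<Lambda>])
  have u\<Lambda>X: "u \<otimes> (\<Lambda> \<otimes> idn X) \<in> Hom C (W \<boxtimes> X) (Z \<one> \<boxtimes> (Z \<alpha> \<boxtimes> X))" by (rule tensor_Hom[OF u \<Lambda>X])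
  have a1: "Z_action \<one> X \<in> Hom C (Z \<one> \<boxtimes> X) X" using Z_action_Hom[OF one X] unfolding unit_Obj_right[OF X] .
  have a1\<alpha>: "Z_action \<one> X \<otimes> idn \<alpha> \<in> Hom C (Z \<one> \<boxtimes> (X \<boxtimes> \<alpha>)) (X \<boxtimes> \<alpha>)"
    using tensor_id_Hom[OF \<alpha> a1] unfolding assoc_Obj[OF Z1 X \<alpha>] .
  have uX: "u \<otimes> idn X \<in> Hom C (W \<boxtimes> X) (Z \<one> \<boxtimes> X)" by (rule tensor_id_Hom[OF X u])
  have "t \<one> \<otimes> ?l = Z_action \<alpha> X \<cdot> ((M \<cdot> (u \<otimes> \<Lambda>)) \<otimes> idn X)"
    unfolding Mu by (rule scalar_integral_action[symmetric, OF \<alpha> \<Lambda> t1 X])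
  also have "\<dots> = Z_action \<alpha> X \<cdot> (M \<otimes> idn X) \<cdot> (u \<otimes> \<Lambda> \<otimes> idn X)"
    unfolding comp_tensor_id[OF u\<Lambda> M X]
    by (rule comp_assoc[OF tensor_id_Hom[OF X u\<Lambda>] tensor_id_Hom[OF X M] Z_action_Hom[OF \<alpha> X]])
  also have "Z_action \<alpha> X \<cdot> (M \<otimes> idn X) = (Z_action \<one> X \<otimes> idn \<alpha>) \<cdot> (idn (Z \<one>) \<otimes> Z_action \<alpha> X)"
    using mult_Z(2)[OF one \<alpha> X] unfolding M_def unit_Obj_left[OF \<alpha>] .
  also have "u \<otimes> \<Lambda> \<otimes> idn X = u \<otimes> (\<Lambda> \<otimes> idn X)" by (rule assoc_Arr[OF Hom_Arr[OF u] Hom_Arr[OF \<Lambda>] id_Arr[OF X]])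
  also have "(Z_action \<one> X \<otimes> idn \<alpha>) \<cdot> (idn (Z \<one>) \<otimes> Z_action \<alpha> X) \<cdot> (u \<otimes> (\<Lambda> \<otimes> idn X))
      = (Z_action \<one> X \<otimes> idn \<alpha>) \<cdot> ((idn (Z \<one>) \<otimes> Z_action \<alpha> X) \<cdot> (u \<otimes> (\<Lambda> \<otimes> idn X)))"
    by (rule comp_assoc[symmetric, OF u\<Lambda>X id_tensor_Hom[OF Z1 Z_action_Hom[OF \<alpha> X]] a1\<alpha>])
  also have "(idn (Z \<one>) \<otimes> Z_action \<alpha> X) \<cdot> (u \<otimes> (\<Lambda> \<otimes> idn X)) = u \<otimes> ?l"
    unfolding integral_action_def tensor_comp[symmetric, OF u id_Hom[OF Z1] \<Lambda>X Z_action_Hom[OF \<alpha> X]] id_comp[OF u] ..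
  also have "\<dots> = (u \<otimes> idn X \<otimes> idn \<alpha>) \<cdot> (idn W \<otimes> ?l)"
    unfolding tensor_id_id[OF X \<alpha> Hom_Arr[OF u]] by (rule tensor_split_left[symmetric, OF u lX])
  also have "(Z_action \<one> X \<otimes> idn \<alpha>) \<cdot> ((u \<otimes> idn X \<otimes> idn \<alpha>) \<cdot> (idn W \<otimes> ?l))
      = (Z_action \<one> X \<otimes> idn \<alpha>) \<cdot> (u \<otimes> idn X \<otimes> idn \<alpha>) \<cdot> (idn W \<otimes> ?l)"
  proof (rule comp_assoc[OF id_tensor_Hom[OF W lX] _ a1\<alpha>])
    show "u \<otimes> idn X \<otimes> idn \<alpha> \<in> Hom C (W \<boxtimes> (X \<boxtimes> \<alpha>)) (Z \<one> \<boxtimes> (X \<boxtimes> \<alpha>))"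
      using tensor_id_Hom[OF \<alpha> uX] unfolding assoc_Obj[OF W X \<alpha>] assoc_Obj[OF Z1 X \<alpha>] .
  qed
  also have "(Z_action \<one> X \<otimes> idn \<alpha>) \<cdot> (u \<otimes> idn X \<otimes> idn \<alpha>) = t X \<otimes> idn \<alpha>"
    unfolding comp_tensor_id[OF uX a1 \<alpha>, symmetric] ut[OF X] ..
  finally show ?thesis by (rule sym)
qed

text \<open>The same argument as for left integrals with the order of the two actions reversed, so
  that \<open>t\<close> comes before \<open>l\<close>.\<close>

lemma right_integral_action:
  assumes \<alpha>: "\<alpha> \<in> Obj C" and int: "right_integral C D Z \<pi> \<alpha> \<Lambda>" and t: "natural_action \<one> W t" and X: "X \<in> Obj C"
  shows "integral_action \<alpha> \<Lambda> X \<cdot> t X = t \<one> \<otimes> integral_action \<alpha> \<Lambda> X"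
proof -
  define M where "M = mult_Z C D Z \<pi> \<alpha> \<one>"
  have \<Lambda>: "\<Lambda> \<in> Hom C \<one> (Z \<alpha>)" and M\<Lambda>: "M \<cdot> (\<Lambda> \<otimes> idn (Z \<one>)) = \<Lambda> \<otimes> counit_Z C D \<pi> \<one>"
    using int unfolding right_integral_def M_def by simp_all
  note one = unit_Obj and Z1 = Z_Obj[OF unit_Obj] and Z\<alpha> = Z_Obj[OF \<alpha>] and W = natural_actionD(1)[OF t]
  have M: "M \<in> Hom C (Z \<alpha> \<boxtimes> Z \<one>) (Z \<alpha>)"
    using mult_Z(1)[OF \<alpha> one] unfolding M_def unit_Obj_right[OF \<alpha>] .
  obtain u where u: "u \<in> Hom C W (Z \<one>)" and ut: "\<And>X. X \<in> Obj C \<Longrightarrow> Z_action \<one> X \<cdot> (u \<otimes> idn X) = t X"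
    using Z_action_universal[OF one t] by blast
  let ?l = "integral_action \<alpha> \<Lambda> X"
  note \<epsilon> = counit_Z_Hom[OF one]
  have \<Lambda>Z: "\<Lambda> \<otimes> idn (Z \<one>) \<in> Hom C (Z \<one>) (Z \<alpha> \<boxtimes> Z \<one>)" by (rule coev_tensor_id_Hom[OF Z1 \<Lambda>])
  have \<Lambda>u: "\<Lambda> \<otimes> u \<in> Hom C W (Z \<alpha> \<boxtimes> Z \<one>)" using tensor_Hom[OF \<Lambda> u] unfolding unit_Obj_left[OF W] .
  have \<Lambda>Zu: "(\<Lambda> \<otimes> idn (Z \<one>)) \<cdot> u = \<Lambda> \<otimes> u"
    using tensor_split_left[OF \<Lambda> u] unfolding unit_Arr_left[OF Hom_Arr[OF u]] .
  have t1: "t \<one> \<in> Hom C W \<one>"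
    using natural_actionD(2)[OF t one] unfolding unit_Obj_right[OF W] unit_Obj_right[OF one] .
  have "M \<cdot> (\<Lambda> \<otimes> u) = M \<cdot> (\<Lambda> \<otimes> idn (Z \<one>)) \<cdot> u"
    unfolding \<Lambda>Zu[symmetric] by (rule comp_assoc[OF u \<Lambda>Z M])
  also have "\<dots> = (\<Lambda> \<otimes> counit_Z C D \<pi> \<one>) \<cdot> (idn \<one> \<otimes> u)" unfolding M\<Lambda> unit_Arr_left[OF Hom_Arr[OF u]] ..
  also have "\<dots> = \<Lambda> \<otimes> (counit_Z C D \<pi> \<one> \<cdot> u)"
    unfolding tensor_comp[symmetric, OF id_Hom[OF one] \<Lambda> u \<epsilon>] comp_id[OF \<Lambda>] ..
  also have "counit_Z C D \<pi> \<one> \<cdot> u = t \<one>" by (rule counit_Z_universal[OF u ut[OF one]])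
  \<comment> \<open>\<Lambda> starts at the unit object and \<open>t \<one>\<close> ends there, so
    the interchange law makes both tensor products equal to the composite of \<open>t \<one>\<close>
    followed by \<Lambda>.\<close>
  also have "\<Lambda> \<otimes> t \<one> = t \<one> \<otimes> \<Lambda>"
    using tensor_split_left[OF \<Lambda> t1] tensor_split_right[OF t1 \<Lambda>]
    unfolding unit_Arr_left[OF Hom_Arr[OF t1]] unit_Arr_right[OF Hom_Arr[OF \<Lambda>]]
      unit_Arr_right[OF Hom_Arr[OF t1]] unit_Arr_left[OF Hom_Arr[OF \<Lambda>]] by simp
  finally have Mu: "M \<cdot> (\<Lambda> \<otimes> u) = t \<one> \<otimes> \<Lambda>" .
  have \<Lambda>X: "\<Lambda> \<otimes> idn X \<in> Hom C X (Z \<alpha> \<boxtimes> X)" by (rule coev_tensor_id_Hom[OF X \<Lambda>])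
  have a1: "Z_action \<one> X \<in> Hom C (Z \<one> \<boxtimes> X) X" using Z_action_Hom[OF one X] unfolding unit_Obj_right[OF X] .
  have uX: "u \<otimes> idn X \<in> Hom C (W \<boxtimes> X) (Z \<one> \<boxtimes> X)" by (rule tensor_id_Hom[OF X u])
  have tX: "t X \<in> Hom C (W \<boxtimes> X) X" using natural_actionD(2)[OF t X] unfolding unit_Obj_right[OF X] .
  have \<Lambda>uX: "\<Lambda> \<otimes> (u \<otimes> idn X) \<in> Hom C (W \<boxtimes> X) (Z \<alpha> \<boxtimes> (Z \<one> \<boxtimes> X))"
    using tensor_Hom[OF \<Lambda> uX] unfolding unit_Obj_left[OF tensor_Obj[OF W X]] .
  have "t \<one> \<otimes> ?l = Z_action \<alpha> X \<cdot> ((M \<cdot> (\<Lambda> \<otimes> u)) \<otimes> idn X)"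
    unfolding Mu by (rule scalar_integral_action[symmetric, OF \<alpha> \<Lambda> t1 X])
  also have "\<dots> = Z_action \<alpha> X \<cdot> (M \<otimes> idn X) \<cdot> (\<Lambda> \<otimes> u \<otimes> idn X)"
    unfolding comp_tensor_id[OF \<Lambda>u M X]
    by (rule comp_assoc[OF tensor_id_Hom[OF X \<Lambda>u] tensor_id_Hom[OF X M] Z_action_Hom[OF \<alpha> X]])
  also have "Z_action \<alpha> X \<cdot> (M \<otimes> idn X) = Z_action \<alpha> X \<cdot> (idn (Z \<alpha>) \<otimes> Z_action \<one> X)"
    using mult_Z(2)[OF \<alpha> one X]
    unfolding M_def unit_Obj_right[OF \<alpha>] unit_Arr_right[OF Hom_Arr[OF Z_action_Hom[OF \<alpha> X]]] .
  also have "\<Lambda> \<otimes> u \<otimes> idn X = \<Lambda> \<otimes> (u \<otimes> idn X)" by (rule assoc_Arr[OF Hom_Arr[OF \<Lambda>] Hom_Arr[OF u] id_Arr[OF X]])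
  also have "Z_action \<alpha> X \<cdot> (idn (Z \<alpha>) \<otimes> Z_action \<one> X) \<cdot> (\<Lambda> \<otimes> (u \<otimes> idn X))
      = Z_action \<alpha> X \<cdot> ((idn (Z \<alpha>) \<otimes> Z_action \<one> X) \<cdot> (\<Lambda> \<otimes> (u \<otimes> idn X)))"
    by (rule comp_assoc[symmetric, OF \<Lambda>uX id_tensor_Hom[OF Z\<alpha> a1] Z_action_Hom[OF \<alpha> X]])
  also have "(idn (Z \<alpha>) \<otimes> Z_action \<one> X) \<cdot> (\<Lambda> \<otimes> (u \<otimes> idn X)) = \<Lambda> \<otimes> t X"
    unfolding tensor_comp[symmetric, OF \<Lambda> id_Hom[OF Z\<alpha>] uX a1] id_comp[OF \<Lambda>] ut[OF X] ..
  also have "\<dots> = (\<Lambda> \<otimes> idn X) \<cdot> t X"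
    using tensor_split_left[OF \<Lambda> tX] unfolding unit_Arr_left[OF Hom_Arr[OF tX]] by (rule sym)
  also have "Z_action \<alpha> X \<cdot> ((\<Lambda> \<otimes> idn X) \<cdot> t X) = ?l \<cdot> t X"
    unfolding integral_action_def by (rule comp_assoc[OF tX \<Lambda>X Z_action_Hom[OF \<alpha> X]])
  finally show ?thesis by (rule sym)
qed

end

end

section \<open>Semisimplicity by splitting\<close>

lemma linear_functional_sum:
  fixes \<phi> :: "'a :: field vec \<Rightarrow> 'a"
  assumes "\<And>v w. v \<in> carrier_vec n \<Longrightarrow> w \<in> carrier_vec n \<Longrightarrow> \<phi> (v + w) = \<phi> v + \<phi> w"
    and "\<And>c v. v \<in> carrier_vec n \<Longrightarrow> \<phi> (c \<cdot>\<^sub>v v) = c * \<phi> v"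
    and x: "x \<in> carrier_vec n"
  shows "\<phi> x = (\<Sum>i<n. x $ i * \<phi> (unit_vec n i))"
proof -
  have "\<exists>M \<in> carrier_mat 1 n. \<forall>v \<in> carrier_vec n. M *\<^sub>v v = vec 1 (\<lambda>_. \<phi> v)"
    by (rule linear_map_matrix_ex) (auto simp: assms(1,2))
  then obtain M where M: "M \<in> carrier_mat 1 n" and M\<phi>: "\<forall>v \<in> carrier_vec n. M *\<^sub>v v = vec 1 (\<lambda>_. \<phi> v)" by blast
  have \<phi>: "\<phi> v = row M 0 \<bullet> v" if v: "v \<in> carrier_vec n" for v
  proof -
    have "(M *\<^sub>v v) $ 0 = \<phi> v" using bspec[OF M\<phi> v] by simp
    then show ?thesis using M by simp
  qed
  have "\<phi> (unit_vec n i) = M $$ (0, i)" if "i < n" for i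
    using \<phi>[of "unit_vec n i"] that M by (simp add: scalar_prod_right_unit)
  then have "(\<Sum>i<n. x $ i * \<phi> (unit_vec n i)) = (\<Sum>i<n. M $$ (0, i) * x $ i)" by (intro sum.cong) simp_all
  also have "\<dots> = row M 0 \<bullet> x" using M x by (simp add: scalar_prod_def lessThan_atLeast0)
  finally show ?thesis using \<phi>[OF x] by simp
qed

context linear_category
begin

text \<open>The same right fold as in \<open>direct_sum\<close>, so the completeness relation stated
  there is literally an instance.\<close>

definition sum_arr :: "'o \<Rightarrow> 'o \<Rightarrow> ('i \<Rightarrow> 'm) \<Rightarrow> 'i list \<Rightarrow> 'm" where
  "sum_arr X Y f xs = foldr (\<lambda>a s. f a \<oplus>\<^sub>a s) xs (Zero C X Y)"

lemma sum_arr_simps [simp]: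
  "sum_arr X Y f [] = Zero C X Y" "sum_arr X Y f (a # xs) = f a \<oplus>\<^sub>a sum_arr X Y f xs"
  by (simp_all add: sum_arr_def)

lemma sum_arr_Hom:
  assumes "X \<in> Obj C" "Y \<in> Obj C" "\<And>a. a \<in> set xs \<Longrightarrow> f a \<in> Hom C X Y"
  shows "sum_arr X Y f xs \<in> Hom C X Y"
  using assms(3) by (induction xs) (simp_all add: zero_Hom assms(1,2) plus_Hom)

lemma sum_arr_cong: "(\<And>a. a \<in> set xs \<Longrightarrow> f a = g a) \<Longrightarrow> sum_arr X Y f xs = sum_arr X Y g xs"
  by (induction xs) simp_all

lemma sum_arr_zero:
  assumes "X \<in> Obj C" "Y \<in> Obj C" "\<And>a. a \<in> set xs \<Longrightarrow> f a = Zero C X Y"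
  shows "sum_arr X Y f xs = Zero C X Y"
  using assms(3) by (induction xs) (simp_all add: zero_plus zero_Hom assms(1,2))

lemma comp_sum_arr:
  assumes X: "X \<in> Obj C" and g: "g \<in> Hom C Y W" and f: "\<And>a. a \<in> set xs \<Longrightarrow> f a \<in> Hom C X Y"
  shows "g \<cdot> sum_arr X Y f xs = sum_arr X W (\<lambda>a. g \<cdot> f a) xs"
  using f
proof (induction xs)
  case Nil
  show ?case using comp_zero[OF g X] by simp
next
  case (Cons a xs)
  have "sum_arr X Y f xs \<in> Hom C X Y" using Cons.prems by (intro sum_arr_Hom X Hom_Obj(1)[OF g]) simp
  then show ?case using Cons by (simp add: comp_plus[of "f a" X Y _ g W] g)
qed

lemma sum_arr_comp:
  assumes W: "W \<in> Obj C" and g: "g \<in> Hom C X Y" and f: "\<And>a. a \<in> set xs \<Longrightarrow> f a \<in> Hom C Y W"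
  shows "sum_arr Y W f xs \<cdot> g = sum_arr X W (\<lambda>a. f a \<cdot> g) xs"
  using f
proof (induction xs)
  case Nil
  show ?case using zero_comp[OF g W] by simp
next
  case (Cons a xs)
  have "sum_arr Y W f xs \<in> Hom C Y W" using Cons.prems by (intro sum_arr_Hom W Hom_Obj(2)[OF g]) simp
  then show ?case using Cons by (simp add: plus_comp[of g X Y "f a" W] g)
qed

end

context matrix_category
begin

lemma U_sum_arr:
  assumes X: "X \<in> Obj C" and Y: "Y \<in> Obj C" and f: "\<And>a. a \<in> set xs \<Longrightarrow> f a \<in> Hom C X Y"
    and ij: "i < dim Y" "j < dim X"
  shows "U (sum_arr X Y f xs) $$ (i, j) = (\<Sum>a\<leftarrow>xs. U (f a) $$ (i, j))"
  using f
proof (induction xs)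
  case Nil
  show ?case using ij by (simp add: U_zero[OF X Y])
next
  case (Cons a xs)
  have s: "sum_arr X Y f xs \<in> Hom C X Y" using Cons.prems by (intro sum_arr_Hom X Y) simp
  show ?case using Cons ij U_carrier[OF s] by (simp add: U_plus[of "f a" X Y, OF _ s])
qed

end

context generated_category
begin

text \<open>Let \<open>m\<close> be the image inclusion of \<open>e\<close> and \<open>q\<close> its
  cokernel. Then \<open>q\<close> and zero agree after \<open>e\<close>, so \<open>q\<close> is
  zero. Since \<open>m\<close> is a kernel of \<open>q\<close>, the identity of \<open>Y\<close>
  factors through \<open>m\<close>, which is thus surjective.\<close>

lemma epi_surj:
  assumes e: "e \<in> Hom C X Y"
    and epi: "\<And>Q a b. a \<in> Hom C Y Q \<Longrightarrow> b \<in> Hom C Y Q \<Longrightarrow> a \<cdot> e = b \<cdot> e \<Longrightarrow> a = b"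
  shows "surj_arr e"
proof -
  note X = Hom_Obj(1)[OF e] and Y = Hom_Obj(2)[OF e]
  obtain J e' m where e': "e' \<in> Hom C X J" and m: "m \<in> Hom C J Y" and em: "e = m \<cdot> e'" and s: "surj_arr e'" and i: "inj_arr m"
    by (rule image_factorization[OF e])
  obtain Q q where q: "q \<in> Hom C Y Q" and qm: "q \<cdot> m = Zero C J Q"
    and ker: "\<And>W f. f \<in> Hom C W Y \<Longrightarrow> q \<cdot> f = Zero C W Q \<Longrightarrow> \<exists>r \<in> Hom C W J. f = m \<cdot> r"
    using cokernel[OF m i] by metis
  note Q = Hom_Obj(2)[OF q]
  have "q \<cdot> e = Zero C Y Q \<cdot> e"
    unfolding zero_comp[OF e Q] unfolding em comp_assoc[OF e' m q] qm zero_comp[OF e' Q] ..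
  then have "q = Zero C Y Q" by (rule epi[OF q zero_Hom[OF Y Q]])
  then have "q \<cdot> idn Y = Zero C Y Q" using zero_comp[OF id_Hom[OF Y] Q] by simp
  then obtain r where r: "r \<in> Hom C Y J" and mr: "idn Y = m \<cdot> r" using ker[OF id_Hom[OF Y]] by blast
  have "U m * U r = 1\<^sub>m (dim Y)" unfolding U_comp[OF r m, symmetric] mr[symmetric] by (rule U_id[OF Y])
  then have "surj_arr m" by (rule right_inverse_surj_arr[OF m U_carrier[OF r]])
  then show ?thesis unfolding em by (rule surj_arr_comp[OF e' s m])
qed

lemma inj_arr_comp:
  assumes f: "f \<in> Hom C X Y" "inj_arr f" and g: "g \<in> Hom C Y W" "inj_arr g"
  shows "inj_arr (g \<cdot> f)"
proof -
  have "g \<cdot> f \<in> Hom C X W" by (rule comp_Hom[OF f(1) g(1)])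
  moreover have "mono_arr C (g \<cdot> f)"
    unfolding mono_arr_def Hom_Src_Tgt[OF comp_Hom[OF f(1) g(1)]]
  proof (intro conjI ballI impI Hom_Arr[OF comp_Hom[OF f(1) g(1)]])
    fix V a b assume a: "a \<in> Hom C V X" and b: "b \<in> Hom C V X" and eq: "g \<cdot> f \<cdot> a = g \<cdot> f \<cdot> b"
    have "f \<cdot> a = f \<cdot> b"
      using eq unfolding comp_assoc[OF a f(1) g(1), symmetric] comp_assoc[OF b f(1) g(1), symmetric]
      by (rule inj_arr_cancel[OF g comp_Hom[OF a f(1)] comp_Hom[OF b f(1)]])
    then show "a = b" by (rule inj_arr_cancel[OF f a b])
  qed
  ultimately show ?thesis by (rule mono_arr_inj)
qed

text \<open>A subobject of least positive dimension is simple: a nonzero subobject of it has at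
  least the same dimension, and an injective arrow between such objects is invertible.\<close>

lemma simple_subobject:
  assumes X: "X \<in> Obj C" and pos: "0 < dim X"
  obtains Y m where "simple_object C Y" "m \<in> Hom C Y X" "inj_arr m"
proof -
  define P where "P = (\<lambda>n. \<exists>Y m. m \<in> Hom C Y X \<and> inj_arr m \<and> dim Y = n \<and> 0 < n)"
  have "inj_arr (idn X)" by (rule left_inverse_inj_arr[OF id_Hom[OF X] one_carrier_mat]) (simp add: U_id[OF X])
  then have "P (dim X)" unfolding P_def using id_Hom[OF X] pos by blast
  then have PL: "P (LEAST n. P n)" by (rule LeastI)
  then obtain Y m where m: "m \<in> Hom C Y X" "inj_arr m" and dY: "dim Y = (LEAST n. P n)" and Y0: "0 < dim Y"
    unfolding P_def by auto
  have Y: "Y \<in> Obj C" by (rule Hom_Obj(1)[OF m(1)])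
  have "simple_object C Y"
    unfolding simple_object_def
  proof (intro conjI ballI impI)
    show "Y \<in> Obj C" "\<not> zero_object C Y" using Y Y0 zero_object_dim[OF Y] by simp_all
    fix f assume f: "f \<in> Arr C" and T: "Tgt C f = Y \<and> mono_arr C f"
    define K where "K = Src C f"
    have fH: "f \<in> Hom C K Y" using f T by (simp add: Hom_def K_def)
    have inj: "inj_arr f" using mono_arr_inj[OF fH] T by simp
    show "zero_object C (Src C f) \<or> iso_arr C f"
    proof (cases "dim K = 0")
      case True
      then show ?thesis using zero_object_dim[OF Hom_Obj(1)[OF fH]] by (simp add: K_def)
    next
      case False
      then have "P (dim K)" unfolding P_def using comp_Hom[OF fH m(1)] inj_arr_comp[OF fH inj m] by blast
      then have "dim Y \<le> dim K" unfolding dY by (rule Least_le)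
      then show ?thesis using inj_arr_iso[OF fH inj] by blast
    qed
  qed
  then show ?thesis using that m by blast
qed

text \<open>Induction on the dimension: a simple subobject \<open>Y\<close> is split off, and the
  quotient \<open>Q\<close> embeds as a complement through a section \<open>s\<close> of the
  quotient map.\<close>

lemma split_surj_semisimple:
  assumes split: "\<And>M N q. q \<in> Hom C M N \<Longrightarrow> surj_arr q \<Longrightarrow> \<exists>s \<in> Hom C N M. q \<cdot> s = idn N"
  shows "semisimple C"
  unfolding semisimple_def
proof
  fix X assume "X \<in> Obj C"
  then show "\<exists>n S. (\<forall>a<n. simple_object C (S a)) \<and> direct_sum C n S X"
  proof (induction "dim X" arbitrary: X rule: less_induct)
    case less
    note X = less.prems
    show ?case
    proof (cases "dim X = 0")
      case True
      then have "idn X = Zero C X X" using zero_object_dim[OF X] by (simp add: zero_object_def)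
      then have "direct_sum C 0 S X" for S unfolding direct_sum_def by simp
      then show ?thesis by (intro exI[of _ 0]) simp
    next
      case False
      then obtain Y m where Y: "simple_object C Y" and m: "m \<in> Hom C Y X" "inj_arr m"
        using simple_subobject[OF X] by blast
      have YO: "Y \<in> Obj C" by (rule Hom_Obj(1)[OF m(1)])
      obtain Q q where q: "q \<in> Hom C X Q" "surj_arr q" and qm: "q \<cdot> m = Zero C Y Q"
        and ker: "\<And>W f. f \<in> Hom C W X \<Longrightarrow> q \<cdot> f = Zero C W Q \<Longrightarrow> \<exists>r \<in> Hom C W Y. f = m \<cdot> r"
        using cokernel[OF m] by metis
      note Q = Hom_Obj(2)[OF q(1)]
      obtain s where s: "s \<in> Hom C Q X" and qs: "q \<cdot> s = idn Q" using split[OF q] by blast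
      have sq: "s \<cdot> q \<in> Hom C X X" by (rule comp_Hom[OF q(1) s])
      \<comment> \<open>\<open>f\<close> is the complementary idempotent
        \<open>idn X - s \<cdot> q\<close>, with the negative supplied by \<open>ex_minus\<close>.
        As \<open>q \<cdot> f\<close> vanishes, \<open>f\<close> factors as
        \<open>m \<cdot> r\<close>, and \<open>r\<close> is the projection onto
        \<open>Y\<close>.\<close>
      obtain f where f: "f \<in> Hom C X X" and sqf: "s \<cdot> q \<oplus>\<^sub>a f = idn X"
      proof -
        obtain n where n: "n \<in> Hom C X X" "s \<cdot> q \<oplus>\<^sub>a n = Zero C X X" using ex_minus[OF sq] by blast
        have "s \<cdot> q \<oplus>\<^sub>a (n \<oplus>\<^sub>a idn X) = idn X"
          unfolding plus_assoc[OF sq n(1) id_Hom[OF X], symmetric] n(2) by (rule zero_plus[OF id_Hom[OF X]])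
        then show ?thesis by (rule that[OF plus_Hom[OF n(1) id_Hom[OF X]]])
      qed
      have ann: "g = Zero C K L" if h: "h \<in> Hom C K L" and g: "g \<in> Hom C K L" and eq: "h \<oplus>\<^sub>a g = h" for h g K L
        using plus_cancel[OF g h] eq plus_comm[OF h g] by simp
      have "q \<cdot> (s \<cdot> q) \<oplus>\<^sub>a q \<cdot> f = q" unfolding comp_plus[OF sq f q(1), symmetric] sqf by (rule comp_id[OF q(1)])
      moreover have qsq: "q \<cdot> (s \<cdot> q) = q" unfolding comp_assoc[OF q(1) s q(1)] qs by (rule id_comp[OF q(1)])
      ultimately have "q \<cdot> f = Zero C X Q" using ann[OF q(1) comp_Hom[OF f q(1)]] by simp
      then obtain r where r: "r \<in> Hom C X Y" and fr: "f = m \<cdot> r" using ker[OF f] by blast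
      have "s \<cdot> q \<cdot> m \<oplus>\<^sub>a f \<cdot> m = m" unfolding plus_comp[OF m(1) sq f, symmetric] sqf by (rule id_comp[OF m(1)])
      moreover have "s \<cdot> q \<cdot> m = Zero C Y X"
        unfolding comp_assoc[OF m(1) q(1) s, symmetric] qm by (rule comp_zero[OF s YO])
      ultimately have "f \<cdot> m = m" using zero_plus[OF comp_Hom[OF m(1) f]] by simp
      then have "m \<cdot> (r \<cdot> m) = m \<cdot> idn Y" unfolding fr comp_assoc[OF m(1) r m(1)] comp_id[OF m(1)] .
      then have rm: "r \<cdot> m = idn Y" by (rule inj_arr_cancel[OF m comp_Hom[OF m(1) r] id_Hom[OF YO]])
      have "s \<cdot> q \<cdot> s \<oplus>\<^sub>a f \<cdot> s = s" unfolding plus_comp[OF s sq f, symmetric] sqf by (rule id_comp[OF s])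
      moreover have "s \<cdot> q \<cdot> s = s" unfolding comp_assoc[OF s q(1) s, symmetric] qs by (rule comp_id[OF s])
      ultimately have "f \<cdot> s = Zero C Q X" using ann[OF s comp_Hom[OF s f]] by simp
      then have "m \<cdot> (r \<cdot> s) = m \<cdot> Zero C Q Y" unfolding fr comp_assoc[OF s r m(1)] comp_zero[OF m(1) Q] .
      then have rs: "r \<cdot> s = Zero C Q Y" by (rule inj_arr_cancel[OF m comp_Hom[OF s r] zero_Hom[OF Q YO]])
      have s_inj: "inj_arr s"
        by (rule left_inverse_inj_arr[OF s U_carrier[OF q(1)]]) (simp add: U_comp[OF s q(1), symmetric] qs U_id[OF Q])
      \<comment> \<open>Needed for the induction. Otherwise the injective \<open>s\<close> would be
        invertible, \<open>r \<cdot> s = 0\<close> would force \<open>r = 0\<close>, and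
        \<open>Y\<close> would be zero because \<open>r \<cdot> m\<close> is its identity.\<close>
      have "dim Q < dim X"
      proof (rule ccontr)
        assume "\<not> dim Q < dim X"
        then have "iso_arr C s" using inj_arr_iso[OF s s_inj] by simp
        then have "surj_arr s" by (rule iso_arr_inj_surj[OF s])
        moreover have "r \<cdot> s = Zero C X Y \<cdot> s" unfolding rs zero_comp[OF s YO] ..
        ultimately have "r = Zero C X Y" using surj_arr_cancel[OF s _ r zero_Hom[OF X YO]] by blast
        then have "zero_object C Y" using rm zero_comp[OF m(1) YO] YO by (simp add: zero_object_def)
        then show False using Y by (simp add: simple_object_def)
      qed
      then obtain n S where S: "\<forall>a<n. simple_object C (S a)" and "direct_sum C n S Q" using less.hyps[OF _ Q] by blast
      then obtain i p where ip: "\<forall>a<n. i a \<in> Hom C (S a) Q \<and> p a \<in> Hom C Q (S a)"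
        and pi: "\<forall>a<n. \<forall>b<n. p a \<cdot> i b = (if a = b then idn (S a) else Zero C (S b) (S a))"
        and sum: "sum_arr Q Q (\<lambda>a. i a \<cdot> p a) [0..<n] = idn Q"
        unfolding direct_sum_def sum_arr_def by blast
      have i: "i a \<in> Hom C (S a) Q" and p: "p a \<in> Hom C Q (S a)" if "a < n" for a using ip that by simp_all
      \<comment> \<open>\<open>Y\<close> takes index 0 and the summands of \<open>Q\<close> move up
        by one, hence the shift of indices in the sum below.\<close>
      define S' where "S' = case_nat Y S"
      define i' where "i' = case_nat m (\<lambda>a. s \<cdot> i a)"
      define p' where "p' = case_nat r (\<lambda>a. p a \<cdot> q)"
      have "direct_sum C (Suc n) S' X"
        unfolding direct_sum_def
      proof (intro exI conjI allI impI)
        fix a assume a: "a < Suc n"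
        show "i' a \<in> Hom C (S' a) X" "p' a \<in> Hom C X (S' a)"
          using a m(1) r comp_Hom[OF i s] comp_Hom[OF q(1) p] by (cases a; simp add: i'_def p'_def S'_def)+
        fix b assume b: "b < Suc n"
        show "p' a \<cdot> i' b = (if a = b then idn (S' a) else Zero C (S' b) (S' a))"
        proof (cases a)
          case a0: 0
          show ?thesis
          proof (cases b)
            case 0
            then show ?thesis using a0 rm by (simp add: i'_def p'_def S'_def)
          next
            case (Suc b')
            then have b': "b' < n" using b by simp
            have "r \<cdot> (s \<cdot> i b') = Zero C (S b') Y"
              unfolding comp_assoc[OF i[OF b'] s r] rs by (rule zero_comp[OF i[OF b'] YO])
            then show ?thesis using a0 Suc by (simp add: i'_def p'_def S'_def)
          qed
        next
          case a': (Suc a')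
          then have an: "a' < n" using a by simp
          show ?thesis
          proof (cases b)
            case 0
            have "p a' \<cdot> q \<cdot> m = Zero C Y (S a')"
              unfolding comp_assoc[OF m(1) q(1) p[OF an], symmetric] qm by (rule comp_zero[OF p[OF an] YO])
            then show ?thesis using a' 0 by (simp add: i'_def p'_def S'_def)
          next
            case (Suc b')
            then have b': "b' < n" using b by simp
            have "p a' \<cdot> q \<cdot> (s \<cdot> i b') = p a' \<cdot> (q \<cdot> s \<cdot> i b')"
              using comp_assoc[OF comp_Hom[OF i[OF b'] s] q(1) p[OF an]] comp_assoc[OF i[OF b'] s q(1)] by simp
            also have "\<dots> = p a' \<cdot> i b'" unfolding qs id_comp[OF i[OF b']] ..
            finally show ?thesis using a' Suc pi an b' by (simp add: i'_def p'_def S'_def)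
          qed
        qed
      next
        have "sum_arr X X (\<lambda>a. i' a \<cdot> p' a) [0..<Suc n] = m \<cdot> r \<oplus>\<^sub>a sum_arr X X (\<lambda>a. s \<cdot> i a \<cdot> (p a \<cdot> q)) [0..<n]"
        proof -
          have "[0..<Suc n] = 0 # map Suc [0..<n]" by (simp add: map_Suc_upt upt_conv_Cons)
          then show ?thesis unfolding sum_arr_def by (simp add: foldr_map i'_def p'_def comp_def del: upt_Suc)
        qed
        also have "sum_arr X X (\<lambda>a. s \<cdot> i a \<cdot> (p a \<cdot> q)) [0..<n] = sum_arr X X (\<lambda>a. s \<cdot> (i a \<cdot> p a) \<cdot> q) [0..<n]"
        proof (rule sum_arr_cong)
          fix a assume "a \<in> set [0..<n]"
          then have a: "a < n" by simp
          show "s \<cdot> i a \<cdot> (p a \<cdot> q) = s \<cdot> (i a \<cdot> p a) \<cdot> q"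
            unfolding comp_assoc[OF q(1) p[OF a] comp_Hom[OF i[OF a] s]] comp_assoc[OF p[OF a] i[OF a] s] ..
        qed
        also have "\<dots> = s \<cdot> sum_arr Q Q (\<lambda>a. i a \<cdot> p a) [0..<n] \<cdot> q"
        proof -
          have ip': "i a \<cdot> p a \<in> Hom C Q Q" if "a \<in> set [0..<n]" for a using that comp_Hom[OF p i] by simp
          have "s \<cdot> sum_arr Q Q (\<lambda>a. i a \<cdot> p a) [0..<n] = sum_arr Q X (\<lambda>a. s \<cdot> (i a \<cdot> p a)) [0..<n]"
            by (rule comp_sum_arr[OF Q s]) (rule ip')
          moreover have "sum_arr Q X (\<lambda>a. s \<cdot> (i a \<cdot> p a)) [0..<n] \<cdot> q = sum_arr X X (\<lambda>a. s \<cdot> (i a \<cdot> p a) \<cdot> q) [0..<n]"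
            by (rule sum_arr_comp[OF X q(1)]) (rule comp_Hom[OF ip' s])
          ultimately show ?thesis by simp
        qed
        also have "\<dots> = s \<cdot> q" unfolding sum comp_id[OF s] ..
        also have "m \<cdot> r \<oplus>\<^sub>a s \<cdot> q = idn X" unfolding fr[symmetric] using sqf plus_comm[OF sq f] by simp
        finally show "foldr (\<lambda>a s. (i' a \<cdot> p' a) \<oplus>\<^sub>a s) [0..<Suc n] (Zero C X X) = idn X"
          unfolding sum_arr_def .
      qed
      moreover have "\<forall>a<Suc n. simple_object C (S' a)" using S Y by (auto simp: S'_def split: nat.split)
      ultimately show ?thesis by blast
    qed
  qed
qed

end

section \<open>Exactness of the tensor product and projectivity of the unit\<close>

locale generated_tensor_category = finite_tensor_category C + generated_category C A dim act U G \<iota> I \<kappa>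
  for C :: "('o, 'm, 'k :: alg_closed_field, 'z) tensor_category_scheme" (structure)
    and A dim act U G \<iota> I \<kappa>

context finite_tensor_category
begin

lemma zero_tensor:
  assumes X: "X \<in> Obj C" and Y: "Y \<in> Obj C" and g: "g \<in> Hom C X' Y'"
  shows "Zero C X Y \<otimes> g = Zero C (X \<boxtimes> X') (Y \<boxtimes> Y')"
proof -
  note z = zero_Hom[OF X Y]
  have "Zero C X Y \<otimes> g \<oplus>\<^sub>a Zero C X Y \<otimes> g = Zero C X Y \<otimes> g"
    unfolding tensor_plus_left[OF z z g, symmetric] zero_plus[OF z] ..
  then show ?thesis by (rule plus_cancel[OF tensor_Hom[OF z g] tensor_Hom[OF z g]])
qed

lemma tensor_zero:
  assumes X: "X \<in> Obj C" and Y: "Y \<in> Obj C" and g: "g \<in> Hom C X' Y'"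
  shows "g \<otimes> Zero C X Y = Zero C (X' \<boxtimes> X) (Y' \<boxtimes> Y)"
proof -
  note z = zero_Hom[OF X Y]
  have "g \<otimes> Zero C X Y \<oplus>\<^sub>a g \<otimes> Zero C X Y = g \<otimes> Zero C X Y"
    unfolding tensor_plus_right[OF g z z, symmetric] zero_plus[OF z] ..
  then show ?thesis by (rule plus_cancel[OF tensor_Hom[OF g z] tensor_Hom[OF g z]])
qed

lemma scale_zero:
  assumes X: "X \<in> Obj C" and Y: "Y \<in> Obj C"
  shows "t \<star> Zero C X Y = Zero C X Y"
proof -
  note z = zero_Hom[OF X Y]
  have "t \<star> Zero C X Y \<oplus>\<^sub>a t \<star> Zero C X Y = t \<star> Zero C X Y"
    unfolding scale_plus[OF z z, symmetric] zero_plus[OF z] ..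
  then show ?thesis by (rule plus_cancel[OF scale_Hom[OF z] scale_Hom[OF z]])
qed

lemma sum_arr_tensor:
  assumes X: "X \<in> Obj C" and Y: "Y \<in> Obj C" and g: "g \<in> Hom C X' Y'"
    and f: "\<And>a. a \<in> set xs \<Longrightarrow> f a \<in> Hom C X Y"
  shows "sum_arr X Y f xs \<otimes> g = sum_arr (X \<boxtimes> X') (Y \<boxtimes> Y') (\<lambda>a. f a \<otimes> g) xs"
  using f
proof (induction xs)
  case Nil
  show ?case using zero_tensor[OF X Y g] by simp
next
  case (Cons a xs)
  have "sum_arr X Y f xs \<in> Hom C X Y" using Cons.prems by (intro sum_arr_Hom X Y) simp
  then show ?case using Cons by (simp add: tensor_plus_left[of "f a" X Y _ g X' Y'] g)
qed

end

context generated_tensor_category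
begin

text \<open>By \<open>epi_surj\<close> it suffices that \<open>idn Y \<otimes> q\<close> can be
  cancelled. Tensoring with \<open>Y\<close> is left adjoint to tensoring with an object
  \<open>Y'\<close> that has \<open>Y\<close> as left dual; transposition \<open>?t\<close> turns
  the equation to be cancelled into one over \<open>q\<close>, and it is injective by the zig-zag
  identity.\<close>

lemma tensor_surj_arr:
  assumes Y: "Y \<in> Obj C" and q: "q \<in> Hom C M N" "surj_arr q"
  shows "surj_arr (idn Y \<otimes> q)"
proof (rule epi_surj)
  note M = Hom_Obj(1)[OF q(1)] and N = Hom_Obj(2)[OF q(1)]
  show Yq: "idn Y \<otimes> q \<in> Hom C (Y \<boxtimes> M) (Y \<boxtimes> N)" by (rule id_tensor_Hom[OF Y q(1)])
  obtain Y' e c where Y': "Y' \<in> Obj C" and d: "is_left_dual C Y' Y e c" using right_rigid[OF Y] by blast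
  note e = dual_facts(2)[OF Y' d] and c = dual_facts(3)[OF Y' d]
  let ?t = "\<lambda>a. (idn Y' \<otimes> a) \<cdot> (c \<otimes> idn N)"
  have cN: "c \<otimes> idn N \<in> Hom C N (Y' \<boxtimes> (Y \<boxtimes> N))"
    using coev_tensor_id_Hom[OF N c] unfolding assoc_Obj[OF Y' Y N] .
  have cM: "c \<otimes> idn M \<in> Hom C M (Y' \<boxtimes> (Y \<boxtimes> M))"
    using coev_tensor_id_Hom[OF M c] unfolding assoc_Obj[OF Y' Y M] .
  have tH: "?t a \<in> Hom C N (Y' \<boxtimes> Q)" if a: "a \<in> Hom C (Y \<boxtimes> N) Q" for a Q
    by (rule comp_Hom[OF cN id_tensor_Hom[OF Y' a]])
  have tq: "?t a \<cdot> q = (idn Y' \<otimes> (a \<cdot> (idn Y \<otimes> q))) \<cdot> (c \<otimes> idn M)" if a: "a \<in> Hom C (Y \<boxtimes> N) Q" for a Q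
  proof -
    have "?t a \<cdot> q = (idn Y' \<otimes> a) \<cdot> ((c \<otimes> idn N) \<cdot> q)"
      by (rule comp_assoc[symmetric, OF q(1) cN id_tensor_Hom[OF Y' a]])
    also have "(c \<otimes> idn N) \<cdot> q = (idn Y' \<otimes> (idn Y \<otimes> q)) \<cdot> (c \<otimes> idn M)"
      unfolding coev_id_slide[OF q(1) c, symmetric] id_id_tensor[OF Y' Y Hom_Arr[OF q(1)]] ..
    also have "(idn Y' \<otimes> a) \<cdot> \<dots> = (idn Y' \<otimes> a) \<cdot> (idn Y' \<otimes> (idn Y \<otimes> q)) \<cdot> (c \<otimes> idn M)"
      by (rule comp_assoc[OF cM id_tensor_Hom[OF Y' Yq] id_tensor_Hom[OF Y' a]])
    finally show ?thesis unfolding id_tensor_comp[OF Yq a Y', symmetric] .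
  qed
  have inv: "a = (e \<otimes> idn Q) \<cdot> (idn Y \<otimes> ?t a)" if a: "a \<in> Hom C (Y \<boxtimes> N) Q" for a Q
  proof -
    note Q = Hom_Obj(2)[OF a]
    have eQ: "e \<otimes> idn Q \<in> Hom C (Y \<boxtimes> (Y' \<boxtimes> Q)) Q"
      using ev_tensor_id_Hom[OF Q e] unfolding assoc_Obj[OF Y Y' Q] .
    have eYN: "e \<otimes> idn (Y \<boxtimes> N) \<in> Hom C (Y \<boxtimes> (Y' \<boxtimes> (Y \<boxtimes> N))) (Y \<boxtimes> N)"
      using ev_tensor_id_Hom[OF tensor_Obj[OF Y N] e] unfolding assoc_Obj[OF Y Y' tensor_Obj[OF Y N]] .
    have YcN: "idn Y \<otimes> (c \<otimes> idn N) \<in> Hom C (Y \<boxtimes> N) (Y \<boxtimes> (Y' \<boxtimes> (Y \<boxtimes> N)))" by (rule id_tensor_Hom[OF Y cN])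
    have YYa: "idn Y \<otimes> (idn Y' \<otimes> a) \<in> Hom C (Y \<boxtimes> (Y' \<boxtimes> (Y \<boxtimes> N))) (Y \<boxtimes> (Y' \<boxtimes> Q))"
      by (rule id_tensor_Hom[OF Y id_tensor_Hom[OF Y' a]])
    have "(e \<otimes> idn Q) \<cdot> (idn Y \<otimes> ?t a) = (e \<otimes> idn Q) \<cdot> (idn Y \<otimes> (idn Y' \<otimes> a)) \<cdot> (idn Y \<otimes> (c \<otimes> idn N))"
      unfolding id_tensor_comp[OF cN id_tensor_Hom[OF Y' a] Y] by (rule comp_assoc[OF YcN YYa eQ])
    also have "(e \<otimes> idn Q) \<cdot> (idn Y \<otimes> (idn Y' \<otimes> a)) = a \<cdot> (e \<otimes> idn (Y \<boxtimes> N))"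
      unfolding id_id_tensor[OF Y Y' Hom_Arr[OF a]] by (rule ev_id_slide[OF a e])
    also have "\<dots> \<cdot> (idn Y \<otimes> (c \<otimes> idn N)) = a \<cdot> ((e \<otimes> idn (Y \<boxtimes> N)) \<cdot> (idn Y \<otimes> (c \<otimes> idn N)))"
      by (rule comp_assoc[symmetric, OF YcN eYN a])
    also have "(e \<otimes> idn (Y \<boxtimes> N)) \<cdot> (idn Y \<otimes> (c \<otimes> idn N)) = idn Y \<otimes> idn N"
    proof -
      have Yc: "idn Y \<otimes> c \<in> Hom C Y (Y \<boxtimes> Y' \<boxtimes> Y)"
        using id_tensor_coev_Hom[OF Y c] unfolding assoc_Obj[OF Y Y' Y] .
      then have "(e \<otimes> idn Y \<otimes> idn N) \<cdot> (idn Y \<otimes> c \<otimes> idn N) = idn Y \<otimes> idn N"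
        using comp_tensor_id[OF Yc ev_tensor_id_Hom[OF Y e] N] dual_facts(5)[OF Y' d] by simp
      then show ?thesis
        unfolding tensor_id_id[OF Y N Hom_Arr[OF e]] assoc_Arr[OF id_Arr[OF Y] Hom_Arr[OF c] id_Arr[OF N]] .
    qed
    finally show ?thesis unfolding tensor_id[OF Y N] comp_id[OF a] by (rule sym)
  qed
  fix Q a b assume a: "a \<in> Hom C (Y \<boxtimes> N) Q" and b: "b \<in> Hom C (Y \<boxtimes> N) Q" and eq: "a \<cdot> (idn Y \<otimes> q) = b \<cdot> (idn Y \<otimes> q)"
  have "?t a \<cdot> q = ?t b \<cdot> q" unfolding tq[OF a] tq[OF b] eq ..
  then have "?t a = ?t b" by (rule surj_arr_cancel[OF q tH[OF a] tH[OF b]])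
  then show "a = b" using inv[OF a] inv[OF b] by simp
qed

text \<open>A tensor category is semisimple as soon as its unit object is projective, because \<open>N' \<boxtimes> -\<close>
  reduces splitting an epimorphism onto \<open>N\<close> to lifting the coevaluation \<open>\<one> \<rightarrow> N' \<boxtimes> N\<close>.\<close>

lemma unit_projective_semisimple:
  assumes lift: "\<And>M N q f. q \<in> Hom C M N \<Longrightarrow> surj_arr q \<Longrightarrow> f \<in> Hom C \<one> N \<Longrightarrow> \<exists>l \<in> Hom C \<one> M. q \<cdot> l = f"
  shows "semisimple C"
proof (rule split_surj_semisimple)
  fix M N q assume q: "q \<in> Hom C M N" "surj_arr q"
  note M = Hom_Obj(1)[OF q(1)] and N = Hom_Obj(2)[OF q(1)]
  \<comment> \<open>\<open>N\<close> is a left dual of \<open>N'\<close>, so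
    \<open>c : \<one> \<rightarrow> N' \<boxtimes> N\<close> is lifted along
    \<open>idn N' \<otimes> q\<close>. Transposing the lift back with \<open>e\<close> gives the
    section, as transposing \<open>c\<close> itself gives the identity of \<open>N\<close>.\<close>
  obtain N' e c where N': "N' \<in> Obj C" and d: "is_left_dual C N' N e c" using right_rigid[OF N] by blast
  note e = dual_facts(2)[OF N' d] and c = dual_facts(3)[OF N' d]
  have N'q: "idn N' \<otimes> q \<in> Hom C (N' \<boxtimes> M) (N' \<boxtimes> N)" by (rule id_tensor_Hom[OF N' q(1)])
  obtain l where l: "l \<in> Hom C \<one> (N' \<boxtimes> M)" and ql: "(idn N' \<otimes> q) \<cdot> l = c"
    using lift[OF N'q tensor_surj_arr[OF N' q] c] by blast
  have Nl: "idn N \<otimes> l \<in> Hom C N (N \<boxtimes> (N' \<boxtimes> M))" by (rule id_tensor_coev_Hom[OF N l])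
  have eM: "e \<otimes> idn M \<in> Hom C (N \<boxtimes> (N' \<boxtimes> M)) M"
    using ev_tensor_id_Hom[OF M e] unfolding assoc_Obj[OF N N' M] .
  have eN: "e \<otimes> idn N \<in> Hom C (N \<boxtimes> (N' \<boxtimes> N)) N"
    using ev_tensor_id_Hom[OF N e] unfolding assoc_Obj[OF N N' N] .
  have NNq: "idn N \<otimes> (idn N' \<otimes> q) \<in> Hom C (N \<boxtimes> (N' \<boxtimes> M)) (N \<boxtimes> (N' \<boxtimes> N))" by (rule id_tensor_Hom[OF N N'q])
  have "q \<cdot> ((e \<otimes> idn M) \<cdot> (idn N \<otimes> l)) = q \<cdot> (e \<otimes> idn M) \<cdot> (idn N \<otimes> l)" by (rule comp_assoc[OF Nl eM q(1)])
  also have "q \<cdot> (e \<otimes> idn M) = (e \<otimes> idn N) \<cdot> (idn N \<otimes> (idn N' \<otimes> q))"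
    unfolding id_id_tensor[OF N N' Hom_Arr[OF q(1)]] by (rule ev_id_slide[symmetric, OF q(1) e])
  also have "\<dots> \<cdot> (idn N \<otimes> l) = (e \<otimes> idn N) \<cdot> ((idn N \<otimes> (idn N' \<otimes> q)) \<cdot> (idn N \<otimes> l))"
    by (rule comp_assoc[symmetric, OF Nl NNq eN])
  also have "\<dots> = idn N"
    unfolding id_tensor_comp[OF l N'q N, symmetric] ql by (rule dual_facts(5)[OF N' d])
  finally show "\<exists>s \<in> Hom C N M. q \<cdot> s = idn N" using comp_Hom[OF Nl eM] by blast
qed

text \<open>The algebra acts irreducibly on a simple object, because \<open>el S x\<close> is
  surjective for nonzero \<open>x\<close>. A rank one operator \<open>act S a\<close> is then
  realised by precomposition: the endomorphism \<open>b\<close> of \<open>G\<close> sends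
  \<open>\<iota>\<close> to \<open>a \<iota>\<close>, so \<open>el S y \<cdot> b\<close> is the
  arrow of the vector \<open>a y\<close>.\<close>

lemma simple_rank_one:
  assumes S: "simple_object C S" and x: "x \<in> carrier_vec (dim S)" "x \<noteq> 0\<^sub>v (dim S)" and s: "s \<in> carrier_vec (dim S)"
  obtains b \<sigma> where "b \<in> Hom C G G" "\<sigma> \<in> carrier_vec (dim S)" "\<sigma> \<bullet> x = 1"
    "\<And>y. y \<in> carrier_vec (dim S) \<Longrightarrow> el S y \<cdot> b = (\<sigma> \<bullet> y) \<star> el S s"
proof -
  have SO: "S \<in> Obj C" using S by (simp add: simple_object_def)
  note aS = act[OF SO]
  let ?\<A> = "act S ` acarrier A"
  obtain M \<sigma> where M: "M \<in> ?\<A>" and \<sigma>: "\<sigma> \<in> carrier_vec (dim S)" "\<sigma> \<bullet> x = 1"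
    and My: "\<And>y. y \<in> carrier_vec (dim S) \<Longrightarrow> M *\<^sub>v y = (\<sigma> \<bullet> y) \<cdot>\<^sub>v s"
  proof (rule irreducible_rank_one[OF _ _ _ _ _ x s])
    show "?\<A> \<subseteq> carrier_mat (dim S) (dim S)" using aS(1) by blast
    show "M * N \<in> ?\<A>" if "M \<in> ?\<A>" "N \<in> ?\<A>" for M N
      using that by (auto simp: aS(3)[symmetric] alg)
    show "M + N \<in> ?\<A>" if "M \<in> ?\<A>" "N \<in> ?\<A>" for M N
      using that by (auto simp: aS(4)[symmetric])
    show "c \<cdot>\<^sub>m M \<in> ?\<A>" if "M \<in> ?\<A>" for c M
      using that by (auto simp: aS(5)[symmetric])
    show "\<exists>M \<in> ?\<A>. M *\<^sub>v x = y"
      if x: "x \<in> carrier_vec (dim S)" "x \<noteq> 0\<^sub>v (dim S)" and y: "y \<in> carrier_vec (dim S)" for x y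
    proof -
      note g = el[OF SO x(1)]
      have "surj_arr (el S x)" by (rule simple_surj[OF S g(1) el_nonzero[OF SO x]])
      then obtain z where z: "z \<in> carrier_vec (dim G)" and zy: "U (el S x) *\<^sub>v z = y"
        using y unfolding surj_arr_def Hom_Src_Tgt[OF g(1)] by blast
      obtain a where a: "a \<in> acarrier A" and az: "act G a *\<^sub>v \<iota> = z" using G_cyclic[OF z] by blast
      have "y = (U (el S x) * act G a) *\<^sub>v \<iota>"
        unfolding assoc_mult_mat_vec[OF U_carrier[OF g(1)] act(1)[OF G_Obj a] \<iota>] az zy ..
      also have "\<dots> = act S a *\<^sub>v x"
        unfolding U_act[OF g(1) a] assoc_mult_mat_vec[OF aS(1)[OF a] U_carrier[OF g(1)] \<iota>] g(2) ..
      finally show ?thesis using a by blast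
    qed
  qed auto
  obtain a where a: "a \<in> acarrier A" and Ma: "M = act S a" using M by blast
  have a\<iota>: "act G a *\<^sub>v \<iota> \<in> carrier_vec (dim G)" using mult_mat_vec_carrier[OF act(1)[OF G_Obj a] \<iota>] .
  define b where "b = el G (act G a *\<^sub>v \<iota>)"
  have b: "b \<in> Hom C G G" unfolding b_def by (rule el(1)[OF G_Obj a\<iota>])
  have "el S y \<cdot> b = (\<sigma> \<bullet> y) \<star> el S s" if y: "y \<in> carrier_vec (dim S)" for y
  proof -
    note g = el[OF SO y]
    have "U (el S y) *\<^sub>v (act G a *\<^sub>v \<iota>) = M *\<^sub>v y"
      unfolding assoc_mult_mat_vec[OF U_carrier[OF g(1)] act(1)[OF G_Obj a] \<iota>, symmetric] U_act[OF g(1) a]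
        assoc_mult_mat_vec[OF aS(1)[OF a] U_carrier[OF g(1)] \<iota>] g(2) Ma ..
    then show ?thesis unfolding b_def comp_el[OF g(1) a\<iota>] My[OF y] using el_scale[OF SO s] by simp
  qed
  then show ?thesis using that[OF b \<sigma>] by blast
qed

section \<open>Functionals as forms with values in the unit object, and the canonical action\<close>

context
  fixes J e c
  assumes dual: "is_left_dual C I J e c"
begin

lemmas J = dual_facts(1)[OF I_Obj dual] and e = dual_facts(2)[OF I_Obj dual] and c = dual_facts(3)[OF I_Obj dual]

text \<open>The functional \<xi>, seen as an arrow \<open>X \<rightarrow> I\<close> and transposed
  along the dual \<open>J\<close> of \<open>I\<close>. With the unit object as target,
  \<open>el X x \<otimes> coev_form X \<xi>\<close> ends in \<open>X\<close> itself.\<close>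

definition coev_form :: "'o \<Rightarrow> 'k vec \<Rightarrow> 'm" where
  "coev_form X \<xi> = e \<cdot> (idn J \<otimes> coel X \<xi>)"

lemma coev_form_Hom:
  assumes "X \<in> Obj C" "\<xi> \<in> carrier_vec (dim X)"
  shows "coev_form X \<xi> \<in> Hom C (J \<boxtimes> X) \<one>"
  unfolding coev_form_def by (rule comp_Hom[OF id_tensor_Hom[OF J coel(1)[OF assms]] e])

lemma coev_form_plus:
  assumes X: "X \<in> Obj C" and x: "\<xi> \<in> carrier_vec (dim X)" and y: "\<eta> \<in> carrier_vec (dim X)"
  shows "coev_form X (\<xi> + \<eta>) = coev_form X \<xi> \<oplus>\<^sub>a coev_form X \<eta>"
  unfolding coev_form_def coel_plus[OF X x y] tensor_plus_right[OF id_Hom[OF J] coel(1)[OF X x] coel(1)[OF X y]]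
  by (rule comp_plus[OF id_tensor_Hom[OF J coel(1)[OF X x]] id_tensor_Hom[OF J coel(1)[OF X y]] e])

lemma coev_form_scale:
  assumes X: "X \<in> Obj C" and x: "\<xi> \<in> carrier_vec (dim X)"
  shows "coev_form X (t \<cdot>\<^sub>v \<xi>) = t \<star> coev_form X \<xi>"
  unfolding coev_form_def coel_scale[OF X x] tensor_scale_right[OF id_Arr[OF J] Hom_Arr[OF coel(1)[OF X x]]]
  by (rule comp_scale[OF id_tensor_Hom[OF J coel(1)[OF X x]] e])

lemma coev_form_comp:
  assumes f: "f \<in> Hom C X Y" and x: "\<xi> \<in> carrier_vec (dim Y)"
  shows "coev_form Y \<xi> \<cdot> (idn J \<otimes> f) = coev_form X ((U f)\<^sup>T *\<^sub>v \<xi>)"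
  unfolding coev_form_def coel_comp[OF f x, symmetric] id_tensor_comp[OF f coel(1)[OF Hom_Obj(2)[OF f] x] J]
  by (rule comp_assoc[symmetric, OF id_tensor_Hom[OF J f] id_tensor_Hom[OF J coel(1)[OF Hom_Obj(2)[OF f] x]] e])

text \<open>Transposing back with \<open>c\<close> recovers \<open>coel X \<xi>\<close> from the
  form, so a zero form comes from the zero functional.\<close>

lemma coev_form_nonzero:
  assumes X: "X \<in> Obj C" and x: "\<xi> \<in> carrier_vec (dim X)" "\<xi> \<noteq> 0\<^sub>v (dim X)"
  shows "coev_form X \<xi> \<noteq> Zero C (J \<boxtimes> X) \<one>"
proof
  assume 0: "coev_form X \<xi> = Zero C (J \<boxtimes> X) \<one>"
  note h = coel(1)[OF X x(1)]
  have JIX: "I \<boxtimes> (J \<boxtimes> X) \<in> Obj C" by (intro tensor_Obj I_Obj J X)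
  have cX: "c \<otimes> idn X \<in> Hom C X (I \<boxtimes> (J \<boxtimes> X))"
    using coev_tensor_id_Hom[OF X c] unfolding assoc_Obj[OF I_Obj J X] .
  have cI: "c \<otimes> idn I \<in> Hom C I (I \<boxtimes> (J \<boxtimes> I))"
    using coev_tensor_id_Hom[OF I_Obj c] unfolding assoc_Obj[OF I_Obj J I_Obj] .
  have Jh: "idn J \<otimes> coel X \<xi> \<in> Hom C (J \<boxtimes> X) (J \<boxtimes> I)" by (rule id_tensor_Hom[OF J h])
  have "(idn I \<otimes> coev_form X \<xi>) \<cdot> (c \<otimes> idn X)
      = (idn I \<otimes> e) \<cdot> ((idn I \<otimes> (idn J \<otimes> coel X \<xi>)) \<cdot> (c \<otimes> idn X))"
    unfolding coev_form_def id_tensor_comp[OF Jh e I_Obj]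
    by (rule comp_assoc[symmetric, OF cX id_tensor_Hom[OF I_Obj Jh] id_tensor_ev_Hom[OF I_Obj e]])
  also have "(idn I \<otimes> (idn J \<otimes> coel X \<xi>)) \<cdot> (c \<otimes> idn X) = (c \<otimes> idn I) \<cdot> coel X \<xi>"
    unfolding id_id_tensor[OF I_Obj J Hom_Arr[OF h]] by (rule coev_id_slide[OF h c])
  also have "(idn I \<otimes> e) \<cdot> \<dots> = (idn I \<otimes> e) \<cdot> (c \<otimes> idn I) \<cdot> coel X \<xi>"
    by (rule comp_assoc[OF h cI id_tensor_ev_Hom[OF I_Obj e]])
  also have "\<dots> = coel X \<xi>" unfolding dual_facts(4)[OF I_Obj dual] by (rule id_comp[OF h])
  also have "(idn I \<otimes> coev_form X \<xi>) \<cdot> (c \<otimes> idn X) = Zero C X I"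
    unfolding 0 tensor_zero[OF tensor_Obj[OF J X] unit_Obj id_Hom[OF I_Obj]] unit_Obj_right[OF I_Obj]
    by (rule zero_comp[OF cX I_Obj])
  finally have "coel X \<xi> = Zero C X I" by (rule sym)
  then have "\<xi> = (U (Zero C X I))\<^sup>T *\<^sub>v \<kappa>" using coel(2)[OF X x(1)] by simp
  also have "\<dots> = 0\<^sub>v (dim X)" unfolding U_zero[OF X I_Obj] using zero_mat_mult_vec[OF \<kappa>, of "dim X"] by simp
  finally show False using x(2) by simp
qed

text \<open>The canonical element \<open>\<Sum>\<^sub>j e\<^sub>j \<otimes> e\<^sub>j\<^sup>*\<close> of \<open>U X \<otimes> (U X)\<^sup>*\<close>, read as an arrow
  \<open>G \<boxtimes> I\<^sup>* \<boxtimes> X \<rightarrow> X\<close>. It is natural in \<open>X\<close> because the canonical element does not depend on the basis.\<close>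

definition basis_action :: "'o \<Rightarrow> 'm" where
  "basis_action X = sum_arr (G \<boxtimes> (J \<boxtimes> X)) X (\<lambda>j. el X (unit_vec (dim X) j) \<otimes> coev_form X (unit_vec (dim X) j)) [0..<dim X]"

lemma el_coev_Hom:
  assumes X: "X \<in> Obj C" and x: "x \<in> carrier_vec (dim X)" and Y: "Y \<in> Obj C" and y: "\<xi> \<in> carrier_vec (dim Y)"
  shows "el X x \<otimes> coev_form Y \<xi> \<in> Hom C (G \<boxtimes> (J \<boxtimes> Y)) X"
  using tensor_Hom[OF el(1)[OF X x] coev_form_Hom[OF Y y]] unfolding unit_Obj_right[OF X] .

lemma basis_action_Hom:
  assumes X: "X \<in> Obj C"
  shows "basis_action X \<in> Hom C (G \<boxtimes> (J \<boxtimes> X)) X"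
  unfolding basis_action_def
  by (intro sum_arr_Hom el_coev_Hom X tensor_Obj G_Obj J) simp_all

text \<open>Both sides expand to the sum of
  \<open>M $$ (i, j) * \<beta> (unit_vec m i) (unit_vec n j)\<close>. This is the scalar form of the
  basis independence of the canonical element.\<close>

lemma trace_transpose:
  fixes \<beta> :: "'k vec \<Rightarrow> 'k vec \<Rightarrow> 'k"
  assumes lin1: "\<And>x y \<xi>. x \<in> carrier_vec m \<Longrightarrow> y \<in> carrier_vec m \<Longrightarrow> \<xi> \<in> carrier_vec n \<Longrightarrow> \<beta> (x + y) \<xi> = \<beta> x \<xi> + \<beta> y \<xi>"
      "\<And>t x \<xi>. x \<in> carrier_vec m \<Longrightarrow> \<xi> \<in> carrier_vec n \<Longrightarrow> \<beta> (t \<cdot>\<^sub>v x) \<xi> = t * \<beta> x \<xi>"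
    and lin2: "\<And>x \<xi> \<eta>. x \<in> carrier_vec m \<Longrightarrow> \<xi> \<in> carrier_vec n \<Longrightarrow> \<eta> \<in> carrier_vec n \<Longrightarrow> \<beta> x (\<xi> + \<eta>) = \<beta> x \<xi> + \<beta> x \<eta>"
      "\<And>t x \<xi>. x \<in> carrier_vec m \<Longrightarrow> \<xi> \<in> carrier_vec n \<Longrightarrow> \<beta> x (t \<cdot>\<^sub>v \<xi>) = t * \<beta> x \<xi>"
    and M: "M \<in> carrier_mat m n"
  shows "(\<Sum>j<n. \<beta> (M *\<^sub>v unit_vec n j) (unit_vec n j)) = (\<Sum>i<m. \<beta> (unit_vec m i) (M\<^sup>T *\<^sub>v unit_vec m i))"
proof -
  have MT: "M\<^sup>T \<in> carrier_mat n m" using M by simp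
  have "\<beta> (M *\<^sub>v unit_vec n j) (unit_vec n j) = (\<Sum>i<m. M $$ (i, j) * \<beta> (unit_vec m i) (unit_vec n j))" if j: "j < n" for j
  proof -
    have "M *\<^sub>v unit_vec n j \<in> carrier_vec m" using M by simp
    then have "\<beta> (M *\<^sub>v unit_vec n j) (unit_vec n j) = (\<Sum>i<m. (M *\<^sub>v unit_vec n j) $ i * \<beta> (unit_vec m i) (unit_vec n j))"
      by (intro linear_functional_sum[of m "\<lambda>x. \<beta> x (unit_vec n j)"]) (simp_all add: lin1)
    then show ?thesis using M j by (simp add: mult_mat_unit_vec[OF M j])
  qed
  moreover have "\<beta> (unit_vec m i) (M\<^sup>T *\<^sub>v unit_vec m i) = (\<Sum>j<n. M $$ (i, j) * \<beta> (unit_vec m i) (unit_vec n j))" if i: "i < m" for i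
  proof -
    have "M\<^sup>T *\<^sub>v unit_vec m i \<in> carrier_vec n" using MT by simp
    then have "\<beta> (unit_vec m i) (M\<^sup>T *\<^sub>v unit_vec m i) = (\<Sum>j<n. (M\<^sup>T *\<^sub>v unit_vec m i) $ j * \<beta> (unit_vec m i) (unit_vec n j))"
      by (intro linear_functional_sum[of n "\<beta> (unit_vec m i)"]) (simp_all add: lin2)
    then show ?thesis using M i by (simp add: mult_mat_unit_vec[OF MT i])
  qed
  ultimately show ?thesis by (simp add: sum.swap[of _ "{..<n}"])
qed

text \<open>Composition with \<open>f\<close> on the target applies \<open>U f\<close> to the
  vectors, and on the source it applies the transpose of \<open>U f\<close> to the
  functionals.\<close>

lemma basis_action_natural:
  assumes f: "f \<in> Hom C X Y"
  shows "f \<cdot> basis_action X = basis_action Y \<cdot> (idn G \<otimes> (idn J \<otimes> f))"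
proof -
  note X = Hom_Obj(1)[OF f] and Y = Hom_Obj(2)[OF f]
  let ?W = "G \<boxtimes> (J \<boxtimes> X)" and ?eX = "unit_vec (dim X)" and ?eY = "unit_vec (dim Y)"
  have W: "?W \<in> Obj C" by (intro tensor_Obj G_Obj J X)
  let ?B = "\<lambda>x \<xi>. el Y x \<otimes> coev_form X \<xi>"
  have B: "?B x \<xi> \<in> Hom C ?W Y" if "x \<in> carrier_vec (dim Y)" "\<xi> \<in> carrier_vec (dim X)" for x \<xi>
    by (rule el_coev_Hom[OF Y that(1) X that(2)])
  note Jf = id_tensor_Hom[OF J f]
  have 1: "f \<cdot> basis_action X = sum_arr ?W Y (\<lambda>j. ?B (U f *\<^sub>v ?eX j) (?eX j)) [0..<dim X]"
  proof -
    have "f \<cdot> basis_action X = sum_arr ?W Y (\<lambda>j. f \<cdot> (el X (?eX j) \<otimes> coev_form X (?eX j))) [0..<dim X]"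
      unfolding basis_action_def by (rule comp_sum_arr[OF W f]) (simp add: el_coev_Hom X)
    also have "\<dots> = sum_arr ?W Y (\<lambda>j. ?B (U f *\<^sub>v ?eX j) (?eX j)) [0..<dim X]"
    proof (rule sum_arr_cong)
      fix j assume "j \<in> set [0..<dim X]"
      have u: "?eX j \<in> carrier_vec (dim X)" by simp
      show "f \<cdot> (el X (?eX j) \<otimes> coev_form X (?eX j)) = ?B (U f *\<^sub>v ?eX j) (?eX j)"
        using tensor_comp[OF el(1)[OF X u] f coev_form_Hom[OF X u] id_Hom[OF unit_Obj]]
        unfolding id_comp[OF coev_form_Hom[OF X u]] unit_Arr_right[OF Hom_Arr[OF f]] comp_el[OF f u] by (rule sym)
    qed
    finally show ?thesis .
  qed
  have 2: "basis_action Y \<cdot> (idn G \<otimes> (idn J \<otimes> f)) = sum_arr ?W Y (\<lambda>i. ?B (?eY i) ((U f)\<^sup>T *\<^sub>v ?eY i)) [0..<dim Y]"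
  proof -
    have "basis_action Y \<cdot> (idn G \<otimes> (idn J \<otimes> f))
        = sum_arr ?W Y (\<lambda>i. (el Y (?eY i) \<otimes> coev_form Y (?eY i)) \<cdot> (idn G \<otimes> (idn J \<otimes> f))) [0..<dim Y]"
      unfolding basis_action_def by (rule sum_arr_comp[OF Y id_tensor_Hom[OF G_Obj Jf]]) (simp add: el_coev_Hom Y)
    also have "\<dots> = sum_arr ?W Y (\<lambda>i. ?B (?eY i) ((U f)\<^sup>T *\<^sub>v ?eY i)) [0..<dim Y]"
    proof (rule sum_arr_cong)
      fix i assume "i \<in> set [0..<dim Y]"
      have u: "?eY i \<in> carrier_vec (dim Y)" by simp
      show "(el Y (?eY i) \<otimes> coev_form Y (?eY i)) \<cdot> (idn G \<otimes> (idn J \<otimes> f)) = ?B (?eY i) ((U f)\<^sup>T *\<^sub>v ?eY i)"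
        unfolding tensor_comp[symmetric, OF id_Hom[OF G_Obj] el(1)[OF Y u] Jf coev_form_Hom[OF Y u]]
          comp_id[OF el(1)[OF Y u]] coev_form_comp[OF f u] ..
    qed
    finally show ?thesis .
  qed
  have c1: "U f *\<^sub>v ?eX j \<in> carrier_vec (dim Y)" for j by (rule U_vec[OF f]) simp
  have c2: "(U f)\<^sup>T *\<^sub>v ?eY i \<in> carrier_vec (dim X)" for i by (rule UT_vec[OF f]) simp
  have s1: "sum_arr ?W Y (\<lambda>j. ?B (U f *\<^sub>v ?eX j) (?eX j)) [0..<dim X] \<in> Hom C ?W Y"
    by (intro sum_arr_Hom W Y B c1) simp
  have s2: "sum_arr ?W Y (\<lambda>i. ?B (?eY i) ((U f)\<^sup>T *\<^sub>v ?eY i)) [0..<dim Y] \<in> Hom C ?W Y"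
    by (intro sum_arr_Hom W Y B c2) simp
  show ?thesis unfolding 1 2
  proof (rule U_faithful[OF s1 s2], rule eq_matI)
    fix p q assume "p < dim_row (U (sum_arr ?W Y (\<lambda>i. ?B (?eY i) ((U f)\<^sup>T *\<^sub>v ?eY i)) [0..<dim Y]))"
      "q < dim_col (U (sum_arr ?W Y (\<lambda>i. ?B (?eY i) ((U f)\<^sup>T *\<^sub>v ?eY i)) [0..<dim Y]))"
    then have pq: "p < dim Y" "q < dim ?W" using U_carrier[OF s2] by simp_all
    \<comment> \<open>Taking one matrix entry at a time turns the arrow-valued pairing of vectors
      and functionals into a scalar bilinear form.\<close>
    define \<beta> where "\<beta> = (\<lambda>x \<xi>. U (?B x \<xi>) $$ (p, q))"
    have plus: "U (a \<oplus>\<^sub>a b) $$ (p, q) = U a $$ (p, q) + U b $$ (p, q)" if "a \<in> Hom C ?W Y" "b \<in> Hom C ?W Y" for a b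
      using U_plus[OF that] U_carrier[OF that(2)] pq by simp
    have scale: "U (t \<star> a) $$ (p, q) = t * U a $$ (p, q)" if "a \<in> Hom C ?W Y" for a t
      using U_scale[OF that] U_carrier[OF that] pq by simp
    have "(\<Sum>j<dim X. \<beta> (U f *\<^sub>v ?eX j) (?eX j)) = (\<Sum>i<dim Y. \<beta> (?eY i) ((U f)\<^sup>T *\<^sub>v ?eY i))"
    proof (rule trace_transpose[OF _ _ _ _ U_carrier[OF f]])
      fix x \<xi> :: "'k vec" assume x: "x \<in> carrier_vec (dim Y)" and \<xi>: "\<xi> \<in> carrier_vec (dim X)"
      note ex = el(1)[OF Y x] and f\<xi> = coev_form_Hom[OF X \<xi>]
      show "\<beta> (t \<cdot>\<^sub>v x) \<xi> = t * \<beta> x \<xi>" for t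
        unfolding \<beta>_def el_scale[OF Y x] tensor_scale_left[OF Hom_Arr[OF ex] Hom_Arr[OF f\<xi>]] by (rule scale[OF B[OF x \<xi>]])
      show "\<beta> x (t \<cdot>\<^sub>v \<xi>) = t * \<beta> x \<xi>" for t
        unfolding \<beta>_def coev_form_scale[OF X \<xi>] tensor_scale_right[OF Hom_Arr[OF ex] Hom_Arr[OF f\<xi>]] by (rule scale[OF B[OF x \<xi>]])
      show "\<beta> (x + y) \<xi> = \<beta> x \<xi> + \<beta> y \<xi>" if y: "y \<in> carrier_vec (dim Y)" for y
        unfolding \<beta>_def el_plus[OF Y x y] tensor_plus_left[OF ex el(1)[OF Y y] f\<xi>] by (rule plus[OF B[OF x \<xi>] B[OF y \<xi>]])
      show "\<beta> x (\<xi> + \<eta>) = \<beta> x \<xi> + \<beta> x \<eta>" if y: "\<eta> \<in> carrier_vec (dim X)" for \<eta>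
        unfolding \<beta>_def coev_form_plus[OF X \<xi> y] tensor_plus_right[OF ex f\<xi> coev_form_Hom[OF X y]]
        by (rule plus[OF B[OF x \<xi>] B[OF x y]])
    qed
    moreover have "U (sum_arr ?W Y (\<lambda>j. ?B (U f *\<^sub>v ?eX j) (?eX j)) [0..<dim X]) $$ (p, q) = (\<Sum>j<dim X. \<beta> (U f *\<^sub>v ?eX j) (?eX j))"
      unfolding \<beta>_def using U_sum_arr[OF W Y B[OF c1] pq, of "[0..<dim X]" ?eX] by (simp add: interv_sum_list_conv_sum_set_nat atLeast0LessThan)
    moreover have "U (sum_arr ?W Y (\<lambda>i. ?B (?eY i) ((U f)\<^sup>T *\<^sub>v ?eY i)) [0..<dim Y]) $$ (p, q) = (\<Sum>i<dim Y. \<beta> (?eY i) ((U f)\<^sup>T *\<^sub>v ?eY i))"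
      unfolding \<beta>_def using U_sum_arr[OF W Y B[OF _ c2] pq, of "[0..<dim Y]" ?eY] by (simp add: interv_sum_list_conv_sum_set_nat atLeast0LessThan)
    ultimately show "U (sum_arr ?W Y (\<lambda>j. ?B (U f *\<^sub>v ?eX j) (?eX j)) [0..<dim X]) $$ (p, q)
      = U (sum_arr ?W Y (\<lambda>i. ?B (?eY i) ((U f)\<^sup>T *\<^sub>v ?eY i)) [0..<dim Y]) $$ (p, q)" by simp
  qed (use U_carrier[OF s1] U_carrier[OF s2] in simp_all)
qed

end

lemma unit_dim_pos: "0 < dim \<one>"
  using simple_unit zero_object_dim[OF unit_Obj] unfolding simple_object_def by simp

text \<open>The forms of the basis functionals are linearly independent with arrows
  \<open>f j\<close> as coefficients, although \<open>U\<close> does not respect tensor products. A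
  rank one endomorphism of \<open>G\<close> makes all forms proportional to one arrow
  \<open>el \<one> y\<close>, which reduces the relation to a scalar combination \<open>h\<close> of
  the \<open>f j\<close>; the scalars are arranged so that a coordinate of \<open>h\<close> is
  1.\<close>

lemma coev_form_independent:
  assumes dual: "is_left_dual C I J e c" and X: "X \<in> Obj C" and Y: "Y \<in> Obj C"
    and f: "\<And>j. j < dim X \<Longrightarrow> f j \<in> Hom C G Y"
    and sum: "sum_arr (G \<boxtimes> (J \<boxtimes> X)) Y (\<lambda>j. f j \<otimes> coev_form J e X (unit_vec (dim X) j)) [0..<dim X] = Zero C (G \<boxtimes> (J \<boxtimes> X)) Y"
    and j: "j < dim X"
  shows "f j = Zero C G Y"
proof (rule ccontr)
  assume nz: "f j \<noteq> Zero C G Y"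
  note J = J[OF dual] and e = e[OF dual] and vH = coev_form_Hom[OF dual]
  note one = unit_Obj
  let ?V = "J \<boxtimes> X" and ?e = "unit_vec (dim X)"
  have V: "?V \<in> Obj C" by (rule tensor_Obj[OF J X])
  have W: "G \<boxtimes> ?V \<in> Obj C" by (rule tensor_Obj[OF G_Obj V])
  have u: "?e k \<in> carrier_vec (dim X)" for k by simp
  have "U (f j) *\<^sub>v \<iota> \<noteq> 0\<^sub>v (dim Y)"
  proof
    assume "U (f j) *\<^sub>v \<iota> = 0\<^sub>v (dim Y)"
    then have "f j = el Y (0\<^sub>v (dim Y))" using el_of[OF f[OF j]] by simp
    then show False using nz el_zero[OF Y] by simp
  qed
  then obtain p where p: "p < dim Y" and pj: "(U (f j) *\<^sub>v \<iota>) $ p \<noteq> 0"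
    using nonzero_vec_index[OF U_vec[OF f[OF j] \<iota>]] by blast
  \<comment> \<open>\<gamma> collects the \<open>p\<close>-th coordinates of the vectors represented
    by the \<open>f k\<close>. It is nonzero because of \<open>f j\<close>, and it is the functional
    that the rank one endomorphism has to detect.\<close>
  define \<gamma> where "\<gamma> = vec (dim X) (\<lambda>k. (U (f k) *\<^sub>v \<iota>) $ p)"
  have \<gamma>: "\<gamma> \<in> carrier_vec (dim X)" by (simp add: \<gamma>_def)
  have "\<gamma> \<noteq> 0\<^sub>v (dim X)"
  proof
    assume "\<gamma> = 0\<^sub>v (dim X)"
    then have "\<gamma> $ j = 0" using j by simp
    then show False using pj j by (simp add: \<gamma>_def)
  qed
  then have "coev_form J e X \<gamma> \<noteq> Zero C ?V \<one>" by (rule coev_form_nonzero[OF dual X \<gamma>])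
  then obtain w where w: "w \<in> carrier_vec (dim ?V)" and y0: "U (coev_form J e X \<gamma>) *\<^sub>v w \<noteq> 0\<^sub>v (dim \<one>)"
    by (rule nonzero_arr_vec[OF vH[OF X \<gamma>]])
  define y where "y = U (coev_form J e X \<gamma>) *\<^sub>v w"
  have y: "y \<in> carrier_vec (dim \<one>)" "y \<noteq> 0\<^sub>v (dim \<one>)" using y0 U_vec[OF vH[OF X \<gamma>] w] by (simp_all add: y_def)
  obtain b \<sigma> where b: "b \<in> Hom C G G" and \<sigma>: "\<sigma> \<in> carrier_vec (dim \<one>)" "\<sigma> \<bullet> y = 1"
    and by': "\<And>z. z \<in> carrier_vec (dim \<one>) \<Longrightarrow> el \<one> z \<cdot> b = (\<sigma> \<bullet> z) \<star> el \<one> y"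
    by (rule simple_rank_one[OF simple_unit y y(1)]) blast
  \<comment> \<open>\<phi> is the factor of proportionality: by \<open>by'\<close>, the form of
    \<xi> precomposed with \<open>el ?V w \<cdot> b\<close> is \<open>\<phi> \<xi>\<close> times
    \<open>el \<one> y\<close>. It is linear, and \<open>\<phi> \<gamma> = 1\<close> by the choice
    of \<sigma>.\<close>
  define \<phi> where "\<phi> \<xi> = \<sigma> \<bullet> (U (coev_form J e X \<xi>) *\<^sub>v w)" for \<xi>
  have g: "el \<one> y \<in> Hom C G \<one>" by (rule el(1)[OF one y(1)])
  have wb: "el ?V w \<cdot> b \<in> Hom C G ?V" by (rule comp_Hom[OF b el(1)[OF V w]])
  have vwb: "coev_form J e X \<xi> \<cdot> (el ?V w \<cdot> b) = \<phi> \<xi> \<star> el \<one> y" if \<xi>: "\<xi> \<in> carrier_vec (dim X)" for \<xi>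
    unfolding comp_assoc[OF b el(1)[OF V w] vH[OF X \<xi>]] comp_el[OF vH[OF X \<xi>] w] \<phi>_def
    by (rule by'[OF U_vec[OF vH[OF X \<xi>] w]])
  define h where "h = sum_arr G Y (\<lambda>k. \<phi> (?e k) \<star> f k) [0..<dim X]"
  have fk: "\<phi> (?e k) \<star> f k \<in> Hom C G Y" if "k \<in> set [0..<dim X]" for k using that scale_Hom[OF f] by simp
  have h: "h \<in> Hom C G Y" unfolding h_def by (intro sum_arr_Hom G_Obj Y fk)
  have Gwb: "idn G \<otimes> (el ?V w \<cdot> b) \<in> Hom C (G \<boxtimes> G) (G \<boxtimes> ?V)" by (rule id_tensor_Hom[OF G_Obj wb])
  have "Zero C (G \<boxtimes> G) Y = Zero C (G \<boxtimes> ?V) Y \<cdot> (idn G \<otimes> (el ?V w \<cdot> b))" by (rule zero_comp[symmetric, OF Gwb Y])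
  also have "\<dots> = sum_arr (G \<boxtimes> G) Y (\<lambda>k. (f k \<otimes> coev_form J e X (?e k)) \<cdot> (idn G \<otimes> (el ?V w \<cdot> b))) [0..<dim X]"
    unfolding sum[symmetric]
  proof (rule sum_arr_comp[OF Y Gwb])
    fix k assume "k \<in> set [0..<dim X]"
    then show "f k \<otimes> coev_form J e X (?e k) \<in> Hom C (G \<boxtimes> ?V) Y"
      using tensor_Hom[OF f vH[OF X u]] unit_Obj_right[OF Y] by simp
  qed
  also have "\<dots> = sum_arr (G \<boxtimes> G) Y (\<lambda>k. (\<phi> (?e k) \<star> f k) \<otimes> el \<one> y) [0..<dim X]"
  proof (rule sum_arr_cong)
    fix k assume "k \<in> set [0..<dim X]"
    then have fk: "f k \<in> Hom C G Y" using f by simp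
    show "(f k \<otimes> coev_form J e X (?e k)) \<cdot> (idn G \<otimes> (el ?V w \<cdot> b)) = (\<phi> (?e k) \<star> f k) \<otimes> el \<one> y"
      unfolding tensor_comp[symmetric, OF id_Hom[OF G_Obj] fk wb vH[OF X u]] comp_id[OF fk] vwb[OF u]
        tensor_scale_right[OF Hom_Arr[OF fk] Hom_Arr[OF g]] tensor_scale_left[OF Hom_Arr[OF fk] Hom_Arr[OF g]] ..
  qed
  also have "\<dots> = h \<otimes> el \<one> y"
    using sum_arr_tensor[OF G_Obj Y g, of "[0..<dim X]" "\<lambda>k. \<phi> (?e k) \<star> f k", OF fk]
    unfolding h_def unit_Obj_right[OF Y] by (rule sym)
  also have "\<dots> = h \<cdot> (idn G \<otimes> el \<one> y)"
    using tensor_split_left[OF h g] unfolding unit_Arr_right[OF Hom_Arr[OF h]] by (rule sym)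
  finally have "h \<cdot> (idn G \<otimes> el \<one> y) = Zero C G Y \<cdot> (idn G \<otimes> el \<one> y)"
    using zero_comp[OF id_tensor_ev_Hom[OF G_Obj g] Y] by simp
  \<comment> \<open>A nonzero arrow to the simple unit object is surjective and remains so after
    tensoring with \<open>G\<close>, so \<open>h \<otimes> el \<one> y = 0\<close> forces
    \<open>h = 0\<close>.\<close>
  moreover have "surj_arr (idn G \<otimes> el \<one> y)"
    by (rule tensor_surj_arr[OF G_Obj g simple_surj[OF simple_unit g el_nonzero[OF one y]]])
  ultimately have "h = Zero C G Y"
    using surj_arr_cancel[OF id_tensor_ev_Hom[OF G_Obj g] _ h zero_Hom[OF G_Obj Y]] by blast
  then have "(U h *\<^sub>v \<iota>) $ p = 0" using p by (simp add: U_zero[OF G_Obj Y] zero_mat_mult_vec[OF \<iota>])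
  moreover have "(U h *\<^sub>v \<iota>) $ p = 1"
  proof -
    have "U h $$ (p, q) = (\<Sum>k<dim X. \<phi> (?e k) * U (f k) $$ (p, q))" if q: "q < dim G" for q
    proof -
      have "U h $$ (p, q) = (\<Sum>k<dim X. U (\<phi> (?e k) \<star> f k) $$ (p, q))"
        unfolding h_def using U_sum_arr[OF G_Obj Y, of "[0..<dim X]" "\<lambda>k. \<phi> (?e k) \<star> f k", OF fk p q]
        by (simp add: interv_sum_list_conv_sum_set_nat atLeast0LessThan)
      also have "\<dots> = (\<Sum>k<dim X. \<phi> (?e k) * U (f k) $$ (p, q))"
      proof (rule sum.cong[OF refl])
        fix k assume "k \<in> {..<dim X}"
        then have "f k \<in> Hom C G Y" using f by simp
        then show "U (\<phi> (?e k) \<star> f k) $$ (p, q) = \<phi> (?e k) * U (f k) $$ (p, q)"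
          using U_carrier[of "f k" G Y] p q by (simp add: U_scale)
      qed
      finally show ?thesis .
    qed
    note entries = this
    have ent: "(U k *\<^sub>v \<iota>) $ p = (\<Sum>q<dim G. U k $$ (p, q) * \<iota> $ q)" if k: "k \<in> Hom C G Y" for k
      using U_carrier[OF k] p \<iota> by (simp add: scalar_prod_def lessThan_atLeast0)
    \<comment> \<open>Exchanging the two sums exhibits the coordinate of \<open>h\<close> as the
      expansion of \<open>\<phi> \<gamma>\<close> in the unit vectors.\<close>
    have "(U h *\<^sub>v \<iota>) $ p = (\<Sum>q<dim G. \<Sum>k<dim X. \<phi> (?e k) * (U (f k) $$ (p, q) * \<iota> $ q))"
      unfolding ent[OF h] by (intro sum.cong refl) (simp add: entries sum_distrib_right mult.assoc)
    also have "\<dots> = (\<Sum>k<dim X. \<phi> (?e k) * (U (f k) *\<^sub>v \<iota>) $ p)"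
      unfolding sum.swap[of _ "{..<dim X}"] by (intro sum.cong refl) (simp add: ent f sum_distrib_left)
    also have "\<dots> = (\<Sum>k<dim X. \<gamma> $ k * \<phi> (?e k))" by (intro sum.cong refl) (simp add: \<gamma>_def)
    also have "\<dots> = \<phi> \<gamma>"
    proof (rule linear_functional_sum[symmetric, OF _ _ \<gamma>])
      fix v :: "'k vec" assume v: "v \<in> carrier_vec (dim X)"
      note vv = U_carrier[OF vH[OF X v]] and uv = U_vec[OF vH[OF X v] w]
      show "\<phi> (t \<cdot>\<^sub>v v) = t * \<phi> v" for t
        unfolding \<phi>_def coev_form_scale[OF dual X v] U_scale[OF vH[OF X v]] smult_mat_mult_vec[OF vv w]
        using \<sigma>(1) uv by simp
      fix v' :: "'k vec" assume v': "v' \<in> carrier_vec (dim X)"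
      show "\<phi> (v + v') = \<phi> v + \<phi> v'"
        unfolding \<phi>_def coev_form_plus[OF dual X v v'] U_plus[OF vH[OF X v] vH[OF X v']]
          add_mult_distrib_mat_vec[OF vv U_carrier[OF vH[OF X v']] w]
        by (rule scalar_prod_add_distrib[OF \<sigma>(1) uv U_vec[OF vH[OF X v'] w]])
    qed
    also have "\<dots> = 1" unfolding \<phi>_def y_def[symmetric] by (rule \<sigma>(2))
    finally show ?thesis .
  qed
  ultimately show False by simp
qed

text \<open>An integral with invertible counit amounts to a natural endomorphism \<open>l\<close> of the identity
  with \<open>l \<one> = id\<close> through which every natural action \<open>t\<close> becomes trivial. Testing this on the
  canonical action shows that \<open>l\<close> kills the annihilator of the unit object, whence \<open>\<one>\<close> is a
  direct summand of the projective object \<open>G\<close>.\<close>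

lemma trivializing_endomorphism_semisimple:
  assumes l: "\<And>X. X \<in> Obj C \<Longrightarrow> l X \<in> Hom C X X" and nat: "\<And>X Y f. f \<in> Hom C X Y \<Longrightarrow> f \<cdot> l X = l Y \<cdot> f"
    and l1: "l \<one> = idn \<one>"
    and triv: "\<And>W t X. natural_action \<one> W t \<Longrightarrow> X \<in> Obj C \<Longrightarrow> l X \<cdot> t X = t \<one> \<otimes> l X"
  shows "semisimple C"
proof -
  note one = unit_Obj and G = G_Obj
  obtain J e c where dual: "is_left_dual C I J e c" using left_rigid[OF I_Obj] by blast
  note J = J[OF dual]
  let ?t = "basis_action J e"
  have GJ: "G \<boxtimes> J \<in> Obj C" by (rule tensor_Obj[OF G J])
  have t: "natural_action \<one> (G \<boxtimes> J) ?t"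
    unfolding natural_action_def
  proof (intro conjI ballI GJ)
    fix X assume X: "X \<in> Obj C"
    show "?t X \<in> Hom C (G \<boxtimes> J \<boxtimes> X) (X \<boxtimes> \<one>)"
      unfolding assoc_Obj[OF G J X] unit_Obj_right[OF X] by (rule basis_action_Hom[OF dual X])
    fix Y f assume f: "f \<in> Hom C X Y"
    show "(f \<otimes> idn \<one>) \<cdot> ?t X = ?t Y \<cdot> (idn (G \<boxtimes> J) \<otimes> f)"
      unfolding unit_Arr_right[OF Hom_Arr[OF f]] id_id_tensor[OF G J Hom_Arr[OF f], symmetric]
      by (rule basis_action_natural[OF dual f])
  qed
  \<comment> \<open>Hypothesis \<open>b0\<close> makes the canonical action at the unit vanish after
    \<open>b\<close>, and triviality carries this over to \<open>l G \<cdot> ?t G\<close>. There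
    \<open>b\<close> composes with the coefficients of the basis forms, which must vanish by
    independence.\<close>
  have kill: "l G \<cdot> b = Zero C G G"
    if b: "b \<in> Hom C G G" and b0: "\<And>y. y \<in> carrier_vec (dim \<one>) \<Longrightarrow> el \<one> y \<cdot> b = Zero C G \<one>" for b
  proof -
    let ?e = "unit_vec (dim G)" and ?v = "\<lambda>j. coev_form J e G (unit_vec (dim G) j)"
    let ?W = "G \<boxtimes> (J \<boxtimes> G)"
    have W: "?W \<in> Obj C" by (intro tensor_Obj G J)
    have u: "?e j \<in> carrier_vec (dim G)" for j by simp
    have v: "?v j \<in> Hom C (J \<boxtimes> G) \<one>" for j by (rule coev_form_Hom[OF dual G u])
    have gv: "el G (?e j) \<otimes> ?v j \<in> Hom C ?W G" for j by (rule el_coev_Hom[OF dual G u G u])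
    have lgb: "l G \<cdot> el G (?e j) \<cdot> b \<in> Hom C G G" for j
      by (rule comp_Hom[OF b comp_Hom[OF el(1)[OF G u] l[OF G]]])
    have bW: "b \<otimes> idn (J \<boxtimes> G) \<in> Hom C ?W ?W" by (rule tensor_id_Hom[OF tensor_Obj[OF J G] b])
    have "l G \<cdot> ?t G \<cdot> (b \<otimes> idn (J \<boxtimes> G)) = sum_arr ?W G (\<lambda>j. (l G \<cdot> el G (?e j) \<cdot> b) \<otimes> ?v j) [0..<dim G]"
    proof -
      have "l G \<cdot> ?t G = sum_arr ?W G (\<lambda>j. l G \<cdot> (el G (?e j) \<otimes> ?v j)) [0..<dim G]"
        unfolding basis_action_def[OF dual] by (rule comp_sum_arr[OF W l[OF G] gv])
      then have "l G \<cdot> ?t G \<cdot> (b \<otimes> idn (J \<boxtimes> G))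
          = sum_arr ?W G (\<lambda>j. l G \<cdot> (el G (?e j) \<otimes> ?v j) \<cdot> (b \<otimes> idn (J \<boxtimes> G))) [0..<dim G]"
        using sum_arr_comp[OF G bW, of "[0..<dim G]" "\<lambda>j. l G \<cdot> (el G (?e j) \<otimes> ?v j)", OF comp_Hom[OF gv l[OF G]]] by simp
      also have "\<dots> = sum_arr ?W G (\<lambda>j. (l G \<cdot> el G (?e j) \<cdot> b) \<otimes> ?v j) [0..<dim G]"
      proof (rule sum_arr_cong)
        fix j
        note g = el(1)[OF G u[of j]]
        have "l G \<cdot> (el G (?e j) \<otimes> ?v j) = (l G \<cdot> el G (?e j)) \<otimes> ?v j"
          using tensor_comp[OF g l[OF G] v[of j] id_Hom[OF one]]
          unfolding id_comp[OF v[of j]] unit_Arr_right[OF Hom_Arr[OF l[OF G]]] by (rule sym)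
        then show "l G \<cdot> (el G (?e j) \<otimes> ?v j) \<cdot> (b \<otimes> idn (J \<boxtimes> G)) = (l G \<cdot> el G (?e j) \<cdot> b) \<otimes> ?v j"
          using tensor_comp[OF b comp_Hom[OF g l[OF G]] id_Hom[OF tensor_Obj[OF J G]] v[of j]] comp_id[OF v[of j]] by simp
      qed
      finally show ?thesis .
    qed
    moreover have "l G \<cdot> ?t G \<cdot> (b \<otimes> idn (J \<boxtimes> G)) = Zero C ?W G"
    proof -
      have t1: "?t \<one> \<in> Hom C (G \<boxtimes> J) \<one>"
        using natural_actionD(2)[OF t one] unfolding unit_Obj_right[OF GJ] unit_Obj_right[OF one] .
      have bJ: "b \<otimes> idn J \<in> Hom C (G \<boxtimes> J) (G \<boxtimes> J)" by (rule tensor_id_Hom[OF J b])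
      have t1b: "?t \<one> \<cdot> (b \<otimes> idn J) = Zero C (G \<boxtimes> J) \<one>"
      proof -
        let ?e1 = "unit_vec (dim \<one>)" and ?v1 = "\<lambda>j. coev_form J e \<one> (unit_vec (dim \<one>) j)"
        have u1: "?e1 j \<in> carrier_vec (dim \<one>)" for j by simp
        have v1: "?v1 j \<in> Hom C J \<one>" for j
          using coev_form_Hom[OF dual one u1] unfolding unit_Obj_right[OF J] .
        have gv1: "el \<one> (?e1 j) \<otimes> ?v1 j \<in> Hom C (G \<boxtimes> J) \<one>" for j
          using el_coev_Hom[OF dual one u1 one u1] unfolding unit_Obj_right[OF J] .
        have "?t \<one> \<cdot> (b \<otimes> idn J) = sum_arr (G \<boxtimes> J) \<one> (\<lambda>j. (el \<one> (?e1 j) \<otimes> ?v1 j) \<cdot> (b \<otimes> idn J)) [0..<dim \<one>]"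
          unfolding basis_action_def[OF dual] unit_Obj_right[OF J] by (rule sum_arr_comp[OF one bJ gv1])
        also have "\<dots> = Zero C (G \<boxtimes> J) \<one>"
        proof (rule sum_arr_zero[OF GJ one])
          fix j
          show "(el \<one> (?e1 j) \<otimes> ?v1 j) \<cdot> (b \<otimes> idn J) = Zero C (G \<boxtimes> J) \<one>"
            unfolding tensor_comp[symmetric, OF b el(1)[OF one u1] id_Hom[OF J] v1] b0[OF u1] comp_id[OF v1]
              zero_tensor[OF G one v1] unit_Obj_right[OF one] ..
        qed
        finally show ?thesis .
      qed
      have bJG: "b \<otimes> idn (J \<boxtimes> G) = (b \<otimes> idn J) \<otimes> idn G" by (rule tensor_id_id[symmetric, OF J G Hom_Arr[OF b]])
      have "l G \<cdot> ?t G \<cdot> (b \<otimes> idn (J \<boxtimes> G)) = (?t \<one> \<cdot> (b \<otimes> idn J)) \<otimes> l G"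
        unfolding triv[OF t G] bJG tensor_comp[symmetric, OF bJ t1 id_Hom[OF G] l[OF G]] comp_id[OF l[OF G]] ..
      then show ?thesis
        unfolding t1b zero_tensor[OF GJ one l[OF G]] unit_Obj_left[OF G] assoc_Obj[OF G J G] .
    qed
    ultimately have "sum_arr ?W G (\<lambda>j. (l G \<cdot> el G (?e j) \<cdot> b) \<otimes> ?v j) [0..<dim G] = Zero C ?W G" by simp
    from coev_form_independent[OF dual G G lgb this]
    have lgb0: "l G \<cdot> el G (?e j) \<cdot> b = Zero C G G" if "j < dim G" for j using that .
    \<comment> \<open>\<open>b\<close> amounts to right multiplication by the algebra element
      \<open>a\<close>. Vanishing of the coefficient at the \<open>j\<close>-th basis vector
      \<open>v\<close> says that \<open>l G\<close> kills \<open>a v\<close>; hence it kills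
      everything of the form \<open>a y\<close>, in particular \<open>a \<iota>\<close>, which is
      \<open>b \<iota>\<close>.\<close>
    obtain a where a: "a \<in> acarrier A" and ab: "act G a *\<^sub>v \<iota> = U b *\<^sub>v \<iota>"
      using G_cyclic[OF U_vec[OF b \<iota>]] by blast
    note aG = act(1)[OF G a] and lG = U_carrier[OF l[OF G]]
    have "U (l G) * act G a = 0\<^sub>m (dim G) (dim G)"
    proof (rule mat_col_eqI)
      fix j assume "j < dim_col (0\<^sub>m (dim G) (dim G) :: 'k mat)"
      then have j: "j < dim G" by simp
      note g = el[OF G u[of j]]
      have "0\<^sub>v (dim G) = U (l G \<cdot> el G (?e j) \<cdot> b) *\<^sub>v \<iota>"
        unfolding lgb0[OF j] U_zero[OF G G] by (rule zero_mat_mult_vec[symmetric, OF \<iota>])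
      also have "\<dots> = U (l G) *\<^sub>v (U (el G (?e j)) *\<^sub>v (act G a *\<^sub>v \<iota>))"
        unfolding U_comp_vec[OF b comp_Hom[OF g(1) l[OF G]] \<iota>] U_comp_vec[OF g(1) l[OF G] U_vec[OF b \<iota>]] ab ..
      also have "U (el G (?e j)) *\<^sub>v (act G a *\<^sub>v \<iota>) = act G a *\<^sub>v ?e j"
        unfolding assoc_mult_mat_vec[OF U_carrier[OF g(1)] aG \<iota>, symmetric] U_act[OF g(1) a]
          assoc_mult_mat_vec[OF aG U_carrier[OF g(1)] \<iota>] g(2) ..
      also have "U (l G) *\<^sub>v (act G a *\<^sub>v ?e j) = col (U (l G) * act G a) j"
        unfolding assoc_mult_mat_vec[OF lG aG u, symmetric] by (rule mult_mat_unit_vec[OF mult_carrier_mat[OF lG aG] j])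
      finally show "col (U (l G) * act G a) j = col (0\<^sub>m (dim G) (dim G)) j" using j by simp
    qed (use lG aG in simp_all)
    then have "U (l G \<cdot> b) *\<^sub>v \<iota> = U (Zero C G G) *\<^sub>v \<iota>"
      unfolding U_comp_vec[OF b l[OF G] \<iota>] ab[symmetric] assoc_mult_mat_vec[OF lG aG \<iota>, symmetric] U_zero[OF G G] by simp
    then show ?thesis by (rule el_eq[OF comp_Hom[OF b l[OF G]] zero_Hom[OF G G]])
  qed
  define s :: "'k vec" where "s = unit_vec (dim \<one>) 0"
  have s: "s \<in> carrier_vec (dim \<one>)" "s \<noteq> 0\<^sub>v (dim \<one>)" using unit_dim_pos by (simp_all add: s_def)
  \<comment> \<open>On the unit object \<open>a\<close> acts as a rank one projection onto the line
    of \<open>s\<close>. So it fixes \<open>?g\<close>, and it sends every arrow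
    \<open>G \<rightarrow> \<one>\<close> to a multiple of \<open>?g\<close>.\<close>
  obtain a \<sigma> where a: "a \<in> Hom C G G" and \<sigma>: "\<sigma> \<bullet> s = 1"
    and ay: "\<And>y. y \<in> carrier_vec (dim \<one>) \<Longrightarrow> el \<one> y \<cdot> a = (\<sigma> \<bullet> y) \<star> el \<one> s"
    by (rule simple_rank_one[OF simple_unit s s(1)]) blast
  let ?g = "el \<one> s"
  have g: "?g \<in> Hom C G \<one>" by (rule el(1)[OF one s(1)])
  have gs: "surj_arr ?g" by (rule simple_surj[OF simple_unit g el_nonzero[OF one s]])
  have la: "l G \<cdot> a \<in> Hom C G G" by (rule comp_Hom[OF a l[OF G]])
  \<comment> \<open>A vector \<open>x\<close> in the kernel of \<open>?g\<close> gives an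
    endomorphism \<open>a \<cdot> el G x\<close> that all arrows
    \<open>G \<rightarrow> \<one>\<close> kill, since they become multiples of \<open>?g\<close>
    after \<open>a\<close>. By \<open>kill\<close> it is annihilated by \<open>l G\<close>, so
    \<open>l G \<cdot> a\<close> factors through \<open>?g\<close>.\<close>
  obtain r where r: "r \<in> Hom C \<one> G" and rg: "r \<cdot> ?g = l G \<cdot> a"
  proof (rule surj_arr_factor[OF g gs la])
    fix x assume x: "x \<in> carrier_vec (dim G)" and gx: "U ?g *\<^sub>v x = 0\<^sub>v (dim \<one>)"
    note b = el[OF G x]
    have gb: "?g \<cdot> el G x = Zero C G \<one>" unfolding comp_el[OF g x] gx by (rule el_zero[OF one])
    have "l G \<cdot> (a \<cdot> el G x) = Zero C G G"
    proof (rule kill[OF comp_Hom[OF b(1) a]])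
      fix y :: "'k vec" assume y: "y \<in> carrier_vec (dim \<one>)"
      have "el \<one> y \<cdot> (a \<cdot> el G x) = (\<sigma> \<bullet> y) \<star> Zero C G \<one>"
        unfolding comp_assoc[OF b(1) a el(1)[OF one y]] ay[OF y] scale_comp[OF b(1) g] gb ..
      also have "\<dots> = Zero C G \<one>"
        by (rule scale_zero[OF G one])
      finally show "el \<one> y \<cdot> (a \<cdot> el G x) = Zero C G \<one>" .
    qed
    then have "U (l G \<cdot> a \<cdot> el G x) *\<^sub>v \<iota> = 0\<^sub>v (dim G)"
      unfolding comp_assoc[OF b(1) a l[OF G]] using U_zero[OF G G] zero_mat_mult_vec[OF \<iota>, of "dim G"] by simp
    then show "U (l G \<cdot> a) *\<^sub>v x = 0\<^sub>v (dim G)" unfolding U_comp_vec[OF b(1) la \<iota>] b(2) .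
  qed blast
  have "?g \<cdot> r \<cdot> ?g = idn \<one> \<cdot> ?g"
  proof -
    have "?g \<cdot> r \<cdot> ?g = ?g \<cdot> (l G \<cdot> a)" unfolding comp_assoc[OF g r g, symmetric] rg ..
    \<comment> \<open>Naturality trades \<open>l G\<close> for \<open>l \<one>\<close>, which is the
      identity, and \<open>a\<close> fixes \<open>?g\<close>.\<close>
    also have "\<dots> = l \<one> \<cdot> ?g \<cdot> a" unfolding comp_assoc[OF a l[OF G] g] nat[OF g] ..
    also have "\<dots> = ?g" unfolding l1 id_comp[OF g] ay[OF s(1)] \<sigma> by (rule one_scale[OF g])
    finally show ?thesis unfolding id_comp[OF g] .
  qed
  then have gr: "?g \<cdot> r = idn \<one>" by (rule surj_arr_cancel[OF g gs comp_Hom[OF r g] id_Hom[OF one]])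
  show ?thesis
  proof (rule unit_projective_semisimple)
    fix M N q f assume q: "q \<in> Hom C M N" "surj_arr q" and f: "f \<in> Hom C \<one> N"
    \<comment> \<open>\<open>G\<close> is projective in the concrete sense that an arrow out of it
      is a vector: a preimage \<open>x\<close> of the vector of \<open>f \<cdot> ?g\<close> lifts
      that arrow along \<open>q\<close>, and \<open>r\<close> restricts the lift to the unit
      object.\<close>
    obtain x where x: "x \<in> carrier_vec (dim M)" and qx: "U q *\<^sub>v x = U f *\<^sub>v s"
      using q(2) U_vec[OF f s(1)] unfolding surj_arr_def Hom_Src_Tgt[OF q(1)] by blast
    note ex = el(1)[OF Hom_Obj(1)[OF q(1)] x]
    have "q \<cdot> el M x = f \<cdot> ?g" unfolding comp_el[OF q(1) x] qx comp_el[OF f s(1)] ..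
    then have "q \<cdot> (el M x \<cdot> r) = f \<cdot> (?g \<cdot> r)"
      unfolding comp_assoc[OF r ex q(1)] comp_assoc[OF r g f] by (rule arg_cong)
    then have "q \<cdot> (el M x \<cdot> r) = f" unfolding gr comp_id[OF f] .
    then show "\<exists>k \<in> Hom C \<one> M. q \<cdot> k = f" using comp_Hom[OF r ex] by (rule bexI)
  qed
qed

section \<open>Semisimple categories and the proof of both implications\<close>

lemma semisimple_decomposition:
  assumes ss: "semisimple C" and X: "X \<in> Obj C"
  shows "\<exists>n S i q. (\<forall>a<n. simple_object C (S a) \<and> i a \<in> Hom C (S a) X \<and> q a \<in> Hom C X (S a)) \<and>
    sum_arr X X (\<lambda>a. i a \<cdot> q a) [0..<n] = idn X"
proof -
  have "\<exists>n S. (\<forall>a<n. simple_object C (S a)) \<and> direct_sum C n S X"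
    using ss X unfolding semisimple_def by simp
  then obtain n S where S: "\<forall>a<n. simple_object C (S a)" and ds: "direct_sum C n S X"
    by (elim exE conjE)
  from ds obtain i q where iq: "\<forall>a<n. i a \<in> Hom C (S a) X \<and> q a \<in> Hom C X (S a)"
    and sum: "foldr (\<lambda>a s. (i a \<cdot> q a) \<oplus>\<^sub>a s) [0..<n] (Zero C X X) = idn X"
    unfolding direct_sum_def by (elim exE conjE)
  have "\<forall>a<n. simple_object C (S a) \<and> i a \<in> Hom C (S a) X \<and> q a \<in> Hom C X (S a)"
    using S iq by simp
  then show ?thesis using sum unfolding sum_arr_def by (intro exI conjI)
qed

text \<open>The identity of \<open>X\<close> is a sum of arrows that factor through simple objects,
  so an arrow out of \<open>X\<close> is determined by its restrictions to them.\<close>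

lemma semisimple_arr_eqI:
  assumes ss: "semisimple C" and g: "g \<in> Hom C X Y" and h: "h \<in> Hom C X Y"
    and eq: "\<And>S f. simple_object C S \<Longrightarrow> f \<in> Hom C S X \<Longrightarrow> g \<cdot> f = h \<cdot> f"
  shows "g = h"
proof -
  note X = Hom_Obj(1)[OF g] and Y = Hom_Obj(2)[OF g]
  obtain n S i q where *: "\<forall>a<n. simple_object C (S a) \<and> i a \<in> Hom C (S a) X \<and> q a \<in> Hom C X (S a)"
    and sum: "sum_arr X X (\<lambda>a. i a \<cdot> q a) [0..<n] = idn X" using semisimple_decomposition[OF ss X] by (elim exE conjE)
  have S: "simple_object C (S a)" and i: "i a \<in> Hom C (S a) X" and q: "q a \<in> Hom C X (S a)"
    if "a \<in> set [0..<n]" for a using * that by simp_all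
  have exp: "k = sum_arr X Y (\<lambda>a. k \<cdot> i a \<cdot> q a) [0..<n]" if k: "k \<in> Hom C X Y" for k
  proof -
    have "k = k \<cdot> sum_arr X X (\<lambda>a. i a \<cdot> q a) [0..<n]" unfolding sum comp_id[OF k] ..
    also have "\<dots> = sum_arr X Y (\<lambda>a. k \<cdot> (i a \<cdot> q a)) [0..<n]"
      by (rule comp_sum_arr[OF X k]) (rule comp_Hom[OF q i])
    also have "\<dots> = sum_arr X Y (\<lambda>a. k \<cdot> i a \<cdot> q a) [0..<n]"
      by (rule sum_arr_cong) (rule comp_assoc[OF q i k])
    finally show ?thesis .
  qed
  have "sum_arr X Y (\<lambda>a. g \<cdot> i a \<cdot> q a) [0..<n] = sum_arr X Y (\<lambda>a. h \<cdot> i a \<cdot> q a) [0..<n]"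
    by (rule sum_arr_cong) (simp add: eq[OF S i])
  then show ?thesis using exp[OF g] exp[OF h] by simp
qed

text \<open>\<open>p X\<close> is the sum of the projections onto the chosen summands that are not
  isomorphic to \<one>. Describing it by its effect on arrows from simple objects removes the choice
  of decomposition, and naturality can later be read off from this description.\<close>

lemma semisimple_projection:
  assumes ss: "semisimple C"
  shows "\<exists>p. \<forall>X \<in> Obj C. p X \<in> Hom C X X \<and> (\<forall>S f. simple_object C S \<longrightarrow> f \<in> Hom C S X \<longrightarrow>
    p X \<cdot> f = (if \<exists>g \<in> Hom C S \<one>. iso_arr C g then Zero C S X else f))"
proof -
  let ?triv = "\<lambda>S. \<exists>g \<in> Hom C S \<one>. iso_arr C g"
  have ex: "\<exists>p. p \<in> Hom C X X \<and>
      (\<forall>S f. simple_object C S \<longrightarrow> f \<in> Hom C S X \<longrightarrow> p \<cdot> f = (if ?triv S then Zero C S X else f))" if X: "X \<in> Obj C" for X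
  proof -
    obtain n S i q where *: "\<forall>a<n. simple_object C (S a) \<and> i a \<in> Hom C (S a) X \<and> q a \<in> Hom C X (S a)"
      and sum: "sum_arr X X (\<lambda>a. i a \<cdot> q a) [0..<n] = idn X" using semisimple_decomposition[OF ss X] by (elim exE conjE)
    have S: "simple_object C (S a)" and i: "i a \<in> Hom C (S a) X" and q: "q a \<in> Hom C X (S a)"
      if "a \<in> set [0..<n]" for a using * that by simp_all
    define r where "r a = (if ?triv (S a) then Zero C X X else i a \<cdot> q a)" for a
    have r: "r a \<in> Hom C X X" if "a \<in> set [0..<n]" for a
      using zero_Hom[OF X X] comp_Hom[OF q[OF that] i[OF that]] by (simp add: r_def)
    let ?p = "sum_arr X X r [0..<n]"
    have p: "?p \<in> Hom C X X" by (rule sum_arr_Hom[OF X X r])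
    have "?p \<cdot> f = (if ?triv T then Zero C T X else f)" if T: "simple_object C T" and f: "f \<in> Hom C T X" for T f
    proof -
      note TO = Hom_Obj(1)[OF f]
      have pf: "?p \<cdot> f = sum_arr T X (\<lambda>a. r a \<cdot> f) [0..<n]" by (rule sum_arr_comp[OF X f r])
      have ff: "f = sum_arr T X (\<lambda>a. i a \<cdot> q a \<cdot> f) [0..<n]"
        using sum_arr_comp[OF X f, of "[0..<n]" "\<lambda>a. i a \<cdot> q a", OF comp_Hom[OF q i]] id_comp[OF f] unfolding sum by simp
      have rf: "r a \<cdot> f = (if ?triv T then Zero C T X else i a \<cdot> q a \<cdot> f)" if a: "a \<in> set [0..<n]" for a
      \<comment> \<open>By Schur's lemma the component of \<open>f\<close> in a summand either
        vanishes or identifies \<open>T\<close> with that summand, and then both or neither are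
        isomorphic to \<one>.\<close>
      proof (cases "q a \<cdot> f = Zero C T (S a)")
        case True
        have "i a \<cdot> q a \<cdot> f = Zero C T X"
          unfolding comp_assoc[OF f q[OF a] i[OF a], symmetric] True by (rule comp_zero[OF i[OF a] TO])
        then show ?thesis by (simp add: r_def zero_comp[OF f X])
      next
        case False
        note qf = comp_Hom[OF f q[OF a]]
        have iso: "iso_arr C (q a \<cdot> f)" by (rule simple_iso[OF T S[OF a] qf False])
        obtain k where k: "k \<in> Hom C (S a) T" "k \<cdot> (q a \<cdot> f) = idn T" "q a \<cdot> f \<cdot> k = idn (S a)"
          by (rule iso_arrE[OF iso qf])
        have kiso: "iso_arr C k" by (rule iso_arrI[OF k(1) qf k(3,2)])
        have trans: "?triv V" if g: "g \<in> Hom C V V'" "iso_arr C g" and V': "?triv V'" for g V V'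
        proof -
          obtain h where h: "h \<in> Hom C V' \<one>" "iso_arr C h" using V' by blast
          have "iso_arr C (h \<cdot> g)"
            by (rule bij_arr_iso[OF comp_Hom[OF g(1) h(1)]
                inj_arr_comp[OF g(1) iso_arr_inj_surj(1)[OF g] h(1) iso_arr_inj_surj(1)[OF h]]
                surj_arr_comp[OF g(1) iso_arr_inj_surj(2)[OF g] h(1) iso_arr_inj_surj(2)[OF h]]])
          then show ?thesis using comp_Hom[OF g(1) h(1)] by blast
        qed
        have "?triv (S a) \<longleftrightarrow> ?triv T" using trans[OF qf iso] trans[OF k(1) kiso] by blast
        then show ?thesis by (simp add: r_def zero_comp[OF f X])
      qed
      show ?thesis
      proof (cases "?triv T")
        case True
        have "?p \<cdot> f = Zero C T X" unfolding pf by (rule sum_arr_zero[OF TO X]) (use rf True in simp)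
        then show ?thesis using True by simp
      next
        case False
        have "?p \<cdot> f = sum_arr T X (\<lambda>a. i a \<cdot> q a \<cdot> f) [0..<n]"
          unfolding pf by (rule sum_arr_cong) (use rf False in simp)
        then show ?thesis using ff False by simp
      qed
    qed
    then show ?thesis using p by (intro exI[of _ ?p] conjI allI impI)
  qed
  show ?thesis by (rule bchoice, rule ballI, rule ex)
qed

lemma semisimple_integral_zero:
  assumes ss: "semisimple C" and \<alpha>: "\<alpha> \<in> Obj C"
    and l: "\<And>X. X \<in> Obj C \<Longrightarrow> l X \<in> Hom C X (X \<boxtimes> \<alpha>)"
    and nat: "\<And>X Y f. f \<in> Hom C X Y \<Longrightarrow> (f \<otimes> idn \<alpha>) \<cdot> l X = l Y \<cdot> f"
    and l1: "l \<one> = Zero C \<one> \<alpha>"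
    and int: "(\<forall>t X. natural_action \<one> \<one> t \<longrightarrow> X \<in> Obj C \<longrightarrow> (t X \<otimes> idn \<alpha>) \<cdot> l X = t \<one> \<otimes> l X) \<or>
      (\<forall>t X. natural_action \<one> \<one> t \<longrightarrow> X \<in> Obj C \<longrightarrow> l X \<cdot> t X = t \<one> \<otimes> l X)"
    and X: "X \<in> Obj C"
  shows "l X = Zero C X (X \<boxtimes> \<alpha>)"
proof -
  note one = unit_Obj
  let ?triv = "\<lambda>S. \<exists>g \<in> Hom C S \<one>. iso_arr C g"
  obtain p where pp: "\<forall>X \<in> Obj C. p X \<in> Hom C X X \<and> (\<forall>S f. simple_object C S \<longrightarrow> f \<in> Hom C S X \<longrightarrow>
    p X \<cdot> f = (if ?triv S then Zero C S X else f))" using semisimple_projection[OF ss] by (elim exE)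
  have p: "p X \<in> Hom C X X" if "X \<in> Obj C" for X using pp that by simp
  have pf: "p X \<cdot> f = (if ?triv S then Zero C S X else f)" if "simple_object C S" "f \<in> Hom C S X" for X S f
    using pp that Hom_Obj(2)[OF that(2)] by simp
  have p0: "p X \<cdot> f = Zero C S X" if "simple_object C S" "f \<in> Hom C S X" "?triv S" for X S f
    unfolding pf[OF that(1,2)] by (rule if_P[OF that(3)])
  have p1: "p X \<cdot> f = f" if "simple_object C S" "f \<in> Hom C S X" "\<not> ?triv S" for X S f
    unfolding pf[OF that(1,2)] by (rule if_not_P[OF that(3)])
  note sep = semisimple_arr_eqI[OF ss]
  have pnat: "f \<cdot> p V = p W \<cdot> f" if f: "f \<in> Hom C V W" for f V W
  proof (rule sep)
    note V = Hom_Obj(1)[OF f] and W = Hom_Obj(2)[OF f]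
    show "f \<cdot> p V \<in> Hom C V W" "p W \<cdot> f \<in> Hom C V W" by (rule comp_Hom[OF p[OF V] f], rule comp_Hom[OF f p[OF W]])
    fix S k assume S: "simple_object C S" and k: "k \<in> Hom C S V"
    note fk = comp_Hom[OF k f]
    have 1: "f \<cdot> p V \<cdot> k = f \<cdot> (p V \<cdot> k)" by (rule comp_assoc[symmetric, OF k p[OF V] f])
    have 2: "p W \<cdot> f \<cdot> k = p W \<cdot> (f \<cdot> k)" by (rule comp_assoc[symmetric, OF k f p[OF W]])
    show "f \<cdot> p V \<cdot> k = p W \<cdot> f \<cdot> k"
    proof (cases "?triv S")
      case True
      show ?thesis unfolding 1 2 p0[OF S k True] p0[OF S fk True] by (rule comp_zero[OF f Hom_Obj(1)[OF k]])
    next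
      case False
      show ?thesis unfolding 1 2 p1[OF S k False] p1[OF S fk False] ..
    qed
  qed
  have t: "natural_action \<one> \<one> p"
    unfolding natural_action_def
  proof (intro conjI ballI one)
    fix V assume V: "V \<in> Obj C"
    show "p V \<in> Hom C (\<one> \<boxtimes> V) (V \<boxtimes> \<one>)" unfolding unit_Obj_left[OF V] unit_Obj_right[OF V] by (rule p[OF V])
    fix W f assume f: "f \<in> Hom C V W"
    show "(f \<otimes> idn \<one>) \<cdot> p V = p W \<cdot> (idn \<one> \<otimes> f)"
      unfolding unit_Arr_left[OF Hom_Arr[OF f]] unit_Arr_right[OF Hom_Arr[OF f]] by (rule pnat[OF f])
  qed
  have one_triv: "?triv \<one>"
    using iso_arrI[OF id_Hom[OF one] id_Hom[OF one]] comp_id[OF id_Hom[OF one]] id_Hom[OF one] by blast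
  have "p \<one> = Zero C \<one> \<one>"
    using p0[OF simple_unit id_Hom[OF one] one_triv] unfolding comp_id[OF p[OF one]] .
  then have "p \<one> \<otimes> l X = Zero C X (X \<boxtimes> \<alpha>)"
    using zero_tensor[OF one one l[OF X]] unfolding unit_Obj_left[OF X] unit_Obj_left[OF tensor_Obj[OF X \<alpha>]] by simp
  \<comment> \<open>For a left integral, naturality of \<open>l\<close> along \<open>p X\<close>
    moves \<open>p X\<close> to the other side, so both kinds of integral give the same
    equation.\<close>
  moreover from int have "l X \<cdot> p X = p \<one> \<otimes> l X"
  proof
    assume "\<forall>t X. natural_action \<one> \<one> t \<longrightarrow> X \<in> Obj C \<longrightarrow> (t X \<otimes> idn \<alpha>) \<cdot> l X = t \<one> \<otimes> l X"
    from this[rule_format, OF t X] show ?thesis unfolding nat[OF p[OF X]] .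
  next
    assume "\<forall>t X. natural_action \<one> \<one> t \<longrightarrow> X \<in> Obj C \<longrightarrow> l X \<cdot> t X = t \<one> \<otimes> l X"
    from this[rule_format, OF t X] show ?thesis .
  qed
  ultimately have lp: "l X \<cdot> p X = Zero C X (X \<boxtimes> \<alpha>)" by simp
  note XA = tensor_Obj[OF X \<alpha>]
  show ?thesis
  proof (rule sep[OF l[OF X] zero_Hom[OF X XA]])
    fix S f assume S: "simple_object C S" and f: "f \<in> Hom C S X"
    note SO = Hom_Obj(1)[OF f]
    show "l X \<cdot> f = Zero C X (X \<boxtimes> \<alpha>) \<cdot> f"
      unfolding zero_comp[OF f XA]
    proof (cases "?triv S")
      case True
      then obtain g where g: "g \<in> Hom C S \<one>" "iso_arr C g" by blast
      obtain k where k: "k \<in> Hom C \<one> S" "k \<cdot> g = idn S" "g \<cdot> k = idn \<one>" by (rule iso_arrE[OF g(2,1)])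
      note fk = comp_Hom[OF k(1) f]
      have fkA: "(f \<cdot> k) \<otimes> idn \<alpha> \<in> Hom C \<alpha> (X \<boxtimes> \<alpha>)" using tensor_id_Hom[OF \<alpha> fk] unfolding unit_Obj_left[OF \<alpha>] .
      \<comment> \<open>On a copy of \<one> inside \<open>X\<close>, naturality expresses
        \<open>l X\<close> through \<open>l \<one>\<close>, which vanishes by assumption.\<close>
      have "l X \<cdot> (f \<cdot> k) = Zero C \<one> (X \<boxtimes> \<alpha>)"
        unfolding nat[OF fk, symmetric] l1 by (rule comp_zero[OF fkA one])
      then have "l X \<cdot> (f \<cdot> k) \<cdot> g = Zero C S (X \<boxtimes> \<alpha>)" using zero_comp[OF g(1) XA] by simp
      moreover have "l X \<cdot> (f \<cdot> k) \<cdot> g = l X \<cdot> f"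
        unfolding comp_assoc[OF g(1) fk l[OF X], symmetric] comp_assoc[OF g(1) k(1) f, symmetric] k(2) comp_id[OF f] ..
      ultimately show "l X \<cdot> f = Zero C S (X \<boxtimes> \<alpha>)" by simp
    next
      case False
      have "l X \<cdot> f = l X \<cdot> (p X \<cdot> f)" unfolding p1[OF S f False] ..
      also have "\<dots> = Zero C S (X \<boxtimes> \<alpha>)"
        unfolding comp_assoc[OF f p[OF X] l[OF X]] lp by (rule zero_comp[OF f XA])
      finally show "l X \<cdot> f = Zero C S (X \<boxtimes> \<alpha>)" .
    qed
  qed
qed

text \<open>Both ends of \<open>l \<one>\<close> are simple, so Schur's lemma makes it invertible.
  Its inverse \<open>\<phi>\<close> removes \<alpha> from the target of \<open>l\<close>, and
  \<open>m\<close> is the resulting natural endomorphism of the identity with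
  \<open>m \<one> = id\<close>.\<close>

lemma nonzero_integral_semisimple:
  assumes \<alpha>: "simple_object C \<alpha>"
    and l: "\<And>X. X \<in> Obj C \<Longrightarrow> l X \<in> Hom C X (X \<boxtimes> \<alpha>)"
    and nat: "\<And>X Y f. f \<in> Hom C X Y \<Longrightarrow> (f \<otimes> idn \<alpha>) \<cdot> l X = l Y \<cdot> f"
    and l1: "l \<one> \<noteq> Zero C \<one> \<alpha>"
    and int: "(\<forall>W t X. natural_action \<one> W t \<longrightarrow> X \<in> Obj C \<longrightarrow> (t X \<otimes> idn \<alpha>) \<cdot> (idn W \<otimes> l X) = t \<one> \<otimes> l X) \<or>
      (\<forall>W t X. natural_action \<one> W t \<longrightarrow> X \<in> Obj C \<longrightarrow> l X \<cdot> t X = t \<one> \<otimes> l X)"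
  shows "semisimple C"
proof -
  note one = unit_Obj
  have \<alpha>O: "\<alpha> \<in> Obj C" using \<alpha> by (simp add: simple_object_def)
  have l1H: "l \<one> \<in> Hom C \<one> \<alpha>" using l[OF one] unfolding unit_Obj_left[OF \<alpha>O] .
  obtain \<phi> where \<phi>: "\<phi> \<in> Hom C \<alpha> \<one>" and \<phi>l: "\<phi> \<cdot> l \<one> = idn \<one>"
    by (rule iso_arrE[OF simple_iso[OF simple_unit \<alpha> l1H l1] l1H])
  define m where "m X = (idn X \<otimes> \<phi>) \<cdot> l X" for X
  have X\<phi>: "idn X \<otimes> \<phi> \<in> Hom C (X \<boxtimes> \<alpha>) X" if X: "X \<in> Obj C" for X by (rule id_tensor_ev_Hom[OF X \<phi>])
  have m: "m X \<in> Hom C X X" if X: "X \<in> Obj C" for X unfolding m_def by (rule comp_Hom[OF l[OF X] X\<phi>[OF X]])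
  have mnat: "f \<cdot> m X = m Y \<cdot> f" if f: "f \<in> Hom C X Y" for X Y f
  proof -
    note X = Hom_Obj(1)[OF f] and Y = Hom_Obj(2)[OF f]
    have "f \<cdot> m X = (idn Y \<otimes> \<phi>) \<cdot> (f \<otimes> idn \<alpha>) \<cdot> l X"
      unfolding m_def id_ev_slide[OF f \<phi>] by (rule comp_assoc[OF l[OF X] X\<phi>[OF X] f])
    also have "\<dots> = (idn Y \<otimes> \<phi>) \<cdot> (l Y \<cdot> f)"
      unfolding nat[OF f, symmetric] by (rule comp_assoc[symmetric, OF l[OF X] tensor_id_Hom[OF \<alpha>O f] X\<phi>[OF Y]])
    also have "\<dots> = m Y \<cdot> f" unfolding m_def by (rule comp_assoc[OF f l[OF Y] X\<phi>[OF Y]])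
    finally show ?thesis .
  qed
  show ?thesis
  proof (rule trivializing_endomorphism_semisimple[OF m mnat])
    show "m \<one> = idn \<one>" unfolding m_def unit_Arr_left[OF Hom_Arr[OF \<phi>]] by (rule \<phi>l)
    fix W t X assume t: "natural_action \<one> W t" and X: "X \<in> Obj C"
    note W = natural_actionD(1)[OF t]
    have t1: "t \<one> \<in> Hom C W \<one>"
      using natural_actionD(2)[OF t one] unfolding unit_Obj_right[OF W] unit_Obj_right[OF one] .
    have tX: "t X \<in> Hom C (W \<boxtimes> X) X" using natural_actionD(2)[OF t X] unfolding unit_Obj_right[OF X] .
    have tl: "t \<one> \<otimes> l X \<in> Hom C (W \<boxtimes> X) (X \<boxtimes> \<alpha>)"
      using tensor_Hom[OF t1 l[OF X]] unfolding unit_Obj_left[OF tensor_Obj[OF X \<alpha>O]] .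
    have tm: "(idn X \<otimes> \<phi>) \<cdot> (t \<one> \<otimes> l X) = t \<one> \<otimes> m X"
      using tensor_comp[OF t1 id_Hom[OF one] l[OF X] X\<phi>[OF X]]
      unfolding id_comp[OF t1] unit_Arr_left[OF Hom_Arr[OF X\<phi>[OF X]]] m_def by (rule sym)
    from int show "m X \<cdot> t X = t \<one> \<otimes> m X"
    proof
      assume "\<forall>W t X. natural_action \<one> W t \<longrightarrow> X \<in> Obj C \<longrightarrow> l X \<cdot> t X = t \<one> \<otimes> l X"
      then have lt: "l X \<cdot> t X = t \<one> \<otimes> l X" using t X by (elim allE impE)
      have "m X \<cdot> t X = (idn X \<otimes> \<phi>) \<cdot> (l X \<cdot> t X)"
        unfolding m_def by (rule comp_assoc[symmetric, OF tX l[OF X] X\<phi>[OF X]])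
      then show ?thesis unfolding lt tm .
    next
      assume "\<forall>W t X. natural_action \<one> W t \<longrightarrow> X \<in> Obj C \<longrightarrow> (t X \<otimes> idn \<alpha>) \<cdot> (idn W \<otimes> l X) = t \<one> \<otimes> l X"
      then have lt: "(t X \<otimes> idn \<alpha>) \<cdot> (idn W \<otimes> l X) = t \<one> \<otimes> l X" using t X by (elim allE impE)
      have Wl: "idn W \<otimes> l X \<in> Hom C (W \<boxtimes> X) (W \<boxtimes> X \<boxtimes> \<alpha>)"
        using id_tensor_Hom[OF W l[OF X]] unfolding assoc_Obj[OF W X \<alpha>O, symmetric] .
      note WX\<phi> = X\<phi>[OF tensor_Obj[OF W X]]
      \<comment> \<open>For a left integral \<open>l\<close> comes before \<open>t\<close>.
        Naturality of the action \<open>t\<close> along the endomorphism \<open>m X\<close> reverses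
        the order, so that the left integral property applies.\<close>
      have "m X \<cdot> t X = t X \<cdot> (idn W \<otimes> m X)"
        using natural_actionD(3)[OF t m[OF X]] unfolding unit_Arr_right[OF Hom_Arr[OF m[OF X]]] .
      also have "idn W \<otimes> m X = (idn (W \<boxtimes> X) \<otimes> \<phi>) \<cdot> (idn W \<otimes> l X)"
        unfolding m_def id_tensor_comp[OF l[OF X] X\<phi>[OF X] W] id_id_tensor[OF W X Hom_Arr[OF \<phi>]] ..
      also have "t X \<cdot> \<dots> = (idn X \<otimes> \<phi>) \<cdot> (t X \<otimes> idn \<alpha>) \<cdot> (idn W \<otimes> l X)"
        unfolding id_ev_slide[OF tX \<phi>] by (rule comp_assoc[OF Wl WX\<phi> tX])
      also have "\<dots> = (idn X \<otimes> \<phi>) \<cdot> ((t X \<otimes> idn \<alpha>) \<cdot> (idn W \<otimes> l X))"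
        by (rule comp_assoc[symmetric, OF Wl tensor_id_Hom[OF \<alpha>O tX] X\<phi>[OF X]])
      finally show ?thesis unfolding lt tm .
    qed
  qed
qed

end

theorem theorem4p12:
  fixes C :: "('o, 'm, 'k :: alg_closed_field) tensor_category"
    and D :: "('o, 'm) left_duality"
    and Z :: "'o \<Rightarrow> 'o" and \<pi> :: "'o \<Rightarrow> 'o \<Rightarrow> 'm"
    and R :: "('o, 'm, 'o \<times> ('o \<Rightarrow> 'm), ('o \<times> ('o \<Rightarrow> 'm)) \<times> 'm \<times> ('o \<times> ('o \<Rightarrow> 'm))) cat_functor"
    and \<alpha> :: 'o and \<Lambda> :: 'm
  assumes "finite_tensor_category C"
    and "is_left_duality C D"
    and "central_comonad C D Z \<pi>"
    and "right_adjoint (drinfeld_center C) C forgetful_functor R"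
    and "modular_object C R \<alpha>"
    and "left_integral C D Z \<pi> \<alpha> \<Lambda> \<or> right_integral C D Z \<pi> \<alpha> \<Lambda>"
    and "\<Lambda> \<noteq> Zero C \<one>\<^bsub>C\<^esub> (Z \<alpha>)"
  shows "counit_Z C D \<pi> \<alpha> \<cdot>\<^bsub>C\<^esub> \<Lambda> \<noteq> Zero C \<one>\<^bsub>C\<^esub> \<alpha> \<longleftrightarrow> semisimple C"
proof -
  interpret finite_tensor_category C by fact
  obtain A dim act U G \<iota> I \<kappa> where gc: "generated_category C A dim act U G \<iota> I \<kappa>"
    using finite_abelian_generated_category[OF finite_abelian] by blast
  interpret generated_category C A dim act U G \<iota> I \<kappa> by (rule gc)
  interpret generated_tensor_category C A dim act U G \<iota> I \<kappa> ..
  have \<alpha>: "simple_object C \<alpha>" using assms(5) unfolding modular_object_def by simp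
  then have \<alpha>O: "\<alpha> \<in> Obj C" by (simp add: simple_object_def)
  have \<Lambda>: "\<Lambda> \<in> Hom C \<one>\<^bsub>C\<^esub> (Z \<alpha>)" using assms(6) unfolding left_integral_def right_integral_def by blast
  let ?l = "integral_action D \<pi> \<alpha> \<Lambda>"
  note l = integral_action_natural[OF assms(2,3) \<alpha>O \<Lambda>]
  note left = left_integral_action[OF assms(2,3) \<alpha>O] and right = right_integral_action[OF assms(2,3) \<alpha>O]
  show ?thesis
    unfolding counit_integral_action[OF assms(2,3) \<alpha>O \<Lambda>]
  proof
    assume nz: "?l \<one>\<^bsub>C\<^esub> \<noteq> Zero C \<one>\<^bsub>C\<^esub> \<alpha>"
    have int: "(\<forall>W t X. natural_action \<one>\<^bsub>C\<^esub> W t \<longrightarrow> X \<in> Obj C \<longrightarrow>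
          (t X \<otimes>\<^bsub>C\<^esub> idn\<^bsub>C\<^esub> \<alpha>) \<cdot>\<^bsub>C\<^esub> (idn\<^bsub>C\<^esub> W \<otimes>\<^bsub>C\<^esub> ?l X) = t \<one>\<^bsub>C\<^esub> \<otimes>\<^bsub>C\<^esub> ?l X) \<or>
        (\<forall>W t X. natural_action \<one>\<^bsub>C\<^esub> W t \<longrightarrow> X \<in> Obj C \<longrightarrow> ?l X \<cdot>\<^bsub>C\<^esub> t X = t \<one>\<^bsub>C\<^esub> \<otimes>\<^bsub>C\<^esub> ?l X)"
      using assms(6) by (rule disj_forward) (intro allI impI, erule left right, assumption+)+
    show "semisimple C"
      by (rule nonzero_integral_semisimple[where l = ?l, OF \<alpha> l nz int])
  next
    assume ss: "semisimple C"
    show "?l \<one>\<^bsub>C\<^esub> \<noteq> Zero C \<one>\<^bsub>C\<^esub> \<alpha>"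
    proof
      assume l1: "?l \<one>\<^bsub>C\<^esub> = Zero C \<one>\<^bsub>C\<^esub> \<alpha>"
      note Z\<alpha> = Z_Obj[OF assms(2,3) \<alpha>O] and z = zero_Hom[OF unit_Obj Z_Obj[OF assms(2,3) \<alpha>O]]
      have int: "(\<forall>t X. natural_action \<one>\<^bsub>C\<^esub> \<one>\<^bsub>C\<^esub> t \<longrightarrow> X \<in> Obj C \<longrightarrow>
            (t X \<otimes>\<^bsub>C\<^esub> idn\<^bsub>C\<^esub> \<alpha>) \<cdot>\<^bsub>C\<^esub> ?l X = t \<one>\<^bsub>C\<^esub> \<otimes>\<^bsub>C\<^esub> ?l X) \<or>
          (\<forall>t X. natural_action \<one>\<^bsub>C\<^esub> \<one>\<^bsub>C\<^esub> t \<longrightarrow> X \<in> Obj C \<longrightarrow> ?l X \<cdot>\<^bsub>C\<^esub> t X = t \<one>\<^bsub>C\<^esub> \<otimes>\<^bsub>C\<^esub> ?l X)"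
        using assms(6)
      proof
        assume int: "left_integral C D Z \<pi> \<alpha> \<Lambda>"
        show ?thesis
        proof (intro disjI1 allI impI)
          fix t X assume t: "natural_action \<one>\<^bsub>C\<^esub> \<one>\<^bsub>C\<^esub> t" and X: "X \<in> Obj C"
          show "(t X \<otimes>\<^bsub>C\<^esub> idn\<^bsub>C\<^esub> \<alpha>) \<cdot>\<^bsub>C\<^esub> ?l X = t \<one>\<^bsub>C\<^esub> \<otimes>\<^bsub>C\<^esub> ?l X"
            using left[OF int t X] unfolding unit_Arr_left[OF Hom_Arr[OF l(1)[OF X]]] .
        qed
      next
        assume int: "right_integral C D Z \<pi> \<alpha> \<Lambda>"
        show ?thesis by (intro disjI2 allI impI) (rule right[OF int])
      qed
      \<comment> \<open>The uniqueness half of the universal property of \<open>Z \<alpha>\<close>: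
        an arrow whose action vanishes on every \<open>X\<close> is zero.\<close>
      have "\<Lambda> = Zero C \<one>\<^bsub>C\<^esub> (Z \<alpha>)"
      proof (rule Z_action_unique[OF assms(2,3) \<alpha>O \<Lambda> z])
        fix X assume X: "X \<in> Obj C"
        have "Z_action D \<pi> \<alpha> X \<cdot>\<^bsub>C\<^esub> (\<Lambda> \<otimes>\<^bsub>C\<^esub> idn\<^bsub>C\<^esub> X) = Zero C X (X \<boxtimes>\<^bsub>C\<^esub> \<alpha>)"
          using semisimple_integral_zero[where l = ?l, OF ss \<alpha>O l l1 int X] unfolding integral_action_def[OF assms(2,3)] .
        moreover have "Z_action D \<pi> \<alpha> X \<cdot>\<^bsub>C\<^esub> (Zero C \<one>\<^bsub>C\<^esub> (Z \<alpha>) \<otimes>\<^bsub>C\<^esub> idn\<^bsub>C\<^esub> X) = Zero C X (X \<boxtimes>\<^bsub>C\<^esub> \<alpha>)"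
          unfolding zero_tensor[OF unit_Obj Z\<alpha> id_Hom[OF X]] unit_Obj_left[OF X]
          by (rule comp_zero[OF Z_action_Hom[OF assms(2,3) \<alpha>O X] X])
        ultimately show "Z_action D \<pi> \<alpha> X \<cdot>\<^bsub>C\<^esub> (\<Lambda> \<otimes>\<^bsub>C\<^esub> idn\<^bsub>C\<^esub> X)
          = Z_action D \<pi> \<alpha> X \<cdot>\<^bsub>C\<^esub> (Zero C \<one>\<^bsub>C\<^esub> (Z \<alpha>) \<otimes>\<^bsub>C\<^esub> idn\<^bsub>C\<^esub> X)" by simp
      qed
      then show False using assms(7) by simp
    qed
  qed
qed

end
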